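(* Let $(E,\tau,M,\rho)$ be a Lie algebroid on a smooth manifold $M$. The Lie derivative has the following properties. 1. For each $V,W\in A^1(M,E)$, $\mathcal{L}_\rho(V)(W)=\{V,W\}$. 2. For $V,V_1,\ldots,V_p\in A^1(M,E)$, $$\mathcal{L}_\rho(V)(V_1\wedge\cdots\wedge V_p)=\sum_{i=1}^pV_1\wedge\cdots\wedge V_{i-1}\wedge\{V,V_i\}\wedge V_{i+1}\wedge\cdots\wedge V_p.$$ 3. For each $V\in A^1(M,E)$, $\mathcal{L}_\rho(V)$ is a derivation of degree $0$ of the exterior algebra $A(M,E)$, i.e. for all $P,Q\in A(M,E)$, $$\mathcal{L}_\rho(V)(P\wedge Q)=\bigl(\mathcal{L}_\rho(V)P\bigr)\wedge Q+P\wedge\mathcal{L}_\rho(V)Q.$$ 4. For each $V\in A^1(M,E)$, $P\in A(M,E)$ and $\eta\in\Omega(M,E)$, $$\mathcal{L}_\rho(V)\bigl(i(P)\eta\bigr)=i\bigl(\mathcal{L}_\rho(V)P\bigr)\eta+i(P)\bigl(\mathcal{L}_\rho(V)\eta\bigr).$$ 5. For each $V\in A^1(M,E)$, $P\in A(M,E)$ and $\eta\in\Omega(M,E)$, $$\mathcal{L}_\rho(V)\bigl(\langle\eta,P\rangle\bigr)=\bigl\langle\mathcal{L}_\rho(V)\eta,P\bigr\rangle+\bigl\langle\eta,\mathcal{L}_\rho(V)P\bigr\rangle.$$ 6. For each $V,W\in A^1(M,E)$ and $P\in A(M,E)$, $$\mathcal{L}_\rho\bigl(\{V,W\}\bigr)P=\bigl(\mathcal{L}_\rho(V)\circ\mathcal{L}_\rho(W)-\mathcal{L}_\rho(W)\circ\mathcal{L}_\rho(V)\bigr)P.$$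 7. For each $V\in A^1(M,E)$, $f\in C^\infty(M,\mathbb{R})$, $P\in A(M,E)$ and $\eta\in\Omega(M,E)$, $$\bigl\langle\eta,\mathcal{L}_\rho(fV)P\bigr\rangle=f\bigl\langle\eta,\mathcal{L}_\rho(V)P\bigr\rangle-\bigl\langle d_\rho f\wedge i(V)\eta,P\bigr\rangle.$$
   Context: A Lie algebroid $(E,\tau,M,\rho)$ is a smooth real vector bundle $(E,\tau,M)$ of finite rank over a smooth manifold $M$ (with projection $\tau:E\to M$), equipped with a Lie algebra bracket $(s_1,s_2)\mapsto\{s_1,s_2\}$ on the space of smooth sections of $\tau$ and a smooth vector bundle map $\rho:E\to TM$ (the anchor), such that $s\mapsto\rho\circ s$ is a Lie algebra homomorphism into the Lie algebra of smooth vector fields on $M$, and $\{s_1,fs_2\}=f\{s_1,s_2\}+\langle df,\rho\circ s_1\rangle s_2$ for all smooth sections $s_1,s_2$ and all $f\in C^\infty(M,\mathbb{R})$. For $p\in\mathbb{Z}$, $A^p(M,E)$ is the space of smooth sections of $\bigwedge^pE$ and $\Omega^p(M,E)$ the space of smooth sections of $\bigwedge^pE^*$, with degree-$0$ parts equal to $C^\infty(M,\mathbb{R})$ and zero for $p<0$; $A(M,E)=\oplus_pA^p(M,E)$ and $\Omega(M,E)=\oplus_p\Omega^p(M,E)$ are graded algebras for the exterior product. An element of $\Omega^p(M,E)$ is identified with a skew-symmetric $C^\infty(M,\mathbb{R})$-multilinear map $A^1(M,E)^p\to C^\infty(M,\mathbb{R})$, the exterior product being given by the sum over shuffles with signs.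 Interior product: for $V\in A^1(M,E)$ and $\eta\in\Omega^p(M,E)$, $i(V)\eta=0$ if $p\le0$ and $i(V)\eta(V_1,\ldots,V_{p-1})=\eta(V,V_1,\ldots,V_{p-1})$ if $p\ge1$. For $f\in A^0(M,E)$, $i(f)\eta=f\eta$; for $p\ge1$, $i(P_1\wedge\cdots\wedge P_p)=i(P_1)\circ\cdots\circ i(P_p)$ with $P_j\in A^1(M,E)$; this is extended by linearity to all $P\in A(M,E)$. The pairing $\Omega(M,E)\times A(M,E)\to C^\infty(M,\mathbb{R})$ is the $C^\infty(M,\mathbb{R})$-bilinear map with $\langle\eta,P\rangle=0$ if $\eta,P$ are homogeneous of different degrees, $\langle\eta,P\rangle=\eta P$ in degree $0$, and $\langle\eta_1\wedge\cdots\wedge\eta_p,v_1\wedge\cdots\wedge v_p\rangle=\det(\langle\eta_i,v_j\rangle)$. For $f\in C^\infty(M,\mathbb{R})$, $d_\rho f\in\Omega^1(M,E)$ is defined by $\langle d_\rho f,V\rangle=\langle df,\rho\circ V\rangle$. For $V\in A^1(M,E)$, the Lie derivative of forms $\mathcal{L}_\rho(V):\Omega(M,E)\to\Omega(M,E)$ is the $\mathbb{R}$-linear, degree $0$ map with $\mathcal{L}_\rho(V)f=\langle df,\rho\circ V\rangle$ for functions $f$ and, for $\eta\in\Omega^p(M,E)$, $p>0$, $(\mathcal{L}_\rho(V)\eta)(V_1,\ldots,V_p)=\mathcal{L}_\rho(V)(\eta(V_1,\ldots,V_p))-\sum_{i=1}^p\eta(V_1,\ldots,\{V,V_i\},\ldots,V_p)$.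 The Lie derivative of multivectors $\mathcal{L}_\rho(V):A(M,E)\to A(M,E)$ is the $\mathbb{R}$-linear, degree $0$ map with the same value on functions and, for $P\in A^p(M,E)$, $p\ge1$, $\langle\eta,\mathcal{L}_\rho(V)P\rangle=\mathcal{L}_\rho(V)(\langle\eta,P\rangle)-\langle\mathcal{L}_\rho(V)\eta,P\rangle$ for all $\eta\in\Omega^p(M,E)$. *)

theory Defs
  imports
    "HOL-Analysis.Analysis"
    "HOL-Library.Function_Algebras"
    "HOL-Combinatorics.Permutations"
begin

section \<open>Smooth maps and smooth manifolds\<close>

text \<open>
  Model spaces are finite-dimensional inner product spaces rather than members of
  the class \<open>euclidean_space\<close>, because the latter excludes dimension \<open>0\<close>
  (manifolds that are points, bundles of rank \<open>0\<close>).
\<close>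

definition finite_dim :: "'a::real_vector itself \<Rightarrow> bool" where
  "finite_dim _ \<longleftrightarrow> (\<exists>B::'a set. finite B \<and> span B = UNIV)"

text \<open>The following two notions are meant for open sets \<open>S\<close>.\<close>

primrec times_differentiable_on ::
  "nat \<Rightarrow> 'a::real_normed_vector set \<Rightarrow> ('a \<Rightarrow> 'b::real_normed_vector) \<Rightarrow> bool" where
  "times_differentiable_on 0 S f \<longleftrightarrow> continuous_on S f"
| "times_differentiable_on (Suc n) S f \<longleftrightarrow>
     (\<forall>x\<in>S. f differentiable (at x)) \<and>
     (\<forall>v. times_differentiable_on n S (\<lambda>x. frechet_derivative f (at x) v))"

definition smooth_on :: "'a::real_normed_vector set \<Rightarrow> ('a \<Rightarrow> 'b::real_normed_vector) \<Rightarrow> bool" where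
  "smooth_on S f \<longleftrightarrow> (\<forall>n. times_differentiable_on n S f)"

definition smooth_manifold ::
  "('m::{t2_space,second_countable_topology} set \<times> ('m \<Rightarrow> 'b::real_inner)) set \<Rightarrow> bool" where
  "smooth_manifold \<A> \<longleftrightarrow>
     finite_dim TYPE('b) \<and>
     (\<Union>(U, \<phi>)\<in>\<A>. U) = UNIV \<and>
     (\<forall>(U, \<phi>)\<in>\<A>. open U \<and> open (\<phi> ` U) \<and> homeomorphism U (\<phi> ` U) \<phi> (inv_into U \<phi>)) \<and>
     (\<forall>(U, \<phi>)\<in>\<A>. \<forall>(V, \<psi>)\<in>\<A>. smooth_on (\<phi> ` (U \<inter> V)) (\<psi> \<circ> inv_into U \<phi>))"

definition msmooth_on ::
  "('m set \<times> ('m \<Rightarrow> 'b::real_inner)) set \<Rightarrow> 'm set \<Rightarrow> ('m \<Rightarrow> 'c::real_normed_vector) \<Rightarrow> bool" where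
  "msmooth_on \<A> W f \<longleftrightarrow> (\<forall>(U, \<phi>)\<in>\<A>. smooth_on (\<phi> ` (U \<inter> W)) (f \<circ> inv_into U \<phi>))"

definition C_inf :: "('m set \<times> ('m \<Rightarrow> 'b::real_inner)) set \<Rightarrow> ('m \<Rightarrow> real) set" where
  "C_inf \<A> = {f. msmooth_on \<A> UNIV f}"

text \<open>
  Tangent vectors are derivations of the algebra of smooth functions at a point;
  they are set to \<open>0\<close> on functions that are not smooth, so that two tangent
  vectors are equal iff they agree on smooth functions. For a tangent vector \<open>X\<close>
  the pairing with the differential of \<open>f\<close> is \<open>X f\<close>.
\<close>

definition tangent_space ::
  "('m set \<times> ('m \<Rightarrow> 'b::real_inner)) set \<Rightarrow> 'm \<Rightarrow> (('m \<Rightarrow> real) \<Rightarrow> real) set" where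
  "tangent_space \<A> x =
     {X. (\<forall>f\<in>C_inf \<A>. \<forall>g\<in>C_inf \<A>. X (f + g) = X f + X g) \<and>
         (\<forall>f\<in>C_inf \<A>. \<forall>a. X (\<lambda>y. a * f y) = a * X f) \<and>
         (\<forall>f\<in>C_inf \<A>. \<forall>g\<in>C_inf \<A>. X (f * g) = f x * X g + g x * X f) \<and>
         (\<forall>f. f \<notin> C_inf \<A> \<longrightarrow> X f = 0)}"

definition vf_bracket ::
  "('m set \<times> ('m \<Rightarrow> 'b::real_inner)) set \<Rightarrow> ('m \<Rightarrow> ('m \<Rightarrow> real) \<Rightarrow> real) \<Rightarrow>
   ('m \<Rightarrow> ('m \<Rightarrow> real) \<Rightarrow> real) \<Rightarrow> 'm \<Rightarrow> ('m \<Rightarrow> real) \<Rightarrow> real" where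
  "vf_bracket \<A> X Y = (\<lambda>x f. if f \<in> C_inf \<A>
     then X x (\<lambda>y. Y y f) - Y x (\<lambda>y. X y f) else 0)"


section \<open>Vector bundles\<close>

text \<open>
  The elements of \<open>'m\<close> are the points of the base, those of \<open>'e\<close> the points of the
  total space; \<open>'k\<close> is the typical fibre. The smooth structure of the total space is
  given by a vector bundle atlas: \<open>(U, \<Phi>) \<in> trivs E\<close> stands for the local
  trivialisation \<open>e \<mapsto> (proj E e, \<Phi> e)\<close> over \<open>U\<close>.
  The operations \<open>vadd\<close> and \<open>vscale\<close> are meaningful within a fibre only.
\<close>

record ('m, 'b, 'e, 'k) vector_bundle =
  atlas :: "('m set \<times> ('m \<Rightarrow> 'b)) set"
  proj :: "'e \<Rightarrow> 'm"
  vadd :: "'e \<Rightarrow> 'e \<Rightarrow> 'e"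
  vscale :: "real \<Rightarrow> 'e \<Rightarrow> 'e"
  trivs :: "('m set \<times> ('e \<Rightarrow> 'k)) set"

definition fibre :: "('m, 'b, 'e, 'k, 'z) vector_bundle_scheme \<Rightarrow> 'm \<Rightarrow> 'e set" where
  "fibre E x = {e. proj E e = x}"

definition triv_inv ::
  "('m, 'b, 'e, 'k, 'z) vector_bundle_scheme \<Rightarrow> ('e \<Rightarrow> 'k) \<Rightarrow> 'm \<Rightarrow> 'k \<Rightarrow> 'e" where
  "triv_inv E \<Phi> x k = inv_into (fibre E x) \<Phi> k"

text \<open>
  The vector space axioms in the fibres follow from those of \<open>'k\<close>, since each
  trivialisation restricts to a bijection of fibres compatible with the operations.
\<close>

definition smooth_vector_bundle ::
  "('m::{t2_space,second_countable_topology}, 'b::real_inner, 'e, 'k::real_inner, 'z)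
     vector_bundle_scheme \<Rightarrow> bool" where
  "smooth_vector_bundle E \<longleftrightarrow>
     smooth_manifold (atlas E) \<and>
     finite_dim TYPE('k) \<and>
     (\<forall>x. \<forall>u\<in>fibre E x. \<forall>v\<in>fibre E x. \<forall>a. vadd E u v \<in> fibre E x \<and> vscale E a u \<in> fibre E x) \<and>
     (\<Union>(U, \<Phi>)\<in>trivs E. U) = UNIV \<and>
     (\<forall>(U, \<Phi>)\<in>trivs E. open U \<and>
        (\<forall>x\<in>U. bij_betw \<Phi> (fibre E x) UNIV \<and>
           (\<forall>u\<in>fibre E x. \<forall>v\<in>fibre E x. \<forall>a.
              \<Phi> (vadd E u v) = \<Phi> u + \<Phi> v \<and> \<Phi> (vscale E a u) = a *\<^sub>R \<Phi> u))) \<and>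
     (\<forall>(U, \<Phi>)\<in>trivs E. \<forall>(V, \<Psi>)\<in>trivs E. \<forall>k.
        msmooth_on (atlas E) (U \<inter> V) (\<lambda>x. \<Psi> (triv_inv E \<Phi> x k)))"

definition smooth_sections ::
  "('m, 'b::real_inner, 'e, 'k::real_inner, 'z) vector_bundle_scheme \<Rightarrow> ('m \<Rightarrow> 'e) set" where
  "smooth_sections E =
     {s. (\<forall>x. s x \<in> fibre E x) \<and> (\<forall>(U, \<Phi>)\<in>trivs E. msmooth_on (atlas E) U (\<lambda>x. \<Phi> (s x)))}"

definition sec_add ::
  "('m, 'b, 'e, 'k, 'z) vector_bundle_scheme \<Rightarrow> ('m \<Rightarrow> 'e) \<Rightarrow> ('m \<Rightarrow> 'e) \<Rightarrow> 'm \<Rightarrow> 'e" where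
  "sec_add E s t = (\<lambda>x. vadd E (s x) (t x))"

definition sec_scale ::
  "('m, 'b, 'e, 'k, 'z) vector_bundle_scheme \<Rightarrow> ('m \<Rightarrow> real) \<Rightarrow> ('m \<Rightarrow> 'e) \<Rightarrow> 'm \<Rightarrow> 'e" where
  "sec_scale E f s = (\<lambda>x. vscale E (f x) (s x))"


section \<open>Lie algebroids\<close>

record ('m, 'b, 'e, 'k) lie_algebroid_data = "('m, 'b, 'e, 'k) vector_bundle" +
  anchor :: "'e \<Rightarrow> ('m \<Rightarrow> real) \<Rightarrow> real"
  bracket :: "('m \<Rightarrow> 'e) \<Rightarrow> ('m \<Rightarrow> 'e) \<Rightarrow> 'm \<Rightarrow> 'e"

text \<open>
  Smoothness of the anchor: in a local trivialisation, its value on a constant section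
  is a smooth vector field, i.e. maps smooth functions to smooth functions.
\<close>

definition smooth_anchor ::
  "('m, 'b::real_inner, 'e, 'k::real_inner) lie_algebroid_data \<Rightarrow> bool" where
  "smooth_anchor L \<longleftrightarrow>
     (\<forall>e. anchor L e \<in> tangent_space (atlas L) (proj L e)) \<and>
     (\<forall>x. \<forall>u\<in>fibre L x. \<forall>v\<in>fibre L x. \<forall>a f.
        anchor L (vadd L u v) f = anchor L u f + anchor L v f \<and>
        anchor L (vscale L a u) f = a * anchor L u f) \<and>
     (\<forall>(U, \<Phi>)\<in>trivs L. \<forall>k. \<forall>f\<in>C_inf (atlas L).
        msmooth_on (atlas L) U (\<lambda>x. anchor L (triv_inv L \<Phi> x k) f))"

definition lie_bracket_on_sections ::
  "('m, 'b::real_inner, 'e, 'k::real_inner) lie_algebroid_data \<Rightarrow> bool" where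
  "lie_bracket_on_sections L \<longleftrightarrow>
     (\<forall>s\<in>smooth_sections L. \<forall>t\<in>smooth_sections L.
        bracket L s t \<in> smooth_sections L \<and>
        bracket L s t = sec_scale L (\<lambda>_. -1) (bracket L t s)) \<and>
     (\<forall>s\<in>smooth_sections L. \<forall>t\<in>smooth_sections L. \<forall>u\<in>smooth_sections L. \<forall>a.
        bracket L (sec_add L s t) u = sec_add L (bracket L s u) (bracket L t u) \<and>
        bracket L (sec_scale L (\<lambda>_. a) s) u = sec_scale L (\<lambda>_. a) (bracket L s u) \<and>
        bracket L s (bracket L t u) =
          sec_add L (bracket L (bracket L s t) u) (bracket L t (bracket L s u)))"

definition lie_fun ::
  "('m, 'b, 'e, 'k) lie_algebroid_data \<Rightarrow> ('m \<Rightarrow> 'e) \<Rightarrow> ('m \<Rightarrow> real) \<Rightarrow> 'm \<Rightarrow> real" where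
  "lie_fun L V f = (\<lambda>x. anchor L (V x) f)"

definition lie_algebroid ::
  "('m::{t2_space,second_countable_topology}, 'b::real_inner, 'e, 'k::real_inner)
     lie_algebroid_data \<Rightarrow> bool" where
  "lie_algebroid L \<longleftrightarrow>
     smooth_vector_bundle L \<and> smooth_anchor L \<and> lie_bracket_on_sections L \<and>
     (\<forall>s\<in>smooth_sections L. \<forall>t\<in>smooth_sections L.
        anchor L \<circ> bracket L s t = vf_bracket (atlas L) (anchor L \<circ> s) (anchor L \<circ> t)) \<and>
     (\<forall>s\<in>smooth_sections L. \<forall>t\<in>smooth_sections L. \<forall>f\<in>C_inf (atlas L).
        bracket L s (sec_scale L f t) =
          sec_add L (sec_scale L f (bracket L s t)) (sec_scale L (lie_fun L s f) t))"


section \<open>Forms and multivectors\<close>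

text \<open>
  For a finite-dimensional vector space \<open>F\<close>, an element of the exterior algebra of the
  dual of \<open>F\<close> is a function on lists of elements of \<open>F\<close>; its component of degree
  \<open>p\<close> is the restriction to the lists of length \<open>p\<close>, which is a skew-symmetric
  multilinear map. Values on lists not contained in \<open>F\<close> are \<open>0\<close>.
  Taking for \<open>F\<close> the fibre of \<open>E\<close> gives the exterior algebra of the dual bundle;
  taking for \<open>F\<close> the dual of the fibre gives the exterior algebra of \<open>E\<close>, with
  \<open>v1 \<and> \<dots> \<and> vp\<close> represented by \<open>[\<alpha>1, \<dots>, \<alpha>p] \<mapsto> det (\<alpha>i (vj))\<close>.
\<close>

definition skew_multilinear ::
  "'v set \<Rightarrow> ('v \<Rightarrow> 'v \<Rightarrow> 'v) \<Rightarrow> (real \<Rightarrow> 'v \<Rightarrow> 'v) \<Rightarrow> ('v list \<Rightarrow> real) \<Rightarrow> bool" where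
  "skew_multilinear F add scl \<omega> \<longleftrightarrow>
     (\<forall>vs. \<not> set vs \<subseteq> F \<longrightarrow> \<omega> vs = 0) \<and>
     (\<forall>vs. set vs \<subseteq> F \<longrightarrow> (\<forall>i<length vs. \<forall>u\<in>F. \<forall>w\<in>F. \<forall>a.
        \<omega> (vs[i := add u w]) = \<omega> (vs[i := u]) + \<omega> (vs[i := w]) \<and>
        \<omega> (vs[i := scl a u]) = a * \<omega> (vs[i := u]))) \<and>
     (\<forall>vs. set vs \<subseteq> F \<longrightarrow> (\<forall>i<length vs. \<forall>j<length vs. i \<noteq> j \<longrightarrow>
        \<omega> (vs[i := vs ! j, j := vs ! i]) = - \<omega> vs))"

definition dual_fibre ::
  "('m, 'b, 'e, 'k, 'z) vector_bundle_scheme \<Rightarrow> 'm \<Rightarrow> ('e \<Rightarrow> real) set" where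
  "dual_fibre E x =
     {\<alpha>. (\<forall>u\<in>fibre E x. \<forall>v\<in>fibre E x. \<forall>a.
            \<alpha> (vadd E u v) = \<alpha> u + \<alpha> v \<and> \<alpha> (vscale E a u) = a * \<alpha> u) \<and>
         (\<forall>e. e \<notin> fibre E x \<longrightarrow> \<alpha> e = 0)}"

text \<open>The pullback to the fibre over \<open>x\<close> of a linear functional on the typical fibre.\<close>

definition triv_dual ::
  "('m, 'b, 'e, 'k, 'z) vector_bundle_scheme \<Rightarrow> ('e \<Rightarrow> 'k) \<Rightarrow> 'm \<Rightarrow> ('k \<Rightarrow> real) \<Rightarrow> 'e \<Rightarrow> real" where
  "triv_dual E \<Phi> x l = (\<lambda>e. if e \<in> fibre E x then l (\<Phi> e) else 0)"

definition forms ::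
  "('m, 'b::real_inner, 'e, 'k::real_inner, 'z) vector_bundle_scheme \<Rightarrow>
   ('m \<Rightarrow> 'e list \<Rightarrow> real) set" where
  "forms E =
     {\<eta>. (\<forall>x. skew_multilinear (fibre E x) (vadd E) (vscale E) (\<eta> x)) \<and>
         (\<exists>N. \<forall>x vs. N < length vs \<longrightarrow> \<eta> x vs = 0) \<and>
         (\<forall>(U, \<Phi>)\<in>trivs E. \<forall>ks.
            msmooth_on (atlas E) U (\<lambda>x. \<eta> x (map (triv_inv E \<Phi> x) ks)))}"

definition multivectors ::
  "('m, 'b::real_inner, 'e, 'k::real_inner, 'z) vector_bundle_scheme \<Rightarrow>
   ('m \<Rightarrow> ('e \<Rightarrow> real) list \<Rightarrow> real) set" where
  "multivectors E =
     {P. (\<forall>x. skew_multilinear (dual_fibre E x) (+) (\<lambda>a \<alpha> e. a * \<alpha> e) (P x)) \<and>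
         (\<exists>N. \<forall>x \<alpha>s. N < length \<alpha>s \<longrightarrow> P x \<alpha>s = 0) \<and>
         (\<forall>(U, \<Phi>)\<in>trivs E. \<forall>ls. (\<forall>l\<in>set ls. linear l) \<longrightarrow>
            msmooth_on (atlas E) U (\<lambda>x. P x (map (triv_dual E \<Phi> x) ls)))}"

definition homogeneous :: "nat \<Rightarrow> ('m \<Rightarrow> 'v list \<Rightarrow> real) set" where
  "homogeneous p = {\<omega>. \<forall>x vs. length vs \<noteq> p \<longrightarrow> \<omega> x vs = 0}"

definition forms_deg ::
  "('m, 'b::real_inner, 'e, 'k::real_inner, 'z) vector_bundle_scheme \<Rightarrow> nat \<Rightarrow>
   ('m \<Rightarrow> 'e list \<Rightarrow> real) set" where
  "forms_deg E p = forms E \<inter> homogeneous p"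

definition multivectors_deg ::
  "('m, 'b::real_inner, 'e, 'k::real_inner, 'z) vector_bundle_scheme \<Rightarrow> nat \<Rightarrow>
   ('m \<Rightarrow> ('e \<Rightarrow> real) list \<Rightarrow> real) set" where
  "multivectors_deg E p = multivectors E \<inter> homogeneous p"

text \<open>Functions as elements of degree \<open>0\<close>, and sections as multivectors of degree \<open>1\<close>.\<close>

definition of_fun :: "('m \<Rightarrow> real) \<Rightarrow> 'm \<Rightarrow> 'v list \<Rightarrow> real" where
  "of_fun f = (\<lambda>x vs. if vs = [] then f x else 0)"

definition of_sec ::
  "('m, 'b, 'e, 'k, 'z) vector_bundle_scheme \<Rightarrow> ('m \<Rightarrow> 'e) \<Rightarrow> 'm \<Rightarrow> ('e \<Rightarrow> real) list \<Rightarrow> real" where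
  "of_sec E V = (\<lambda>x \<alpha>s. case \<alpha>s of [\<alpha>] \<Rightarrow> (if \<alpha> \<in> dual_fibre E x then \<alpha> (V x) else 0) | _ \<Rightarrow> 0)"

definition fun_scale ::
  "('m \<Rightarrow> real) \<Rightarrow> ('m \<Rightarrow> 'v list \<Rightarrow> real) \<Rightarrow> 'm \<Rightarrow> 'v list \<Rightarrow> real" (infixr "\<odot>" 75) where
  "f \<odot> \<omega> = (\<lambda>x vs. f x * \<omega> x vs)"

text \<open>
  A subset \<open>S\<close> of the positions of a list determines a shuffle (the positions in
  \<open>S\<close> followed by the other ones), whose inversions are counted below.
\<close>

definition shuffle_sign :: "nat set \<Rightarrow> real" where
  "shuffle_sign S = (-1) ^ card {(i, j). i \<in> S \<and> j \<notin> S \<and> j < i}"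

definition wedge ::
  "('m \<Rightarrow> 'v list \<Rightarrow> real) \<Rightarrow> ('m \<Rightarrow> 'v list \<Rightarrow> real) \<Rightarrow> 'm \<Rightarrow> 'v list \<Rightarrow> real"
  (infixr "\<curlywedge>" 70) where
  "\<omega> \<curlywedge> \<zeta> = (\<lambda>x vs. \<Sum>S\<in>Pow {..<length vs}.
     shuffle_sign S * \<omega> x (nths vs S) * \<zeta> x (nths vs (- S)))"

definition wedge_list :: "('m \<Rightarrow> 'v list \<Rightarrow> real) list \<Rightarrow> 'm \<Rightarrow> 'v list \<Rightarrow> real" where
  "wedge_list \<omega>s = foldr (\<curlywedge>) \<omega>s (of_fun 1)"

definition eval_form :: "('m \<Rightarrow> 'e list \<Rightarrow> real) \<Rightarrow> ('m \<Rightarrow> 'e) list \<Rightarrow> 'm \<Rightarrow> real" where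
  "eval_form \<eta> Vs = (\<lambda>x. \<eta> x (map (\<lambda>V. V x) Vs))"

definition real_linear_on ::
  "('m \<Rightarrow> 'v list \<Rightarrow> real) set \<Rightarrow> (('m \<Rightarrow> 'v list \<Rightarrow> real) \<Rightarrow> 'm \<Rightarrow> 'v list \<Rightarrow> real) \<Rightarrow> bool" where
  "real_linear_on X D \<longleftrightarrow>
     (\<forall>\<omega>\<in>X. \<forall>\<zeta>\<in>X. D (\<omega> + \<zeta>) = D \<omega> + D \<zeta>) \<and>
     (\<forall>\<omega>\<in>X. \<forall>a. D ((\<lambda>_. a) \<odot> \<omega>) = (\<lambda>_. a) \<odot> D \<omega>)"


section \<open>Interior product and pairing\<close>

definition interior_sec ::
  "('m \<Rightarrow> 'e) \<Rightarrow> ('m \<Rightarrow> 'e list \<Rightarrow> real) \<Rightarrow> 'm \<Rightarrow> 'e list \<Rightarrow> real" where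
  "interior_sec V \<eta> = (\<lambda>x vs. \<eta> x (V x # vs))"

text \<open>
  The remaining operators are given by their characteristic properties and are taken
  in the extensional function spaces \<open>\<rightarrow>\<^sub>E\<close>, so that they are unique as HOL functions.
\<close>

definition interior_mv ::
  "('m, 'b::real_inner, 'e, 'k::real_inner, 'z) vector_bundle_scheme \<Rightarrow>
   ('m \<Rightarrow> ('e \<Rightarrow> real) list \<Rightarrow> real) \<Rightarrow> ('m \<Rightarrow> 'e list \<Rightarrow> real) \<Rightarrow> 'm \<Rightarrow> 'e list \<Rightarrow> real" where
  "interior_mv E = (THE \<iota>. \<iota> \<in> multivectors E \<rightarrow>\<^sub>E (forms E \<rightarrow>\<^sub>E forms E) \<and>
     (\<forall>P\<in>multivectors E. \<forall>Q\<in>multivectors E. \<forall>f\<in>C_inf (atlas E). \<forall>g\<in>C_inf (atlas E).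
        \<forall>\<eta>\<in>forms E. \<iota> (f \<odot> P + g \<odot> Q) \<eta> = f \<odot> \<iota> P \<eta> + g \<odot> \<iota> Q \<eta>) \<and>
     (\<forall>f\<in>C_inf (atlas E). \<forall>\<eta>\<in>forms E. \<iota> (of_fun f) \<eta> = f \<odot> \<eta>) \<and>
     (\<forall>Vs\<in>lists (smooth_sections E). Vs \<noteq> [] \<longrightarrow> (\<forall>\<eta>\<in>forms E.
        \<iota> (wedge_list (map (of_sec E) Vs)) \<eta> = foldr interior_sec Vs \<eta>)))"

text \<open>The Leibniz formula for the determinant of the matrix \<open>a\<close> of size \<open>p\<close>.\<close>

definition det_fun :: "nat \<Rightarrow> (nat \<Rightarrow> nat \<Rightarrow> real) \<Rightarrow> real" where
  "det_fun p a = (\<Sum>\<pi> | \<pi> permutes {..<p}. of_int (sign \<pi>) * (\<Prod>i<p. a i (\<pi> i)))"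

definition pairing ::
  "('m, 'b::real_inner, 'e, 'k::real_inner, 'z) vector_bundle_scheme \<Rightarrow>
   ('m \<Rightarrow> 'e list \<Rightarrow> real) \<Rightarrow> ('m \<Rightarrow> ('e \<Rightarrow> real) list \<Rightarrow> real) \<Rightarrow> 'm \<Rightarrow> real" where
  "pairing E = (THE \<beta>. \<beta> \<in> forms E \<rightarrow>\<^sub>E (multivectors E \<rightarrow>\<^sub>E C_inf (atlas E)) \<and>
     (\<forall>\<eta>\<in>forms E. \<forall>\<zeta>\<in>forms E. \<forall>f\<in>C_inf (atlas E). \<forall>g\<in>C_inf (atlas E).
        \<forall>P\<in>multivectors E. \<beta> (f \<odot> \<eta> + g \<odot> \<zeta>) P = f * \<beta> \<eta> P + g * \<beta> \<zeta> P) \<and>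
     (\<forall>P\<in>multivectors E. \<forall>Q\<in>multivectors E. \<forall>f\<in>C_inf (atlas E). \<forall>g\<in>C_inf (atlas E).
        \<forall>\<eta>\<in>forms E. \<beta> \<eta> (f \<odot> P + g \<odot> Q) = f * \<beta> \<eta> P + g * \<beta> \<eta> Q) \<and>
     (\<forall>p q. p \<noteq> q \<longrightarrow> (\<forall>\<eta>\<in>forms_deg E p. \<forall>P\<in>multivectors_deg E q. \<beta> \<eta> P = 0)) \<and>
     (\<forall>f\<in>C_inf (atlas E). \<forall>g\<in>C_inf (atlas E). \<beta> (of_fun f) (of_fun g) = f * g) \<and>
     (\<forall>\<eta>s\<in>lists (forms_deg E 1). \<forall>Vs\<in>lists (smooth_sections E).
        length \<eta>s = length Vs \<and> Vs \<noteq> [] \<longrightarrow>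
        \<beta> (wedge_list \<eta>s) (wedge_list (map (of_sec E) Vs)) =
          (\<lambda>x. det_fun (length Vs) (\<lambda>i j. (\<eta>s ! i) x [(Vs ! j) x]))))"


section \<open>Lie derivatives\<close>

definition d_rho ::
  "('m, 'b, 'e, 'k) lie_algebroid_data \<Rightarrow> ('m \<Rightarrow> real) \<Rightarrow> 'm \<Rightarrow> 'e list \<Rightarrow> real" where
  "d_rho L f = (\<lambda>x vs. case vs of [e] \<Rightarrow> (if e \<in> fibre L x then anchor L e f else 0) | _ \<Rightarrow> 0)"

definition lie_form ::
  "('m, 'b::real_inner, 'e, 'k::real_inner) lie_algebroid_data \<Rightarrow> ('m \<Rightarrow> 'e) \<Rightarrow>
   ('m \<Rightarrow> 'e list \<Rightarrow> real) \<Rightarrow> 'm \<Rightarrow> 'e list \<Rightarrow> real" where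
  "lie_form L V = (THE D. D \<in> forms L \<rightarrow>\<^sub>E forms L \<and>
     real_linear_on (forms L) D \<and>
     (\<forall>p. D ` forms_deg L p \<subseteq> forms_deg L p) \<and>
     (\<forall>f\<in>C_inf (atlas L). D (of_fun f) = of_fun (lie_fun L V f)) \<and>
     (\<forall>p>0. \<forall>\<eta>\<in>forms_deg L p. \<forall>Vs\<in>lists (smooth_sections L). length Vs = p \<longrightarrow>
        eval_form (D \<eta>) Vs = lie_fun L V (eval_form \<eta> Vs)
          - (\<Sum>i<p. eval_form \<eta> (Vs[i := bracket L V (Vs ! i)]))))"

definition lie_mv ::
  "('m, 'b::real_inner, 'e, 'k::real_inner) lie_algebroid_data \<Rightarrow> ('m \<Rightarrow> 'e) \<Rightarrow>
   ('m \<Rightarrow> ('e \<Rightarrow> real) list \<Rightarrow> real) \<Rightarrow> 'm \<Rightarrow> ('e \<Rightarrow> real) list \<Rightarrow> real" where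
  "lie_mv L V = (THE D. D \<in> multivectors L \<rightarrow>\<^sub>E multivectors L \<and>
     real_linear_on (multivectors L) D \<and>
     (\<forall>p. D ` multivectors_deg L p \<subseteq> multivectors_deg L p) \<and>
     (\<forall>f\<in>C_inf (atlas L). D (of_fun f) = of_fun (lie_fun L V f)) \<and>
     (\<forall>p>0. \<forall>P\<in>multivectors_deg L p. \<forall>\<eta>\<in>forms_deg L p.
        pairing L \<eta> (D P) = lie_fun L V (pairing L \<eta> P) - pairing L (lie_form L V \<eta>) P))"

definition derivation_deg0 ::
  "('m, 'b::real_inner, 'e, 'k::real_inner, 'z) vector_bundle_scheme \<Rightarrow>
   (('m \<Rightarrow> ('e \<Rightarrow> real) list \<Rightarrow> real) \<Rightarrow> 'm \<Rightarrow> ('e \<Rightarrow> real) list \<Rightarrow> real) \<Rightarrow> bool" where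
  "derivation_deg0 E D \<longleftrightarrow>
     real_linear_on (multivectors E) D \<and>
     (\<forall>p. D ` multivectors_deg E p \<subseteq> multivectors_deg E p) \<and>
     (\<forall>P\<in>multivectors E. \<forall>Q\<in>multivectors E. D (P \<curlywedge> Q) = D P \<curlywedge> Q + P \<curlywedge> D Q)"

end

theory Submission
  imports Defs
begin

text \<open>
  Skew-symmetric tensor fields on a bundle and on its dual are treated alike, as
  \<open>C\<^sup>\<infinity>\<close>-multilinear skew maps on sections. A derivation \<open>\<delta>\<close> of the module of
  sections over a derivation \<open>X\<close> of the functions induces
  \<open>D \<omega> (V1, \<dots>, Vp) = X (\<omega> (V1, \<dots>, Vp)) - \<Sum> \<omega> (\<dots>, \<delta> Vi, \<dots>)\<close>, which is tensorial
  because the Leibniz terms cancel. For \<open>\<delta> = {V, \<cdot>}\<close> this is the Lie derivative of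
  forms; for the derivation that it induces on sections of the dual bundle it is the Lie
  derivative of multivectors. The rule \<open>i(V) D = D i(V) - i(\<delta> V)\<close> gives the derivation
  property by induction on the degree. Compatibility with the pairing and the interior
  product need only be checked on decomposable multivectors: the defect is
  \<open>C\<^sup>\<infinity>\<close>-linear in the multivector, and near any point every multivector, multiplied by
  a bump function, is a \<open>C\<^sup>\<infinity>\<close>-combination of exterior products of global sections.
  The same argument shows that the pairing, the interior product and the Lie derivatives
  are determined by their characteristic properties.
\<close>

section \<open>Smooth maps\<close>

text \<open>Fibres are bare sets with two operations, so vectors are compared through all linear
  functionals and combinations of sections are described by their effect on such functionals.
  Partitions of unity are avoided: a local frame consists of global sections e i and functionals c i
  with h v = \<Sum> c i (v) e i over the whole base, where h is 1 near the given point. Euler's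
  identity, applied once per degree, turns h^p \<omega> into a combination of exterior products; and
  h^N K \<omega> = K (h^N \<omega>) for C-linear K, so nothing about the locality of K has to be
  known beforehand. The dual bundle has the same kind of frames, with e and c exchanged, and the
  original sections serve as its coframes. The pairing is a contraction against a frame; it is
  independent of the frame because \<Sum> e i \<otimes> c i is the identity. All operators are
  definite descriptions, so each requires an explicit candidate and a uniqueness proof. Lie
  derivatives are not C-linear; for them uniqueness goes through real linearity and homogeneous
  components.\<close>

lemma times_differentiable_on_cong:
  assumes "open S" "\<And>x. x \<in> S \<Longrightarrow> f x = g x"
  shows "times_differentiable_on n S f \<longleftrightarrow> times_differentiable_on n S g"
  using assms(2)
proof (induction n arbitrary: f g)
  case 0
  then show ?case by (auto cong: continuous_on_cong)
next
  case (Suc n)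
  have *: "times_differentiable_on (Suc n) S g"
    if fg: "\<And>x. x \<in> S \<Longrightarrow> f x = g x" and f: "times_differentiable_on (Suc n) S f"
    for f g :: "'a \<Rightarrow> 'b"
  proof -
    have d: "g differentiable (at x)" if "x \<in> S" for x
      using f fg that assms(1)
      by (metis differentiable_def has_derivative_transform_within_open
          times_differentiable_on.simps(2))
    have e: "frechet_derivative f (at x) = frechet_derivative g (at x)" if "x \<in> S" for x
      using frechet_derivative_transform_within_open[OF _ assms(1) that] f fg that by auto
    have "times_differentiable_on n S (\<lambda>x. frechet_derivative g (at x) v)" for v
      using Suc.IH[of "\<lambda>x. frechet_derivative f (at x) v" "\<lambda>x. frechet_derivative g (at x) v"] e f
      by auto
    with d show ?thesis by simp
  qed
  show ?case using *[of f g] *[of g f] Suc.prems by metis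
qed

text \<open>Allows any explicit derivative in place of \<open>frechet_derivative\<close>; together
  with the elimination rule below it makes each closure property an induction on the order that uses
  only the corresponding rule of differentiation.\<close>

lemma times_differentiable_on_SucI:
  assumes "open S" and der: "\<And>x. x \<in> S \<Longrightarrow> (f has_derivative f' x) (at x)"
    and "\<And>v. times_differentiable_on n S (\<lambda>x. f' x v)"
  shows "times_differentiable_on (Suc n) S f"
proof -
  have "times_differentiable_on n S (\<lambda>x. frechet_derivative f (at x) v)" for v
    using times_differentiable_on_cong[OF assms(1), of "\<lambda>x. frechet_derivative f (at x) v"
        "\<lambda>x. f' x v" n] assms(3) frechet_derivative_at[OF der] by metis
  then show ?thesis using der by (auto simp: differentiable_def)
qed

lemma times_differentiable_on_SucE:
  assumes "times_differentiable_on (Suc n) S f"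
  obtains f' where "\<And>x. x \<in> S \<Longrightarrow> (f has_derivative f' x) (at x)"
    and "\<And>v. times_differentiable_on n S (\<lambda>x. f' x v)"
  using that[of "\<lambda>x. frechet_derivative f (at x)"] assms by (auto simp: frechet_derivative_works)

lemma times_differentiable_on_Suc:
  "times_differentiable_on (Suc n) S f \<Longrightarrow> times_differentiable_on n S f"
proof (induction n arbitrary: f)
  case 0
  then show ?case
    by (auto intro!: continuous_at_imp_continuous_on differentiable_imp_continuous_within)
next
  case (Suc n)
  then show ?case by (metis times_differentiable_on.simps(2))
qed

lemma times_differentiable_on_subset:
  "times_differentiable_on n S f \<Longrightarrow> T \<subseteq> S \<Longrightarrow> times_differentiable_on n T f"
  by (induction n arbitrary: f) (auto intro: continuous_on_subset)

lemma times_differentiable_on_local: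
  assumes "open S" "\<And>x. x \<in> S \<Longrightarrow> \<exists>T. open T \<and> x \<in> T \<and> times_differentiable_on n (S \<inter> T) f"
  shows "times_differentiable_on n S f"
  using assms(2)
proof (induction n arbitrary: f)
  case 0
  have "isCont f x" if "x \<in> S" for x
    using 0[OF that] assms(1) that
    by (auto simp: continuous_on_eq_continuous_at open_Int)
  then show ?case by (simp add: continuous_at_imp_continuous_on)
next
  case (Suc n)
  have "times_differentiable_on n S (\<lambda>x. frechet_derivative f (at x) v)" for v
    by (rule Suc.IH) (use Suc.prems in \<open>metis times_differentiable_on.simps(2)\<close>)
  moreover have "\<forall>x\<in>S. f differentiable (at x)"
    using Suc.prems by (metis IntI times_differentiable_on.simps(2))
  ultimately show ?case by simp
qed

lemma times_differentiable_on_const: "times_differentiable_on n S (\<lambda>x. c)"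
proof (induction n arbitrary: c)
  case (Suc n)
  have "frechet_derivative (\<lambda>x. c) (at x) = (\<lambda>v. 0)" for x :: 'a
    using frechet_derivative_at[OF has_derivative_const] by metis
  then show ?case using Suc by simp
qed simp

lemma times_differentiable_on_bounded_linear:
  assumes "open S" "bounded_linear f"
  shows "times_differentiable_on n S f"
proof (cases n)
  case 0
  then show ?thesis using assms by (simp add: linear_continuous_on)
next
  case (Suc m)
  show ?thesis unfolding Suc
    by (rule times_differentiable_on_SucI[OF assms(1), of _ "\<lambda>x. f"])
      (auto intro: bounded_linear_imp_has_derivative assms times_differentiable_on_const)
qed

lemma times_differentiable_on_add:
  assumes "open S" "times_differentiable_on n S f" "times_differentiable_on n S g"
  shows "times_differentiable_on n S (\<lambda>x. f x + g x)"
  using assms(2,3)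
proof (induction n arbitrary: f g)
  case 0
  then show ?case by (auto intro: continuous_intros)
next
  case (Suc n)
  obtain f' where f': "\<And>x. x \<in> S \<Longrightarrow> (f has_derivative f' x) (at x)"
    "\<And>v. times_differentiable_on n S (\<lambda>x. f' x v)"
    by (rule times_differentiable_on_SucE[OF Suc.prems(1)]) blast
  obtain g' where g': "\<And>x. x \<in> S \<Longrightarrow> (g has_derivative g' x) (at x)"
    "\<And>v. times_differentiable_on n S (\<lambda>x. g' x v)"
    by (rule times_differentiable_on_SucE[OF Suc.prems(2)]) blast
  show ?case
    by (rule times_differentiable_on_SucI[OF assms(1), of _ "\<lambda>x v. f' x v + g' x v"])
      (auto intro: has_derivative_add f' g' Suc.IH)
qed

text \<open>One product rule serves for products of functions, scalar multiples and inner products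
  alike. The undifferentiated factors in the derivative are covered by
  \<open>times_differentiable_on_Suc\<close>.\<close>

lemma times_differentiable_on_bilinear:
  assumes "open S" "bounded_bilinear mul"
    "times_differentiable_on n S f" "times_differentiable_on n S g"
  shows "times_differentiable_on n S (\<lambda>x. mul (f x) (g x))"
  using assms(3,4)
proof (induction n arbitrary: f g)
  case 0
  then show ?case by (auto intro: bounded_bilinear.continuous_on[OF assms(2)])
next
  case (Suc n)
  obtain f' where f': "\<And>x. x \<in> S \<Longrightarrow> (f has_derivative f' x) (at x)"
    "\<And>v. times_differentiable_on n S (\<lambda>x. f' x v)"
    by (rule times_differentiable_on_SucE[OF Suc.prems(1)]) blast
  obtain g' where g': "\<And>x. x \<in> S \<Longrightarrow> (g has_derivative g' x) (at x)"
    "\<And>v. times_differentiable_on n S (\<lambda>x. g' x v)"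
    by (rule times_differentiable_on_SucE[OF Suc.prems(2)]) blast
  show ?case
    by (rule times_differentiable_on_SucI[OF assms(1),
          of _ "\<lambda>x v. mul (f x) (g' x v) + mul (f' x v) (g x)"])
      (intro bounded_bilinear.FDERIV[OF assms(2)] f' g' Suc.IH times_differentiable_on_add assms(1)
        Suc.prems[THEN times_differentiable_on_Suc]; assumption)+
qed

lemmas times_differentiable_on_mult =
  times_differentiable_on_bilinear[OF _ bounded_bilinear_mult]

lemma times_differentiable_on_compose_real:
  fixes h :: "real \<Rightarrow> real" and q :: "'a::real_normed_vector \<Rightarrow> real"
  assumes "open S" "open T" "q ` S \<subseteq> T" "times_differentiable_on n T h" "times_differentiable_on n S q"
  shows "times_differentiable_on n S (\<lambda>x. h (q x))"
  using assms(4,5)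
proof (induction n arbitrary: h)
  case 0
  then show ?case using assms(3) by (auto intro: continuous_on_compose2)
next
  case (Suc n)
  obtain q' where q': "\<And>x. x \<in> S \<Longrightarrow> (q has_derivative q' x) (at x)"
    "\<And>v. times_differentiable_on n S (\<lambda>x. q' x v)"
    by (rule times_differentiable_on_SucE[OF Suc.prems(2)]) blast
  obtain h' where h': "\<And>x. x \<in> T \<Longrightarrow> (h has_derivative h' x) (at x)"
    "\<And>v. times_differentiable_on n T (\<lambda>x. h' x v)"
    by (rule times_differentiable_on_SucE[OF Suc.prems(1)]) blast
  \<comment> \<open>A linear map of the line is multiplication by its value at 1, so the chain rule
    takes the form of a product whose first factor is again a composition, to which the induction
    hypothesis applies.\<close>
  have lin: "h' t r = h' t 1 * r" if "t \<in> T" for t r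
    using linear_scale[OF has_derivative_linear[OF h'(1)[OF that]], of r 1] by simp
  have "times_differentiable_on n S (\<lambda>x. h' (q x) 1 * q' x v)" for v
    by (intro times_differentiable_on_mult[OF assms(1)]
        Suc.IH[of "\<lambda>t. h' t 1"] h' q' times_differentiable_on_Suc[OF Suc.prems(2)])
  moreover have "((\<lambda>x. h (q x)) has_derivative (\<lambda>v. h' (q x) 1 * q' x v)) (at x)" if "x \<in> S" for x
  proof -
    have "q x \<in> T" using that assms(3) by auto
    then have "((\<lambda>x. h (q x)) has_derivative (\<lambda>v. h' (q x) (q' x v))) (at x)"
      using has_derivative_compose[OF q'(1)[OF that] h'(1)] by simp
    then show ?thesis using lin[OF \<open>q x \<in> T\<close>] by (metis (no_types, lifting) ext)
  qed
  ultimately show ?case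
    by (intro times_differentiable_on_SucI[OF assms(1), of _ "\<lambda>x v. h' (q x) 1 * q' x v"]) auto
qed

lemma smooth_on_cong: "open S \<Longrightarrow> (\<And>x. x \<in> S \<Longrightarrow> f x = g x) \<Longrightarrow> smooth_on S f = smooth_on S g"
  unfolding smooth_on_def using times_differentiable_on_cong by metis

lemma smooth_on_inverse: "smooth_on {0<..} (inverse :: real \<Rightarrow> real)"
  unfolding smooth_on_def
proof
  fix n
  show "times_differentiable_on n {0<..} (inverse :: real \<Rightarrow> real)"
  proof (induction n)
    case 0
    then show ?case by (auto intro!: continuous_intros)
  next
    case (Suc n)
    have "times_differentiable_on n {0<..} (\<lambda>x. (-v) * (inverse x * inverse x))" for v :: real
      by (intro times_differentiable_on_mult Suc times_differentiable_on_const) auto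
    then show ?case
      by (intro times_differentiable_on_SucI[of _ _ "\<lambda>x v. (-v) * (inverse x * inverse x)"])
        (auto intro!: derivative_eq_intros)
  qed
qed

text \<open>
  The functions equal to \<open>p (1/t) exp (-1/t)\<close> for positive \<open>t\<close> and to \<open>0\<close>
  elsewhere, with \<open>p\<close> a polynomial, are closed under differentiation.
\<close>

definition flat_exp :: "real poly \<Rightarrow> real \<Rightarrow> real" where
  "flat_exp p t = (if t \<le> 0 then 0 else poly p (inverse t) * exp (- inverse t))"

lemma poly_exp_tendsto_0: "((\<lambda>x::real. poly p x * exp (- x)) \<longlongrightarrow> 0) at_top"
proof (induction p)
  case (pCons a p)
  have "((\<lambda>x. poly q x * exp (- x)) \<longlongrightarrow> 0) at_top" for q :: "real poly"
  proof -
    have "((\<lambda>x. \<Sum>i\<le>degree q. coeff q i * (x ^ i / exp x)) \<longlongrightarrow> (\<Sum>i\<le>degree q. coeff q i * 0)) at_top"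
      by (intro tendsto_intros tendsto_power_div_exp_0)
    then show ?thesis
      by (simp add: poly_altdef exp_minus sum_divide_distrib divide_inverse sum_distrib_right mult.assoc)
  qed
  then show ?case .
qed simp

text \<open>With s = 1/t one has ds/dt = -s^2, hence the derivative of p(s) exp(-s) is s^2 (p(s) -
  p'(s)) exp(-s); this is the polynomial \<open>monom 1 2 * (p - pderiv p)\<close>.\<close>

lemma DERIV_flat_exp:
  "(flat_exp p has_real_derivative flat_exp (monom 1 2 * (p - pderiv p)) t) (at t)"
proof -
  consider "t < 0" | "t = 0" | "t > 0" by linarith
  then show ?thesis
  proof cases
    case 1
    have "((\<lambda>t. 0) has_real_derivative 0) (at t)" by simp
    then have "(flat_exp p has_real_derivative 0) (at t)"
      by (rule has_field_derivative_transform_within_open[of _ _ _ "{..<0}"])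
        (use 1 in \<open>auto simp: flat_exp_def\<close>)
    then show ?thesis using 1 by (simp add: flat_exp_def)
  next
    case 3
    have "((\<lambda>t. poly p (inverse t) * exp (- inverse t)) has_real_derivative
        poly (monom 1 2 * (p - pderiv p)) (inverse t) * exp (- inverse t)) (at t)"
      using 3 by (auto intro!: derivative_eq_intros DERIV_chain2[OF poly_DERIV]
          simp: poly_monom power2_eq_square algebra_simps)
    then have "(flat_exp p has_real_derivative
        poly (monom 1 2 * (p - pderiv p)) (inverse t) * exp (- inverse t)) (at t)"
      by (rule has_field_derivative_transform_within_open[of _ _ _ "{0<..}"])
        (use 3 in \<open>auto simp: flat_exp_def\<close>)
    then show ?thesis using 3 by (simp add: flat_exp_def)
  next
    case 2
    \<comment> \<open>Dividing by x multiplies p by its variable 1/x, so the right difference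
      quotient at 0 is a function of the same kind, with polynomial
      \<open>pCons 0 p\<close>.\<close>
    have *: "((\<lambda>x. poly (pCons 0 p) (inverse x) * exp (- inverse x)) \<longlongrightarrow> 0) (at_right 0)"
      using filterlim_compose[OF poly_exp_tendsto_0 filterlim_inverse_at_top_right] .
    have "((\<lambda>x. flat_exp p x / x) \<longlongrightarrow> 0) (at_right 0)"
      by (rule Lim_transform_eventually[OF *])
        (auto simp: flat_exp_def field_simps
          intro: eventually_mono[OF eventually_at_right_less[of 0]])
    moreover have "((\<lambda>x. flat_exp p x / x) \<longlongrightarrow> 0) (at_left 0)"
      by (rule Lim_transform_eventually[OF tendsto_const])
        (auto simp: flat_exp_def eventually_at_filter)
    ultimately have "((\<lambda>x. flat_exp p x / x) \<longlongrightarrow> 0) (at 0)"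
      by (simp add: filterlim_split_at)
    then show ?thesis using 2 by (simp add: DERIV_def flat_exp_def)
  qed
qed

lemma smooth_on_flat_exp: "smooth_on UNIV (flat_exp p)"
  unfolding smooth_on_def
proof
  fix n
  show "times_differentiable_on n UNIV (flat_exp p)"
  proof (induction n arbitrary: p)
    case 0
    then show ?case
      using DERIV_flat_exp[THEN DERIV_isCont] by (auto intro: continuous_at_imp_continuous_on)
  next
    case (Suc n)
    have "times_differentiable_on n UNIV (\<lambda>x. flat_exp (monom 1 2 * (p - pderiv p)) x * v)" for v :: real
      by (intro times_differentiable_on_mult Suc times_differentiable_on_const) auto
    then show ?case
      by (intro times_differentiable_on_SucI[of _ _
            "\<lambda>x v. flat_exp (monom 1 2 * (p - pderiv p)) x * v"])
        (auto intro: DERIV_flat_exp[unfolded has_field_derivative_def])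
  qed
qed

text \<open>The quotient f(2-t) / (f(2-t) + f(t-1)), where f is exp(-1/t) continued by 0. The two
  arguments add up to 1, so at least one is positive and the denominator never vanishes.\<close>

lemma smooth_cutoff:
  obtains h :: "real \<Rightarrow> real" where "smooth_on UNIV h" "\<And>t. t \<le> 1 \<Longrightarrow> h t = 1" "\<And>t. t \<ge> 2 \<Longrightarrow> h t = 0"
proof
  let ?f = "flat_exp 1"
  let ?d = "\<lambda>t. ?f (2 - t) + ?f (t - 1)"
  have pos: "?d t > 0" for t by (simp add: flat_exp_def add_pos_nonneg)
  have f: "times_differentiable_on n UNIV (\<lambda>t. ?f (a * t + b))" for a b n
  proof (rule times_differentiable_on_compose_real[of UNIV UNIV "\<lambda>t. a * t + b"])
    show "times_differentiable_on n UNIV ?f"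
      using smooth_on_flat_exp unfolding smooth_on_def by blast
    show "times_differentiable_on n UNIV (\<lambda>t. a * t + b)"
      by (rule times_differentiable_on_add[OF open_UNIV
            times_differentiable_on_bounded_linear[OF open_UNIV bounded_linear_mult_right]
            times_differentiable_on_const])
  qed auto
  have d: "times_differentiable_on n UNIV ?d" for n
    using times_differentiable_on_add[OF _ f[of n "-1" 2] f[of n 1 "-1"]]
    by (simp add: algebra_simps)
  have "times_differentiable_on n UNIV (\<lambda>t. inverse (?d t))" for n
    by (rule times_differentiable_on_compose_real[of UNIV "{0<..}" ?d n inverse for n])
      (use pos d smooth_on_inverse in \<open>auto simp: smooth_on_def\<close>)
  then show "smooth_on UNIV (\<lambda>t. ?f (2 - t) * inverse (?d t))"
    unfolding smooth_on_def using f[of _ "-1" 2]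
    by (intro allI times_differentiable_on_mult)
      (simp_all add: algebra_simps)
  show "?f (2 - t) * inverse (?d t) = 1" if "t \<le> 1" for t
    using pos[of t] that by (simp add: flat_exp_def)
  show "?f (2 - t) * inverse (?d t) = 0" if "t \<ge> 2" for t
    using that by (simp add: flat_exp_def)
qed

section \<open>Exterior algebra at a point\<close>

text \<open>The operations \<open>add\<close> and \<open>scl\<close> are meaningful on F only, so
  linearity is required there and \<phi> is unconstrained elsewhere. Such functionals replace the
  missing vector space structure: they are used to state identities between vectors.\<close>

definition linear_fun ::
  "'v set \<Rightarrow> ('v \<Rightarrow> 'v \<Rightarrow> 'v) \<Rightarrow> (real \<Rightarrow> 'v \<Rightarrow> 'v) \<Rightarrow> ('v \<Rightarrow> real) \<Rightarrow> bool" where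
  "linear_fun F add scl \<phi> \<longleftrightarrow>
     (\<forall>u\<in>F. \<forall>v\<in>F. \<forall>a. \<phi> (add u v) = \<phi> u + \<phi> v \<and> \<phi> (scl a u) = a * \<phi> u)"

lemma linear_funI:
  assumes "\<And>u v. u \<in> F \<Longrightarrow> v \<in> F \<Longrightarrow> \<phi> (add u v) = \<phi> u + \<phi> v"
    and "\<And>a u. u \<in> F \<Longrightarrow> \<phi> (scl a u) = a * \<phi> u"
  shows "linear_fun F add scl \<phi>"
  using assms by (auto simp: linear_fun_def)

lemma linear_fun_add: "linear_fun F add scl \<phi> \<Longrightarrow> u \<in> F \<Longrightarrow> v \<in> F \<Longrightarrow> \<phi> (add u v) = \<phi> u + \<phi> v"
  unfolding linear_fun_def by blast

lemma linear_fun_scl: "linear_fun F add scl \<phi> \<Longrightarrow> u \<in> F \<Longrightarrow> \<phi> (scl a u) = a * \<phi> u"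
  unfolding linear_fun_def by blast

lemma skew_multilinear_outside:
  "skew_multilinear F add scl \<omega> \<Longrightarrow> \<not> set vs \<subseteq> F \<Longrightarrow> \<omega> vs = 0"
  by (simp add: skew_multilinear_def)

lemma skew_multilinear_linear:
  assumes "skew_multilinear F add scl \<omega>" "set us \<subseteq> F" "set vs \<subseteq> F"
  shows "linear_fun F add scl (\<lambda>v. \<omega> (us @ v # vs))"
proof -
  have "\<omega> ((us @ v # vs)[length us := add v w]) =
      \<omega> ((us @ v # vs)[length us := v]) + \<omega> ((us @ v # vs)[length us := w]) \<and>
      \<omega> ((us @ v # vs)[length us := scl a v]) = a * \<omega> ((us @ v # vs)[length us := v])"
    if "v \<in> F" "w \<in> F" for v w a
  proof -
    have "set (us @ v # vs) \<subseteq> F" "length us < length (us @ v # vs)" using assms that by auto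
    then show ?thesis using assms(1) that unfolding skew_multilinear_def by blast
  qed
  then show ?thesis by (simp add: linear_fun_def)
qed

lemma skew_multilinear_linear_Cons:
  "skew_multilinear F add scl \<omega> \<Longrightarrow> set vs \<subseteq> F \<Longrightarrow> linear_fun F add scl (\<lambda>v. \<omega> (v # vs))"
  using skew_multilinear_linear[of F add scl \<omega> "[]"] by simp

text \<open>Holds for arbitrary entries: if one of them lies outside F, both sides are 0.\<close>

lemma skew_multilinear_swap:
  assumes "skew_multilinear F add scl \<omega>"
  shows "\<omega> (us @ v # w # vs) = - \<omega> (us @ w # v # vs)"
proof (cases "set (us @ v # w # vs) \<subseteq> F")
  case True
  let ?l = "us @ v # w # vs"
  have "\<omega> (?l[length us := ?l ! (length us + 1), length us + 1 := ?l ! length us]) = - \<omega> ?l"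
    using assms True unfolding skew_multilinear_def by (metis (no_types, lifting) add.commute
        length_append length_Cons less_add_same_cancel1 nat_add_left_cancel_less not_less_eq plus_1_eq_Suc zero_less_Suc n_not_Suc_n)
  moreover have "?l[length us := ?l ! (length us + 1), length us + 1 := ?l ! length us] = us @ w # v # vs"
    by (simp add: nth_append list_update_append)
  ultimately show ?thesis by simp
next
  case False
  then have "\<not> set (us @ w # v # vs) \<subseteq> F" by auto
  with False have "\<omega> (us @ v # w # vs) = 0" "\<omega> (us @ w # v # vs) = 0"
    using skew_multilinear_outside[OF assms] by blast+
  then show ?thesis by simp
qed

text \<open>Swaps of neighbours suffice. To exchange a and b with a block \<open>ms\<close> between
  them, a passes over \<open>ms\<close>, the neighbours a and b are swapped, and b passes back over
  \<open>ms\<close>; the two signs (-1)^length ms cancel and one minus sign remains.\<close>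

lemma skew_multilinearI:
  assumes outside: "\<And>vs. \<not> set vs \<subseteq> F \<Longrightarrow> \<omega> vs = 0"
    and linear: "\<And>us vs. set us \<subseteq> F \<Longrightarrow> set vs \<subseteq> F \<Longrightarrow>
        linear_fun F add scl (\<lambda>v. \<omega> (us @ v # vs))"
    and swap: "\<And>us v w vs. set us \<subseteq> F \<Longrightarrow> v \<in> F \<Longrightarrow> w \<in> F \<Longrightarrow> set vs \<subseteq> F \<Longrightarrow>
        \<omega> (us @ v # w # vs) = - \<omega> (us @ w # v # vs)"
  shows "skew_multilinear F add scl \<omega>"
proof -
  have move: "\<omega> (us @ a # ms @ vs) = (-1) ^ length ms * \<omega> (us @ ms @ a # vs)"
    if "set (us @ a # ms @ vs) \<subseteq> F" for us a ms vs
    using that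
  proof (induction ms arbitrary: us)
    case (Cons m ms)
    then show ?case
      using swap[of us a m "ms @ vs"] Cons.IH[of "us @ [m]"] by simp
  qed simp
  have exch: "\<omega> (us @ a # ms @ b # vs) = - \<omega> (us @ b # ms @ a # vs)"
    if "set (us @ a # ms @ b # vs) \<subseteq> F" for us a ms b vs
  proof -
    have "\<omega> (us @ a # ms @ b # vs) = (-1) ^ length ms * \<omega> ((us @ ms) @ a # b # vs)"
      using move[of us a ms "b # vs"] that by simp
    also have "\<dots> = - ((-1) ^ length ms * \<omega> ((us @ ms) @ b # a # vs))"
      using swap[of "us @ ms" a b vs] that by simp
    also have "\<dots> = - \<omega> (us @ b # ms @ a # vs)"
      using move[of us b ms "a # vs"] that by simp
    finally show ?thesis .
  qed
  have swap_lt: "\<omega> (vs[i := vs ! j, j := vs ! i]) = - \<omega> vs"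
    if "set vs \<subseteq> F" "i < j" "j < length vs" for vs i j
  proof -
    define us ms ws where "us = take i vs" and "ms = take (j - Suc i) (drop (Suc i) vs)"
      and "ws = drop (Suc j) vs"
    have vs: "vs = us @ vs ! i # ms @ vs ! j # ws"
    proof -
      have "vs = us @ vs ! i # drop (Suc i) vs"
        using that by (simp add: us_def id_take_nth_drop)
      moreover have "drop (Suc i) vs = ms @ drop (j - Suc i) (drop (Suc i) vs)"
        unfolding ms_def by (rule append_take_drop_id[symmetric])
      moreover have "drop (j - Suc i) (drop (Suc i) vs) = vs ! j # ws"
        using that by (simp add: ws_def Cons_nth_drop_Suc)
      ultimately show ?thesis by metis
    qed
    have l: "length us = i" "length ms = j - Suc i" using that by (simp_all add: us_def ms_def)
    have "(us @ a # ms @ b # ws)[i := b, j := a] = us @ b # ms @ a # ws" for a b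
    proof -
      have "i = length us" "j = length us + Suc (length ms)" using l that by auto
      then show ?thesis by (simp add: list_update_append)
    qed
    then have "vs[i := vs ! j, j := vs ! i] = us @ vs ! j # ms @ vs ! i # ws"
      using vs by metis
    moreover have "set (us @ vs ! i # ms @ vs ! j # ws) \<subseteq> F" using vs that(1) by argo
    then have "\<omega> (us @ vs ! i # ms @ vs ! j # ws) = - \<omega> (us @ vs ! j # ms @ vs ! i # ws)"
      by (rule exch)
    ultimately show ?thesis using vs by simp
  qed
  have "\<omega> (vs[i := vs ! j, j := vs ! i]) = - \<omega> vs"
    if "set vs \<subseteq> F" "i < length vs" "j < length vs" "i \<noteq> j" for vs i j
    using swap_lt[of vs i j] swap_lt[of vs j i] that list_update_swap[of i j vs "vs ! j" "vs ! i"]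
    by (cases "i < j") auto
  moreover have "\<omega> (vs[i := add u w]) = \<omega> (vs[i := u]) + \<omega> (vs[i := w]) \<and>
        \<omega> (vs[i := scl a u]) = a * \<omega> (vs[i := u])"
    if "set vs \<subseteq> F" "i < length vs" "u \<in> F" "w \<in> F" for vs i u w a
  proof -
    have "set (take i vs) \<subseteq> F" "set (drop (Suc i) vs) \<subseteq> F"
      using that set_take_subset set_drop_subset by (metis order_trans)+
    from linear[OF this] show ?thesis
      using that by (simp add: upd_conv_take_nth_drop linear_fun_def)
  qed
  ultimately show ?thesis unfolding skew_multilinear_def using outside by blast
qed

lemma skew_multilinear_Cons:
  assumes "skew_multilinear F add scl \<omega>" "v \<in> F"
  shows "skew_multilinear F add scl (\<lambda>us. \<omega> (v # us))"
proof (rule skew_multilinearI)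
  show "\<omega> (v # vs) = 0" if "\<not> set vs \<subseteq> F" for vs
    by (rule skew_multilinear_outside[OF assms(1)]) (use that in auto)
  show "linear_fun F add scl (\<lambda>u. \<omega> (v # us @ u # vs))" if "set us \<subseteq> F" "set vs \<subseteq> F" for us vs
    using skew_multilinear_linear[OF assms(1), of "v # us" vs] that assms(2) by simp
  show "\<omega> (v # us @ u # w # vs) = - \<omega> (v # us @ w # u # vs)" for us u w vs
    using skew_multilinear_swap[OF assms(1), of "v # us" u w vs] by simp
qed

lemma skew_multilinear_swap_Cons:
  "skew_multilinear F add scl \<omega> \<Longrightarrow> \<omega> (v # w # vs) = - \<omega> (w # v # vs)"
  using skew_multilinear_swap[of F add scl \<omega> "[]" v w vs] by simp

lemma skew_multilinear_add:
  assumes "skew_multilinear F add scl \<omega>" "skew_multilinear F add scl \<zeta>"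
  shows "skew_multilinear F add scl (\<lambda>vs. \<omega> vs + \<zeta> vs)"
proof (rule skew_multilinearI)
  show "linear_fun F add scl (\<lambda>v. \<omega> (us @ v # vs) + \<zeta> (us @ v # vs))"
    if "set us \<subseteq> F" "set vs \<subseteq> F" for us vs
    using assms[THEN skew_multilinear_linear, OF that] by (auto simp: linear_fun_def algebra_simps)
  show "\<omega> (us @ v # w # vs) + \<zeta> (us @ v # w # vs) = - (\<omega> (us @ w # v # vs) + \<zeta> (us @ w # v # vs))"
    for us v w vs
    using assms[THEN skew_multilinear_swap, of us v w vs] by simp
qed (simp add: assms[THEN skew_multilinear_outside])

text \<open>A function on lists carries all degrees at once. Degree-dependent factors yield the
  grade involution and, with values 0 and 1, the projections to homogeneous components.\<close>

lemma skew_multilinear_scale_degree: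
  assumes "skew_multilinear F add scl \<omega>"
  shows "skew_multilinear F add scl (\<lambda>vs. k (length vs) * \<omega> vs)"
proof (rule skew_multilinearI)
  show "linear_fun F add scl (\<lambda>v. k (length (us @ v # vs)) * \<omega> (us @ v # vs))"
    if "set us \<subseteq> F" "set vs \<subseteq> F" for us vs
    using skew_multilinear_linear[OF assms that] by (simp add: linear_fun_def algebra_simps)
  show "k (length (us @ v # w # vs)) * \<omega> (us @ v # w # vs) =
      - (k (length (us @ w # v # vs)) * \<omega> (us @ w # v # vs))" for us v w vs
    using skew_multilinear_swap[OF assms, of us v w vs] by simp
qed (simp add: skew_multilinear_outside[OF assms])

lemma skew_multilinear_scale:
  "skew_multilinear F add scl \<omega> \<Longrightarrow> skew_multilinear F add scl (\<lambda>vs. k * \<omega> vs)"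
  using skew_multilinear_scale_degree[of F add scl \<omega> "\<lambda>_. k"] by simp

section \<open>Exterior product at a point and its antiderivation rule\<close>

definition wedge_at :: "('v list \<Rightarrow> real) \<Rightarrow> ('v list \<Rightarrow> real) \<Rightarrow> 'v list \<Rightarrow> real" where
  "wedge_at a b vs =
     (\<Sum>S\<in>Pow {..<length vs}. shuffle_sign S * a (nths vs S) * b (nths vs (- S)))"

text \<open>The grade involution, (-1)^p in degree p. It supplies the sign in the antiderivation
  rule for factors that are not homogeneous.\<close>

definition grade_inv :: "('v list \<Rightarrow> real) \<Rightarrow> 'v list \<Rightarrow> real" where
  "grade_inv a vs = (-1) ^ length vs * a vs"

lemma wedge_apply: "(\<omega> \<curlywedge> \<zeta>) x = wedge_at (\<omega> x) (\<zeta> x)"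
  by (simp add: wedge_def wedge_at_def fun_eq_iff)

text \<open>An inversion consists of an element of the set and a smaller non-element. If 0 belongs
  to the set, it occurs in neither role.\<close>

lemma shuffle_sign_insert: "shuffle_sign (insert 0 (Suc ` S)) = shuffle_sign S"
proof -
  have "{(i, j). i \<in> insert 0 (Suc ` S) \<and> j \<notin> insert 0 (Suc ` S) \<and> j < i} =
      map_prod Suc Suc ` {(i, j). i \<in> S \<and> j \<notin> S \<and> j < i}" (is "?A = _ ` ?B")
  proof (intro subset_antisym subsetI)
    fix p assume "p \<in> ?A"
    then obtain i j where "p = (Suc i, j)" "i \<in> S" "j \<notin> insert 0 (Suc ` S)" "j < Suc i" by auto
    then show "p \<in> map_prod Suc Suc ` ?B" by (cases j) force+
  qed auto
  moreover have "card (map_prod Suc Suc ` ?B) = card ?B"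
    by (rule card_image) (auto simp: inj_on_def)
  ultimately show ?thesis unfolding shuffle_sign_def by simp
qed

text \<open>If 0 is left out of the set, it forms an additional inversion with each of the
  \<open>card S\<close> elements.\<close>

lemma shuffle_sign_Suc:
  assumes "finite S"
  shows "shuffle_sign (Suc ` S) = (-1) ^ card S * shuffle_sign S"
proof -
  let ?B = "{(i, j). i \<in> S \<and> j \<notin> S \<and> j < i}"
  have fin: "finite ?B"
    by (rule finite_subset[of _ "S \<times> {..Max S}"]) (use assms in \<open>auto intro: le_trans[OF less_imp_le Max_ge]\<close>)
  have "{(i, j). i \<in> Suc ` S \<and> j \<notin> Suc ` S \<and> j < i} =
      map_prod Suc Suc ` ?B \<union> (\<lambda>i. (Suc i, 0)) ` S" (is "?A = _")
  proof (intro subset_antisym subsetI)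
    fix p assume "p \<in> ?A"
    then obtain i j where "p = (Suc i, j)" "i \<in> S" "j \<notin> Suc ` S" "j < Suc i" by auto
    then show "p \<in> map_prod Suc Suc ` ?B \<union> (\<lambda>i. (Suc i, 0)) ` S" by (cases j) force+
  qed auto
  moreover have "card (map_prod Suc Suc ` ?B \<union> (\<lambda>i. (Suc i, 0)) ` S) = card ?B + card S"
    using fin assms
    by (subst card_Un_disjoint) (auto simp: card_image prod.inj_map inj_on_subset inj_on_def)
  ultimately show ?thesis unfolding shuffle_sign_def by (simp add: power_add)
qed

text \<open>This says that the interior product is an antiderivation.\<close>

lemma wedge_at_Cons:
  "wedge_at a b (v # vs) =
     wedge_at (\<lambda>us. a (v # us)) b vs + wedge_at (grade_inv a) (\<lambda>us. b (v # us)) vs"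
proof -
  let ?n = "length vs"
  let ?f = "\<lambda>S. shuffle_sign S * a (nths (v # vs) S) * b (nths (v # vs) (- S))"
  \<comment> \<open>Position 0 is that of v. Subsets containing it hand v to the factor a; the
    others hand it to b, and the sign (-1)^card S from \<open>shuffle_sign_Suc\<close> turns a into
    \<open>grade_inv a\<close>.\<close>
  have Pow: "Pow {..<Suc ?n} = (\<lambda>S. insert 0 (Suc ` S)) ` Pow {..<?n} \<union> (`) Suc ` Pow {..<?n}"
  proof (intro subset_antisym subsetI)
    fix S assume S: "S \<in> Pow {..<Suc ?n}"
    let ?T = "{j. Suc j \<in> S}"
    have "?T \<in> Pow {..<?n}" using S by auto
    moreover have "S = (if 0 \<in> S then insert 0 (Suc ` ?T) else Suc ` ?T)"
    proof -
      have "j \<in> S - {0} \<longleftrightarrow> j \<in> Suc ` ?T" for j by (cases j) auto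
      then have "S - {0} = Suc ` ?T" by blast
      then show ?thesis by auto
    qed
    ultimately show "S \<in> (\<lambda>S. insert 0 (Suc ` S)) ` Pow {..<?n} \<union> (`) Suc ` Pow {..<?n}"
      by (metis UnCI image_eqI)
  qed auto
  have "sum ?f (Pow {..<Suc ?n}) =
      sum ?f ((\<lambda>S. insert 0 (Suc ` S)) ` Pow {..<?n}) + sum ?f ((`) Suc ` Pow {..<?n})"
    unfolding Pow by (rule sum.union_disjoint) auto
  also have "sum ?f ((\<lambda>S. insert 0 (Suc ` S)) ` Pow {..<?n}) = wedge_at (\<lambda>us. a (v # us)) b vs"
  proof (subst sum.reindex)
    show "inj_on (\<lambda>S. insert 0 (Suc ` S)) (Pow {..<?n})"
    proof (rule inj_onI)
      fix S T assume "insert 0 (Suc ` S) = insert 0 (Suc ` T)"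
      then have "{j. Suc j \<in> insert 0 (Suc ` S)} = {j. Suc j \<in> insert 0 (Suc ` T)}" by simp
      then show "S = T" by auto
    qed
    have "j \<notin> Suc ` S \<longleftrightarrow> j \<in> insert 0 (Suc ` (- S))" for S j
      by (cases j) auto
    then have "{j. j \<notin> Suc ` S} = insert 0 (Suc ` (- S))" for S by blast
    then show "sum (?f \<circ> (\<lambda>S. insert 0 (Suc ` S))) (Pow {..<?n}) = wedge_at (\<lambda>us. a (v # us)) b vs"
      unfolding wedge_at_def
      by (intro sum.cong) (auto simp: nths_Cons shuffle_sign_insert image_iff Compl_eq)
  qed
  also have "sum ?f ((`) Suc ` Pow {..<?n}) = wedge_at (grade_inv a) (\<lambda>us. b (v # us)) vs"
  proof (subst sum.reindex)
    show "inj_on ((`) Suc) (Pow {..<?n})" by (auto simp: inj_on_def)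
    have "shuffle_sign (Suc ` S) * a (nths vs S) = shuffle_sign S * grade_inv a (nths vs S)"
      if "S \<in> Pow {..<?n}" for S
    proof -
      have "{i. i < ?n \<and> i \<in> S} = S" using that by auto
      then show ?thesis using that
        by (simp add: grade_inv_def length_nths shuffle_sign_Suc finite_subset[of S "{..<?n}"])
    qed
    then show "sum (?f \<circ> (`) Suc) (Pow {..<?n}) = wedge_at (grade_inv a) (\<lambda>us. b (v # us)) vs"
      unfolding wedge_at_def
      by (intro sum.cong) (auto simp: nths_Cons image_iff Compl_eq)
  qed
  finally show ?thesis by (simp add: wedge_at_def)
qed

lemma wedge_at_Nil [simp]: "wedge_at a b [] = a [] * b []"
  by (simp add: wedge_at_def shuffle_sign_def)

lemma wedge_at_add_left: "wedge_at (\<lambda>us. a us + a' us) b vs = wedge_at a b vs + wedge_at a' b vs"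
  by (simp add: wedge_at_def algebra_simps sum.distrib)

lemma wedge_at_add_right: "wedge_at a (\<lambda>us. b us + b' us) vs = wedge_at a b vs + wedge_at a b' vs"
  by (simp add: wedge_at_def algebra_simps sum.distrib)

lemma wedge_at_scale_left: "wedge_at (\<lambda>us. k * a us) b vs = k * wedge_at a b vs"
  by (simp add: wedge_at_def algebra_simps sum_distrib_left)

lemma wedge_at_scale_right: "wedge_at a (\<lambda>us. k * b us) vs = k * wedge_at a b vs"
  by (simp add: wedge_at_def algebra_simps sum_distrib_left)

lemma wedge_at_minus_left: "wedge_at (\<lambda>us. - a us) b vs = - wedge_at a b vs"
  by (simp add: wedge_at_def sum_negf)

lemma wedge_at_minus_right: "wedge_at a (\<lambda>us. - b us) vs = - wedge_at a b vs"
  by (simp add: wedge_at_def sum_negf)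

lemma wedge_at_cong:
  assumes "\<And>us. set us \<subseteq> set vs \<Longrightarrow> a us = a' us" "\<And>us. set us \<subseteq> set vs \<Longrightarrow> b us = b' us"
  shows "wedge_at a b vs = wedge_at a' b' vs"
  unfolding wedge_at_def
  by (intro sum.cong refl arg_cong2[of _ _ _ _ "(*)"] assms set_nths_subset)

text \<open>By \<open>wedge_at_Cons\<close> the head of \<open>us\<close> can be absorbed into
  either factor, which leaves \<open>us\<close> empty. There linearity is that of the factors, and
  under a swap of v and w the two mixed terms, with one vector in each factor, change
  places.\<close>

lemma skew_multilinear_wedge_at:
  assumes "skew_multilinear F add scl a" "skew_multilinear F add scl b"
  shows "skew_multilinear F add scl (wedge_at a b)"
proof (rule skew_multilinearI)
  have gi: "skew_multilinear F add scl (grade_inv a)" if "skew_multilinear F add scl a" for a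
    using skew_multilinear_scale_degree[OF that, of "\<lambda>n. (-1) ^ n"] by (simp add: grade_inv_def [abs_def])
  show "wedge_at a b vs = 0" if vs: "\<not> set vs \<subseteq> F" for vs
  proof -
    \<comment> \<open>The two complementary sublists exhaust the entries, so an entry outside F
      reaches one of the factors.\<close>
    have "a (nths vs S) = 0 \<or> b (nths vs (- S)) = 0" for S
    proof -
      have "set (nths vs S) \<union> set (nths vs (- S)) = set vs"
        by (auto simp: set_nths) (metis in_set_conv_nth)
      then show ?thesis using vs assms skew_multilinear_outside by (metis Un_least)
    qed
    then show ?thesis unfolding wedge_at_def by (intro sum.neutral) auto
  qed
  show "linear_fun F add scl (\<lambda>v. wedge_at a b (us @ v # vs))" if "set us \<subseteq> F" "set vs \<subseteq> F" for us vs
    using that(1) assms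
  proof (induction us arbitrary: a b)
    case Nil
    have *: "linear_fun F add scl (\<lambda>v. c (v # us))" if "skew_multilinear F add scl c" "set us \<subseteq> set vs"
      for c us
      using that \<open>set vs \<subseteq> F\<close> by (intro skew_multilinear_linear_Cons) auto
    have L: "wedge_at (\<lambda>us. a (add u w # us)) b vs =
        wedge_at (\<lambda>us. a (u # us) + a (w # us)) b vs"
      "wedge_at (grade_inv a) (\<lambda>us. b (add u w # us)) vs =
        wedge_at (grade_inv a) (\<lambda>us. b (u # us) + b (w # us)) vs"
      "wedge_at (\<lambda>us. a (scl k u # us)) b vs =
        wedge_at (\<lambda>us. k * a (u # us)) b vs"
      "wedge_at (grade_inv a) (\<lambda>us. b (scl k u # us)) vs =
        wedge_at (grade_inv a) (\<lambda>us. k * b (u # us)) vs"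
      if "u \<in> F" "w \<in> F" for u w k
      using that *[OF Nil(2)] *[OF Nil(3)] by (auto intro!: wedge_at_cong simp: linear_fun_def)
    show ?case
      by (rule linear_funI)
        (simp_all add: wedge_at_Cons L wedge_at_add_left wedge_at_add_right
          wedge_at_scale_left wedge_at_scale_right algebra_simps)
  next
    case (Cons u us)
    have "linear_fun F add scl (\<lambda>v. wedge_at (\<lambda>us. a (u # us)) b (us @ v # vs))"
      "linear_fun F add scl (\<lambda>v. wedge_at (grade_inv a) (\<lambda>us. b (u # us)) (us @ v # vs))"
      using Cons by (auto intro!: Cons.IH skew_multilinear_Cons gi)
    then show ?case by (simp add: wedge_at_Cons linear_fun_def algebra_simps)
  qed
  show "wedge_at a b (us @ v # w # vs) = - wedge_at a b (us @ w # v # vs)"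
    if "set us \<subseteq> F" for us v w vs
    using that assms
  proof (induction us arbitrary: a b)
    case Nil
    have "grade_inv (grade_inv a) = a" by (simp add: grade_inv_def fun_eq_iff flip: power_add mult.assoc)
    \<comment> \<open>Contraction lowers the degree by one and hence anticommutes with the grade
      involution; this is the minus sign of the mixed terms.\<close>
    moreover have "(\<lambda>us. grade_inv a (u # us)) = (\<lambda>us. - grade_inv (\<lambda>us. a (u # us)) us)" for u
      by (simp add: grade_inv_def)
    moreover have "(\<lambda>us. a (v # w # us)) = (\<lambda>us. - a (w # v # us))"
      "(\<lambda>us. b (v # w # us)) = (\<lambda>us. - b (w # v # us))"
      using Nil skew_multilinear_swap_Cons by metis+
    ultimately show ?case
      by (simp add: wedge_at_Cons wedge_at_minus_left wedge_at_minus_right)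
  next
    case (Cons u us)
    then show ?case
      using Cons.IH[of "\<lambda>us. a (u # us)" b] Cons.IH[of "grade_inv a" "\<lambda>us. b (u # us)"]
      by (simp add: wedge_at_Cons skew_multilinear_Cons gi)
  qed
qed

lemma wedge_at_zero_left [simp]: "wedge_at (\<lambda>us. 0) b vs = 0"
  by (simp add: wedge_at_def)

lemma wedge_at_degree_0:
  "(\<And>us. us \<noteq> [] \<Longrightarrow> a us = 0) \<Longrightarrow> wedge_at a b vs = a [] * b vs"
proof (induction vs arbitrary: a b)
  case (Cons v vs)
  have "grade_inv a us = a us" for us
    using Cons.prems by (cases us) (auto simp: grade_inv_def)
  then have "grade_inv a = a" by blast
  then show ?case
    using Cons.IH[of a] Cons.prems by (simp add: wedge_at_Cons)
qed simp

lemma wedge_at_degree_1_Cons: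
  assumes "\<And>us. length us \<noteq> 1 \<Longrightarrow> g us = 0"
  shows "wedge_at g b (v # vs) = g [v] * b vs - wedge_at g (\<lambda>us. b (v # us)) vs"
proof -
  have "grade_inv g us = - g us" for us
    using assms by (cases "length us = 1") (auto simp: grade_inv_def)
  then have "grade_inv g = (\<lambda>us. - g us)" by blast
  then show ?thesis
    using assms by (simp add: wedge_at_Cons wedge_at_degree_0 wedge_at_minus_left)
qed

lemma wedge_at_degree_1:
  assumes "\<And>us. length us \<noteq> 1 \<Longrightarrow> g us = 0"
  shows "wedge_at g b vs = (\<Sum>k<length vs. (-1) ^ k * g [vs ! k] * b (take k vs @ drop (Suc k) vs))"
proof (induction vs arbitrary: b)
  case Nil
  then show ?case using assms by simp
next
  case (Cons v vs)
  show ?case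
    by (simp add: wedge_at_degree_1_Cons[OF assms] Cons sum.lessThan_Suc_shift sum_negf
        flip: sum_subtractf del: sum.lessThan_Suc)
qed

text \<open>Euler's identity: \<Sum> c i \<and> i(e i) multiplies degree p by p. Expanding along the
  first entry contributes k \<omega> once, and skew-symmetry passes to the remaining entries. The
  factor k admits frames that reproduce vectors only up to a bump function.\<close>

lemma wedge_at_euler:
  assumes "skew_multilinear F add scl \<omega>" "set vs \<subseteq> F" "\<And>i. i < n \<Longrightarrow> e i \<in> F"
    and "\<And>i us. i < n \<Longrightarrow> length us \<noteq> 1 \<Longrightarrow> g i us = 0"
    and "\<And>v \<phi>. v \<in> F \<Longrightarrow> linear_fun F add scl \<phi> \<Longrightarrow> (\<Sum>i<n. g i [v] * \<phi> (e i)) = k * \<phi> v"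
  shows "(\<Sum>i<n. wedge_at (g i) (\<lambda>us. \<omega> (e i # us)) vs) = real (length vs) * k * \<omega> vs"
  using assms(1,2)
proof (induction vs arbitrary: \<omega>)
  case Nil
  then show ?case using assms(4) by simp
next
  case (Cons v vs)
  have "(\<Sum>i<n. wedge_at (g i) (\<lambda>us. \<omega> (e i # us)) (v # vs)) =
      (\<Sum>i<n. g i [v] * \<omega> (e i # vs)) - (\<Sum>i<n. wedge_at (g i) (\<lambda>us. \<omega> (e i # v # us)) vs)"
    using assms(4) by (simp add: wedge_at_degree_1_Cons sum_subtractf)
  also have "(\<Sum>i<n. wedge_at (g i) (\<lambda>us. \<omega> (e i # v # us)) vs) =
      - (\<Sum>i<n. wedge_at (g i) (\<lambda>us. \<omega> (v # e i # us)) vs)"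
    using skew_multilinear_swap_Cons[OF Cons.prems(1), of _ v]
    by (simp add: wedge_at_minus_right sum_negf)
  also have "(\<Sum>i<n. wedge_at (g i) (\<lambda>us. \<omega> (v # e i # us)) vs) =
      real (length vs) * k * \<omega> (v # vs)"
    using Cons.prems by (intro Cons.IH skew_multilinear_Cons) auto
  also have "(\<Sum>i<n. g i [v] * \<omega> (e i # vs)) = k * \<omega> (v # vs)"
    using assms(5)[OF _ skew_multilinear_linear_Cons[OF Cons.prems(1)]] Cons.prems(2) by auto
  finally show ?case by (simp add: algebra_simps)
qed

text \<open>
  Contraction of a multivector \<open>P\<close> of degree \<open>p\<close> with a form \<open>\<omega>\<close> in terms of a frame
  \<open>e\<close> and its coframe \<open>c\<close>: the recursion unfolds to
  \<open>1/p! \<Sum> \<omega> [e i1, \<dots>, e ip] P [c i1, \<dots>, c ip]\<close>.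
\<close>

primrec contract :: "nat \<Rightarrow> (nat \<Rightarrow> 'v) \<Rightarrow> (nat \<Rightarrow> 'w) \<Rightarrow> nat \<Rightarrow> ('v list \<Rightarrow> real) \<Rightarrow> ('w list \<Rightarrow> real) \<Rightarrow> real"
  where
    "contract n e c 0 \<omega> P = \<omega> [] * P []"
  | "contract n e c (Suc p) \<omega> P =
       (\<Sum>i<n. contract n e c p (\<lambda>vs. \<omega> (e i # vs)) (\<lambda>\<alpha>s. P (c i # \<alpha>s))) / Suc p"

text \<open>The recursion treats form and multivector alike, so rules for one argument yield those
  for the other.\<close>

lemma contract_commute: "contract n e c p \<omega> P = contract n c e p P \<omega>"
  by (induction p arbitrary: \<omega> P) auto

lemma contract_add_left:
  "contract n e c p (\<lambda>vs. \<omega> vs + \<zeta> vs) P = contract n e c p \<omega> P + contract n e c p \<zeta> P"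
  by (induction p arbitrary: \<omega> \<zeta> P) (auto simp: algebra_simps sum.distrib add_divide_distrib)

lemma contract_scale_left: "contract n e c p (\<lambda>vs. k * \<omega> vs) P = k * contract n e c p \<omega> P"
  by (induction p arbitrary: \<omega> P) (auto simp: sum_distrib_left)

lemma contract_add_right:
  "contract n e c p \<omega> (\<lambda>vs. P vs + Q vs) = contract n e c p \<omega> P + contract n e c p \<omega> Q"
  by (simp add: contract_commute[of n e] contract_add_left)

lemma contract_scale_right: "contract n e c p \<omega> (\<lambda>vs. k * P vs) = k * contract n e c p \<omega> P"
  by (simp add: contract_commute[of n e] contract_scale_left)

lemma contract_cong:
  assumes "\<And>i. i < n \<Longrightarrow> e i \<in> F" "\<And>i. i < n \<Longrightarrow> c i \<in> F'"
    and "\<And>vs. set vs \<subseteq> F \<Longrightarrow> length vs = p \<Longrightarrow> \<omega> vs = \<omega>' vs"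
    and "\<And>vs. set vs \<subseteq> F' \<Longrightarrow> length vs = p \<Longrightarrow> P vs = P' vs"
  shows "contract n e c p \<omega> P = contract n e c p \<omega>' P'"
  using assms(3,4)
proof (induction p arbitrary: \<omega> P \<omega>' P')
  case (Suc p)
  have "contract n e c p (\<lambda>vs. \<omega> (e i # vs)) (\<lambda>\<alpha>s. P (c i # \<alpha>s)) =
      contract n e c p (\<lambda>vs. \<omega>' (e i # vs)) (\<lambda>\<alpha>s. P' (c i # \<alpha>s))" if "i < n" for i
    using that assms(1,2) Suc.prems by (intro Suc.IH) auto
  then show ?case by simp
qed simp

lemma contract_zero_left [simp]: "contract n e c p (\<lambda>vs. 0) P = 0"
  using contract_scale_left[of n e c p 0 "\<lambda>_. 0" P] by simp

lemma contract_zero_right [simp]: "contract n e c p \<omega> (\<lambda>vs. 0) = 0"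
  using contract_scale_right[of n e c p \<omega> 0 "\<lambda>_. 0"] by simp

lemma contract_sum_left:
  "contract n e c p (\<lambda>vs. \<Sum>i\<in>I. k i * \<omega> i vs) P = (\<Sum>i\<in>I. k i * contract n e c p (\<omega> i) P)"
  by (induction I rule: infinite_finite_induct)
    (simp_all add: contract_add_left contract_scale_left)

lemma contract_sum_right:
  "contract n e c p \<omega> (\<lambda>vs. \<Sum>i\<in>I. k i * P i vs) = (\<Sum>i\<in>I. k i * contract n e c p \<omega> (P i))"
  by (simp add: contract_commute[of n e] contract_sum_left)

text \<open>Exterior multiplication by v is adjoint to contraction with u. In degree p + 2 the first
  slot either meets v, which gives the wanted value x, or leaves v to the induction hypothesis,
  which gives p + 1 further copies of x; the factor 1/(p + 2) in \<open>contract\<close> restores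
  x.\<close>

lemma contract_wedge_at:
  assumes "skew_multilinear F add scl \<omega>" "\<And>i. i < n \<Longrightarrow> e i \<in> F" "u \<in> F"
    and "\<And>\<phi>. linear_fun F add scl \<phi> \<Longrightarrow> \<phi> u = (\<Sum>i<n. v [c i] * \<phi> (e i))"
    and "\<And>\<alpha>s. length \<alpha>s \<noteq> 1 \<Longrightarrow> v \<alpha>s = 0"
  shows "contract n e c (Suc p) \<omega> (wedge_at v q) = contract n e c p (\<lambda>vs. \<omega> (u # vs)) q"
  using assms(1)
proof (induction p arbitrary: \<omega> q)
  case (0 \<omega>)
  have "linear_fun F add scl (\<lambda>v. \<omega> [v])"
    using skew_multilinear_linear_Cons[OF 0, of "[]"] by simp
  from assms(4)[OF this] show ?case
    using assms(5) by (simp add: wedge_at_degree_1_Cons[of v] sum_distrib_right sum_distrib_left algebra_simps)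
next
  case (Suc p)
  let ?c = "contract n e c"
  have "?c (Suc p) (\<lambda>vs. \<omega> (e i # vs)) (\<lambda>\<alpha>s. wedge_at v q (c i # \<alpha>s)) =
      v [c i] * ?c (Suc p) (\<lambda>vs. \<omega> (e i # vs)) q +
      ?c p (\<lambda>vs. \<omega> (u # e i # vs)) (\<lambda>\<alpha>s. q (c i # \<alpha>s))" if "i < n" for i
  proof -
    have "?c (Suc p) (\<lambda>vs. \<omega> (e i # vs)) (\<lambda>\<alpha>s. wedge_at v q (c i # \<alpha>s)) =
        ?c (Suc p) (\<lambda>vs. \<omega> (e i # vs)) (\<lambda>\<alpha>s. v [c i] * q \<alpha>s + (-1) * wedge_at v (\<lambda>\<alpha>s. q (c i # \<alpha>s)) \<alpha>s)"
      using assms(5) by (simp add: wedge_at_degree_1_Cons[of v])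
    also have "\<dots> = v [c i] * ?c (Suc p) (\<lambda>vs. \<omega> (e i # vs)) q -
        ?c (Suc p) (\<lambda>vs. \<omega> (e i # vs)) (wedge_at v (\<lambda>\<alpha>s. q (c i # \<alpha>s)))"
      unfolding contract_add_right contract_scale_right by simp
    also have "?c (Suc p) (\<lambda>vs. \<omega> (e i # vs)) (wedge_at v (\<lambda>\<alpha>s. q (c i # \<alpha>s))) =
        ?c p (\<lambda>vs. \<omega> (e i # u # vs)) (\<lambda>\<alpha>s. q (c i # \<alpha>s))"
      by (rule Suc.IH[OF skew_multilinear_Cons[OF Suc.prems assms(2)[OF that]]])
    \<comment> \<open>This minus sign cancels the one from expanding the exterior product past the
      slot of \<open>c i\<close>.\<close>
    also have "(\<lambda>vs. \<omega> (e i # u # vs)) = (\<lambda>vs. (-1) * \<omega> (u # e i # vs))"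
      using skew_multilinear_swap_Cons[OF Suc.prems, of "e i" u] by simp
    finally show ?thesis unfolding contract_scale_left by simp
  qed
  then have "?c (Suc (Suc p)) \<omega> (wedge_at v q) =
      ((\<Sum>i<n. v [c i] * ?c (Suc p) (\<lambda>vs. \<omega> (e i # vs)) q) +
       (\<Sum>i<n. ?c p (\<lambda>vs. \<omega> (u # e i # vs)) (\<lambda>\<alpha>s. q (c i # \<alpha>s)))) / Suc (Suc p)"
    by (subst contract.simps(2), subst sum.distrib[symmetric])
      (intro arg_cong2[of _ _ _ _ "(/)"] sum.cong refl, simp only: lessThan_iff)
  also have "(\<Sum>i<n. ?c p (\<lambda>vs. \<omega> (u # e i # vs)) (\<lambda>\<alpha>s. q (c i # \<alpha>s))) =
      Suc p * ?c (Suc p) (\<lambda>vs. \<omega> (u # vs)) q" by simp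
  also have "(\<Sum>i<n. v [c i] * ?c (Suc p) (\<lambda>vs. \<omega> (e i # vs)) q) = ?c (Suc p) (\<lambda>vs. \<omega> (u # vs)) q"
    unfolding contract_sum_left[symmetric]
  proof (rule contract_cong[of n e F c UNIV])
    show "(\<Sum>i<n. v [c i] * \<omega> (e i # vs)) = \<omega> (u # vs)" if "set vs \<subseteq> F" for vs
      using assms(4)[OF skew_multilinear_linear_Cons[OF Suc.prems that]] by simp
  qed (use assms(2) in auto)
  also have "(x + Suc p * x) / Suc (Suc p) = x" for x :: real
    by (simp add: divide_simps) (simp add: algebra_simps)
  finally show ?case .
qed

subsection \<open>Determinants\<close>

text \<open>The Leibniz formula over an arbitrary index set, so that removing an index stays within
  the same family of determinants.\<close>

definition det_on :: "nat set \<Rightarrow> (nat \<Rightarrow> nat \<Rightarrow> real) \<Rightarrow> real" where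
  "det_on S a = (\<Sum>\<pi> | \<pi> permutes S. of_int (sign \<pi>) * (\<Prod>i\<in>S. a i (\<pi> i)))"

text \<open>A permutation of \<open>insert c S\<close> is a transposition of c and b composed with a
  permutation q of S. It sends c to b, and where q takes the value b it takes the value c; so this
  is the expansion along row c, with column c put in the place of column b and a sign for b \<noteq>
  c.\<close>

lemma det_on_insert:
  assumes "finite S" "c \<notin> S"
  shows "det_on (insert c S) a =
    a c c * det_on S a - (\<Sum>b\<in>S. a c b * det_on S (\<lambda>i j. a i (if j = b then c else j)))"
proof -
  let ?f = "\<lambda>\<pi>. of_int (sign \<pi>) * (\<Prod>i\<in>insert c S. a i (\<pi> i))"
  have perm: "permutation q" if "q permutes S" for q
    using that assms(1) permutation_permutes by blast
  have c: "?f (Transposition.transpose c c \<circ> q) = a c c * (of_int (sign q) * (\<Prod>i\<in>S. a i (q i)))"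
    if "q permutes S" for q
    using that assms by (simp add: permutes_not_in algebra_simps)
  have b: "?f (Transposition.transpose c b \<circ> q) =
      - (a c b * (of_int (sign q) * (\<Prod>i\<in>S. a i (if q i = b then c else q i))))"
    if "q permutes S" "b \<in> S" for q b
  proof -
    have "sign (Transposition.transpose c b \<circ> q) = - sign q"
      using that assms perm by (subst sign_compose) (auto simp: sign_swap_id permutation_swap_id)
    moreover have "(Transposition.transpose c b \<circ> q) c = b" using that assms by (simp add: permutes_not_in)
    moreover have "(Transposition.transpose c b \<circ> q) i = (if q i = b then c else q i)" if "i \<in> S" for i
      using that \<open>q permutes S\<close> assms permutes_in_image[OF \<open>q permutes S\<close>, of i]
      by (auto simp: Transposition.transpose_def)
    then have "(\<Prod>i\<in>S. a i ((Transposition.transpose c b \<circ> q) i)) = (\<Prod>i\<in>S. a i (if q i = b then c else q i))"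
      by (intro prod.cong) auto
    ultimately show ?thesis using assms by (simp del: o_apply)
  qed
  have "det_on (insert c S) a = (\<Sum>b\<in>insert c S. \<Sum>q | q permutes S. ?f (Transposition.transpose c b \<circ> q))"
    unfolding det_on_def by (rule sum_over_permutations_insert[OF assms])
  also have "\<dots> = (\<Sum>q | q permutes S. ?f (Transposition.transpose c c \<circ> q)) +
      (\<Sum>b\<in>S. \<Sum>q | q permutes S. ?f (Transposition.transpose c b \<circ> q))"
    by (rule sum.insert[OF assms])
  also have "(\<Sum>q | q permutes S. ?f (Transposition.transpose c c \<circ> q)) = a c c * det_on S a"
    unfolding det_on_def sum_distrib_left by (rule sum.cong[OF refl c]) auto
  also have "(\<Sum>b\<in>S. \<Sum>q | q permutes S. ?f (Transposition.transpose c b \<circ> q)) =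
      - (\<Sum>b\<in>S. a c b * det_on S (\<lambda>i j. a i (if j = b then c else j)))"
    unfolding det_on_def sum_distrib_left sum_negf[symmetric]
    by (intro sum.cong[OF refl] b) auto
  finally show ?thesis by simp
qed

lemma skew_multilinear_move:
  assumes "skew_multilinear F add scl \<omega>"
  shows "\<omega> (us @ a # ms @ vs) = (-1) ^ length ms * \<omega> (us @ ms @ a # vs)"
proof (induction ms arbitrary: us)
  case (Cons m ms)
  then show ?case
    using skew_multilinear_swap[OF assms, of us a m "ms @ vs"] Cons.IH[of "us @ [m]"] by simp
qed simp

text \<open>Moving v from the front to position k costs (-1)^k, exactly the sign of the k-th term of
  the expansion. The resulting replacement of an entry matches the replaced column in
  \<open>det_on_insert\<close>.\<close>

lemma wedge_at_degree_1_skew: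
  assumes "skew_multilinear F add scl \<omega>" and g: "\<And>us. length us \<noteq> 1 \<Longrightarrow> g us = 0"
  shows "wedge_at g (\<lambda>us. \<omega> (v # us)) vs = (\<Sum>k<length vs. g [vs ! k] * \<omega> (vs[k := v]))"
proof -
  have "\<omega> (v # take k vs @ drop (Suc k) vs) = (-1) ^ k * \<omega> (vs[k := v])" if "k < length vs" for k
    using skew_multilinear_move[OF assms(1), of "[]" v "take k vs" "drop (Suc k) vs"] that
    by (simp add: upd_conv_take_nth_drop)
  then have "(-1) ^ k * g [vs ! k] * \<omega> (v # take k vs @ drop (Suc k) vs) = g [vs ! k] * \<omega> (vs[k := v])"
    if "k < length vs" for k
    using that by (cases "even k") simp_all
  then show ?thesis
    by (subst wedge_at_degree_1[OF g]) (auto intro!: sum.cong)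
qed

text \<open>Both sides obey the same expansion along the first factor. The offset k lets the
  determinant of the remaining factors live on indices from \<open>Suc k\<close> on, which spares a
  reindexing of permutations.\<close>

lemma foldr_wedge_at_eq_det:
  assumes "length gs = length vs"
    and "\<And>g. g \<in> set gs \<Longrightarrow> skew_multilinear F add scl g"
    and "\<And>g us. g \<in> set gs \<Longrightarrow> length us \<noteq> 1 \<Longrightarrow> g us = 0"
    and one: "skew_multilinear F add scl one" "one [] = 1"
  shows "foldr wedge_at gs one vs =
    det_on {k..<k + length vs} (\<lambda>i j. (gs ! (i - k)) [vs ! (j - k)])"
  using assms(1-3)
proof (induction gs arbitrary: vs k)
  case Nil
  then show ?case by (simp add: det_on_def one(2))
next
  case (Cons g gs)
  then obtain v ws where vs: "vs = v # ws" and len: "length gs = length ws"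
    by (metis length_Suc_conv)
  have skew: "skew_multilinear F add scl (foldr wedge_at gs one)"
    using Cons.prems(2) by (induction gs) (auto intro: one skew_multilinear_wedge_at)
  let ?S = "{Suc k..<Suc k + length ws}"
  let ?a = "\<lambda>i j. ((g # gs) ! (i - k)) [vs ! (j - k)]"
  have IH: "foldr wedge_at gs one us =
      det_on ?S (\<lambda>i j. (gs ! (i - Suc k)) [us ! (j - Suc k)])" if "length us = length ws" for us
    using Cons.IH[of us "Suc k"] Cons.prems len that by simp
  have cong: "det_on ?S a = det_on ?S b" if "\<And>i j. i \<in> ?S \<Longrightarrow> j \<in> ?S \<Longrightarrow> a i j = b i j" for a b
    unfolding det_on_def using that by (intro sum.cong arg_cong2[of _ _ _ _ "(*)"] prod.cong refl)
      (auto simp: permutes_in_image simp del: atLeastLessThan_iff)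
  have "{k..<k + length vs} = insert k ?S" by (auto simp: vs)
  then have "det_on {k..<k + length vs} ?a = g [v] * det_on ?S ?a -
      (\<Sum>b\<in>?S. g [vs ! (b - k)] * det_on ?S (\<lambda>i j. ?a i (if j = b then k else j)))"
    by (simp add: det_on_insert vs)
  also have "det_on ?S ?a = foldr wedge_at gs one ws"
    unfolding IH[OF refl] by (rule cong) (auto simp: vs nth_Cons' Suc_diff_Suc)
  also have "(\<Sum>b\<in>?S. g [vs ! (b - k)] * det_on ?S (\<lambda>i j. ?a i (if j = b then k else j))) =
      (\<Sum>b<length ws. g [ws ! b] * foldr wedge_at gs one (ws[b := v]))"
  proof (rule sum.reindex_bij_witness[of _ "\<lambda>b. Suc k + b" "\<lambda>b. b - Suc k"])
    fix b assume b: "b \<in> ?S"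
    have "vs ! (b - k) = ws ! (b - Suc k)" using b by (auto simp: vs nth_Cons' Suc_diff_Suc)
    moreover have "det_on ?S (\<lambda>i j. ?a i (if j = b then k else j)) =
        foldr wedge_at gs one (ws[b - Suc k := v])"
      by (subst IH, simp, rule cong) (use b in \<open>auto simp: vs nth_Cons' nth_list_update\<close>)
    ultimately show "g [ws ! (b - Suc k)] * foldr wedge_at gs one (ws[b - Suc k := v]) =
        g [vs ! (b - k)] * det_on ?S (\<lambda>i j. ?a i (if j = b then k else j))" by simp
  qed auto
  also have "\<dots> = wedge_at g (\<lambda>us. foldr wedge_at gs one (v # us)) ws"
    using wedge_at_degree_1_skew[OF skew, of g v ws] Cons.prems(3)[of g] by simp
  finally show ?case
    using Cons.prems(3)[of g] by (simp add: vs wedge_at_degree_1_Cons)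
qed

section \<open>Dual frames\<close>

definition dual_of ::
  "'v set \<Rightarrow> ('v \<Rightarrow> 'v \<Rightarrow> 'v) \<Rightarrow> (real \<Rightarrow> 'v \<Rightarrow> 'v) \<Rightarrow> ('v \<Rightarrow> real) set" where
  "dual_of F add scl = {\<alpha>. linear_fun F add scl \<alpha> \<and> (\<forall>v. v \<notin> F \<longrightarrow> \<alpha> v = 0)}"

text \<open>Equal to \<open>(+)\<close> on functions; under its own name it stays folded until
  \<open>dual_add_apply\<close> is invoked.\<close>

definition dual_add :: "('v \<Rightarrow> real) \<Rightarrow> ('v \<Rightarrow> real) \<Rightarrow> 'v \<Rightarrow> real" where
  "dual_add \<alpha> \<beta> = (\<lambda>e. \<alpha> e + \<beta> e)"

lemma dual_add_apply: "dual_add \<alpha> \<beta> e = \<alpha> e + \<beta> e"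
  by (simp add: dual_add_def)

abbreviation (input) dual_scale :: "real \<Rightarrow> ('v \<Rightarrow> real) \<Rightarrow> 'v \<Rightarrow> real" where
  "dual_scale \<equiv> \<lambda>a \<alpha> e. a * \<alpha> e"

definition eval_at :: "('v \<Rightarrow> real) set \<Rightarrow> 'v \<Rightarrow> ('v \<Rightarrow> real) \<Rightarrow> real" where
  "eval_at F' v \<alpha> = (if \<alpha> \<in> F' then \<alpha> v else 0)"

definition is_frame ::
  "'v set \<Rightarrow> ('v \<Rightarrow> 'v \<Rightarrow> 'v) \<Rightarrow> (real \<Rightarrow> 'v \<Rightarrow> 'v) \<Rightarrow> nat \<Rightarrow> (nat \<Rightarrow> 'v) \<Rightarrow> (nat \<Rightarrow> 'v \<Rightarrow> real) \<Rightarrow> bool" where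
  "is_frame F add scl n e c \<longleftrightarrow>
     (\<forall>i<n. e i \<in> F \<and> c i \<in> dual_of F add scl) \<and>
     (\<forall>v\<in>F. \<forall>\<phi>. linear_fun F add scl \<phi> \<longrightarrow> \<phi> v = (\<Sum>i<n. c i v * \<phi> (e i)))"

lemma dual_of_add: "\<alpha> \<in> dual_of F add scl \<Longrightarrow> \<beta> \<in> dual_of F add scl \<Longrightarrow> dual_add \<alpha> \<beta> \<in> dual_of F add scl"
  by (auto simp: dual_add_apply dual_of_def linear_fun_def algebra_simps)

lemma dual_of_scale: "\<alpha> \<in> dual_of F add scl \<Longrightarrow> (\<lambda>e. a * \<alpha> e) \<in> dual_of F add scl"
  by (auto simp: dual_of_def linear_fun_def algebra_simps)

lemma linear_fun_dual_sum:
  fixes n :: nat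
  assumes "\<And>i. i < n \<Longrightarrow> c i \<in> dual_of F add scl" "linear_fun (dual_of F add scl) dual_add dual_scale \<psi>"
    and "0 \<in> dual_of F add scl"
  shows "(\<lambda>v. \<Sum>i<n. k i * c i v) \<in> dual_of F add scl \<and> \<psi> (\<lambda>v. \<Sum>i<n. k i * c i v) = (\<Sum>i<n. k i * \<psi> (c i))"
  using assms(1)
proof (induction n)
  case 0
  have "\<psi> (\<lambda>v. 0 * (0 :: 'a \<Rightarrow> real) v) = 0 * \<psi> 0"
    using assms(2,3) unfolding linear_fun_def by blast
  then show ?case using assms(3) by (simp add: zero_fun_def)
next
  case (Suc n)
  let ?s = "\<lambda>v. \<Sum>i<n. k i * c i v" and ?t = "\<lambda>v. k n * c n v"
  have IH: "?s \<in> dual_of F add scl" "\<psi> ?s = (\<Sum>i<n. k i * \<psi> (c i))" using Suc by auto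
  have t: "?t \<in> dual_of F add scl" "\<psi> ?t = k n * \<psi> (c n)"
    using Suc.prems[of n] assms(2) by (auto simp: dual_of_scale linear_fun_def)
  have e: "(\<lambda>v. \<Sum>i<Suc n. k i * c i v) = dual_add ?s ?t" by (simp add: fun_eq_iff dual_add_apply)
  have "\<psi> (dual_add ?s ?t) = \<psi> ?s + \<psi> ?t" using assms(2) IH(1) t(1) unfolding linear_fun_def by blast
  then show ?case unfolding e using IH t dual_of_add[OF IH(1) t(1)] by simp
qed

lemma zero_in_dual_of: "0 \<in> dual_of F add scl"
  by (simp add: dual_of_def linear_fun_def)

text \<open>The transposed formula k \<alpha> = \<Sum> \<alpha>(e i) c i: the coframe is a frame of
  the dual, with evaluation at e i as coefficients. Outside F both sides vanish by the convention in
  \<open>dual_of\<close>.\<close>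

lemma dual_expansion:
  fixes n :: nat
  assumes "\<And>i. i < n \<Longrightarrow> c i \<in> dual_of F add scl"
    and "\<And>v. v \<in> F \<Longrightarrow> k * \<alpha> v = (\<Sum>i<n. c i v * \<alpha> (e i))"
    and "\<alpha> \<in> dual_of F add scl" "linear_fun (dual_of F add scl) dual_add dual_scale \<psi>"
  shows "k * \<psi> \<alpha> = (\<Sum>i<n. \<alpha> (e i) * \<psi> (c i))"
proof -
  have "k * \<alpha> v = (\<Sum>i<n. \<alpha> (e i) * c i v)" for v
  proof (cases "v \<in> F")
    case False
    then have "\<alpha> v = 0" "\<And>i. i < n \<Longrightarrow> c i v = 0" using assms(1,3) by (auto simp: dual_of_def)
    then show ?thesis by simp
  qed (simp add: assms(2) mult.commute)
  then have "(\<lambda>v. k * \<alpha> v) = (\<lambda>v. \<Sum>i<n. \<alpha> (e i) * c i v)" by simp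
  moreover have "\<psi> (\<lambda>v. k * \<alpha> v) = k * \<psi> \<alpha>" using assms(3,4) unfolding linear_fun_def by blast
  ultimately show ?thesis
    using linear_fun_dual_sum[OF assms(1,4) zero_in_dual_of, of n] by simp
qed

lemma is_frame_dual_expansion:
  assumes "is_frame F add scl n e c" "\<alpha> \<in> dual_of F add scl"
    and "linear_fun (dual_of F add scl) dual_add dual_scale \<psi>"
  shows "\<psi> \<alpha> = (\<Sum>i<n. \<alpha> (e i) * \<psi> (c i))"
  using dual_expansion[of n c F add scl 1 \<alpha> e \<psi>] assms by (auto simp: is_frame_def dual_of_def)

text \<open>The inner contraction is moved to the frame b, d by induction. Then e i = \<Sum> d j (e
  i) b j is inserted into the form, and after exchanging the sums \<Sum> d j (e i) c i = d j is
  collected in the multivector.\<close>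

lemma contract_frame_independent:
  assumes "is_frame F add scl n e c" "is_frame F add scl m b d"
    and "skew_multilinear F add scl \<omega>" "skew_multilinear (dual_of F add scl) dual_add dual_scale P"
  shows "contract n e c p \<omega> P = contract m b d p \<omega> P"
  using assms(3,4)
proof (induction p arbitrary: \<omega> P)
  case (Suc p)
  let ?D = "dual_of F add scl"
  have ec: "e i \<in> F" "c i \<in> ?D" if "i < n" for i using assms(1) that by (auto simp: is_frame_def)
  have bd: "b i \<in> F" "d i \<in> ?D" if "i < m" for i using assms(2) that by (auto simp: is_frame_def)
  have "(\<Sum>i<n. contract n e c p (\<lambda>vs. \<omega> (e i # vs)) (\<lambda>\<alpha>s. P (c i # \<alpha>s))) =
      (\<Sum>i<n. contract m b d p (\<lambda>vs. \<omega> (e i # vs)) (\<lambda>\<alpha>s. P (c i # \<alpha>s)))"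
    using Suc ec by (intro sum.cong refl Suc.IH skew_multilinear_Cons) auto
  also have "\<dots> = (\<Sum>i<n. \<Sum>j<m. d j (e i) * contract m b d p (\<lambda>vs. \<omega> (b j # vs)) (\<lambda>\<alpha>s. P (c i # \<alpha>s)))"
  proof (rule sum.cong[OF refl])
    fix i assume i: "i \<in> {..<n}"
    show "contract m b d p (\<lambda>vs. \<omega> (e i # vs)) (\<lambda>\<alpha>s. P (c i # \<alpha>s)) =
        (\<Sum>j<m. d j (e i) * contract m b d p (\<lambda>vs. \<omega> (b j # vs)) (\<lambda>\<alpha>s. P (c i # \<alpha>s)))"
      unfolding contract_sum_left[symmetric]
    proof (rule contract_cong[of m b F d ?D])
      show "\<omega> (e i # vs) = (\<Sum>j<m. d j (e i) * \<omega> (b j # vs))" if "set vs \<subseteq> F" for vs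
        using assms(2) skew_multilinear_linear_Cons[OF Suc.prems(1) that] ec i
        unfolding is_frame_def by blast
    qed (use bd in auto)
  qed
  also have "\<dots> = (\<Sum>j<m. \<Sum>i<n. d j (e i) * contract m b d p (\<lambda>vs. \<omega> (b j # vs)) (\<lambda>\<alpha>s. P (c i # \<alpha>s)))"
    by (rule sum.swap)
  also have "\<dots> = (\<Sum>j<m. contract m b d p (\<lambda>vs. \<omega> (b j # vs)) (\<lambda>\<alpha>s. P (d j # \<alpha>s)))"
  proof (rule sum.cong[OF refl])
    fix j assume j: "j \<in> {..<m}"
    show "(\<Sum>i<n. d j (e i) * contract m b d p (\<lambda>vs. \<omega> (b j # vs)) (\<lambda>\<alpha>s. P (c i # \<alpha>s))) =
        contract m b d p (\<lambda>vs. \<omega> (b j # vs)) (\<lambda>\<alpha>s. P (d j # \<alpha>s))"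
      unfolding contract_sum_right[symmetric]
    proof (rule contract_cong[of m b F d ?D])
      show "(\<Sum>i<n. d j (e i) * P (c i # vs)) = P (d j # vs)" if "set vs \<subseteq> ?D" for vs
        using is_frame_dual_expansion[OF assms(1) bd(2) skew_multilinear_linear_Cons[OF Suc.prems(2) that]] j
        by simp
    qed (use bd in auto)
  qed
  finally show ?case by simp
qed simp

section \<open>Tensor fields\<close>

lemma skew_multilinear_of_fun: "skew_multilinear F add scl (of_fun f x)"
  by (rule skew_multilinearI) (auto simp: of_fun_def linear_fun_def split: if_splits)

text \<open>Smoothness is tested against the given sections, so the dual bundle needs no
  trivialisations of its own.\<close>

definition dual_sections ::
  "('m \<Rightarrow> real) set \<Rightarrow> ('m \<Rightarrow> 'v set) \<Rightarrow> ('v \<Rightarrow> 'v \<Rightarrow> 'v) \<Rightarrow> (real \<Rightarrow> 'v \<Rightarrow> 'v) \<Rightarrow> ('m \<Rightarrow> 'v) set \<Rightarrow>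
   ('m \<Rightarrow> 'v \<Rightarrow> real) set" where
  "dual_sections C F add scl \<Gamma> =
     {\<alpha>. (\<forall>x. \<alpha> x \<in> dual_of (F x) add scl) \<and> (\<forall>s\<in>\<Gamma>. (\<lambda>x. \<alpha> x (s x)) \<in> C)}"

definition one_form :: "('m \<Rightarrow> 'v \<Rightarrow> real) \<Rightarrow> 'm \<Rightarrow> 'v list \<Rightarrow> real" where
  "one_form \<alpha> x vs = (case vs of [v] \<Rightarrow> \<alpha> x v | _ \<Rightarrow> 0)"

lemma one_form_simps [simp]:
  "one_form \<alpha> x [] = 0" "one_form \<alpha> x [v] = \<alpha> x v" "one_form \<alpha> x (v # w # vs) = 0"
  by (simp_all add: one_form_def)

lemma one_form_degree: "length vs \<noteq> 1 \<Longrightarrow> one_form \<alpha> x vs = 0"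
  by (auto simp: one_form_def split: list.split)

text \<open>
  An axiomatic description of the sections \<open>\<Gamma>\<close> of a vector bundle with fibres \<open>F x\<close>.
  The set \<open>\<Theta>\<close> contains enough sections of the dual bundle for local coframes; in a
  local frame, \<open>h\<close> is a bump function.
\<close>

locale tensor_bundle =
  fixes C :: "('m::topological_space \<Rightarrow> real) set"
    and F :: "'m \<Rightarrow> 'v set"
    and add :: "'v \<Rightarrow> 'v \<Rightarrow> 'v" and scl :: "real \<Rightarrow> 'v \<Rightarrow> 'v"
    and \<Gamma> :: "('m \<Rightarrow> 'v) set" and \<Theta> :: "('m \<Rightarrow> 'v \<Rightarrow> real) set"
  assumes C_const: "(\<lambda>x. a) \<in> C"
    and C_add: "f \<in> C \<Longrightarrow> g \<in> C \<Longrightarrow> f + g \<in> C"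
    and C_mult: "f \<in> C \<Longrightarrow> g \<in> C \<Longrightarrow> f * g \<in> C"
    and C_local: "(\<And>x. \<exists>W g. open W \<and> x \<in> W \<and> g \<in> C \<and> (\<forall>y\<in>W. f y = g y)) \<Longrightarrow> f \<in> C"
    and F_scl: "u \<in> F x \<Longrightarrow> scl a u \<in> F x"
    and F_separated: "u \<in> F x \<Longrightarrow> v \<in> F x \<Longrightarrow>
      (\<And>\<phi>. linear_fun (F x) add scl \<phi> \<Longrightarrow> \<phi> u = \<phi> v) \<Longrightarrow> u = v"
    and sections_nonempty: "\<Gamma> \<noteq> {}"
    and section_in: "s \<in> \<Gamma> \<Longrightarrow> s x \<in> F x"
    and section_add: "s \<in> \<Gamma> \<Longrightarrow> t \<in> \<Gamma> \<Longrightarrow> (\<lambda>x. add (s x) (t x)) \<in> \<Gamma>"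
    and section_scl: "f \<in> C \<Longrightarrow> s \<in> \<Gamma> \<Longrightarrow> (\<lambda>x. scl (f x) (s x)) \<in> \<Gamma>"
    and coframe_dual: "\<Theta> \<subseteq> dual_sections C F add scl \<Gamma>"
    and local_frame: "\<exists>h\<in>C. \<exists>W (n::nat) e c. open W \<and> x \<in> W \<and> (\<forall>y\<in>W. h y = 1) \<and>
      (\<forall>i<n. e i \<in> \<Gamma> \<and> c i \<in> \<Theta>) \<and>
      (\<forall>y. \<forall>v\<in>F y. \<forall>\<phi>. linear_fun (F y) add scl \<phi> \<longrightarrow>
        h y * \<phi> v = (\<Sum>i<n. c i y v * \<phi> (e i y)))"
begin

definition frame_near ::
  "'m \<Rightarrow> ('m \<Rightarrow> real) \<Rightarrow> 'm set \<Rightarrow> nat \<Rightarrow> (nat \<Rightarrow> 'm \<Rightarrow> 'v) \<Rightarrow> (nat \<Rightarrow> 'm \<Rightarrow> 'v \<Rightarrow> real) \<Rightarrow> bool" where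
  "frame_near x h W n e c \<longleftrightarrow> h \<in> C \<and> open W \<and> x \<in> W \<and> (\<forall>y\<in>W. h y = 1) \<and>
      (\<forall>i<n. e i \<in> \<Gamma> \<and> c i \<in> \<Theta>) \<and>
      (\<forall>y. \<forall>v\<in>F y. \<forall>\<phi>. linear_fun (F y) add scl \<phi> \<longrightarrow>
        h y * \<phi> v = (\<Sum>i<n. c i y v * \<phi> (e i y)))"

lemma frame_near_exists: "\<exists>h W n e c. frame_near x h W n e c"
  unfolding frame_near_def using local_frame[of x] by (simp add: Bex_def)

lemma frame_nearD:
  assumes "frame_near x h W n e c"
  shows "h \<in> C" "open W" "x \<in> W" "y \<in> W \<Longrightarrow> h y = 1"
    "i < n \<Longrightarrow> e i \<in> \<Gamma>" "i < n \<Longrightarrow> c i \<in> \<Theta>"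
    "v \<in> F y \<Longrightarrow> linear_fun (F y) add scl \<phi> \<Longrightarrow> h y * \<phi> v = (\<Sum>i<n. c i y v * \<phi> (e i y))"
  using assms by (simp_all add: frame_near_def)

lemma C_add': "f \<in> C \<Longrightarrow> g \<in> C \<Longrightarrow> (\<lambda>x. f x + g x) \<in> C"
  using C_add unfolding plus_fun_def by blast

lemma C_mult': "f \<in> C \<Longrightarrow> g \<in> C \<Longrightarrow> (\<lambda>x. f x * g x) \<in> C"
  using C_mult unfolding times_fun_def by blast

lemma C_minus: "f \<in> C \<Longrightarrow> (\<lambda>x. - f x) \<in> C"
  using C_mult'[OF C_const[of "-1"]] by force

lemma C_diff: "f \<in> C \<Longrightarrow> g \<in> C \<Longrightarrow> (\<lambda>x. f x - g x) \<in> C"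
  using C_add'[OF _ C_minus] by force

lemma C_sum: "(\<And>i. i \<in> I \<Longrightarrow> f i \<in> C) \<Longrightarrow> (\<lambda>x. \<Sum>i\<in>I. f i x) \<in> C"
  by (induction I rule: infinite_finite_induct) (auto intro: C_add' C_const)

lemma C_power: "f \<in> C \<Longrightarrow> (\<lambda>x. f x ^ k) \<in> C"
  by (induction k) (auto intro: C_const C_mult')

text \<open>Smoothness is tested on global sections, which makes sense for a bundle and for its
  dual. Its agreement with smoothness in trivialisations is proved in
  \<open>forms_eq_tensors\<close> and \<open>multivectors_eq_tensors\<close>.\<close>

definition tensors :: "('m \<Rightarrow> 'v list \<Rightarrow> real) set" where
  "tensors = {\<omega>. (\<forall>x. skew_multilinear (F x) add scl (\<omega> x)) \<and>
     (\<exists>N. \<forall>x vs. N < length vs \<longrightarrow> \<omega> x vs = 0) \<and>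
     (\<forall>Vs\<in>lists \<Gamma>. eval_form \<omega> Vs \<in> C)}"

lemma tensor_skew: "\<omega> \<in> tensors \<Longrightarrow> skew_multilinear (F x) add scl (\<omega> x)"
  by (simp add: tensors_def)

lemma tensor_bound: "\<omega> \<in> tensors \<Longrightarrow> \<exists>N. \<forall>x vs. N < length vs \<longrightarrow> \<omega> x vs = 0"
  by (simp add: tensors_def)

lemma tensor_eval: "\<omega> \<in> tensors \<Longrightarrow> Vs \<in> lists \<Gamma> \<Longrightarrow> eval_form \<omega> Vs \<in> C"
  by (simp add: tensors_def)

lemma tensorI:
  assumes "\<And>x. skew_multilinear (F x) add scl (\<omega> x)" "\<And>x vs. N < length vs \<Longrightarrow> \<omega> x vs = 0"
    and "\<And>Vs. Vs \<in> lists \<Gamma> \<Longrightarrow> eval_form \<omega> Vs \<in> C"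
  shows "\<omega> \<in> tensors"
  unfolding tensors_def using assms by blast

lemma tensor_add: 
  assumes "\<omega> \<in> tensors" "\<zeta> \<in> tensors"
  shows "\<omega> + \<zeta> \<in> tensors"
proof -
  obtain N M where "\<And>x vs. N < length vs \<Longrightarrow> \<omega> x vs = 0" "\<And>x vs. M < length vs \<Longrightarrow> \<zeta> x vs = 0"
    using assms tensor_bound by metis
  moreover have "(\<omega> + \<zeta>) x = (\<lambda>vs. \<omega> x vs + \<zeta> x vs)" for x by auto
  moreover have "eval_form (\<omega> + \<zeta>) Vs = eval_form \<omega> Vs + eval_form \<zeta> Vs" for Vs
    by (simp add: eval_form_def fun_eq_iff)
  ultimately show ?thesis
    using assms by (intro tensorI[of _ "max N M"])
      (auto intro: skew_multilinear_add tensor_skew C_add tensor_eval)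
qed

lemma tensor_scale:
  assumes "f \<in> C" "\<omega> \<in> tensors"
  shows "f \<odot> \<omega> \<in> tensors"
proof -
  obtain N where "\<And>x vs. N < length vs \<Longrightarrow> \<omega> x vs = 0"
    using assms tensor_bound by metis
  moreover have "(f \<odot> \<omega>) x = (\<lambda>vs. f x * \<omega> x vs)" for x by (auto simp: fun_scale_def)
  moreover have "eval_form (f \<odot> \<omega>) Vs = f * eval_form \<omega> Vs" for Vs
    by (simp add: eval_form_def fun_eq_iff fun_scale_def)
  ultimately show ?thesis
    using assms by (intro tensorI[of _ N])
      (auto intro: skew_multilinear_scale tensor_skew C_mult tensor_eval)
qed

lemma tensor_interior:
  assumes "V \<in> \<Gamma>" "\<omega> \<in> tensors"
  shows "interior_sec V \<omega> \<in> tensors"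
proof -
  obtain N where "\<And>x vs. N < length vs \<Longrightarrow> \<omega> x vs = 0"
    using assms tensor_bound by metis
  moreover have "eval_form (interior_sec V \<omega>) Vs = eval_form \<omega> (V # Vs)" for Vs
    by (simp add: eval_form_def fun_eq_iff interior_sec_def)
  ultimately show ?thesis
    using assms by (intro tensorI[of _ N])
      (auto intro!: tensor_eval[OF assms(2)] skew_multilinear_Cons[OF tensor_skew] section_in
        simp: interior_sec_def [abs_def])
qed

lemma tensor_degree_scale:
  assumes "\<omega> \<in> tensors"
  shows "(\<lambda>x vs. k (length vs) * \<omega> x vs) \<in> tensors"
proof -
  obtain N where "\<And>x vs. N < length vs \<Longrightarrow> \<omega> x vs = 0"
    using assms tensor_bound by metis
  moreover have "eval_form (\<lambda>x vs. k (length vs) * \<omega> x vs) Vs = (\<lambda>x. k (length Vs)) * eval_form \<omega> Vs" for Vs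
    by (simp add: eval_form_def fun_eq_iff)
  ultimately show ?thesis
    using assms by (intro tensorI[of _ N])
      (auto intro: skew_multilinear_scale_degree tensor_skew C_mult C_const tensor_eval)
qed

lemma tensor_of_fun:
  assumes "f \<in> C"
  shows "of_fun f \<in> tensors"
proof (rule tensorI[of _ 0])
  show "skew_multilinear (F x) add scl (of_fun f x)" for x
    by (rule skew_multilinear_of_fun)
  show "eval_form (of_fun f) Vs \<in> C" for Vs
    using assms C_const[of 0] by (cases Vs) (auto simp: eval_form_def of_fun_def)
qed (auto simp: of_fun_def)

lemma tensor_one_form:
  assumes "\<alpha> \<in> dual_sections C F add scl \<Gamma>"
  shows "one_form \<alpha> \<in> tensors"
proof (rule tensorI[of _ 1])
  have d: "\<alpha> x \<in> dual_of (F x) add scl" for x using assms by (simp add: dual_sections_def)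
  show "skew_multilinear (F x) add scl (one_form \<alpha> x)" for x
  proof (rule skew_multilinearI)
    show "one_form \<alpha> x vs = 0" if "\<not> set vs \<subseteq> F x" for vs
      using d[of x] that by (auto simp: one_form_def dual_of_def split: list.split)
    show "linear_fun (F x) add scl (\<lambda>v. one_form \<alpha> x (us @ v # vs))" for us vs
    proof (cases "us = [] \<and> vs = []")
      case True
      then show ?thesis using d[of x] by (simp add: dual_of_def)
    next
      case False
      have "one_form \<alpha> x (us @ v # vs) = 0" for v
        by (rule one_form_degree) (use False in auto)
      then show ?thesis by (simp add: linear_fun_def)
    qed
    show "one_form \<alpha> x (us @ v # w # vs) = - one_form \<alpha> x (us @ w # v # vs)" for us v w vs
      by (simp add: one_form_degree)
  qed
  show "eval_form (one_form \<alpha>) Vs \<in> C" if "Vs \<in> lists \<Gamma>" for Vs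
  proof (cases "length Vs = 1")
    case True
    then obtain V where "Vs = [V]" by (auto simp: length_Suc_conv)
    then show ?thesis using assms that by (simp add: eval_form_def dual_sections_def)
  next
    case False
    then show ?thesis by (simp add: eval_form_def one_form_degree C_const)
  qed
qed (auto simp: one_form_degree)

lemma tensor_wedge:
  assumes "\<omega> \<in> tensors" "\<zeta> \<in> tensors"
  shows "\<omega> \<curlywedge> \<zeta> \<in> tensors"
proof -
  obtain N M where NM: "\<And>x vs. N < length vs \<Longrightarrow> \<omega> x vs = 0" "\<And>x vs. M < length vs \<Longrightarrow> \<zeta> x vs = 0"
    using assms tensor_bound by metis
  have "(\<omega> \<curlywedge> \<zeta>) x vs = 0" if "N + M < length vs" for x vs
  proof -
    have "\<omega> x (nths vs S) = 0 \<or> \<zeta> x (nths vs (- S)) = 0" for S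
    proof -
      \<comment> \<open>The lengths of the complementary sublists add up to that of
        \<open>vs\<close>, so one of them exceeds its degree bound.\<close>
      have "card {i. i < length vs \<and> i \<in> S} + card {i. i < length vs \<and> i \<in> - S} = length vs"
        by (subst card_Un_disjoint[symmetric]) (auto intro: arg_cong[of _ "{..<length vs}" card, simplified])
      then have "N < length (nths vs S) \<or> M < length (nths vs (- S))"
        using that by (auto simp: length_nths)
      then show ?thesis using NM by blast
    qed
    then show ?thesis unfolding wedge_def by (intro sum.neutral) auto
  qed
  moreover have "eval_form (\<omega> \<curlywedge> \<zeta>) Vs \<in> C" if "Vs \<in> lists \<Gamma>" for Vs
  proof -
    have l: "nths Vs S \<in> lists \<Gamma>" for S using that set_nths_subset[of Vs S] by (auto simp: lists_eq_set)
    have "eval_form (\<omega> \<curlywedge> \<zeta>) Vs = (\<lambda>x. \<Sum>S\<in>Pow {..<length Vs}.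
        (shuffle_sign S * eval_form \<omega> (nths Vs S) x) * eval_form \<zeta> (nths Vs (- S)) x)"
      by (simp add: eval_form_def wedge_def nths_map)
    also have "\<dots> \<in> C"
      by (intro C_sum C_mult' C_const tensor_eval assms l)
    finally show ?thesis .
  qed
  ultimately show ?thesis
    using assms by (intro tensorI[of _ "N + M"]) (auto simp: wedge_apply skew_multilinear_wedge_at tensor_skew)
qed

subsection \<open>Tensoriality\<close>

definition fun_linear :: "(('m \<Rightarrow> 'v) \<Rightarrow> 'm \<Rightarrow> real) \<Rightarrow> bool" where
  "fun_linear K \<longleftrightarrow>
     (\<forall>s\<in>\<Gamma>. \<forall>t\<in>\<Gamma>. K (\<lambda>x. add (s x) (t x)) = K s + K t) \<and>
     (\<forall>f\<in>C. \<forall>s\<in>\<Gamma>. K (\<lambda>x. scl (f x) (s x)) = f * K s)"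

text \<open>The section \<Sum> k i e i, characterised by the values of linear functionals and of
  C-linear maps on it, as the fibre operations provide no finite sums. The empty sum is 0 times an
  arbitrary section.\<close>

lemma linear_combination:
  fixes n :: nat
  assumes "\<And>i. i < n \<Longrightarrow> k i \<in> C \<and> e i \<in> \<Gamma>"
  shows "\<exists>s\<in>\<Gamma>. (\<forall>x \<phi>. linear_fun (F x) add scl \<phi> \<longrightarrow> \<phi> (s x) = (\<Sum>i<n. k i x * \<phi> (e i x))) \<and>
    (\<forall>K. fun_linear K \<longrightarrow> K s = (\<lambda>x. \<Sum>i<n. k i x * K (e i) x))"
  using assms
proof (induction n)
  case 0
  obtain s where s: "s \<in> \<Gamma>" using sections_nonempty by blast
  show ?case
  proof (rule bexI[of _ "\<lambda>x. scl 0 (s x)"], intro conjI allI impI)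
    fix x \<phi> assume "linear_fun (F x) add scl \<phi>"
    then have "\<phi> (scl 0 (s x)) = 0 * \<phi> (s x)" using section_in[OF s] unfolding linear_fun_def by blast
    then show "\<phi> (scl 0 (s x)) = (\<Sum>i<0. k i x * \<phi> (e i x))" by simp
  next
    fix K assume "fun_linear K"
    then have "K (\<lambda>x. scl 0 (s x)) = (\<lambda>_. 0) * K s"
      using s C_const[of 0] unfolding fun_linear_def by fast
    then show "K (\<lambda>x. scl 0 (s x)) = (\<lambda>x. \<Sum>i<0. k i x * K (e i) x)" by auto
  qed (rule section_scl[OF C_const s])
next
  case (Suc n)
  have "k i \<in> C \<and> e i \<in> \<Gamma>" if "i < n" for i using Suc.prems[of i] that by simp
  from Suc.IH[OF this] obtain s where s: "s \<in> \<Gamma>"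
    "\<And>x \<phi>. linear_fun (F x) add scl \<phi> \<Longrightarrow> \<phi> (s x) = (\<Sum>i<n. k i x * \<phi> (e i x))"
    "\<And>K. fun_linear K \<Longrightarrow> K s = (\<lambda>x. \<Sum>i<n. k i x * K (e i) x)"
    by blast
  have k: "k n \<in> C" "e n \<in> \<Gamma>" using Suc.prems[of n] by auto
  have t: "(\<lambda>x. scl (k n x) (e n x)) \<in> \<Gamma>" by (rule section_scl[OF k])
  show ?case
  proof (rule bexI[of _ "\<lambda>x. add (s x) (scl (k n x) (e n x))"], intro conjI allI impI)
    fix x \<phi> assume "linear_fun (F x) add scl \<phi>"
    with section_in[OF s(1), of x] section_in[OF k(2), of x] section_in[OF t, of x] s(2)[of x \<phi>]
    show "\<phi> (add (s x) (scl (k n x) (e n x))) = (\<Sum>i<Suc n. k i x * \<phi> (e i x))"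
      by (simp add: linear_fun_def)
  next
    fix K assume K: "fun_linear K"
    have "K (\<lambda>x. add (s x) (scl (k n x) (e n x))) = K s + K (\<lambda>x. scl (k n x) (e n x))"
      using K s(1) t by (simp add: fun_linear_def)
    also have "K (\<lambda>x. scl (k n x) (e n x)) = k n * K (e n)"
      using K k by (simp add: fun_linear_def)
    finally show "K (\<lambda>x. add (s x) (scl (k n x) (e n x))) = (\<lambda>x. \<Sum>i<Suc n. k i x * K (e i) x)"
      using s(3)[OF K] by (simp add: fun_eq_iff)
  qed (rule section_add[OF s(1) t])
qed

text \<open>The section h s equals the combination of the global e i with the smooth coefficients c
  i (s). Hence h K s = \<Sum> c i (s) K (e i), and at x, where h is 1, only s x enters.\<close>

lemma fun_linear_pointwise:
  assumes "fun_linear K" "s \<in> \<Gamma>" "t \<in> \<Gamma>" "s x = t x"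
  shows "K s x = K t x"
proof -
  obtain h W n e c where "frame_near x h W n e c" using frame_near_exists[of x] by blast
  note fr = frame_nearD[OF this]
  have "K s x = (\<Sum>i<n. c i x (s x) * K (e i) x)" if s: "s \<in> \<Gamma>" for s
  proof -
    have "(\<lambda>x. c i x (s x)) \<in> C" if "i < n" for i
      using fr(6)[OF that] coframe_dual s by (auto simp: dual_sections_def)
    then obtain t where t: "t \<in> \<Gamma>"
      "\<And>x \<phi>. linear_fun (F x) add scl \<phi> \<Longrightarrow> \<phi> (t x) = (\<Sum>i<n. c i x (s x) * \<phi> (e i x))"
      "\<And>K. fun_linear K \<Longrightarrow> K t = (\<lambda>x. \<Sum>i<n. c i x (s x) * K (e i) x)"
      using linear_combination[of n "\<lambda>i x. c i x (s x)" e] fr(5) by blast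
    have "t = (\<lambda>y. scl (h y) (s y))"
    proof
      fix y show "t y = scl (h y) (s y)"
      proof (rule F_separated)
        fix \<phi> assume \<phi>: "linear_fun (F y) add scl \<phi>"
        have "\<phi> (scl (h y) (s y)) = h y * \<phi> (s y)"
          by (rule linear_fun_scl[OF \<phi> section_in[OF s]])
        then show "\<phi> (t y) = \<phi> (scl (h y) (s y))"
          using t(2)[OF \<phi>] fr(7)[OF section_in[OF s] \<phi>] by simp
      qed (use section_in s t(1) F_scl in blast)+
    qed
    then have "h * K s = (\<lambda>x. \<Sum>i<n. c i x (s x) * K (e i) x)"
      using t(3)[OF assms(1)] assms(1) s fr(1) unfolding fun_linear_def by metis
    then show ?thesis using fr(4)[OF fr(3)] by (auto dest!: fun_cong[of _ _ x])
  qed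
  with assms show ?thesis by simp
qed

text \<open>The constants c i x v serve as coefficients of the global sections e i; since h is 1 at
  x, the combination passes through v.\<close>

lemma section_through: "v \<in> F x \<Longrightarrow> \<exists>s\<in>\<Gamma>. s x = v"
proof -
  assume v: "v \<in> F x"
  obtain h W n e c where "frame_near x h W n e c" using frame_near_exists[of x] by blast
  note fr = frame_nearD[OF this]
  obtain t where t: "t \<in> \<Gamma>"
    "\<And>y \<phi>. linear_fun (F y) add scl \<phi> \<Longrightarrow> \<phi> (t y) = (\<Sum>i<n. c i x v * \<phi> (e i y))"
    using linear_combination[of n "\<lambda>i y. c i x v" e] fr(5) C_const by blast
  have "t x = v"
  proof (rule F_separated)
    fix \<phi> assume \<phi>: "linear_fun (F x) add scl \<phi>"
    show "\<phi> (t x) = \<phi> v" using t(2)[OF \<phi>] fr(7)[OF v \<phi>] fr(4)[OF fr(3)] by simp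
  qed (use v section_in[OF t(1)] in auto)
  with t(1) show ?thesis by blast
qed

definition sec_through :: "'m \<Rightarrow> 'v \<Rightarrow> 'm \<Rightarrow> 'v" where
  "sec_through x v = (SOME s. s \<in> \<Gamma> \<and> s x = v)"

lemma sec_through: "v \<in> F x \<Longrightarrow> sec_through x v \<in> \<Gamma>" "v \<in> F x \<Longrightarrow> sec_through x v x = v"
  using section_through[of v x] someI_ex[of "\<lambda>s. s \<in> \<Gamma> \<and> s x = v"] by (auto simp: sec_through_def)

lemma sections_through:
  assumes "set vs \<subseteq> F x"
  obtains Vs where "Vs \<in> lists \<Gamma>" "map (\<lambda>V. V x) Vs = vs"
  by (rule that[of "map (sec_through x) vs"])
    (use assms in \<open>auto simp: sec_through subset_iff intro!: map_idI\<close>)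

lemma tensor_eqI:
  assumes "\<omega> \<in> tensors" "\<zeta> \<in> tensors"
    and "\<And>Vs. Vs \<in> lists \<Gamma> \<Longrightarrow> eval_form \<omega> Vs = eval_form \<zeta> Vs"
  shows "\<omega> = \<zeta>"
proof (intro ext)
  fix x vs
  show "\<omega> x vs = \<zeta> x vs"
  proof (cases "set vs \<subseteq> F x")
    case True
    then obtain Vs where Vs: "Vs \<in> lists \<Gamma>" "map (\<lambda>V. V x) Vs = vs" by (rule sections_through)
    show ?thesis using fun_cong[OF assms(3)[OF Vs(1)], of x] Vs(2) by (simp add: eval_form_def)
  next
    case False
    then show ?thesis using assms(1,2)[THEN tensor_skew] skew_multilinear_outside by metis
  qed
qed

text \<open>Meant as the inverse of \<open>eval_form\<close>: the vectors at x are extended to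
  arbitrarily chosen sections, and R is evaluated on them at x.\<close>

definition tensor_of :: "(('m \<Rightarrow> 'v) list \<Rightarrow> 'm \<Rightarrow> real) \<Rightarrow> 'm \<Rightarrow> 'v list \<Rightarrow> real" where
  "tensor_of R x vs = (if set vs \<subseteq> F x then R (map (sec_through x) vs) x else 0)"

text \<open>A C-linear slot depends on a section only through its value at x, by
  \<open>fun_linear_pointwise\<close>. The chosen extensions in \<open>tensor_of\<close> are
  therefore immaterial, and fibrewise linearity is inherited from R.\<close>

lemma
  assumes lin: "\<And>us vs. us \<in> lists \<Gamma> \<Longrightarrow> vs \<in> lists \<Gamma> \<Longrightarrow> fun_linear (\<lambda>s. R (us @ s # vs))"
    and swap: "\<And>us s t vs. us \<in> lists \<Gamma> \<Longrightarrow> s \<in> \<Gamma> \<Longrightarrow> t \<in> \<Gamma> \<Longrightarrow> vs \<in> lists \<Gamma> \<Longrightarrow>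
        R (us @ s # t # vs) = - R (us @ t # s # vs)"
    and bound: "\<And>Vs. Vs \<in> lists \<Gamma> \<Longrightarrow> N < length Vs \<Longrightarrow> R Vs = 0"
    and C: "\<And>Vs. Vs \<in> lists \<Gamma> \<Longrightarrow> R Vs \<in> C"
  shows eval_tensor_of: "Vs \<in> lists \<Gamma> \<Longrightarrow> eval_form (tensor_of R) Vs = R Vs"
    and tensor_of_tensor: "tensor_of R \<in> tensors"
proof -
  \<comment> \<open>Sections are exchanged one at a time; those already exchanged accumulate in
    \<open>us\<close>.\<close>
  have pointwise: "R (us @ Vs) x = R (us @ Ws) x"
    if "us \<in> lists \<Gamma>" "Vs \<in> lists \<Gamma>" "Ws \<in> lists \<Gamma>" "map (\<lambda>V. V x) Vs = map (\<lambda>V. V x) Ws"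
    for us Vs Ws x
    using that
  proof (induction Vs arbitrary: us Ws)
    case (Cons V Vs)
    then obtain W Ws' where W: "Ws = W # Ws'" by (cases Ws) auto
    have "R (us @ V # Vs) x = R (us @ W # Vs) x"
      by (rule fun_linear_pointwise[OF lin]) (use Cons.prems W in auto)
    also have "\<dots> = R ((us @ [W]) @ Ws') x"
      using Cons.IH[of "us @ [W]" Ws'] Cons.prems W by auto
    finally show ?case using W by simp
  qed simp
  have at: "tensor_of R x (map (\<lambda>V. V x) Vs) = R Vs x" if "Vs \<in> lists \<Gamma>" for Vs x
  proof -
    have "set (map (\<lambda>V. V x) Vs) \<subseteq> F x" using that section_in by auto
    moreover from this have "R (map (sec_through x) (map (\<lambda>V. V x) Vs)) x = R Vs x"
      using that by (intro pointwise[of "[]", simplified]) (auto simp: sec_through subset_iff)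
    ultimately show ?thesis by (simp add: tensor_of_def)
  qed
  then show ev: "eval_form (tensor_of R) Vs = R Vs" if "Vs \<in> lists \<Gamma>" for Vs
    using that by (simp add: eval_form_def)
  show "tensor_of R \<in> tensors"
  proof (rule tensorI[of _ N])
    show "eval_form (tensor_of R) Vs \<in> C" if "Vs \<in> lists \<Gamma>" for Vs
      using ev C that by simp
    show "tensor_of R x vs = 0" if "N < length vs" for x vs
    proof (cases "set vs \<subseteq> F x")
      case True
      then have "map (sec_through x) vs \<in> lists \<Gamma>" by (auto simp: sec_through subset_iff)
      then show ?thesis using bound that by (simp add: tensor_of_def)
    qed (simp add: tensor_of_def)
    fix x
    show "skew_multilinear (F x) add scl (tensor_of R x)"
    proof (rule skew_multilinearI)
      fix us vs assume "set us \<subseteq> F x" "set vs \<subseteq> F x"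
      then obtain Us Vs where U: "Us \<in> lists \<Gamma>" "map (\<lambda>V. V x) Us = us"
        and V: "Vs \<in> lists \<Gamma>" "map (\<lambda>V. V x) Vs = vs"
        using sections_through by metis
      have l: "fun_linear (\<lambda>s. R (Us @ s # Vs))" by (rule lin[OF U(1) V(1)])
      have at': "tensor_of R x (us @ s x # vs) = R (Us @ s # Vs) x" if "s \<in> \<Gamma>" for s
        using at[of "Us @ s # Vs" x] U V that by auto
      show "linear_fun (F x) add scl (\<lambda>v. tensor_of R x (us @ v # vs))"
      proof (rule linear_funI)
        fix u v assume "u \<in> F x" "v \<in> F x"
        then obtain s t where s: "s \<in> \<Gamma>" "s x = u" and t: "t \<in> \<Gamma>" "t x = v"
          using section_through by metis
        show "tensor_of R x (us @ add u v # vs) = tensor_of R x (us @ u # vs) + tensor_of R x (us @ v # vs)"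
          using at'[OF s(1)] at'[OF t(1)] at'[OF section_add[OF s(1) t(1)]] s t l
          by (simp add: fun_linear_def)
        fix a
        show "tensor_of R x (us @ scl a u # vs) = a * tensor_of R x (us @ u # vs)"
          using at'[OF s(1)] at'[OF section_scl[OF C_const s(1), of a]] s l C_const[of a]
          by (simp add: fun_linear_def)
      qed
      fix u v assume "u \<in> F x" "v \<in> F x"
      then obtain s t where s: "s \<in> \<Gamma>" "s x = u" and t: "t \<in> \<Gamma>" "t x = v"
        using section_through by metis
      show "tensor_of R x (us @ u # v # vs) = - tensor_of R x (us @ v # u # vs)"
        using at[of "Us @ s # t # Vs" x] at[of "Us @ t # s # Vs" x] swap[OF U(1) s(1) t(1) V(1)] U V s t
        by auto
    qed (simp add: tensor_of_def)
  qed
qed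

end

lemma eval_form_add [simp]: "eval_form (\<omega> + \<zeta>) Vs = eval_form \<omega> Vs + eval_form \<zeta> Vs"
  by (simp add: eval_form_def fun_eq_iff)

lemma eval_form_diff [simp]: "eval_form (\<omega> - \<zeta>) Vs = eval_form \<omega> Vs - eval_form \<zeta> Vs"
  by (simp add: eval_form_def fun_eq_iff)

lemma eval_form_scale [simp]: "eval_form (f \<odot> \<omega>) Vs = f * eval_form \<omega> Vs"
  by (simp add: eval_form_def fun_eq_iff fun_scale_def)

lemma eval_form_interior [simp]: "eval_form (interior_sec V \<omega>) Vs = eval_form \<omega> (V # Vs)"
  by (simp add: eval_form_def interior_sec_def)

lemma interior_sec_add [simp]: "interior_sec V (\<omega> + \<zeta>) = interior_sec V \<omega> + interior_sec V \<zeta>"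
  by (simp add: interior_sec_def fun_eq_iff)

lemma interior_sec_scale [simp]: "interior_sec V (f \<odot> \<omega>) = f \<odot> interior_sec V \<omega>"
  by (simp add: interior_sec_def fun_eq_iff fun_scale_def)

lemma wedge_list_simps: "wedge_list [] = of_fun 1" "wedge_list (\<omega> # \<omega>s) = \<omega> \<curlywedge> wedge_list \<omega>s"
  by (simp_all add: wedge_list_def)

lemma wedge_list_at: "wedge_list \<omega>s x = foldr wedge_at (map (\<lambda>\<omega>. \<omega> x) \<omega>s) (of_fun 1 x)"
  by (induction \<omega>s) (simp_all add: wedge_list_simps wedge_apply one_fun_def)

lemma wedge_add_left: "(\<omega> + \<omega>') \<curlywedge> \<zeta> = \<omega> \<curlywedge> \<zeta> + \<omega>' \<curlywedge> \<zeta>"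
  by (simp add: wedge_def fun_eq_iff algebra_simps sum.distrib)

lemma wedge_add_right: "\<omega> \<curlywedge> (\<zeta> + \<zeta>') = \<omega> \<curlywedge> \<zeta> + \<omega> \<curlywedge> \<zeta>'"
  by (simp add: wedge_def fun_eq_iff algebra_simps sum.distrib)

lemma wedge_scale_right: "\<omega> \<curlywedge> (f \<odot> \<zeta>) = f \<odot> (\<omega> \<curlywedge> \<zeta>)"
  by (simp add: wedge_def fun_scale_def fun_eq_iff algebra_simps sum_distrib_left)

lemma fun_scale_scale: "f \<odot> g \<odot> \<omega> = (f * g) \<odot> \<omega>"
  by (simp add: fun_scale_def fun_eq_iff)

lemma fun_scale_add: "f \<odot> (\<omega> + \<zeta>) = f \<odot> \<omega> + f \<odot> \<zeta>"
  by (simp add: fun_scale_def fun_eq_iff algebra_simps)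

lemma sum_fun_apply: "(\<Sum>i\<in>I. f i) x = (\<Sum>i\<in>I. f i x)"
  by (induction I rule: infinite_finite_induct) auto

context tensor_bundle
begin

lemma tensor_diff:
  assumes "\<omega> \<in> tensors" "\<zeta> \<in> tensors"
  shows "\<omega> - \<zeta> \<in> tensors"
proof -
  have "\<omega> - \<zeta> = \<omega> + (\<lambda>_. -1) \<odot> \<zeta>" by (simp add: fun_eq_iff fun_scale_def)
  then show ?thesis using assms by (simp only: tensor_add tensor_scale C_const)
qed

lemma interior_add:
  assumes "\<omega> \<in> tensors" "s \<in> \<Gamma>" "t \<in> \<Gamma>"
  shows "interior_sec (\<lambda>x. add (s x) (t x)) \<omega> = interior_sec s \<omega> + interior_sec t \<omega>"
proof (intro ext)
  fix x vs
  show "interior_sec (\<lambda>x. add (s x) (t x)) \<omega> x vs = (interior_sec s \<omega> + interior_sec t \<omega>) x vs"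
  proof (cases "set vs \<subseteq> F x")
    case True
    then show ?thesis
      using linear_fun_add[OF skew_multilinear_linear_Cons[OF tensor_skew[OF assms(1)]]] section_in assms(2,3)
      by (simp add: interior_sec_def)
  next
    case False
    then have "\<omega> x (v # vs) = 0" for v
      using skew_multilinear_outside[OF tensor_skew[OF assms(1)]] by simp
    then show ?thesis by (simp add: interior_sec_def)
  qed
qed

lemma interior_scl:
  assumes "\<omega> \<in> tensors" "s \<in> \<Gamma>"
  shows "interior_sec (\<lambda>x. scl (f x) (s x)) \<omega> = f \<odot> interior_sec s \<omega>"
proof (intro ext)
  fix x vs
  show "interior_sec (\<lambda>x. scl (f x) (s x)) \<omega> x vs = (f \<odot> interior_sec s \<omega>) x vs"
  proof (cases "set vs \<subseteq> F x")
    case True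
    then show ?thesis
      using linear_fun_scl[OF skew_multilinear_linear_Cons[OF tensor_skew[OF assms(1)]]] section_in assms(2)
      by (simp add: interior_sec_def fun_scale_def)
  next
    case False
    then have "\<omega> x (v # vs) = 0" for v
      using skew_multilinear_outside[OF tensor_skew[OF assms(1)]] by simp
    then show ?thesis by (simp add: interior_sec_def fun_scale_def)
  qed
qed

lemma interior_swap:
  assumes "\<omega> \<in> tensors"
  shows "interior_sec s (interior_sec t \<omega>) = (\<lambda>_. -1) \<odot> interior_sec t (interior_sec s \<omega>)"
proof (intro ext)
  fix x vs
  show "interior_sec s (interior_sec t \<omega>) x vs = ((\<lambda>_. -1) \<odot> interior_sec t (interior_sec s \<omega>)) x vs"
    using skew_multilinear_swap_Cons[OF tensor_skew[OF assms], of x "t x" "s x" vs]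
    by (simp add: interior_sec_def fun_scale_def)
qed

lemma eval_linear_Cons:
  assumes "\<omega> \<in> tensors" "s \<in> \<Gamma>" "t \<in> \<Gamma>"
  shows "eval_form \<omega> ((\<lambda>x. add (s x) (t x)) # Vs) = eval_form \<omega> (s # Vs) + eval_form \<omega> (t # Vs)"
    and "eval_form \<omega> ((\<lambda>x. scl (f x) (s x)) # Vs) = f * eval_form \<omega> (s # Vs)"
  using interior_add[OF assms] interior_scl[OF assms(1,2), of f]
  by (simp_all flip: eval_form_interior)

lemma eval_fun_linear:
  assumes "\<omega> \<in> tensors" "us \<in> lists \<Gamma>" "vs \<in> lists \<Gamma>"
  shows "fun_linear (\<lambda>s. eval_form \<omega> (us @ s # vs))"
proof -
  have l: "linear_fun (F x) add scl (\<lambda>v. \<omega> x (map (\<lambda>V. V x) us @ v # map (\<lambda>V. V x) vs))" for x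
    by (rule skew_multilinear_linear[OF tensor_skew[OF assms(1)]]) (use assms(2,3) section_in in auto)
  show ?thesis
    unfolding fun_linear_def
    using linear_fun_add[OF l] linear_fun_scl[OF l] section_in by (auto simp: eval_form_def fun_eq_iff)
qed

lemma one_form_dual_section:
  assumes "one_form \<alpha> \<in> tensors"
  shows "\<alpha> \<in> dual_sections C F add scl \<Gamma>"
  unfolding dual_sections_def dual_of_def mem_Collect_eq
proof (intro conjI allI ballI impI)
  show "linear_fun (F x) add scl (\<alpha> x)" for x
    using skew_multilinear_linear_Cons[OF tensor_skew[OF assms], of "[]" x] by simp
  show "\<alpha> x v = 0" if "v \<notin> F x" for x v
    using skew_multilinear_outside[OF tensor_skew[OF assms], of "[v]" x] that by simp
  show "(\<lambda>x. \<alpha> x (s x)) \<in> C" if "s \<in> \<Gamma>" for s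
    using tensor_eval[OF assms, of "[s]"] that by (simp add: eval_form_def)
qed

subsection \<open>Decomposition into exterior products\<close>

inductive spanned :: "('m \<Rightarrow> 'v list \<Rightarrow> real) \<Rightarrow> bool" where
  spanned_wedge: "f \<in> C \<Longrightarrow> \<alpha>s \<in> lists \<Theta> \<Longrightarrow> spanned (f \<odot> wedge_list (map one_form \<alpha>s))"
| spanned_add: "spanned \<omega> \<Longrightarrow> spanned \<zeta> \<Longrightarrow> spanned (\<omega> + \<zeta>)"

lemma spanned_scale: "spanned \<omega> \<Longrightarrow> f \<in> C \<Longrightarrow> spanned (f \<odot> \<omega>)"
  by (induction rule: spanned.induct)
    (auto simp: fun_scale_scale fun_scale_add intro: spanned.intros C_mult)

lemma spanned_one_form: "spanned \<omega> \<Longrightarrow> \<alpha> \<in> \<Theta> \<Longrightarrow> spanned (one_form \<alpha> \<curlywedge> \<omega>)"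
proof (induction rule: spanned.induct)
  case (spanned_wedge f \<alpha>s)
  then show ?case
    using spanned.spanned_wedge[of f "\<alpha> # \<alpha>s"] by (simp add: wedge_scale_right wedge_list_simps)
qed (auto simp: wedge_add_right intro: spanned_add)

lemma spanned_zero: "spanned 0"
proof -
  have "spanned ((\<lambda>_. 0) \<odot> wedge_list (map one_form []))" by (rule spanned_wedge[OF C_const]) auto
  moreover have "(\<lambda>_. 0) \<odot> wedge_list (map one_form []) = (0 :: 'm \<Rightarrow> 'v list \<Rightarrow> real)"
    by (simp add: fun_scale_def fun_eq_iff)
  ultimately show ?thesis by simp
qed

lemma spanned_sum: "(\<And>i. i \<in> I \<Longrightarrow> spanned (\<omega> i)) \<Longrightarrow> spanned (\<Sum>i\<in>I. \<omega> i)"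
  by (induction I rule: infinite_finite_induct) (auto intro: spanned_zero spanned_add)

lemma one_form_tensor: "\<alpha> \<in> \<Theta> \<Longrightarrow> one_form \<alpha> \<in> tensors"
  using coframe_dual tensor_one_form by blast

lemma wedge_list_tensor: "\<omega>s \<in> lists tensors \<Longrightarrow> wedge_list \<omega>s \<in> tensors"
  using tensor_of_fun[OF C_const[of 1]]
  by (induction \<omega>s) (auto simp: wedge_list_simps one_fun_def intro: tensor_wedge)

lemma wedge_list_one_form_tensor:
  assumes "\<alpha>s \<in> lists \<Theta>"
  shows "wedge_list (map one_form \<alpha>s) \<in> tensors"
proof (rule wedge_list_tensor)
  show "map one_form \<alpha>s \<in> lists tensors"
    using assms by (induction \<alpha>s) (simp_all add: one_form_tensor)
qed

lemma spanned_tensor: "spanned \<omega> \<Longrightarrow> \<omega> \<in> tensors"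
proof (induction rule: spanned.induct)
  case (spanned_wedge f \<alpha>s)
  then show ?case by (intro tensor_scale wedge_list_one_form_tensor)
next
  case (spanned_add \<omega> \<zeta>)
  then show ?case by (intro tensor_add)
qed

text \<open>In degree p + 1 Euler's identity reads (p + 1) h \<omega> = \<Sum> c i \<and> i(e i)
  \<omega>, and the contractions have degree p. Each degree thus costs one factor h and a division
  by p + 1.\<close>

lemma homogeneous_spanned:
  assumes fr: "frame_near x h W n e c" and "\<omega> \<in> tensors" "\<omega> \<in> homogeneous p"
  shows "spanned ((\<lambda>y. h y ^ p) \<odot> \<omega>)"
  using assms(2,3)
proof (induction p arbitrary: \<omega>)
  case 0
  have "(\<lambda>y. h y ^ 0) \<odot> \<omega> = eval_form \<omega> [] \<odot> wedge_list (map one_form [])"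
    using 0(2) by (auto simp: wedge_list_simps fun_eq_iff fun_scale_def eval_form_def of_fun_def homogeneous_def)
  moreover have "spanned (eval_form \<omega> [] \<odot> wedge_list (map one_form []))"
    using 0(1) tensor_eval by (intro spanned_wedge) auto
  ultimately show ?case by (simp only:)
next
  case (Suc p)
  note fr = frame_nearD[OF fr]
  let ?z = "\<lambda>i. one_form (c i) \<curlywedge> (\<lambda>y. h y ^ p) \<odot> interior_sec (e i) \<omega>"
  have "spanned (?z i)" if "i < n" for i
    using Suc.prems fr(5,6)[OF that]
    by (intro spanned_one_form Suc.IH tensor_interior) (auto simp: homogeneous_def interior_sec_def)
  moreover define Z where "Z = (\<Sum>i<n. ?z i)"
  ultimately have "spanned ((\<lambda>_. 1 / real (Suc p)) \<odot> Z)"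
    unfolding Z_def
    by (intro spanned_scale C_const spanned_sum) auto
  moreover have "(\<lambda>_. 1 / real (Suc p)) \<odot> Z = (\<lambda>y. h y ^ Suc p) \<odot> \<omega>"
  proof (intro ext)
    fix y vs
    have "Z y vs =
        h y ^ p * (\<Sum>i<n. wedge_at (one_form (c i) y) (\<lambda>us. \<omega> y (e i y # us)) vs)"
      unfolding Z_def wedge_scale_right sum_fun_apply
      by (simp add: wedge_apply fun_scale_def interior_sec_def sum_distrib_left)
    also have "\<dots> = h y ^ p * (real (length vs) * h y * \<omega> y vs)"
    proof (cases "set vs \<subseteq> F y")
      case True
      have "(\<Sum>i<n. wedge_at (one_form (c i) y) (\<lambda>us. \<omega> y (e i y # us)) vs) =
          real (length vs) * h y * \<omega> y vs"
        by (rule wedge_at_euler[OF tensor_skew[OF Suc.prems(1)] True])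
          (use fr section_in one_form_degree in auto)
      then show ?thesis by simp
    next
      case False
      have "one_form (c i) \<curlywedge> interior_sec (e i) \<omega> \<in> tensors" if "i < n" for i
        using fr(5,6)[OF that] Suc.prems by (intro tensor_wedge one_form_tensor tensor_interior) auto
      from skew_multilinear_outside[OF tensor_skew[OF this] False]
      have "wedge_at (one_form (c i) y) (\<lambda>us. \<omega> y (e i y # us)) vs = 0" if "i < n" for i
        using that by (simp add: wedge_apply interior_sec_def)
      then show ?thesis
        using skew_multilinear_outside[OF tensor_skew[OF Suc.prems(1)] False] by simp
    qed
    finally have eq: "Z y vs = h y ^ p * (real (length vs) * h y * \<omega> y vs)" .
    show "((\<lambda>_. 1 / real (Suc p)) \<odot> Z) y vs = ((\<lambda>y. h y ^ Suc p) \<odot> \<omega>) y vs"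
      using Suc.prems(2) unfolding fun_scale_def eq
      by (cases "length vs = Suc p") (auto simp: homogeneous_def field_simps)
  qed
  ultimately show ?case by (simp only:)
qed

text \<open>The component of degree k is spanned after multiplication by h^k; the remaining factor
  h^(N-k) brings all components to the common power h^N.\<close>

lemma tensor_spanned:
  assumes fr: "frame_near x h W n e c" and \<omega>: "\<omega> \<in> tensors" "\<And>x vs. N < length vs \<Longrightarrow> \<omega> x vs = 0"
  shows "spanned ((\<lambda>y. h y ^ N) \<odot> \<omega>)"
proof -
  \<comment> \<open>\<open>?t k\<close> is the part of degree below k, so that
    \<open>?t (Suc N)\<close> is \<omega> itself.\<close>
  let ?t = "\<lambda>k x vs. (if length vs < k then 1 else 0) * \<omega> x vs"
  have "spanned ((\<lambda>y. h y ^ N) \<odot> ?t k)" if "k \<le> Suc N" for k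
    using that
  proof (induction k)
    case 0
    have "(\<lambda>y. h y ^ N) \<odot> ?t 0 = 0" by (simp add: fun_scale_def fun_eq_iff)
    then show ?case by (metis spanned_zero)
  next
    case (Suc k)
    let ?c = "\<lambda>x vs. (if length vs = k then 1 else 0) * \<omega> x vs"
    have "spanned ((\<lambda>y. h y ^ k) \<odot> ?c)"
      by (rule homogeneous_spanned[OF fr])
        (auto simp: homogeneous_def intro: tensor_degree_scale[OF \<omega>(1), of "\<lambda>n. if n = k then 1 else 0"])
    then have c: "spanned ((\<lambda>y. h y ^ (N - k)) \<odot> (\<lambda>y. h y ^ k) \<odot> ?c)"
      by (rule spanned_scale[OF _ C_power[OF frame_nearD(1)[OF fr]]])
    have "(\<lambda>y. h y ^ N) \<odot> ?t (Suc k) =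
        (\<lambda>y. h y ^ N) \<odot> ?t k + (\<lambda>y. h y ^ (N - k)) \<odot> (\<lambda>y. h y ^ k) \<odot> ?c"
      using Suc.prems by (auto simp: fun_scale_def fun_eq_iff less_Suc_eq simp flip: power_add mult.assoc)
    moreover have "spanned ((\<lambda>y. h y ^ N) \<odot> ?t k)" using Suc by simp
    then have "spanned ((\<lambda>y. h y ^ N) \<odot> ?t k + (\<lambda>y. h y ^ (N - k)) \<odot> (\<lambda>y. h y ^ k) \<odot> ?c)"
      by (rule spanned_add[OF _ c])
    ultimately show ?case by (simp only:)
  qed
  moreover have "?t (Suc N) = \<omega>" using \<omega>(2) by (auto simp: fun_eq_iff)
  ultimately show ?thesis by force
qed

text \<open>Since h^N \<omega> is spanned, h^N K \<omega> = K (h^N \<omega>) = 0, and h is 1 at x.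
  The factor h does the work of a locality assumption on K.\<close>

lemma tensor_vanishing:
  assumes add: "\<And>\<omega> \<zeta>. \<omega> \<in> tensors \<Longrightarrow> \<zeta> \<in> tensors \<Longrightarrow> K (\<omega> + \<zeta>) = K \<omega> + K \<zeta>"
    and scale: "\<And>f \<omega>. f \<in> C \<Longrightarrow> \<omega> \<in> tensors \<Longrightarrow> K (f \<odot> \<omega>) = f * K \<omega>"
    and wedge: "\<And>\<alpha>s. \<alpha>s \<in> lists \<Theta> \<Longrightarrow> K (wedge_list (map one_form \<alpha>s)) = 0"
    and \<omega>: "\<omega> \<in> tensors"
  shows "K \<omega> = (0 :: 'm \<Rightarrow> real)"
proof
  fix x
  have 0: "K \<zeta> = 0" if "spanned \<zeta>" for \<zeta>
    using that
  proof (induction rule: spanned.induct)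
    case (spanned_wedge f \<alpha>s)
    then have "K (f \<odot> wedge_list (map one_form \<alpha>s)) = f * K (wedge_list (map one_form \<alpha>s))"
      by (intro scale wedge_list_one_form_tensor)
    with spanned_wedge show ?case by (simp add: wedge fun_eq_iff)
  next
    case (spanned_add \<omega> \<zeta>)
    have "K (\<omega> + \<zeta>) = K \<omega> + K \<zeta>"
      using spanned_add.hyps by (intro add spanned_tensor)
    moreover have "K \<omega> = 0" "K \<zeta> = 0" by (rule spanned_add.IH)+
    ultimately show "K (\<omega> + \<zeta>) = 0" by simp
  qed
  obtain h W n e c where fr: "frame_near x h W n e c" using frame_near_exists by blast
  obtain N where N: "\<And>x vs. N < length vs \<Longrightarrow> \<omega> x vs = 0" using tensor_bound[OF \<omega>] by blast
  have "(\<lambda>y. h y ^ N) * K \<omega> = 0"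
    using 0[OF tensor_spanned[OF fr \<omega> N]] scale[OF C_power[OF frame_nearD(1)[OF fr]] \<omega>] by simp
  moreover have "h x = 1" using frame_nearD(3,4)[OF fr] by blast
  ultimately show "K \<omega> x = 0 x" by (auto dest!: fun_cong[of _ _ x])
qed

end

section \<open>Lie derivatives of tensor fields\<close>

locale lie_bundle = tensor_bundle C F add scl \<Gamma> \<Theta>
  for C :: "('m::topological_space \<Rightarrow> real) set"
    and F :: "'m \<Rightarrow> 'v set"
    and add :: "'v \<Rightarrow> 'v \<Rightarrow> 'v" and scl :: "real \<Rightarrow> 'v \<Rightarrow> 'v"
    and \<Gamma> :: "('m \<Rightarrow> 'v) set" and \<Theta> :: "('m \<Rightarrow> 'v \<Rightarrow> real) set" +
  fixes X :: "('m \<Rightarrow> real) \<Rightarrow> 'm \<Rightarrow> real" and \<delta> :: "('m \<Rightarrow> 'v) \<Rightarrow> 'm \<Rightarrow> 'v"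
  assumes X_in: "f \<in> C \<Longrightarrow> X f \<in> C"
    and X_add: "f \<in> C \<Longrightarrow> g \<in> C \<Longrightarrow> X (f + g) = X f + X g"
    and X_mult: "f \<in> C \<Longrightarrow> g \<in> C \<Longrightarrow> X (f * g) = f * X g + X f * g"
    and X_scale: "f \<in> C \<Longrightarrow> X (\<lambda>x. a * f x) = (\<lambda>x. a * X f x)"
    and \<delta>_in: "s \<in> \<Gamma> \<Longrightarrow> \<delta> s \<in> \<Gamma>"
    and \<delta>_add: "s \<in> \<Gamma> \<Longrightarrow> t \<in> \<Gamma> \<Longrightarrow> \<delta> (\<lambda>x. add (s x) (t x)) = (\<lambda>x. add (\<delta> s x) (\<delta> t x))"
    and \<delta>_scl: "f \<in> C \<Longrightarrow> s \<in> \<Gamma> \<Longrightarrow>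
      \<delta> (\<lambda>x. scl (f x) (s x)) = (\<lambda>x. add (scl (f x) (\<delta> s x)) (scl (X f x) (s x)))"
begin

lemma X_zero [simp]: "X 0 = 0"
  using X_scale[OF C_const[of 0], of 0] by (simp add: zero_fun_def)

lemma X_const [simp]: "X (\<lambda>_. a) = 0"
proof -
  have "X (\<lambda>_. 1) = X (\<lambda>_. 1) + X (\<lambda>_. 1)"
    using X_mult[OF C_const[of 1] C_const[of 1]] by (simp add: times_fun_def plus_fun_def)
  then have "X (\<lambda>_. 1) = 0" by simp
  then show ?thesis using X_scale[OF C_const[of 1], of a] by (simp add: fun_eq_iff)
qed

text \<open>The recursion is the rule i(V) D = D i(V) - i(\<delta> V) read at the first argument.
  Properties then follow by induction on the arguments with \<omega> replaced by its contraction;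
  \<open>lie_eval_eq\<close> gives the closed formula.\<close>

primrec lie_eval :: "('m \<Rightarrow> 'v list \<Rightarrow> real) \<Rightarrow> ('m \<Rightarrow> 'v) list \<Rightarrow> 'm \<Rightarrow> real" where
  "lie_eval \<omega> [] = X (eval_form \<omega> [])"
| "lie_eval \<omega> (V # Vs) = lie_eval (interior_sec V \<omega>) Vs - eval_form \<omega> (\<delta> V # Vs)"

lemma lie_eval_eq:
  "lie_eval \<omega> Vs = X (eval_form \<omega> Vs) - (\<Sum>i<length Vs. eval_form \<omega> (Vs[i := \<delta> (Vs ! i)]))"
proof (induction Vs arbitrary: \<omega>)
  case (Cons V Vs)
  show ?case
    using Cons.IH[of "interior_sec V \<omega>"]
    by (simp add: sum.lessThan_Suc_shift algebra_simps del: sum.lessThan_Suc)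
qed simp

lemma lie_eval_in:
  "\<omega> \<in> tensors \<Longrightarrow> Vs \<in> lists \<Gamma> \<Longrightarrow> lie_eval \<omega> Vs \<in> C"
proof (induction Vs arbitrary: \<omega>)
  case (Cons V Vs)
  then have "lie_eval (interior_sec V \<omega>) Vs \<in> C" "eval_form \<omega> (\<delta> V # Vs) \<in> C"
    by (auto intro!: Cons.IH tensor_interior tensor_eval \<delta>_in)
  then show ?case using C_diff by (simp add: fun_diff_def)
qed (auto intro: X_in tensor_eval)

lemma lie_eval_add:
  "\<omega> \<in> tensors \<Longrightarrow> \<zeta> \<in> tensors \<Longrightarrow> Vs \<in> lists \<Gamma> \<Longrightarrow>
    lie_eval (\<omega> + \<zeta>) Vs = lie_eval \<omega> Vs + lie_eval \<zeta> Vs"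
  by (induction Vs arbitrary: \<omega> \<zeta>) (simp_all add: X_add tensor_eval tensor_interior)

lemma lie_eval_scale:
  "f \<in> C \<Longrightarrow> \<omega> \<in> tensors \<Longrightarrow> Vs \<in> lists \<Gamma> \<Longrightarrow>
    lie_eval (f \<odot> \<omega>) Vs = f * lie_eval \<omega> Vs + X f * eval_form \<omega> Vs"
  by (induction Vs arbitrary: \<omega>) (simp_all add: X_mult tensor_eval tensor_interior algebra_simps)

lemma lie_eval_diff:
  assumes "\<omega> \<in> tensors" "\<zeta> \<in> tensors" "Vs \<in> lists \<Gamma>"
  shows "lie_eval (\<omega> - \<zeta>) Vs = lie_eval \<omega> Vs - lie_eval \<zeta> Vs"
  using lie_eval_add[OF tensor_diff[OF assms(1,2)] assms(2,3)] by (simp add: algebra_simps)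

text \<open>A slot behind \<open>us\<close> is brought to the front by contraction with the head of
  \<open>us\<close>. In the front slot \<open>lie_eval_scale\<close> produces X f \<omega>(s, ...)
  and \<delta> of the rescaled section produces the same term, which is subtracted.\<close>

lemma lie_eval_fun_linear:
  assumes "\<omega> \<in> tensors" "us \<in> lists \<Gamma>" "vs \<in> lists \<Gamma>"
  shows "fun_linear (\<lambda>s. lie_eval \<omega> (us @ s # vs))"
  using assms(2,1)
proof (induction us arbitrary: \<omega> rule: lists.induct)
  case Nil
  show ?case unfolding fun_linear_def
  proof (intro conjI ballI)
    fix s t assume "s \<in> \<Gamma>" "t \<in> \<Gamma>"
    with Nil assms(3) show "lie_eval \<omega> ([] @ (\<lambda>x. add (s x) (t x)) # vs) =
        lie_eval \<omega> ([] @ s # vs) + lie_eval \<omega> ([] @ t # vs)"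
      by (simp add: \<delta>_add interior_add lie_eval_add tensor_interior eval_linear_Cons \<delta>_in)
  next
    fix f s assume f: "f \<in> C" and s: "s \<in> \<Gamma>"
    have "eval_form \<omega> (\<delta> (\<lambda>x. scl (f x) (s x)) # vs) =
        f * eval_form \<omega> (\<delta> s # vs) + X f * eval_form \<omega> (s # vs)"
      using eval_linear_Cons[OF Nil section_scl[OF f \<delta>_in[OF s]] section_scl[OF X_in[OF f] s]]
        eval_linear_Cons(2)[OF Nil \<delta>_in[OF s] \<delta>_in[OF s]] eval_linear_Cons(2)[OF Nil s s]
      by (simp add: \<delta>_scl[OF f s])
    with f s Nil assms(3) show "lie_eval \<omega> ([] @ (\<lambda>x. scl (f x) (s x)) # vs) = f * lie_eval \<omega> ([] @ s # vs)"
      by (simp add: interior_scl lie_eval_scale tensor_interior algebra_simps)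
  qed
next
  case (Cons u us)
  have "fun_linear (\<lambda>s. eval_form \<omega> ((\<delta> u # us) @ s # vs))"
    by (rule eval_fun_linear) (use Cons assms(3) \<delta>_in in auto)
  with Cons.IH[OF tensor_interior[OF Cons.hyps(1) Cons.prems]]
  show ?case by (auto simp: fun_linear_def fun_eq_iff algebra_simps)
qed

lemma lie_eval_swap:
  assumes "\<omega> \<in> tensors" "us \<in> lists \<Gamma>" "s \<in> \<Gamma>" "t \<in> \<Gamma>" "vs \<in> lists \<Gamma>"
  shows "lie_eval \<omega> (us @ s # t # vs) = - lie_eval \<omega> (us @ t # s # vs)"
  using assms(2,1)
proof (induction us arbitrary: \<omega> rule: lists.induct)
  have swap: "eval_form \<omega> (us @ s # t # vs) = - eval_form \<omega> (us @ t # s # vs)"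
    if "\<omega> \<in> tensors" for \<omega> us and s t :: "'m \<Rightarrow> 'v"
  proof
    fix x
    show "eval_form \<omega> (us @ s # t # vs) x = (- eval_form \<omega> (us @ t # s # vs)) x"
      using skew_multilinear_swap[OF tensor_skew[OF that], of x "map (\<lambda>V. V x) us" "s x" "t x"]
      by (simp add: eval_form_def)
  qed
  {
    case Nil
    have "interior_sec t (interior_sec s \<omega>) = (\<lambda>_. -1) \<odot> interior_sec s (interior_sec t \<omega>)"
      by (rule interior_swap[OF Nil])
    then have "lie_eval (interior_sec t (interior_sec s \<omega>)) vs = - lie_eval (interior_sec s (interior_sec t \<omega>)) vs"
      using lie_eval_scale[OF C_const[of "-1"] tensor_interior[OF assms(3) tensor_interior[OF assms(4) Nil]] assms(5)]
      by (simp add: fun_eq_iff[of "lie_eval _ _"])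
    then show "lie_eval \<omega> ([] @ s # t # vs) = - lie_eval \<omega> ([] @ t # s # vs)"
      using swap[OF Nil, of "[]" s "\<delta> t"] swap[OF Nil, of "[]" "\<delta> s" t] by simp
  next
    case (Cons u us)
    then show ?case
      using Cons.IH[OF tensor_interior[OF Cons.hyps(1) Cons.prems]] swap[OF Cons.prems, of "\<delta> u # us" s t]
      by simp
  }
qed

definition lie_op :: "('m \<Rightarrow> 'v list \<Rightarrow> real) \<Rightarrow> 'm \<Rightarrow> 'v list \<Rightarrow> real" where
  "lie_op \<omega> = tensor_of (lie_eval \<omega>)"

lemma lie_eval_bound:
  assumes "\<And>x vs. N < length vs \<Longrightarrow> \<omega> x vs = 0" "N < length Vs"
  shows "lie_eval \<omega> Vs = 0"
proof -
  have "eval_form \<omega> Ws = 0" if "length Ws = length Vs" for Ws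
    using assms that by (auto simp: eval_form_def fun_eq_iff)
  then show ?thesis by (simp add: lie_eval_eq)
qed

lemma
  assumes "\<omega> \<in> tensors"
  shows lie_op_eval: "Vs \<in> lists \<Gamma> \<Longrightarrow> eval_form (lie_op \<omega>) Vs = lie_eval \<omega> Vs"
    and lie_op_tensor: "lie_op \<omega> \<in> tensors"
proof -
  obtain N where N: "\<And>x vs. N < length vs \<Longrightarrow> \<omega> x vs = 0" using tensor_bound[OF assms] by blast
  note R = lie_eval_fun_linear[OF assms] lie_eval_swap[OF assms] lie_eval_bound[OF N] lie_eval_in[OF assms]
  show "Vs \<in> lists \<Gamma> \<Longrightarrow> eval_form (lie_op \<omega>) Vs = lie_eval \<omega> Vs"
    unfolding lie_op_def by (rule eval_tensor_of[of "lie_eval \<omega>" N, OF R])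
  show "lie_op \<omega> \<in> tensors"
    unfolding lie_op_def by (rule tensor_of_tensor[of "lie_eval \<omega>" N, OF R])
qed

lemma lie_op_add:
  assumes "\<omega> \<in> tensors" "\<zeta> \<in> tensors"
  shows "lie_op (\<omega> + \<zeta>) = lie_op \<omega> + lie_op \<zeta>"
  using assms by (intro tensor_eqI) (simp_all add: lie_op_eval lie_op_tensor tensor_add lie_eval_add)

lemma lie_op_scale:
  assumes "f \<in> C" "\<omega> \<in> tensors"
  shows "lie_op (f \<odot> \<omega>) = f \<odot> lie_op \<omega> + X f \<odot> \<omega>"
  using assms
  by (intro tensor_eqI)
    (simp_all add: lie_op_eval lie_op_tensor tensor_add tensor_scale X_in lie_eval_scale)

lemma lie_op_interior:
  assumes "\<omega> \<in> tensors" "V \<in> \<Gamma>"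
  shows "interior_sec V (lie_op \<omega>) = lie_op (interior_sec V \<omega>) - interior_sec (\<delta> V) \<omega>"
  using assms
  by (intro tensor_eqI)
    (simp_all add: lie_op_eval lie_op_tensor tensor_diff tensor_interior \<delta>_in)

lemma lie_op_of_fun:
  assumes "f \<in> C"
  shows "lie_op (of_fun f) = of_fun (X f)"
proof (rule tensor_eqI)
  fix Vs assume Vs: "Vs \<in> lists \<Gamma>"
  show "eval_form (lie_op (of_fun f)) Vs = eval_form (of_fun (X f)) Vs"
  proof (cases Vs)
    case Nil
    then show ?thesis using assms by (simp add: lie_op_eval tensor_of_fun) (simp add: eval_form_def of_fun_def)
  next
    case (Cons V Ws)
    have "lie_eval (of_fun f) Vs = 0"
      by (rule lie_eval_bound[of 0]) (auto simp: of_fun_def Cons)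
    moreover have "eval_form (of_fun (X f)) Vs = 0"
      by (simp add: eval_form_def of_fun_def Cons fun_eq_iff)
    ultimately show ?thesis using assms Vs by (simp only: lie_op_eval tensor_of_fun)
  qed
qed (use assms in \<open>auto intro: lie_op_tensor tensor_of_fun X_in\<close>)

lemma lie_op_homogeneous:
  assumes "\<omega> \<in> tensors" "\<omega> \<in> homogeneous p"
  shows "lie_op \<omega> \<in> homogeneous p"
  unfolding homogeneous_def mem_Collect_eq
proof (intro allI impI)
  fix x and vs :: "'v list" assume l: "length vs \<noteq> p"
  show "lie_op \<omega> x vs = 0"
  proof (cases "set vs \<subseteq> F x")
    case True
    then obtain Vs where Vs: "Vs \<in> lists \<Gamma>" "map (\<lambda>V. V x) Vs = vs" by (rule sections_through)
    then have len: "length Vs \<noteq> p" using l by auto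
    then have "eval_form \<omega> Ws = 0" if "length Ws = length Vs" for Ws
      using that assms(2) by (auto simp: eval_form_def homogeneous_def fun_eq_iff)
    then have "lie_eval \<omega> Vs = 0" by (simp add: lie_eval_eq)
    then have "eval_form (lie_op \<omega>) Vs x = 0" using lie_op_eval[OF assms(1) Vs(1)] by simp
    then show ?thesis using Vs by (simp add: eval_form_def)
  qed (use skew_multilinear_outside[OF tensor_skew[OF lie_op_tensor[OF assms(1)]]] in auto)
qed

lemma eval_wedge_Cons:
  "eval_form (\<omega> \<curlywedge> \<zeta>) (V # Vs) = eval_form (interior_sec V \<omega> \<curlywedge> \<zeta>) Vs +
     eval_form ((\<lambda>x. grade_inv (\<omega> x)) \<curlywedge> interior_sec V \<zeta>) Vs"
  by (simp add: fun_eq_iff eval_form_def wedge_apply wedge_at_Cons interior_sec_def)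

lemma interior_wedge:
  "interior_sec V (\<omega> \<curlywedge> \<zeta>) = interior_sec V \<omega> \<curlywedge> \<zeta> + (\<lambda>x. grade_inv (\<omega> x)) \<curlywedge> interior_sec V \<zeta>"
  by (simp add: fun_eq_iff wedge_apply wedge_at_Cons interior_sec_def)

lemma grade_inv_tensor: "\<omega> \<in> tensors \<Longrightarrow> (\<lambda>x. grade_inv (\<omega> x)) \<in> tensors"
  using tensor_degree_scale[of \<omega> "\<lambda>n. (-1) ^ n"] by (simp add: grade_inv_def [abs_def])

text \<open>All terms of the closed formula for \<open>lie_eval\<close> have the same number of
  arguments, so the sign factors out. The commutation is needed because contracting an exterior
  product introduces the grade involution of the first factor.\<close>

lemma lie_op_grade_inv:
  assumes "\<omega> \<in> tensors"
  shows "lie_op (\<lambda>x. grade_inv (\<omega> x)) = (\<lambda>x. grade_inv (lie_op \<omega> x))"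
proof (rule tensor_eqI)
  fix Vs assume Vs: "Vs \<in> lists \<Gamma>"
  have g: "eval_form (\<lambda>x. grade_inv (\<omega> x)) Ws = (\<lambda>x. (-1) ^ length Ws * eval_form \<omega> Ws x)" for \<omega> :: "'m \<Rightarrow> 'v list \<Rightarrow> real" and Ws
    by (simp add: eval_form_def grade_inv_def)
  show "eval_form (lie_op (\<lambda>x. grade_inv (\<omega> x))) Vs = eval_form (\<lambda>x. grade_inv (lie_op \<omega> x)) Vs"
    unfolding lie_op_eval[OF grade_inv_tensor[OF assms] Vs] g lie_op_eval[OF assms Vs] lie_eval_eq
    using X_scale[OF tensor_eval[OF assms Vs]]
    by (simp add: fun_eq_iff sum_fun_apply sum_distrib_left right_diff_distrib)
qed (use assms in \<open>auto intro: lie_op_tensor grade_inv_tensor\<close>)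

text \<open>The induction runs over the arguments, for all pairs of factors at once: contracting
  with V gives two products covered by the hypothesis. The corrections i(\<delta> V) from the two
  factors assemble, by \<open>eval_wedge_Cons\<close>, to the contraction of the whole product with
  \<delta> V.\<close>

lemma lie_eval_wedge:
  assumes "Vs \<in> lists \<Gamma>" "\<omega> \<in> tensors" "\<zeta> \<in> tensors"
  shows "lie_eval (\<omega> \<curlywedge> \<zeta>) Vs = eval_form (lie_op \<omega> \<curlywedge> \<zeta> + \<omega> \<curlywedge> lie_op \<zeta>) Vs"
  using assms
proof (induction Vs arbitrary: \<omega> \<zeta> rule: lists.induct)
  case Nil
  have "eval_form (\<omega> \<curlywedge> \<zeta>) [] = eval_form \<omega> [] * eval_form \<zeta> []" for \<omega> \<zeta> :: "'m \<Rightarrow> 'v list \<Rightarrow> real"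
    by (simp add: eval_form_def wedge_apply fun_eq_iff)
  then show "lie_eval (\<omega> \<curlywedge> \<zeta>) [] = eval_form (lie_op \<omega> \<curlywedge> \<zeta> + \<omega> \<curlywedge> lie_op \<zeta>) []"
    using Nil by (simp add: X_mult tensor_eval lie_op_eval)
next
  case (Cons V Vs)
  let ?g = "\<lambda>\<omega> x. grade_inv (\<omega> x)"
  have t: "interior_sec V \<omega> \<in> tensors" "interior_sec V \<zeta> \<in> tensors" "?g \<omega> \<in> tensors"
    using Cons by (auto intro: tensor_interior grade_inv_tensor)
  have IH: "lie_eval (\<omega> \<curlywedge> \<zeta>) Vs = eval_form (lie_op \<omega> \<curlywedge> \<zeta> + \<omega> \<curlywedge> lie_op \<zeta>) Vs"
    if "\<omega> \<in> tensors" "\<zeta> \<in> tensors" for \<omega> \<zeta>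
    by (rule Cons.IH[OF that])
  have "lie_eval (interior_sec V (\<omega> \<curlywedge> \<zeta>)) Vs =
      lie_eval (interior_sec V \<omega> \<curlywedge> \<zeta>) Vs + lie_eval (?g \<omega> \<curlywedge> interior_sec V \<zeta>) Vs"
    unfolding interior_wedge using Cons t by (intro lie_eval_add tensor_wedge)
  also have "\<dots> = eval_form (lie_op (interior_sec V \<omega>) \<curlywedge> \<zeta>) Vs + eval_form (interior_sec V \<omega> \<curlywedge> lie_op \<zeta>) Vs +
      eval_form (?g (lie_op \<omega>) \<curlywedge> interior_sec V \<zeta>) Vs + eval_form (?g \<omega> \<curlywedge> lie_op (interior_sec V \<zeta>)) Vs"
    using Cons.prems t by (simp add: IH lie_op_grade_inv)
  finally have 1: "lie_eval (interior_sec V (\<omega> \<curlywedge> \<zeta>)) Vs = \<dots>" .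
  have i: "lie_op (interior_sec V \<omega>) = interior_sec V (lie_op \<omega>) + interior_sec (\<delta> V) \<omega>" if "\<omega> \<in> tensors" for \<omega>
    using lie_op_interior[OF that Cons.hyps(1)] by simp
  show "lie_eval (\<omega> \<curlywedge> \<zeta>) (V # Vs) = eval_form (lie_op \<omega> \<curlywedge> \<zeta> + \<omega> \<curlywedge> lie_op \<zeta>) (V # Vs)"
    using Cons.prems by (simp add: 1 i eval_wedge_Cons wedge_add_left wedge_add_right)
qed

lemma lie_op_wedge:
  assumes "\<omega> \<in> tensors" "\<zeta> \<in> tensors"
  shows "lie_op (\<omega> \<curlywedge> \<zeta>) = lie_op \<omega> \<curlywedge> \<zeta> + \<omega> \<curlywedge> lie_op \<zeta>"
proof (rule tensor_eqI)
  show "eval_form (lie_op (\<omega> \<curlywedge> \<zeta>)) Vs = eval_form (lie_op \<omega> \<curlywedge> \<zeta> + \<omega> \<curlywedge> lie_op \<zeta>) Vs"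
    if "Vs \<in> lists \<Gamma>" for Vs
    using lie_op_eval[OF tensor_wedge[OF assms] that] lie_eval_wedge[OF that assms] by simp
qed (use assms in \<open>auto intro!: lie_op_tensor tensor_wedge tensor_add\<close>)

section \<open>The induced derivation of the dual bundle, and commutators\<close>

definition dual_der :: "('m \<Rightarrow> 'v \<Rightarrow> real) \<Rightarrow> 'm \<Rightarrow> 'v \<Rightarrow> real" where
  "dual_der \<alpha> x v = lie_op (one_form \<alpha>) x [v]"

lemma lie_op_one_form:
  assumes "\<alpha> \<in> dual_sections C F add scl \<Gamma>"
  shows "lie_op (one_form \<alpha>) = one_form (dual_der \<alpha>)"
proof -
  have "lie_op (one_form \<alpha>) \<in> homogeneous 1"
    by (rule lie_op_homogeneous[OF tensor_one_form[OF assms]]) (auto simp: homogeneous_def one_form_degree)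
  then have "lie_op (one_form \<alpha>) x vs = one_form (dual_der \<alpha>) x vs" for x vs
    by (cases "length vs = 1") (auto simp: homogeneous_def one_form_degree length_Suc_conv dual_der_def)
  then show ?thesis by blast
qed

lemma dual_der_in:
  assumes "\<alpha> \<in> dual_sections C F add scl \<Gamma>"
  shows "dual_der \<alpha> \<in> dual_sections C F add scl \<Gamma>"
  using lie_op_tensor[OF tensor_one_form[OF assms]]
  unfolding lie_op_one_form[OF assms] by (rule one_form_dual_section)

lemma dual_der_apply:
  assumes "\<alpha> \<in> dual_sections C F add scl \<Gamma>" "s \<in> \<Gamma>"
  shows "(\<lambda>x. dual_der \<alpha> x (s x)) = X (\<lambda>x. \<alpha> x (s x)) - (\<lambda>x. \<alpha> x (\<delta> s x))"
proof -
  have "eval_form (one_form \<alpha>) [s] = (\<lambda>x. \<alpha> x (s x))" for s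
    by (simp add: eval_form_def)
  then show ?thesis
    using lie_op_eval[OF tensor_one_form[OF assms(1)], of "[s]"] assms(2)
    by (simp add: dual_der_def eval_form_def[of "lie_op _"])
qed

text \<open>Here X'' and \<delta>'' are the commutators of X, X' and of \<delta>, \<delta>', the
  latter written as a sum because sections have no subtraction. Expanding both iterated derivatives
  at the first argument, the terms with i(\<delta> V) and i(\<delta>' V) cancel and
  \<delta>'(\<delta> V) - \<delta>(\<delta>' V) = - \<delta>'' V remains.\<close>

lemma lie_eval_commutator:
  assumes "lie_bundle C F add scl \<Gamma> \<Theta> X' \<delta>'" "lie_bundle C F add scl \<Gamma> \<Theta> X'' \<delta>''"
    and X: "\<And>f. f \<in> C \<Longrightarrow> X'' f = X (X' f) - X' (X f)"
    and \<delta>: "\<And>s. s \<in> \<Gamma> \<Longrightarrow> \<delta> (\<delta>' s) = (\<lambda>x. add (\<delta>'' s x) (\<delta>' (\<delta> s) x))"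
    and "Vs \<in> lists \<Gamma>" "\<omega> \<in> tensors"
  shows "lie_bundle.lie_eval X'' \<delta>'' \<omega> Vs =
    lie_eval (lie_bundle.lie_op F \<Gamma> X' \<delta>' \<omega>) Vs - lie_bundle.lie_eval X' \<delta>' (lie_op \<omega>) Vs"
proof -
  interpret a: lie_bundle C F add scl \<Gamma> \<Theta> X' \<delta>' by fact
  interpret b: lie_bundle C F add scl \<Gamma> \<Theta> X'' \<delta>'' by fact
  show ?thesis using assms(5,6)
  proof (induction Vs arbitrary: \<omega> rule: lists.induct)
    case Nil
    then show ?case by (simp add: X tensor_eval lie_op_eval a.lie_op_eval)
  next
    case (Cons V Vs)
    have 1: "lie_eval (interior_sec V (a.lie_op \<omega>)) Vs =
        lie_eval (a.lie_op (interior_sec V \<omega>)) Vs - lie_eval (interior_sec (\<delta>' V) \<omega>) Vs"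
      using Cons by (simp add: a.lie_op_interior lie_eval_diff a.lie_op_tensor tensor_interior a.\<delta>_in)
    have 2: "a.lie_eval (interior_sec V (lie_op \<omega>)) Vs =
        a.lie_eval (lie_op (interior_sec V \<omega>)) Vs - a.lie_eval (interior_sec (\<delta> V) \<omega>) Vs"
      using Cons by (simp add: lie_op_interior a.lie_eval_diff lie_op_tensor tensor_interior \<delta>_in)
    have 3: "eval_form (a.lie_op \<omega>) (\<delta> V # Vs) =
        a.lie_eval (interior_sec (\<delta> V) \<omega>) Vs - eval_form \<omega> (\<delta>' (\<delta> V) # Vs)"
      using Cons by (simp add: a.lie_op_eval \<delta>_in)
    have 4: "eval_form (lie_op \<omega>) (\<delta>' V # Vs) =
        lie_eval (interior_sec (\<delta>' V) \<omega>) Vs - eval_form \<omega> (\<delta> (\<delta>' V) # Vs)"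
      using Cons by (simp add: lie_op_eval a.\<delta>_in)
    have 5: "eval_form \<omega> (\<delta> (\<delta>' V) # Vs) = eval_form \<omega> (\<delta>'' V # Vs) + eval_form \<omega> (\<delta>' (\<delta> V) # Vs)"
      using eval_linear_Cons(1)[OF Cons.prems b.\<delta>_in a.\<delta>_in[OF \<delta>_in]] Cons.hyps \<delta> by simp
    show ?case
      using Cons.IH[OF tensor_interior[OF Cons.hyps(1) Cons.prems]]
      by (simp add: 1 2 3 4 5 algebra_simps)
  qed
qed

lemma lie_op_commutator:
  assumes "lie_bundle C F add scl \<Gamma> \<Theta> X' \<delta>'" "lie_bundle C F add scl \<Gamma> \<Theta> X'' \<delta>''"
    and "\<And>f. f \<in> C \<Longrightarrow> X'' f = X (X' f) - X' (X f)"
    and "\<And>s. s \<in> \<Gamma> \<Longrightarrow> \<delta> (\<delta>' s) = (\<lambda>x. add (\<delta>'' s x) (\<delta>' (\<delta> s) x))"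
    and "\<omega> \<in> tensors"
  shows "lie_bundle.lie_op F \<Gamma> X'' \<delta>'' \<omega> =
    lie_op (lie_bundle.lie_op F \<Gamma> X' \<delta>' \<omega>) - lie_bundle.lie_op F \<Gamma> X' \<delta>' (lie_op \<omega>)"
proof -
  interpret a: lie_bundle C F add scl \<Gamma> \<Theta> X' \<delta>' by fact
  interpret b: lie_bundle C F add scl \<Gamma> \<Theta> X'' \<delta>'' by fact
  show ?thesis
  proof (rule tensor_eqI)
    show "eval_form (b.lie_op \<omega>) Vs = eval_form (lie_op (a.lie_op \<omega>) - a.lie_op (lie_op \<omega>)) Vs"
      if "Vs \<in> lists \<Gamma>" for Vs
      using lie_eval_commutator[OF assms(1-4) that assms(5)] assms(5) that
      by (simp add: b.lie_op_eval lie_op_eval a.lie_op_eval lie_op_tensor a.lie_op_tensor)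
  qed (use assms(5) in \<open>auto intro!: tensor_diff lie_op_tensor a.lie_op_tensor b.lie_op_tensor\<close>)
qed

end

context lie_bundle
begin

text \<open>Modelled on \<delta>' = {f V, \<cdot>} with \<beta> = d f: the bracket differentiates f
  as well, which gives the term - \<beta>(s) V. Subtracted in each slot, this term adds up to
  \<beta> \<and> i(V) \<omega>.\<close>

lemma lie_op_scaled:
  assumes "lie_bundle C F add scl \<Gamma> \<Theta> X' \<delta>'"
    and X: "\<And>g. g \<in> C \<Longrightarrow> X' g = f * X g"
    and \<delta>: "\<And>s. s \<in> \<Gamma> \<Longrightarrow> \<delta>' s = (\<lambda>x. add (scl (f x) (\<delta> s x)) (scl (- \<beta> x (s x)) (V x)))"
    and V: "V \<in> \<Gamma>" and \<beta>: "\<beta> \<in> dual_sections C F add scl \<Gamma>" and f: "f \<in> C"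
    and \<omega>: "\<omega> \<in> tensors"
  shows "lie_bundle.lie_op F \<Gamma> X' \<delta>' \<omega> = f \<odot> lie_op \<omega> + one_form \<beta> \<curlywedge> interior_sec V \<omega>"
proof -
  interpret a: lie_bundle C F add scl \<Gamma> \<Theta> X' \<delta>' by fact
  have eval: "a.lie_eval \<omega> Vs = f * lie_eval \<omega> Vs + eval_form (one_form \<beta> \<curlywedge> interior_sec V \<omega>) Vs"
    if "Vs \<in> lists \<Gamma>" "\<omega> \<in> tensors" for Vs \<omega>
    using that
  proof (induction Vs arbitrary: \<omega> rule: lists.induct)
    case Nil
    then show "a.lie_eval \<omega> [] = f * lie_eval \<omega> [] + eval_form (one_form \<beta> \<curlywedge> interior_sec V \<omega>) []"
      by (simp add: X tensor_eval) (simp add: eval_form_def wedge_apply fun_eq_iff)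
  next
    case (Cons W Vs)
    have IH: "a.lie_eval (interior_sec W \<omega>) Vs =
        f * lie_eval (interior_sec W \<omega>) Vs + eval_form (one_form \<beta> \<curlywedge> interior_sec V (interior_sec W \<omega>)) Vs"
      by (rule Cons.IH[OF tensor_interior[OF Cons.hyps(1) Cons.prems]])
    have \<beta>W: "(\<lambda>x. - \<beta> x (W x)) \<in> C"
      using \<beta> Cons.hyps(1) C_minus by (simp add: dual_sections_def)
    have 1: "eval_form \<omega> (\<delta>' W # Vs) = f * eval_form \<omega> (\<delta> W # Vs) - (\<lambda>x. \<beta> x (W x)) * eval_form \<omega> (V # Vs)"
      using eval_linear_Cons(1)[OF Cons.prems section_scl[OF f \<delta>_in[OF Cons.hyps(1)]] section_scl[OF \<beta>W V], of Vs]
        eval_linear_Cons(2)[OF Cons.prems \<delta>_in[OF Cons.hyps(1)] V, of f Vs]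
        eval_linear_Cons(2)[OF Cons.prems V V, of "\<lambda>x. - \<beta> x (W x)" Vs]
      by (simp add: \<delta>[OF Cons.hyps(1)] fun_eq_iff)
    \<comment> \<open>Moving W past \<beta> and then past V changes the sign twice, so the tail of
      the product appears with a plus sign, as in the induction hypothesis.\<close>
    have "interior_sec W (interior_sec V \<omega>) = (\<lambda>_. -1) \<odot> interior_sec V (interior_sec W \<omega>)"
      by (rule interior_swap[OF Cons.prems])
    then have w: "wedge_at (one_form \<beta> x) (\<lambda>us. \<omega> x (V x # W x # us)) vs =
        - wedge_at (one_form \<beta> x) (\<lambda>us. \<omega> x (W x # V x # us)) vs" for x vs
      by (simp add: fun_eq_iff interior_sec_def fun_scale_def wedge_at_minus_right)
    have 2: "eval_form (one_form \<beta> \<curlywedge> interior_sec V \<omega>) (W # Vs) =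
        (\<lambda>x. \<beta> x (W x)) * eval_form \<omega> (V # Vs) + eval_form (one_form \<beta> \<curlywedge> interior_sec V (interior_sec W \<omega>)) Vs"
      by (simp add: eval_form_def wedge_apply wedge_at_degree_1_Cons one_form_degree fun_eq_iff
          interior_sec_def w)
    show "a.lie_eval \<omega> (W # Vs) =
        f * lie_eval \<omega> (W # Vs) + eval_form (one_form \<beta> \<curlywedge> interior_sec V \<omega>) (W # Vs)"
      by (simp add: 1 2 IH algebra_simps)
  qed
  show ?thesis
  proof (rule tensor_eqI)
    show "eval_form (a.lie_op \<omega>) Vs = eval_form (f \<odot> lie_op \<omega> + one_form \<beta> \<curlywedge> interior_sec V \<omega>) Vs"
      if "Vs \<in> lists \<Gamma>" for Vs
      using eval[OF that \<omega>] that \<omega> by (simp add: a.lie_op_eval lie_op_eval)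
  qed (use assms(7) f V \<beta> in \<open>auto intro!: a.lie_op_tensor tensor_add tensor_scale lie_op_tensor
      tensor_wedge tensor_one_form tensor_interior\<close>)
qed

end

section \<open>Pairing and interior product\<close>

context tensor_bundle
begin

abbreviation "F' \<equiv> \<lambda>x. dual_of (F x) add scl"
abbreviation "\<Gamma>' \<equiv> dual_sections C F add scl \<Gamma>"

definition bidual :: "('m \<Rightarrow> 'v) \<Rightarrow> 'm \<Rightarrow> ('v \<Rightarrow> real) \<Rightarrow> real" where
  "bidual s x = eval_at (F' x) (s x)"

lemma bidual_simp: "\<alpha> \<in> F' x \<Longrightarrow> bidual s x \<alpha> = \<alpha> (s x)"
  by (simp add: bidual_def eval_at_def)

text \<open>Frame and coframe change places, with the same bump function, by
  \<open>dual_expansion\<close>. Taking for \<Theta> only the evaluations at sections in \<Gamma>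
  means that the spanning results for the dual produce exterior products of sections of the original
  bundle.\<close>

lemma dual_tensor_bundle: "tensor_bundle C F' dual_add dual_scale \<Gamma>' (bidual ` \<Gamma>)"
proof
  show "(\<lambda>x. a) \<in> C" for a by (rule C_const)
  show "f \<in> C \<Longrightarrow> g \<in> C \<Longrightarrow> f + g \<in> C" for f g by (rule C_add)
  show "f \<in> C \<Longrightarrow> g \<in> C \<Longrightarrow> f * g \<in> C" for f g by (rule C_mult)
  show "f \<in> C" if "\<And>x. \<exists>W g. open W \<and> x \<in> W \<and> g \<in> C \<and> (\<forall>y\<in>W. f y = g y)" for f
    by (rule C_local) (rule that)
  show "(\<lambda>e. a * u e) \<in> F' x" if "u \<in> F' x" for u a x using that by (rule dual_of_scale)
  show "u = v" if "u \<in> F' x" "v \<in> F' x"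
    "\<And>\<phi>. linear_fun (F' x) dual_add dual_scale \<phi> \<Longrightarrow> \<phi> u = \<phi> v" for u v x
  proof
    fix w show "u w = v w" by (rule that(3)) (simp add: linear_fun_def dual_add_apply)
  qed
  have "(\<lambda>x. 0) \<in> \<Gamma>'"
    by (simp add: dual_sections_def zero_in_dual_of C_const)
  then show "\<Gamma>' \<noteq> {}" by blast
  show "s x \<in> F' x" if "s \<in> \<Gamma>'" for s x using that by (simp add: dual_sections_def)
  show "(\<lambda>x. dual_add (s x) (t x)) \<in> \<Gamma>'" if "s \<in> \<Gamma>'" "t \<in> \<Gamma>'" for s t
    using that by (auto simp: dual_sections_def dual_of_add C_add' dual_add_apply)
  show "(\<lambda>x e. f x * s x e) \<in> \<Gamma>'" if "f \<in> C" "s \<in> \<Gamma>'" for f s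
    using that by (auto simp: dual_sections_def dual_of_scale C_mult')
  show "bidual ` \<Gamma> \<subseteq> dual_sections C F' dual_add dual_scale \<Gamma>'"
  proof
    fix b assume "b \<in> bidual ` \<Gamma>"
    then obtain s where s: "s \<in> \<Gamma>" "b = bidual s" by blast
    have "b x \<in> dual_of (F' x) dual_add dual_scale" for x
      unfolding s dual_of_def[of "F' x"]
      by (auto simp: linear_fun_def bidual_def eval_at_def dual_of_add dual_of_scale dual_add_apply)
    moreover have "(\<lambda>x. b x (\<alpha> x)) \<in> C" if "\<alpha> \<in> \<Gamma>'" for \<alpha>
    proof -
      have "(\<lambda>x. b x (\<alpha> x)) = (\<lambda>x. \<alpha> x (s x))"
        using that by (auto simp: s bidual_simp dual_sections_def)
      then show ?thesis using that s by (simp add: dual_sections_def)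
    qed
    ultimately show "b \<in> dual_sections C F' dual_add dual_scale \<Gamma>'" by (simp add: dual_sections_def)
  qed
  fix x
  obtain h W n e c where "frame_near x h W n e c" using frame_near_exists[of x] by blast
  note fr = frame_nearD[OF this]
  have c: "c i \<in> \<Gamma>'" if "i < n" for i using fr(6)[OF that] coframe_dual by blast
  show "\<exists>h\<in>C. \<exists>W (n::nat) e c. open W \<and> x \<in> W \<and> (\<forall>y\<in>W. h y = 1) \<and>
      (\<forall>i<n. e i \<in> \<Gamma>' \<and> c i \<in> bidual ` \<Gamma>) \<and>
      (\<forall>y. \<forall>v\<in>F' y. \<forall>\<phi>. linear_fun (F' y) dual_add dual_scale \<phi> \<longrightarrow>
        h y * \<phi> v = (\<Sum>i<n. c i y v * \<phi> (e i y)))"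
  proof (rule bexI[of _ h], rule exI[of _ W], rule exI[of _ n], rule exI[of _ c],
      rule exI[of _ "\<lambda>i. bidual (e i)"], intro conjI allI impI ballI)
    fix y \<alpha> \<psi> assume \<alpha>: "\<alpha> \<in> F' y" and \<psi>: "linear_fun (F' y) dual_add dual_scale \<psi>"
    have "h y * \<psi> \<alpha> = (\<Sum>i<n. \<alpha> (e i y) * \<psi> (c i y))"
    proof (rule dual_expansion[OF _ _ \<alpha> \<psi>])
      show "c i y \<in> F' y" if "i < n" for i using c[OF that] by (simp add: dual_sections_def)
      show "h y * \<alpha> v = (\<Sum>i<n. c i y v * \<alpha> (e i y))" if "v \<in> F y" for v
        using fr(7)[OF that, of \<alpha>] \<alpha> by (simp add: dual_of_def)
    qed
    then show "h y * \<psi> \<alpha> = (\<Sum>i<n. bidual (e i) y \<alpha> * \<psi> (c i y))"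
      using \<alpha> by (simp add: bidual_simp)
  qed (use fr(1-5) c in auto)
qed

end

text \<open>Same axioms as \<open>tensor_bundle\<close>; being a locale of its own, it passes to the
  dual once without repeating the step for the dual of the dual.\<close>

locale bundle_pair = tensor_bundle C F add scl \<Gamma> \<Theta>
  for C :: "('m::topological_space \<Rightarrow> real) set"
    and F :: "'m \<Rightarrow> 'v set"
    and add :: "'v \<Rightarrow> 'v \<Rightarrow> 'v" and scl :: "real \<Rightarrow> 'v \<Rightarrow> 'v"
    and \<Gamma> :: "('m \<Rightarrow> 'v) set" and \<Theta> :: "('m \<Rightarrow> 'v \<Rightarrow> real) set"

sublocale bundle_pair \<subseteq> dual: tensor_bundle C F' dual_add dual_scale \<Gamma>' "bidual ` \<Gamma>"
  by (rule dual_tensor_bundle)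

context bundle_pair
begin

abbreviation "multivecs \<equiv> dual.tensors"

lemma frame_near_is_frame:
  assumes "frame_near x h W n e c" "y \<in> W"
  shows "is_frame (F y) add scl n (\<lambda>i. e i y) (\<lambda>i. c i y)"
  unfolding is_frame_def
proof (intro conjI allI ballI impI)
  note fr = frame_nearD[OF assms(1)]
  show "e i y \<in> F y" if "i < n" for i using fr(5)[OF that] section_in by blast
  show "c i y \<in> F' y" if "i < n" for i using fr(6)[OF that] coframe_dual by (auto simp: dual_sections_def)
  show "\<phi> v = (\<Sum>i<n. c i y v * \<phi> (e i y))" if "v \<in> F y" "linear_fun (F y) add scl \<phi>" for v \<phi>
    using fr(7)[OF that] fr(4)[OF assms(2)] by simp
qed

section \<open>The pairing as contraction with a frame\<close>

definition frame_at :: "'m \<Rightarrow> nat \<times> (nat \<Rightarrow> 'v) \<times> (nat \<Rightarrow> 'v \<Rightarrow> real)" where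
  "frame_at x = (SOME (n, e, c). is_frame (F x) add scl n e c)"

lemma frame_at:
  obtains n e c where "frame_at x = (n, e, c)" "is_frame (F x) add scl n e c"
proof -
  obtain h W n e c where fr: "frame_near x h W n e c" using frame_near_exists[of x] by blast
  have "\<exists>t. case t of (n, e, c) \<Rightarrow> is_frame (F x) add scl n e c"
    using frame_near_is_frame[OF fr frame_nearD(3)[OF fr]] by blast
  from someI_ex[OF this] show ?thesis
    by (cases "frame_at x") (auto simp: frame_at_def intro: that)
qed

definition deg_bound :: "(('v \<Rightarrow> real) list \<Rightarrow> real) \<Rightarrow> nat" where
  "deg_bound P = (LEAST N. \<forall>\<alpha>s. N < length \<alpha>s \<longrightarrow> P \<alpha>s = 0)"

text \<open>Components are contracted degree by degree, up to the degree of P at the point. The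
  chosen frame and this bound are immaterial: \<open>pair_at_eq\<close> permits every frame and
  every larger bound.\<close>

definition pair_at :: "'m \<Rightarrow> ('v list \<Rightarrow> real) \<Rightarrow> (('v \<Rightarrow> real) list \<Rightarrow> real) \<Rightarrow> real" where
  "pair_at x \<omega> P = (case frame_at x of (n, e, c) \<Rightarrow> \<Sum>p\<le>deg_bound P. contract n e c p \<omega> P)"

lemma pair_at_eq:
  assumes "is_frame (F x) add scl n e c" "skew_multilinear (F x) add scl \<omega>"
    and "skew_multilinear (F' x) dual_add dual_scale P" "\<And>\<alpha>s. N < length \<alpha>s \<Longrightarrow> P \<alpha>s = 0"
  shows "pair_at x \<omega> P = (\<Sum>p\<le>N. contract n e c p \<omega> P)"
proof -
  obtain m b d where bd: "frame_at x = (m, b, d)" "is_frame (F x) add scl m b d" by (rule frame_at)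
  have B: "P \<alpha>s = 0" if "deg_bound P < length \<alpha>s" for \<alpha>s
    using LeastI_ex[of "\<lambda>N. \<forall>\<alpha>s. N < length \<alpha>s \<longrightarrow> P \<alpha>s = 0"] assms(4) that unfolding deg_bound_def by blast
  have "deg_bound P \<le> N" unfolding deg_bound_def by (rule Least_le) (use assms(4) in blast)
  have zero: "contract m b d p \<omega> P = 0" if "deg_bound P < p" for p
  proof -
    have "contract m b d p \<omega> P = contract m b d p \<omega> (\<lambda>_. 0)"
      by (rule contract_cong[of m b UNIV d UNIV]) (use B that in auto)
    then show ?thesis by simp
  qed
  have "pair_at x \<omega> P = (\<Sum>p\<le>deg_bound P. contract m b d p \<omega> P)"
    by (simp add: pair_at_def bd)
  also have "\<dots> = (\<Sum>p\<le>N. contract m b d p \<omega> P)"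
    by (rule sum.mono_neutral_left) (use zero \<open>deg_bound P \<le> N\<close> in auto)
  also have "\<dots> = (\<Sum>p\<le>N. contract n e c p \<omega> P)"
    by (intro sum.cong refl contract_frame_independent[OF bd(2) assms(1-3)])
  finally show ?thesis .
qed

definition skew_mv :: "'m \<Rightarrow> (('v \<Rightarrow> real) list \<Rightarrow> real) \<Rightarrow> bool" where
  "skew_mv x P \<longleftrightarrow> skew_multilinear (F' x) dual_add dual_scale P \<and> (\<exists>N. \<forall>\<alpha>s. N < length \<alpha>s \<longrightarrow> P \<alpha>s = 0)"

lemma skew_mv_tensor: "P \<in> multivecs \<Longrightarrow> skew_mv x (P x)"
  unfolding skew_mv_def using dual.tensor_skew dual.tensor_bound by blast

lemma pair_at_frame:
  assumes "skew_mv x P"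
  obtains N n e c where "is_frame (F x) add scl n e c" "\<And>\<alpha>s. N < length \<alpha>s \<Longrightarrow> P \<alpha>s = 0"
    "\<And>\<omega>. skew_multilinear (F x) add scl \<omega> \<Longrightarrow> pair_at x \<omega> P = (\<Sum>p\<le>N. contract n e c p \<omega> P)"
proof -
  obtain n e c where fr: "is_frame (F x) add scl n e c" by (rule frame_at)
  obtain N where N: "\<And>\<alpha>s. N < length \<alpha>s \<Longrightarrow> P \<alpha>s = 0" using assms by (auto simp: skew_mv_def)
  show ?thesis
    by (rule that[OF fr N]) (use pair_at_eq[OF fr _ _ N] assms in \<open>auto simp: skew_mv_def\<close>)
qed

lemma pair_at_add_left:
  assumes "skew_mv x P" "skew_multilinear (F x) add scl \<omega>" "skew_multilinear (F x) add scl \<zeta>"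
  shows "pair_at x (\<lambda>vs. \<omega> vs + \<zeta> vs) P = pair_at x \<omega> P + pair_at x \<zeta> P"
proof -
  obtain N n e c where
    "\<And>\<omega>. skew_multilinear (F x) add scl \<omega> \<Longrightarrow> pair_at x \<omega> P = (\<Sum>p\<le>N. contract n e c p \<omega> P)"
    by (rule pair_at_frame[OF assms(1)]) blast
  with assms show ?thesis
    by (simp add: skew_multilinear_add contract_add_left sum.distrib)
qed

lemma pair_at_scale_left:
  assumes "skew_mv x P" "skew_multilinear (F x) add scl \<omega>"
  shows "pair_at x (\<lambda>vs. k * \<omega> vs) P = k * pair_at x \<omega> P"
proof -
  obtain N n e c where
    "\<And>\<omega>. skew_multilinear (F x) add scl \<omega> \<Longrightarrow> pair_at x \<omega> P = (\<Sum>p\<le>N. contract n e c p \<omega> P)"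
    by (rule pair_at_frame[OF assms(1)]) blast
  with assms show ?thesis
    by (simp add: skew_multilinear_scale contract_scale_left sum_distrib_left)
qed

lemma pair_at_zero_left [simp]: "pair_at x (\<lambda>vs. 0) P = 0"
  by (simp add: pair_at_def split: prod.split)

lemma pair_at_cong:
  assumes "\<And>vs. set vs \<subseteq> F x \<Longrightarrow> \<omega> vs = \<zeta> vs"
  shows "pair_at x \<omega> P = pair_at x \<zeta> P"
proof -
  obtain n e c where fr: "frame_at x = (n, e, c)" "is_frame (F x) add scl n e c" by (rule frame_at)
  show ?thesis unfolding pair_at_def fr prod.case
    by (intro sum.cong refl contract_cong[of n e "F x" c UNIV])
      (use fr(2) assms in \<open>auto simp: is_frame_def\<close>)
qed

lemma pair_at_add_right:
  assumes "skew_mv x P" "skew_mv x Q" "skew_multilinear (F x) add scl \<omega>"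
  shows "pair_at x \<omega> (\<lambda>\<alpha>s. P \<alpha>s + Q \<alpha>s) = pair_at x \<omega> P + pair_at x \<omega> Q"
proof -
  obtain n e c where fr: "is_frame (F x) add scl n e c" by (rule frame_at)
  obtain N M where NM: "\<And>\<alpha>s. N < length \<alpha>s \<Longrightarrow> P \<alpha>s = 0" "\<And>\<alpha>s. M < length \<alpha>s \<Longrightarrow> Q \<alpha>s = 0"
    using assms by (auto simp: skew_mv_def)
  have "pair_at x \<omega> (\<lambda>\<alpha>s. P \<alpha>s + Q \<alpha>s) = (\<Sum>p\<le>max N M. contract n e c p \<omega> (\<lambda>\<alpha>s. P \<alpha>s + Q \<alpha>s))"
    by (rule pair_at_eq[OF fr]) (use assms NM in \<open>auto intro: skew_multilinear_add simp: skew_mv_def\<close>)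
  moreover have "pair_at x \<omega> P = (\<Sum>p\<le>max N M. contract n e c p \<omega> P)"
    by (rule pair_at_eq[OF fr]) (use assms NM in \<open>auto simp: skew_mv_def\<close>)
  moreover have "pair_at x \<omega> Q = (\<Sum>p\<le>max N M. contract n e c p \<omega> Q)"
    by (rule pair_at_eq[OF fr]) (use assms NM in \<open>auto simp: skew_mv_def\<close>)
  ultimately show ?thesis by (simp add: contract_add_right sum.distrib)
qed

lemma pair_at_scale_right:
  assumes "skew_mv x P" "skew_multilinear (F x) add scl \<omega>"
  shows "pair_at x \<omega> (\<lambda>\<alpha>s. k * P \<alpha>s) = k * pair_at x \<omega> P"
proof -
  obtain N n e c where fr: "is_frame (F x) add scl n e c" "\<And>\<alpha>s. N < length \<alpha>s \<Longrightarrow> P \<alpha>s = 0"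
    "\<And>\<omega>. skew_multilinear (F x) add scl \<omega> \<Longrightarrow> pair_at x \<omega> P = (\<Sum>p\<le>N. contract n e c p \<omega> P)"
    by (rule pair_at_frame[OF assms(1)]) blast
  have "pair_at x \<omega> (\<lambda>\<alpha>s. k * P \<alpha>s) = (\<Sum>p\<le>N. contract n e c p \<omega> (\<lambda>\<alpha>s. k * P \<alpha>s))"
    by (rule pair_at_eq[OF fr(1)]) (use assms fr(2) in \<open>auto intro: skew_multilinear_scale simp: skew_mv_def\<close>)
  then show ?thesis using fr(3)[OF assms(2)] by (simp add: contract_scale_right sum_distrib_left)
qed

lemma contract_degree_0:
  assumes "\<And>\<alpha>s. \<alpha>s \<noteq> [] \<Longrightarrow> P \<alpha>s = 0"
  shows "(\<Sum>p\<le>N. contract n e c p \<omega> P) = \<omega> [] * P []"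
proof -
  have "contract n e c (Suc p) \<omega> P = 0" for p
    using assms by simp
  then show ?thesis by (induction N) (simp_all del: contract.simps(2))
qed

lemma pair_at_of_fun:
  assumes "skew_multilinear (F x) add scl \<omega>"
  shows "pair_at x \<omega> (of_fun f x) = f x * \<omega> []"
proof -
  obtain n e c where fr: "is_frame (F x) add scl n e c" by (rule frame_at)
  have "pair_at x \<omega> (of_fun f x) = (\<Sum>p\<le>0. contract n e c p \<omega> (of_fun f x))"
    by (rule pair_at_eq[OF fr assms skew_multilinear_of_fun]) (auto simp: of_fun_def)
  then show ?thesis by (simp add: of_fun_def)
qed

text \<open>The product has degree bound \<open>Suc N\<close> and no component of degree 0, so after
  the shift of the summation index \<open>contract_wedge_at\<close> applies term by term.\<close>

lemma pair_at_wedge: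
  assumes "skew_mv x Q" "skew_multilinear (F x) add scl \<omega>" "V \<in> \<Gamma>"
  shows "pair_at x \<omega> (wedge_at (one_form (bidual V) x) Q) = pair_at x (\<lambda>us. \<omega> (V x # us)) Q"
proof -
  let ?v = "one_form (bidual V) x"
  obtain N n e c where fr: "is_frame (F x) add scl n e c" "\<And>\<alpha>s. N < length \<alpha>s \<Longrightarrow> Q \<alpha>s = 0"
    "\<And>\<omega>. skew_multilinear (F x) add scl \<omega> \<Longrightarrow> pair_at x \<omega> Q = (\<Sum>p\<le>N. contract n e c p \<omega> Q)"
    by (rule pair_at_frame[OF assms(1)]) blast
  have sv: "skew_multilinear (F' x) dual_add dual_scale ?v"
    using dual.one_form_tensor assms(3) by (intro dual.tensor_skew) auto
  have "pair_at x \<omega> (wedge_at ?v Q) = (\<Sum>p\<le>Suc N. contract n e c p \<omega> (wedge_at ?v Q))"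
  proof (rule pair_at_eq[OF fr(1) assms(2)])
    show "skew_multilinear (F' x) dual_add dual_scale (wedge_at ?v Q)"
      using sv assms(1) by (intro skew_multilinear_wedge_at) (auto simp: skew_mv_def)
    show "wedge_at ?v Q \<alpha>s = 0" if "Suc N < length \<alpha>s" for \<alpha>s
      using that fr(2) by (subst wedge_at_degree_1) (auto intro!: sum.neutral one_form_degree)
  qed
  also have "\<dots> = contract n e c 0 \<omega> (wedge_at ?v Q) + (\<Sum>p\<le>N. contract n e c (Suc p) \<omega> (wedge_at ?v Q))"
    by (rule sum.atMost_Suc_shift)
  also have "contract n e c 0 \<omega> (wedge_at ?v Q) = 0" by simp
  also have "(\<Sum>p\<le>N. contract n e c (Suc p) \<omega> (wedge_at ?v Q)) = (\<Sum>p\<le>N. contract n e c p (\<lambda>us. \<omega> (V x # us)) Q)"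
  proof (intro sum.cong refl contract_wedge_at[OF assms(2)])
    show "e i \<in> F x" if "i < n" for i using fr(1) that by (simp add: is_frame_def)
    show "V x \<in> F x" using assms(3) by (rule section_in)
    show "\<phi> (V x) = (\<Sum>i<n. ?v [c i] * \<phi> (e i))" if "linear_fun (F x) add scl \<phi>" for \<phi>
      using fr(1) section_in[OF assms(3), of x] that by (simp add: is_frame_def bidual_simp)
  qed (rule one_form_degree)
  finally show ?thesis
    using fr(3)[OF skew_multilinear_Cons[OF assms(2) section_in[OF assms(3)]]] by simp
qed

text \<open>The mirror image of \<open>pair_at_wedge\<close>: after \<open>contract_commute\<close>,
  P plays the form, c the frame and \<alpha> the vector, whose expansion is
  \<open>is_frame_dual_expansion\<close>.\<close>

lemma pair_at_wedge_left:
  assumes "skew_mv x P" "skew_multilinear (F x) add scl \<zeta>" "\<alpha> \<in> \<Gamma>'"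
  shows "pair_at x (wedge_at (one_form \<alpha> x) \<zeta>) P = pair_at x \<zeta> (\<lambda>\<alpha>s. P (\<alpha> x # \<alpha>s))"
proof -
  obtain N n e c where fr: "is_frame (F x) add scl n e c" "\<And>\<alpha>s. N < length \<alpha>s \<Longrightarrow> P \<alpha>s = 0"
    by (rule pair_at_frame[OF assms(1)]) blast
  have P: "skew_multilinear (F' x) dual_add dual_scale P" using assms(1) by (simp add: skew_mv_def)
  have \<alpha>: "\<alpha> x \<in> F' x" using assms(3) by (simp add: dual_sections_def)
  have "pair_at x (wedge_at (one_form \<alpha> x) \<zeta>) P = (\<Sum>p\<le>Suc N. contract n e c p (wedge_at (one_form \<alpha> x) \<zeta>) P)"
    by (rule pair_at_eq[OF fr(1) skew_multilinear_wedge_at[OF tensor_skew[OF tensor_one_form[OF assms(3)]] assms(2)] P])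
      (use fr(2) in auto)
  also have "\<dots> = contract n e c 0 (wedge_at (one_form \<alpha> x) \<zeta>) P +
      (\<Sum>p\<le>N. contract n e c (Suc p) (wedge_at (one_form \<alpha> x) \<zeta>) P)"
    by (rule sum.atMost_Suc_shift)
  also have "contract n e c 0 (wedge_at (one_form \<alpha> x) \<zeta>) P = 0" by simp
  also have "(\<Sum>p\<le>N. contract n e c (Suc p) (wedge_at (one_form \<alpha> x) \<zeta>) P) =
      (\<Sum>p\<le>N. contract n e c p \<zeta> (\<lambda>\<alpha>s. P (\<alpha> x # \<alpha>s)))"
    unfolding contract_commute[of n e]
  proof (intro sum.cong refl contract_wedge_at[OF P])
    show "c i \<in> F' x" if "i < n" for i using fr(1) that by (simp add: is_frame_def)
    show "\<phi> (\<alpha> x) = (\<Sum>i<n. one_form \<alpha> x [e i] * \<phi> (c i))" if "linear_fun (F' x) dual_add dual_scale \<phi>" for \<phi>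
      using is_frame_dual_expansion[OF fr(1) \<alpha> that] by simp
    show "\<alpha> x \<in> F' x" by (rule \<alpha>)
  qed (rule one_form_degree)
  also have "0 + (\<Sum>p\<le>N. contract n e c p \<zeta> (\<lambda>\<alpha>s. P (\<alpha> x # \<alpha>s))) = pair_at x \<zeta> (\<lambda>\<alpha>s. P (\<alpha> x # \<alpha>s))"
    using pair_at_eq[OF fr(1) assms(2) skew_multilinear_Cons[OF P \<alpha>], of N] fr(2) by simp
  finally show ?thesis .
qed

definition pair :: "('m \<Rightarrow> 'v list \<Rightarrow> real) \<Rightarrow> ('m \<Rightarrow> ('v \<Rightarrow> real) list \<Rightarrow> real) \<Rightarrow> 'm \<Rightarrow> real" where
  "pair \<omega> P x = pair_at x (\<omega> x) (P x)"

text \<open>The reversal accounts for the order of the factors in the interior product by a decomposable multivector.\<close>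

definition inter :: "('m \<Rightarrow> ('v \<Rightarrow> real) list \<Rightarrow> real) \<Rightarrow> ('m \<Rightarrow> 'v list \<Rightarrow> real) \<Rightarrow> 'm \<Rightarrow> 'v list \<Rightarrow> real" where
  "inter P \<eta> x vs = pair_at x (\<lambda>us. \<eta> x (rev us @ vs)) (P x)"

text \<open>The frames in \<open>pair_at\<close> are chosen pointwise and need not vary smoothly.
  Near x frame independence replaces them by the values of the global sections e i and c i, for
  which the contraction is a finite combination of products of smooth evaluations.\<close>

lemma pair_in:
  assumes "\<omega> \<in> tensors" "P \<in> multivecs"
  shows "pair \<omega> P \<in> C"
proof (rule C_local)
  fix x
  obtain h W n e c where fr: "frame_near x h W n e c" using frame_near_exists[of x] by blast
  obtain N where N: "\<And>x \<alpha>s. N < length \<alpha>s \<Longrightarrow> P x \<alpha>s = 0" using dual.tensor_bound[OF assms(2)] by blast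
  let ?c = "\<lambda>p \<omega> P y. contract n (\<lambda>i. e i y) (\<lambda>i. c i y) p (\<omega> y) (P y)"
  have c: "?c p \<omega> P \<in> C" if "\<omega> \<in> tensors" "P \<in> multivecs" for p \<omega> P
    using that
  proof (induction p arbitrary: \<omega> P)
    case 0
    then show ?case
      using C_mult'[OF tensor_eval[of \<omega> "[]"] dual.tensor_eval[of P "[]"]] by (simp add: eval_form_def)
  next
    case (Suc p)
    have "(\<lambda>y. \<Sum>i<n. ?c p (interior_sec (e i) \<omega>) (interior_sec (c i) P) y * (1 / Suc p)) \<in> C"
    proof (intro C_sum C_mult' C_const Suc.IH)
      fix i assume "i \<in> {..<n}"
      then have "e i \<in> \<Gamma>" "c i \<in> \<Gamma>'" using frame_nearD(5,6)[OF fr] coframe_dual by auto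
      then show "interior_sec (e i) \<omega> \<in> tensors" "interior_sec (c i) P \<in> multivecs"
        using Suc.prems by (auto intro: tensor_interior dual.tensor_interior)
    qed
    then show ?case by (simp add: interior_sec_def sum_divide_distrib)
  qed
  have "pair \<omega> P y = (\<Sum>p\<le>N. ?c p \<omega> P y)" if "y \<in> W" for y
    unfolding pair_def
    by (rule pair_at_eq[OF frame_near_is_frame[OF fr that]])
      (use assms N in \<open>auto intro: tensor_skew dual.tensor_skew\<close>)
  then show "\<exists>W g. open W \<and> x \<in> W \<and> g \<in> C \<and> (\<forall>y\<in>W. pair \<omega> P y = g y)"
    using frame_nearD(2,3)[OF fr] C_sum[of "{..N}" "\<lambda>p. ?c p \<omega> P"] c[OF assms]
    by (intro exI[of _ W] exI[of _ "\<lambda>y. \<Sum>p\<le>N. ?c p \<omega> P y"]) auto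
qed

lemma pair_add_left:
  "\<omega> \<in> tensors \<Longrightarrow> \<zeta> \<in> tensors \<Longrightarrow> P \<in> multivecs \<Longrightarrow> pair (\<omega> + \<zeta>) P = pair \<omega> P + pair \<zeta> P"
  by (simp add: fun_eq_iff pair_def plus_fun_def pair_at_add_left skew_mv_tensor tensor_skew)

lemma pair_scale_left:
  "\<omega> \<in> tensors \<Longrightarrow> P \<in> multivecs \<Longrightarrow> pair (f \<odot> \<omega>) P = f * pair \<omega> P"
  by (simp add: fun_eq_iff pair_def fun_scale_def pair_at_scale_left skew_mv_tensor tensor_skew)

lemma pair_add_right:
  "\<omega> \<in> tensors \<Longrightarrow> Q \<in> multivecs \<Longrightarrow> P \<in> multivecs \<Longrightarrow> pair \<omega> (P + Q) = pair \<omega> P + pair \<omega> Q"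
  by (simp add: fun_eq_iff pair_def plus_fun_def pair_at_add_right skew_mv_tensor tensor_skew)

lemma pair_scale_right:
  "\<omega> \<in> tensors \<Longrightarrow> P \<in> multivecs \<Longrightarrow> pair \<omega> (f \<odot> P) = f * pair \<omega> P"
  by (simp add: fun_eq_iff pair_def fun_scale_def pair_at_scale_right skew_mv_tensor tensor_skew)

lemma pair_diff_left:
  assumes "\<omega> \<in> tensors" "\<zeta> \<in> tensors" "P \<in> multivecs"
  shows "pair (\<omega> - \<zeta>) P = pair \<omega> P - pair \<zeta> P"
  using pair_add_left[OF tensor_diff[OF assms(1,2)] assms(2,3)] by (simp add: algebra_simps)

lemma pair_of_fun: "\<omega> \<in> tensors \<Longrightarrow> pair \<omega> (of_fun f) = f * eval_form \<omega> []"
  by (simp add: fun_eq_iff pair_def pair_at_of_fun tensor_skew eval_form_def)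

lemma pair_wedge:
  assumes "\<omega> \<in> tensors" "Q \<in> multivecs" "V \<in> \<Gamma>"
  shows "pair \<omega> (one_form (bidual V) \<curlywedge> Q) = pair (interior_sec V \<omega>) Q"
proof
  fix x
  show "pair \<omega> (one_form (bidual V) \<curlywedge> Q) x = pair (interior_sec V \<omega>) Q x"
    using pair_at_wedge[OF skew_mv_tensor[OF assms(2)] tensor_skew[OF assms(1)] assms(3), of x]
    by (simp add: pair_def wedge_apply interior_sec_def)
qed

lemma bidual_wedge_in: "Vs \<in> lists \<Gamma> \<Longrightarrow> wedge_list (map (\<lambda>V. one_form (bidual V)) Vs) \<in> multivecs"
  using dual.wedge_list_one_form_tensor[of "map bidual Vs"] by (simp add: o_def in_lists_conv_set)

lemma pair_wedge_list:
  assumes "Vs \<in> lists \<Gamma>" "\<omega> \<in> tensors"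
  shows "pair \<omega> (wedge_list (map (\<lambda>V. one_form (bidual V)) Vs)) = eval_form \<omega> Vs"
  using assms
proof (induction Vs arbitrary: \<omega> rule: list.induct)
  case Nil
  then show ?case by (simp add: wedge_list_simps pair_of_fun)
next
  case (Cons V Vs)
  then show ?case
    using pair_wedge[OF Cons.prems(2) bidual_wedge_in[of Vs], of V] Cons.IH[OF _ tensor_interior[of V \<omega>]]
    by (simp add: wedge_list_simps)
qed

lemma pair_wedge_left:
  assumes "\<zeta> \<in> tensors" "P \<in> multivecs" "\<alpha> \<in> \<Gamma>'"
  shows "pair (one_form \<alpha> \<curlywedge> \<zeta>) P = pair \<zeta> (interior_sec \<alpha> P)"
proof
  fix x
  show "pair (one_form \<alpha> \<curlywedge> \<zeta>) P x = pair \<zeta> (interior_sec \<alpha> P) x"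
    using pair_at_wedge_left[OF skew_mv_tensor[OF assms(2)] tensor_skew[OF assms(1)] assms(3), of x]
    by (simp add: pair_def wedge_apply interior_sec_def)
qed

lemma pair_of_fun_left:
  assumes "P \<in> multivecs"
  shows "pair (of_fun f) P = f * eval_form P []"
proof
  fix x
  obtain N n e c where fr: "is_frame (F x) add scl n e c"
    "\<And>\<omega>. skew_multilinear (F x) add scl \<omega> \<Longrightarrow> pair_at x \<omega> (P x) = (\<Sum>p\<le>N. contract n e c p \<omega> (P x))"
    by (rule pair_at_frame[OF skew_mv_tensor[OF assms], of x]) blast
  show "pair (of_fun f) P x = (f * eval_form P []) x"
    using contract_degree_0[of "of_fun f x" n c e "P x" N]
    by (simp add: pair_def fr skew_multilinear_of_fun contract_commute[of n e])
      (simp add: of_fun_def eval_form_def)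
qed

text \<open>Nondegeneracy of the pairing: the values of P are recovered by pairing it with products
  of one-forms.\<close>

lemma pair_wedge_list_left:
  assumes "\<alpha>s \<in> lists \<Gamma>'" "P \<in> multivecs"
  shows "pair (wedge_list (map one_form \<alpha>s)) P = eval_form P \<alpha>s"
  using assms
proof (induction \<alpha>s arbitrary: P rule: list.induct)
  case Nil
  then show ?case by (simp add: wedge_list_simps pair_of_fun_left)
next
  case (Cons \<alpha> \<alpha>s)
  have "map one_form \<alpha>s \<in> lists tensors" using Cons.prems(1) tensor_one_form by auto
  from pair_wedge_left[OF wedge_list_tensor[OF this] Cons.prems(2), of \<alpha>]
  show ?case
    using Cons.IH[OF _ dual.tensor_interior[of \<alpha> P]] Cons.prems by (simp add: wedge_list_simps)
qed

lemma pair_degrees: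
  assumes "\<omega> \<in> tensors" "P \<in> multivecs" "\<omega> \<in> homogeneous p" "P \<in> homogeneous q" "p \<noteq> q"
  shows "pair \<omega> P = 0"
proof
  fix x
  obtain N n e c where fr:
    "\<And>\<omega>. skew_multilinear (F x) add scl \<omega> \<Longrightarrow> pair_at x \<omega> (P x) = (\<Sum>p\<le>N. contract n e c p \<omega> (P x))"
    by (rule pair_at_frame[OF skew_mv_tensor[OF assms(2)], of x]) blast
  have "contract n e c k (\<omega> x) (P x) = 0" for k
  proof (cases "k = p")
    case True
    have "contract n e c k (\<omega> x) (P x) = contract n e c k (\<omega> x) (\<lambda>_. 0)"
      by (rule contract_cong[of n e UNIV c UNIV]) (use assms True in \<open>auto simp: homogeneous_def\<close>)
    then show ?thesis by simp
  next
    case False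
    have "contract n e c k (\<omega> x) (P x) = contract n e c k (\<lambda>_. 0) (P x)"
      by (rule contract_cong[of n e UNIV c UNIV]) (use assms False in \<open>auto simp: homogeneous_def\<close>)
    then show ?thesis by simp
  qed
  then show "pair \<omega> P x = 0 x" by (simp add: pair_def fr tensor_skew[OF assms(1)])
qed

lemma skew_rev_append:
  assumes "skew_multilinear (F x) add scl \<eta>"
  shows "skew_multilinear (F x) add scl (\<lambda>us. \<eta> (rev us @ vs))"
proof (rule skew_multilinearI)
  show "\<eta> (rev us @ vs) = 0" if "\<not> set us \<subseteq> F x" for us
    by (rule skew_multilinear_outside[OF assms]) (use that in auto)
  show "linear_fun (F x) add scl (\<lambda>v. \<eta> (rev (us @ v # ws) @ vs))" if "set us \<subseteq> F x" "set ws \<subseteq> F x" for us ws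
  proof (cases "set vs \<subseteq> F x")
    case True
    then show ?thesis
      using skew_multilinear_linear[OF assms, of "rev ws" "rev us @ vs"] that by simp
  next
    case False
    then have "\<eta> (rev (us @ v # ws) @ vs) = 0" for v
      by (intro skew_multilinear_outside[OF assms]) auto
    then show ?thesis by (simp add: linear_fun_def)
  qed
  show "\<eta> (rev (us @ v # w # ws) @ vs) = - \<eta> (rev (us @ w # v # ws) @ vs)" for us v w ws
    using skew_multilinear_swap[OF assms, of "rev ws" w v "rev us @ vs"] by simp
qed

lemma inter_tensor:
  assumes "P \<in> multivecs" "\<eta> \<in> tensors"
  shows "inter P \<eta> \<in> tensors"
proof -
  obtain N where N: "\<And>x vs. N < length vs \<Longrightarrow> \<eta> x vs = 0" using tensor_bound[OF assms(2)] by blast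
  note sk = tensor_skew[OF assms(2)] and mv = skew_mv_tensor[OF assms(1)]
  show ?thesis
  proof (rule tensorI[of _ N])
    show "inter P \<eta> x vs = 0" if "N < length vs" for x vs
      using N that by (simp add: inter_def)
    fix x
    show "skew_multilinear (F x) add scl (inter P \<eta> x)"
    proof (rule skew_multilinearI)
      show "inter P \<eta> x vs = 0" if "\<not> set vs \<subseteq> F x" for vs
      proof -
        have "\<eta> x (rev us @ vs) = 0" for us
          by (rule skew_multilinear_outside[OF sk]) (use that in auto)
        then show ?thesis by (simp add: inter_def)
      qed
      show "linear_fun (F x) add scl (\<lambda>v. inter P \<eta> x (us @ v # vs))" if "set us \<subseteq> F x" "set vs \<subseteq> F x" for us vs
      proof (rule linear_funI)
        have l: "linear_fun (F x) add scl (\<lambda>v. \<eta> x (rev ws @ us @ v # vs))" if "set ws \<subseteq> F x" for ws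
          using skew_multilinear_linear[OF sk, of "rev ws @ us" x vs] that \<open>set us \<subseteq> F x\<close> \<open>set vs \<subseteq> F x\<close> by simp
        fix u v assume uv: "u \<in> F x" "v \<in> F x"
        have "inter P \<eta> x (us @ add u v # vs) =
            pair_at x (\<lambda>ws. \<eta> x (rev ws @ us @ u # vs) + \<eta> x (rev ws @ us @ v # vs)) (P x)"
          unfolding inter_def by (rule pair_at_cong) (rule linear_fun_add[OF l uv])
        also have "\<dots> = inter P \<eta> x (us @ u # vs) + inter P \<eta> x (us @ v # vs)"
          unfolding inter_def by (rule pair_at_add_left[OF mv skew_rev_append[OF sk] skew_rev_append[OF sk]])
        finally show "inter P \<eta> x (us @ add u v # vs) = inter P \<eta> x (us @ u # vs) + inter P \<eta> x (us @ v # vs)" .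
      next
        have l: "linear_fun (F x) add scl (\<lambda>v. \<eta> x (rev ws @ us @ v # vs))" if "set ws \<subseteq> F x" for ws
          using skew_multilinear_linear[OF sk, of "rev ws @ us" x vs] that \<open>set us \<subseteq> F x\<close> \<open>set vs \<subseteq> F x\<close> by simp
        fix a u assume u: "u \<in> F x"
        have "inter P \<eta> x (us @ scl a u # vs) = pair_at x (\<lambda>ws. a * \<eta> x (rev ws @ us @ u # vs)) (P x)"
          unfolding inter_def by (rule pair_at_cong) (rule linear_fun_scl[OF l u])
        also have "\<dots> = a * inter P \<eta> x (us @ u # vs)"
          unfolding inter_def by (rule pair_at_scale_left[OF mv skew_rev_append[OF sk]])
        finally show "inter P \<eta> x (us @ scl a u # vs) = a * inter P \<eta> x (us @ u # vs)" .
      qed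
      show "inter P \<eta> x (us @ v # w # vs) = - inter P \<eta> x (us @ w # v # vs)" for us v w vs
      proof -
        have "inter P \<eta> x (us @ v # w # vs) = pair_at x (\<lambda>ws. (-1) * \<eta> x (rev ws @ us @ w # v # vs)) (P x)"
          unfolding inter_def
        proof (rule pair_at_cong)
          show "\<eta> x (rev ws @ us @ v # w # vs) = (-1) * \<eta> x (rev ws @ us @ w # v # vs)" for ws
            using skew_multilinear_swap[OF sk, of x "rev ws @ us" v w vs] by simp
        qed
        then show ?thesis
          unfolding inter_def pair_at_scale_left[OF mv skew_rev_append[OF sk]] by simp
      qed
    qed
  next
    fix Vs assume Vs: "Vs \<in> lists \<Gamma>"
    \<comment> \<open>With \<open>Vs\<close> fixed, the remaining arguments again form a tensor
      field, so smoothness of the interior product is smoothness of a pairing.\<close>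
    let ?z = "\<lambda>x us. \<eta> x (rev us @ map (\<lambda>V. V x) Vs)"
    have "?z \<in> tensors"
    proof (rule tensorI[of _ N])
      show "eval_form ?z Us \<in> C" if "Us \<in> lists \<Gamma>" for Us
        using tensor_eval[OF assms(2), of "rev Us @ Vs"] that Vs by (auto simp: eval_form_def rev_map in_lists_conv_set)
    qed (use N skew_rev_append[OF sk] in auto)
    from pair_in[OF this assms(1)] show "eval_form (inter P \<eta>) Vs \<in> C"
      by (simp add: eval_form_def inter_def pair_def [abs_def])
  qed
qed

lemma inter_add_left:
  assumes "P \<in> multivecs" "Q \<in> multivecs" "\<eta> \<in> tensors"
  shows "inter (P + Q) \<eta> = inter P \<eta> + inter Q \<eta>"
  using assms
  by (simp add: fun_eq_iff inter_def plus_fun_def pair_at_add_right skew_mv_tensor skew_rev_append tensor_skew)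

lemma inter_scale_left:
  assumes "P \<in> multivecs" "\<eta> \<in> tensors"
  shows "inter (f \<odot> P) \<eta> = f \<odot> inter P \<eta>"
  using assms
  by (simp add: fun_eq_iff inter_def fun_scale_def pair_at_scale_right skew_mv_tensor skew_rev_append tensor_skew)

lemma inter_of_fun: "\<eta> \<in> tensors \<Longrightarrow> inter (of_fun f) \<eta> = f \<odot> \<eta>"
  by (simp add: fun_eq_iff inter_def fun_scale_def pair_at_of_fun skew_rev_append tensor_skew)

text \<open>Thanks to the reversal, V, the first factor, ends up immediately before
  \<open>vs\<close>, that is, as first argument of \<open>inter Q \<eta>\<close>. This is i(V \<and>
  Q) = i(V) i(Q).\<close>

lemma inter_wedge:
  assumes "Q \<in> multivecs" "\<eta> \<in> tensors" "V \<in> \<Gamma>"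
  shows "inter (one_form (bidual V) \<curlywedge> Q) \<eta> = interior_sec V (inter Q \<eta>)"
proof (intro ext)
  fix x vs
  show "inter (one_form (bidual V) \<curlywedge> Q) \<eta> x vs = interior_sec V (inter Q \<eta>) x vs"
    using pair_at_wedge[OF skew_mv_tensor[OF assms(1)] skew_rev_append[OF tensor_skew[OF assms(2)]] assms(3)]
    by (simp add: inter_def wedge_apply interior_sec_def)
qed

lemma inter_wedge_list:
  assumes "Vs \<in> lists \<Gamma>" "\<eta> \<in> tensors"
  shows "inter (wedge_list (map (\<lambda>V. one_form (bidual V)) Vs)) \<eta> = foldr interior_sec Vs \<eta>"
  using assms(1)
proof (induction Vs rule: list.induct)
  case Nil
  show ?case using assms(2) by (simp add: wedge_list_simps inter_of_fun fun_scale_def)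
next
  case (Cons V Vs)
  then show ?case
    using inter_wedge[OF bidual_wedge_in[of Vs] assms(2), of V] by (simp add: wedge_list_simps)
qed

end

locale lie_pair = lie_bundle C F add scl \<Gamma> \<Theta> X \<delta>
  for C :: "('m::topological_space \<Rightarrow> real) set"
    and F :: "'m \<Rightarrow> 'v set"
    and add :: "'v \<Rightarrow> 'v \<Rightarrow> 'v" and scl :: "real \<Rightarrow> 'v \<Rightarrow> 'v"
    and \<Gamma> :: "('m \<Rightarrow> 'v) set" and \<Theta> :: "('m \<Rightarrow> 'v \<Rightarrow> real) set"
    and X :: "('m \<Rightarrow> real) \<Rightarrow> 'm \<Rightarrow> real" and \<delta> :: "('m \<Rightarrow> 'v) \<Rightarrow> 'm \<Rightarrow> 'v"

sublocale lie_pair \<subseteq> bundle_pair ..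

text \<open>With \<open>dual_der\<close> as derivation of the dual sections, the operator
  \<open>dual.lie_op\<close> on multivectors and its product and commutator rules are instances of
  what holds for forms.\<close>

sublocale lie_pair \<subseteq> dual: lie_bundle C F' dual_add dual_scale \<Gamma>' "bidual ` \<Gamma>" X dual_der
proof
  show "X (f + g) = X f + X g" if "f \<in> C" "g \<in> C" for f g using that by (rule X_add)
  show "X (f * g) = f * X g + X f * g" if "f \<in> C" "g \<in> C" for f g using that by (rule X_mult)
  show "X (\<lambda>x. a * f x) = (\<lambda>x. a * X f x)" if "f \<in> C" for f a using that by (rule X_scale)
  show "X f \<in> C" if "f \<in> C" for f using that by (rule X_in)
  show "dual_der \<alpha> \<in> \<Gamma>'" if "\<alpha> \<in> \<Gamma>'" for \<alpha> using that by (rule dual_der_in)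
  show "dual_der (\<lambda>x. dual_add (\<alpha> x) (\<beta> x)) = (\<lambda>x. dual_add (dual_der \<alpha> x) (dual_der \<beta> x))" if "\<alpha> \<in> \<Gamma>'" "\<beta> \<in> \<Gamma>'" for \<alpha> \<beta>
  proof -
    have "one_form (\<lambda>x. dual_add (\<alpha> x) (\<beta> x)) = one_form \<alpha> + one_form \<beta>"
      by (auto simp: fun_eq_iff one_form_def dual_add_apply split: list.split)
    then have "lie_op (one_form (\<lambda>x. dual_add (\<alpha> x) (\<beta> x))) = lie_op (one_form \<alpha>) + lie_op (one_form \<beta>)"
      using lie_op_add[OF tensor_one_form[OF that(1)] tensor_one_form[OF that(2)]] by (simp only:)
    then show ?thesis by (intro ext) (simp only: dual_der_def dual_add_apply plus_fun_apply)
  qed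
  show "dual_der (\<lambda>x e. f x * \<alpha> x e) = (\<lambda>x. dual_add (\<lambda>e. f x * dual_der \<alpha> x e) (\<lambda>e. X f x * \<alpha> x e))"
    if "f \<in> C" "\<alpha> \<in> \<Gamma>'" for f \<alpha>
  proof -
    have "one_form (\<lambda>x e. f x * \<alpha> x e) = f \<odot> one_form \<alpha>"
      by (auto simp: fun_eq_iff one_form_def fun_scale_def split: list.split)
    then have "lie_op (one_form (\<lambda>x e. f x * \<alpha> x e)) = f \<odot> lie_op (one_form \<alpha>) + X f \<odot> one_form \<alpha>"
      using lie_op_scale[OF that(1) tensor_one_form[OF that(2)]] by (simp only:)
    then show ?thesis
      by (intro ext) (simp only: dual_der_def dual_add_apply plus_fun_apply fun_scale_def one_form_simps)
  qed
qed

context lie_pair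
begin

text \<open>Dualising twice gives back \<delta>, since X(\<alpha>(V)) - (\<open>dual_der\<close>
  \<alpha>)(V) = \<alpha>(\<delta> V).\<close>

lemma lie_mv_one_form:
  assumes "V \<in> \<Gamma>"
  shows "dual.lie_op (one_form (bidual V)) = one_form (bidual (\<delta> V))"
proof (rule dual.tensor_eqI)
  have b: "bidual s \<in> dual_sections C F' dual_add dual_scale \<Gamma>'" if "s \<in> \<Gamma>" for s
    using that dual.coframe_dual by blast
  show "dual.lie_op (one_form (bidual V)) \<in> multivecs" "one_form (bidual (\<delta> V)) \<in> multivecs"
    using b assms by (auto intro!: dual.lie_op_tensor dual.tensor_one_form \<delta>_in)
  fix \<alpha>s assume \<alpha>s: "\<alpha>s \<in> lists \<Gamma>'"
  show "eval_form (dual.lie_op (one_form (bidual V))) \<alpha>s = eval_form (one_form (bidual (\<delta> V))) \<alpha>s"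
  proof (cases "length \<alpha>s = 1")
    case True
    then obtain \<alpha> where \<alpha>: "\<alpha>s = [\<alpha>]" "\<alpha> \<in> \<Gamma>'" using \<alpha>s by (auto simp: length_Suc_conv)
    have e: "(\<lambda>x. bidual s x (\<beta> x)) = (\<lambda>x. \<beta> x (s x))" if "\<beta> \<in> \<Gamma>'" for s \<beta>
      using that by (auto simp: dual_sections_def bidual_simp)
    have "(\<lambda>x. dual.dual_der (bidual V) x (\<alpha> x)) = (\<lambda>x. \<alpha> x (\<delta> V x))"
      using dual.dual_der_apply[OF b[OF assms] \<alpha>(2)] dual_der_apply[OF \<alpha>(2) assms]
      by (simp add: e \<alpha> dual_der_in)
    then show ?thesis
      by (simp add: dual.lie_op_one_form[OF b[OF assms]] \<alpha> eval_form_def e)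
  next
    case False
    then show ?thesis
      by (simp add: dual.lie_op_one_form[OF b[OF assms]] eval_form_def one_form_degree)
  qed
qed

lemma bidual_one_form_in: "V \<in> \<Gamma> \<Longrightarrow> one_form (bidual V) \<in> multivecs"
  by (intro dual.one_form_tensor) simp

text \<open>On V \<and> Q the pairing is contraction with V. The term i(\<delta> V) from
  \<open>lie_op_interior\<close> cancels \<delta> V \<and> Q from the derivative of the multivector,
  which leaves the identity for \<open>interior_sec V \<omega>\<close> and Q.\<close>

lemma X_pair:
  assumes "\<omega> \<in> tensors" "P \<in> multivecs"
  shows "X (pair \<omega> P) = pair (lie_op \<omega>) P + pair \<omega> (dual.lie_op P)"
proof -
  let ?K = "\<lambda>P. X (pair \<omega> P) - pair (lie_op \<omega>) P - pair \<omega> (dual.lie_op P)"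
  have "?K P = 0"
  proof (rule dual.tensor_vanishing[of ?K])
    show "?K (P + Q) = ?K P + ?K Q" if "P \<in> multivecs" "Q \<in> multivecs" for P Q
      using that assms(1)
      by (simp add: pair_add_right X_add pair_in lie_op_tensor dual.lie_op_add dual.lie_op_tensor)
    show "?K (f \<odot> P) = f * ?K P" if "f \<in> C" "P \<in> multivecs" for f P
      using that assms(1)
      by (simp add: pair_scale_right pair_add_right X_mult pair_in lie_op_tensor dual.lie_op_scale
          dual.lie_op_tensor dual.tensor_scale X_in algebra_simps)
    show "?K (wedge_list (map one_form vs)) = 0" if "vs \<in> lists (bidual ` \<Gamma>)" for vs
    proof -
      have "vs \<in> map bidual ` lists \<Gamma>" using that by (simp only: lists_image)
      then obtain Vs where Vs: "Vs \<in> lists \<Gamma>" "vs = map bidual Vs" by blast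
      let ?w = "\<lambda>Vs. wedge_list (map (\<lambda>V. one_form (bidual V)) Vs)"
      have "X (pair \<omega> (?w Vs)) = pair (lie_op \<omega>) (?w Vs) + pair \<omega> (dual.lie_op (?w Vs))"
        using Vs(1) assms(1)
      proof (induction Vs arbitrary: \<omega> rule: list.induct)
        case Nil
        have "dual.lie_op (of_fun 1) = of_fun 0"
          using dual.lie_op_of_fun[OF C_const[of 1]] by (simp add: one_fun_def)
        then show ?case using Nil by (simp add: wedge_list_simps pair_of_fun lie_op_tensor lie_op_eval)
      next
        case (Cons V Vs)
        then have V: "V \<in> \<Gamma>" and Q: "?w Vs \<in> multivecs" by (auto intro: bidual_wedge_in)
        have \<omega>: "\<omega> \<in> tensors" by (rule Cons.prems(2))
        have "dual.lie_op (?w (V # Vs)) =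
            one_form (bidual (\<delta> V)) \<curlywedge> ?w Vs + one_form (bidual V) \<curlywedge> dual.lie_op (?w Vs)"
          using V Q by (simp add: wedge_list_simps dual.lie_op_wedge bidual_one_form_in lie_mv_one_form)
        then have "pair \<omega> (dual.lie_op (?w (V # Vs))) =
            pair (interior_sec (\<delta> V) \<omega>) (?w Vs) + pair (interior_sec V \<omega>) (dual.lie_op (?w Vs))"
          using V Q \<omega>
          by (simp add: pair_add_right pair_wedge dual.tensor_wedge bidual_one_form_in \<delta>_in dual.lie_op_tensor)
        moreover have "pair (lie_op \<omega>) (?w (V # Vs)) =
            pair (lie_op (interior_sec V \<omega>)) (?w Vs) - pair (interior_sec (\<delta> V) \<omega>) (?w Vs)"
          using V Q \<omega>
          by (simp add: wedge_list_simps pair_wedge lie_op_tensor lie_op_interior pair_diff_left tensor_interior \<delta>_in)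
        moreover have "X (pair (interior_sec V \<omega>) (?w Vs)) =
            pair (lie_op (interior_sec V \<omega>)) (?w Vs) + pair (interior_sec V \<omega>) (dual.lie_op (?w Vs))"
          by (rule Cons.IH) (use Cons.prems V \<omega> in \<open>auto intro: tensor_interior\<close>)
        then have "X (pair \<omega> (?w (V # Vs))) =
            pair (lie_op (interior_sec V \<omega>)) (?w Vs) + pair (interior_sec V \<omega>) (dual.lie_op (?w Vs))"
          using V Q \<omega> by (simp add: wedge_list_simps pair_wedge)
        ultimately show "X (pair \<omega> (?w (V # Vs))) =
            pair (lie_op \<omega>) (?w (V # Vs)) + pair \<omega> (dual.lie_op (?w (V # Vs)))"
          by simp
      qed
      then show ?thesis by (simp add: Vs o_def)
    qed
  qed (rule assms(2))
  then show ?thesis by (simp add: algebra_simps)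
qed

text \<open>The defect is a form, whereas \<open>tensor_vanishing\<close> handles function-valued
  maps; hence the evaluation on fixed sections \<open>Us\<close>. On V \<and> Q both the left side
  and i(\<delta> V \<and> Q) produce i(\<delta> V) i(Q).\<close>

lemma lie_op_inter:
  assumes "\<eta> \<in> tensors" "P \<in> multivecs"
  shows "lie_op (inter P \<eta>) = inter (dual.lie_op P) \<eta> + inter P (lie_op \<eta>)"
proof (rule tensor_eqI)
  fix Us assume Us: "Us \<in> lists \<Gamma>"
  let ?D = "\<lambda>P. lie_op (inter P \<eta>) - inter (dual.lie_op P) \<eta> - inter P (lie_op \<eta>)"
  have "eval_form (?D P) Us = 0"
  proof (rule dual.tensor_vanishing[of "\<lambda>P. eval_form (?D P) Us"])
    show "eval_form (?D (P + Q)) Us = eval_form (?D P) Us + eval_form (?D Q) Us"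
      if "P \<in> multivecs" "Q \<in> multivecs" for P Q
      using that assms(1)
      by (simp add: inter_add_left lie_op_add inter_tensor lie_op_tensor dual.lie_op_add dual.lie_op_tensor)
    show "eval_form (?D (f \<odot> P)) Us = f * eval_form (?D P) Us" if "f \<in> C" "P \<in> multivecs" for f P
      using that assms(1)
      by (simp add: inter_scale_left inter_add_left lie_op_scale inter_tensor lie_op_tensor dual.lie_op_scale
          dual.lie_op_tensor dual.tensor_scale X_in algebra_simps)
    show "eval_form (?D (wedge_list (map one_form vs))) Us = 0" if "vs \<in> lists (bidual ` \<Gamma>)" for vs
    proof -
      have "vs \<in> map bidual ` lists \<Gamma>" using that by (simp only: lists_image)
      then obtain Vs where Vs: "Vs \<in> lists \<Gamma>" "vs = map bidual Vs" by blast
      let ?w = "\<lambda>Vs. wedge_list (map (\<lambda>V. one_form (bidual V)) Vs)"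
      have "lie_op (inter (?w Vs) \<eta>) = inter (dual.lie_op (?w Vs)) \<eta> + inter (?w Vs) (lie_op \<eta>)"
        using Vs(1)
      proof (induction Vs rule: list.induct)
        case Nil
        have "dual.lie_op (of_fun 1) = of_fun 0"
          using dual.lie_op_of_fun[OF C_const[of 1]] by (simp add: one_fun_def)
        then have "inter (dual.lie_op (of_fun 1)) \<eta> = 0 \<odot> \<eta>" "inter (of_fun 1) \<zeta> = 1 \<odot> \<zeta>"
          if "\<zeta> \<in> tensors" for \<zeta>
          using assms(1) that inter_of_fun by metis+
        then show ?case using assms(1) lie_op_tensor[OF assms(1)]
          by (simp add: wedge_list_simps fun_scale_def fun_eq_iff)
      next
        case (Cons V Vs)
        then have V: "V \<in> \<Gamma>" and Q: "?w Vs \<in> multivecs" by (auto intro: bidual_wedge_in)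
        have "dual.lie_op (?w (V # Vs)) =
            one_form (bidual (\<delta> V)) \<curlywedge> ?w Vs + one_form (bidual V) \<curlywedge> dual.lie_op (?w Vs)"
          using V Q by (simp add: wedge_list_simps dual.lie_op_wedge bidual_one_form_in lie_mv_one_form)
        then have "inter (dual.lie_op (?w (V # Vs))) \<eta> =
            interior_sec (\<delta> V) (inter (?w Vs) \<eta>) + interior_sec V (inter (dual.lie_op (?w Vs)) \<eta>)"
          using V Q assms(1)
          by (simp add: inter_add_left inter_wedge dual.tensor_wedge bidual_one_form_in \<delta>_in dual.lie_op_tensor)
        moreover have "inter (?w (V # Vs)) \<zeta> = interior_sec V (inter (?w Vs) \<zeta>)" if "\<zeta> \<in> tensors" for \<zeta>
          using V Q that by (simp add: wedge_list_simps inter_wedge)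
        moreover have "lie_op (interior_sec V (inter (?w Vs) \<eta>)) =
            interior_sec V (lie_op (inter (?w Vs) \<eta>)) + interior_sec (\<delta> V) (inter (?w Vs) \<eta>)"
          using lie_op_interior[OF inter_tensor[OF Q assms(1)] V] by simp
        moreover have "lie_op (inter (?w Vs) \<eta>) = inter (dual.lie_op (?w Vs)) \<eta> + inter (?w Vs) (lie_op \<eta>)"
          by (rule Cons.IH) (use Cons.prems in simp)
        ultimately show "lie_op (inter (?w (V # Vs)) \<eta>) =
            inter (dual.lie_op (?w (V # Vs))) \<eta> + inter (?w (V # Vs)) (lie_op \<eta>)"
          using assms(1) lie_op_tensor[OF assms(1)] by (simp add: add_ac)
      qed
      then have "?D (wedge_list (map one_form vs)) = 0" by (simp add: Vs o_def)
      then show ?thesis by (simp add: eval_form_def fun_eq_iff)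
    qed
  qed (rule assms(2))
  then show "eval_form (lie_op (inter P \<eta>)) Us = eval_form (inter (dual.lie_op P) \<eta> + inter P (lie_op \<eta>)) Us"
    by (simp add: algebra_simps)
qed (use assms in \<open>auto intro!: lie_op_tensor inter_tensor tensor_add dual.lie_op_tensor\<close>)

end

section \<open>Smooth functions on manifolds\<close>

lemma smooth_on_const: "smooth_on S (\<lambda>x. c)"
  by (simp add: smooth_on_def times_differentiable_on_const)

lemma smooth_on_add:
  "open S \<Longrightarrow> smooth_on S f \<Longrightarrow> smooth_on S g \<Longrightarrow> smooth_on S (\<lambda>x. f x + g x)"
  by (simp add: smooth_on_def times_differentiable_on_add)

lemma smooth_on_bilinear:
  "open S \<Longrightarrow> bounded_bilinear mul \<Longrightarrow> smooth_on S f \<Longrightarrow> smooth_on S g \<Longrightarrow> smooth_on S (\<lambda>x. mul (f x) (g x))"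
  by (simp add: smooth_on_def times_differentiable_on_bilinear)

lemma smooth_on_compose_real:
  "open S \<Longrightarrow> smooth_on UNIV h \<Longrightarrow> smooth_on S q \<Longrightarrow> smooth_on S (\<lambda>x. (h :: real \<Rightarrow> real) (q x))"
  unfolding smooth_on_def using times_differentiable_on_compose_real[of S UNIV q] by blast

lemma smooth_on_subset: "smooth_on S f \<Longrightarrow> T \<subseteq> S \<Longrightarrow> smooth_on T f"
  unfolding smooth_on_def using times_differentiable_on_subset by blast

lemma smooth_on_local:
  assumes "open S" "\<And>x. x \<in> S \<Longrightarrow> \<exists>T. open T \<and> x \<in> T \<and> smooth_on (S \<inter> T) f"
  shows "smooth_on S f"
  unfolding smooth_on_def
proof
  fix n show "times_differentiable_on n S f"
    by (rule times_differentiable_on_local[OF assms(1)]) (use assms(2) in \<open>auto simp: smooth_on_def\<close>)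
qed

text \<open>An orthogonal spanning set of vectors c, each paired with the functional of c / (c
  \<bullet> c). The pairs form a list, so rank 0 is just the empty sum.\<close>

lemma finite_dim_expansion:
  assumes "finite_dim TYPE('v::real_inner)"
  shows "\<exists>bs :: ('v \<times> 'v) list. \<forall>k. k = (\<Sum>i<length bs. (snd (bs ! i) \<bullet> k) *\<^sub>R fst (bs ! i))"
proof -
  obtain B :: "'v set" where B: "finite B" "span B = UNIV" using assms by (auto simp: finite_dim_def)
  obtain S where S: "finite S" "span S = span B" "pairwise orthogonal S"
    using basis_orthogonal[OF B(1)] by blast
  have exp: "k = (\<Sum>c\<in>S. ((1 / (c \<bullet> c)) *\<^sub>R c \<bullet> k) *\<^sub>R c)" for k :: 'v
  proof -
    have "k \<in> span S" using S B by simp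
    then obtain u where u: "k = (\<Sum>c\<in>S. u c *\<^sub>R c)" using S(1) by (auto simp: span_finite)
    have "((1 / (c \<bullet> c)) *\<^sub>R c \<bullet> k) *\<^sub>R c = u c *\<^sub>R c" if "c \<in> S" for c
    proof -
      have "c \<bullet> k = (\<Sum>d\<in>S. if d = c then u c * (c \<bullet> c) else 0)"
        unfolding u inner_sum_right using S(3) that
        by (intro sum.cong) (auto simp: pairwise_def orthogonal_def)
      also have "\<dots> = u c * (c \<bullet> c)" using S(1) that by simp
      \<comment> \<open>The zero vector may belong to S; its term vanishes on both sides.\<close>
      finally show ?thesis by (cases "c = 0") auto
    qed
    then have "(\<Sum>c\<in>S. ((1 / (c \<bullet> c)) *\<^sub>R c \<bullet> k) *\<^sub>R c) = (\<Sum>c\<in>S. u c *\<^sub>R c)"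
      by (rule sum.cong[OF refl])
    then show ?thesis using u by simp
  qed
  obtain f where f: "bij_betw f {0..<card S} S" using ex_bij_betw_nat_finite[OF S(1)] by blast
  show ?thesis
  proof (intro exI[of _ "map (\<lambda>i. (f i, (1 / (f i \<bullet> f i)) *\<^sub>R f i)) [0..<card S]"] allI)
    fix k
    have "k = (\<Sum>i<card S. ((1 / (f i \<bullet> f i)) *\<^sub>R f i \<bullet> k) *\<^sub>R f i)"
      unfolding lessThan_atLeast0 by (subst sum.reindex_bij_betw[OF f]) (rule exp)
    then show "k = (\<Sum>i<length (map (\<lambda>i. (f i, (1 / (f i \<bullet> f i)) *\<^sub>R f i)) [0..<card S]).
        (snd (map (\<lambda>i. (f i, (1 / (f i \<bullet> f i)) *\<^sub>R f i)) [0..<card S] ! i) \<bullet> k) *\<^sub>R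
          fst (map (\<lambda>i. (f i, (1 / (f i \<bullet> f i)) *\<^sub>R f i)) [0..<card S] ! i))" by simp
  qed
qed

text \<open>Sums of the b i with coefficients in given intervals lie in a compact set, built up as
  successive continuous images. The ball is a closed subset of such a set.\<close>

lemma compact_cball_finite_dim:
  fixes x :: "'v::real_inner"
  assumes "finite_dim TYPE('v)"
  shows "compact (cball x r)"
proof -
  obtain bs :: "('v \<times> 'v) list"
    where bs: "\<forall>k. k = (\<Sum>i<length bs. (snd (bs ! i) \<bullet> k) *\<^sub>R fst (bs ! i))"
    using finite_dim_expansion[OF assms] by (elim exE)
  define n b d where "n = length bs" and "b = (\<lambda>i. fst (bs ! i))" and "d = (\<lambda>i. snd (bs ! i))"
  have e: "(\<Sum>i<n. (d i \<bullet> k) *\<^sub>R b i) = k" for k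
    unfolding n_def b_def d_def by (rule bs[rule_format, symmetric])
  have box: "\<exists>K. compact K \<and> (\<forall>a. (\<forall>i<m. \<bar>a i\<bar> \<le> R i) \<longrightarrow> (\<Sum>i<m. a i *\<^sub>R b i) \<in> K)" for m and R :: "nat \<Rightarrow> real"
  proof (induction m)
    case 0
    show ?case by (rule exI[of _ "{0}"]) simp
  next
    case (Suc m)
    then obtain K where K: "compact K" "\<And>a. (\<forall>i<m. \<bar>a i\<bar> \<le> R i) \<Longrightarrow> (\<Sum>i<m. a i *\<^sub>R b i) \<in> K" by blast
    have "compact ((\<lambda>(v, t). v + t *\<^sub>R b m) ` (K \<times> {- R m..R m}))"
      by (intro compact_continuous_image compact_Times K compact_Icc)
        (auto simp: case_prod_beta intro!: continuous_intros)
    moreover have "(\<Sum>i<Suc m. a i *\<^sub>R b i) \<in> (\<lambda>(v, t). v + t *\<^sub>R b m) ` (K \<times> {- R m..R m})"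
      if "\<forall>i<Suc m. \<bar>a i\<bar> \<le> R i" for a
      by (rule image_eqI[of _ _ "(\<Sum>i<m. a i *\<^sub>R b i, a m)"]) (use that K(2) in \<open>auto simp: abs_le_iff\<close>)
    ultimately show ?case by blast
  qed
  \<comment> \<open>By Cauchy-Schwarz the coefficient \<open>d i \<bullet> k\<close> of a point k of
    the ball is bounded by norm (d i) times norm k, and norm k is at most norm x + r.\<close>
  obtain K where K: "compact K"
    "\<And>a. (\<forall>i<n. \<bar>a i\<bar> \<le> norm (d i) * (norm x + r)) \<Longrightarrow> (\<Sum>i<n. a i *\<^sub>R b i) \<in> K"
    using box[of n "\<lambda>i. norm (d i) * (norm x + r)"] by blast
  have "cball x r \<subseteq> K"
  proof
    fix k assume "k \<in> cball x r"
    then have "norm k \<le> norm x + r"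
      using norm_triangle_sub[of k x] by (simp add: dist_norm norm_minus_commute)
    then have "\<bar>d i \<bullet> k\<bar> \<le> norm (d i) * (norm x + r)" for i
      using order_trans[OF Cauchy_Schwarz_ineq2 mult_left_mono] by (metis norm_ge_zero)
    then show "k \<in> K" using K(2)[of "\<lambda>i. d i \<bullet> k"] e[of k] by simp
  qed
  then show ?thesis using compact_Int_closed[OF K(1) closed_cball] by (metis inf.absorb_iff2)
qed

locale manifold =
  fixes A :: "('m::{t2_space,second_countable_topology} set \<times> ('m \<Rightarrow> 'b::real_inner)) set"
  assumes smooth_manifold: "smooth_manifold A"
begin

lemma chart:
  assumes "(U, \<phi>) \<in> A"
  shows "open U" "open (\<phi> ` U)" "homeomorphism U (\<phi> ` U) \<phi> (inv_into U \<phi>)"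
  using smooth_manifold assms unfolding smooth_manifold_def by blast+

lemma chart_inv: "(U, \<phi>) \<in> A \<Longrightarrow> x \<in> U \<Longrightarrow> inv_into U \<phi> (\<phi> x) = x"
  using chart(3)[of U \<phi>] by (simp add: homeomorphism_def)

lemma chart_exists: "\<exists>U \<phi>. (U, \<phi>) \<in> A \<and> x \<in> U"
proof -
  have "x \<in> (\<Union>(U, \<phi>)\<in>A. U)" using smooth_manifold by (simp add: smooth_manifold_def)
  then show ?thesis by blast
qed

lemma chart_change: "(U, \<phi>) \<in> A \<Longrightarrow> (V, \<psi>) \<in> A \<Longrightarrow> smooth_on (\<phi> ` (U \<inter> V)) (\<psi> \<circ> inv_into U \<phi>)"
  using smooth_manifold unfolding smooth_manifold_def by blast

lemma chart_image_open:
  assumes "(U, \<phi>) \<in> A" "open W"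
  shows "open (\<phi> ` (U \<inter> W))"
proof -
  have "\<phi> ` (U \<inter> W) = \<phi> ` U \<inter> inv_into U \<phi> -` W"
    using chart_inv[OF assms(1)] by auto
  then show ?thesis
    using continuous_open_preimage[of "\<phi> ` U" "inv_into U \<phi>" W] chart[OF assms(1)] assms(2)
    by (simp add: homeomorphism_def)
qed

lemma msmooth_onI:
  "(\<And>U \<phi>. (U, \<phi>) \<in> A \<Longrightarrow> smooth_on (\<phi> ` (U \<inter> W)) (\<lambda>y. f (inv_into U \<phi> y))) \<Longrightarrow> msmooth_on A W f"
  unfolding msmooth_on_def by (auto simp: o_def)

lemma msmooth_onD:
  "msmooth_on A W f \<Longrightarrow> (U, \<phi>) \<in> A \<Longrightarrow> smooth_on (\<phi> ` (U \<inter> W)) (\<lambda>y. f (inv_into U \<phi> y))"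
  unfolding msmooth_on_def by (auto simp: o_def)

lemma msmooth_on_cong:
  assumes "open W" "\<And>x. x \<in> W \<Longrightarrow> f x = g x" "msmooth_on A W g"
  shows "msmooth_on A W f"
proof (rule msmooth_onI)
  fix U \<phi> assume U: "(U, \<phi>) \<in> A"
  have "smooth_on (\<phi> ` (U \<inter> W)) (\<lambda>y. f (inv_into U \<phi> y)) = smooth_on (\<phi> ` (U \<inter> W)) (\<lambda>y. g (inv_into U \<phi> y))"
    by (rule smooth_on_cong[OF chart_image_open[OF U assms(1)]])
      (auto simp: chart_inv[OF U] assms(2))
  then show "smooth_on (\<phi> ` (U \<inter> W)) (\<lambda>y. f (inv_into U \<phi> y))"
    using msmooth_onD[OF assms(3) U] by simp
qed

lemma msmooth_on_subset:
  assumes "msmooth_on A W f" "T \<subseteq> W"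
  shows "msmooth_on A T f"
proof (rule msmooth_onI)
  fix U \<phi> assume U: "(U, \<phi>) \<in> A"
  show "smooth_on (\<phi> ` (U \<inter> T)) (\<lambda>y. f (inv_into U \<phi> y))"
    by (rule smooth_on_subset[OF msmooth_onD[OF assms(1) U]]) (use assms(2) in auto)
qed

lemma msmooth_on_local:
  assumes "open W" "\<And>x. x \<in> W \<Longrightarrow> \<exists>T. open T \<and> x \<in> T \<and> msmooth_on A (W \<inter> T) f"
  shows "msmooth_on A W f"
proof (rule msmooth_onI)
  fix U \<phi> assume U: "(U, \<phi>) \<in> A"
  show "smooth_on (\<phi> ` (U \<inter> W)) (\<lambda>y. f (inv_into U \<phi> y))"
  proof (rule smooth_on_local[OF chart_image_open[OF U assms(1)]])
    fix y assume "y \<in> \<phi> ` (U \<inter> W)"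
    then obtain x where x: "x \<in> U" "x \<in> W" "y = \<phi> x" by blast
    then obtain T where T: "open T" "x \<in> T" "msmooth_on A (W \<inter> T) f" using assms(2) by blast
    have "inj_on \<phi> U" by (rule inj_on_inverseI) (rule chart_inv[OF U])
    then have "\<phi> ` (U \<inter> W) \<inter> \<phi> ` (U \<inter> T) = \<phi> ` ((U \<inter> W) \<inter> (U \<inter> T))"
      by (intro inj_on_image_Int[symmetric, of _ U]) auto
    also have "(U \<inter> W) \<inter> (U \<inter> T) = U \<inter> (W \<inter> T)" by blast
    finally have "\<phi> ` (U \<inter> W) \<inter> \<phi> ` (U \<inter> T) = \<phi> ` (U \<inter> (W \<inter> T))" .
    then show "\<exists>S. open S \<and> y \<in> S \<and> smooth_on (\<phi> ` (U \<inter> W) \<inter> S) (\<lambda>y. f (inv_into U \<phi> y))"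
      using chart_image_open[OF U T(1)] x T(2) msmooth_onD[OF T(3) U]
      by (intro exI[of _ "\<phi> ` (U \<inter> T)"]) auto
  qed
qed

lemma msmooth_on_Un:
  assumes "open S" "open T" "msmooth_on A S f" "msmooth_on A T f"
  shows "msmooth_on A (S \<union> T) f"
proof (rule msmooth_on_local)
  fix x assume "x \<in> S \<union> T"
  moreover have "(S \<union> T) \<inter> S = S" "(S \<union> T) \<inter> T = T" by auto
  ultimately show "\<exists>R. open R \<and> x \<in> R \<and> msmooth_on A ((S \<union> T) \<inter> R) f"
    using assms by (metis Un_iff)
qed (use assms in auto)

lemma msmooth_on_const: "msmooth_on A W (\<lambda>x. c)"
  by (rule msmooth_onI) (rule smooth_on_const)

lemma msmooth_on_add:
  assumes "open W" "msmooth_on A W f" "msmooth_on A W g"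
  shows "msmooth_on A W (\<lambda>x. f x + g x)"
  using assms by (auto intro!: msmooth_onI smooth_on_add chart_image_open dest: msmooth_onD)

lemma msmooth_on_bilinear:
  assumes "bounded_bilinear mul" "open W" "msmooth_on A W f" "msmooth_on A W g"
  shows "msmooth_on A W (\<lambda>x. mul (f x) (g x))"
proof (rule msmooth_onI)
  fix U \<phi> assume U: "(U, \<phi>) \<in> A"
  show "smooth_on (\<phi> ` (U \<inter> W)) (\<lambda>y. mul (f (inv_into U \<phi> y)) (g (inv_into U \<phi> y)))"
    by (rule smooth_on_bilinear[OF chart_image_open[OF U assms(2)] assms(1)
          msmooth_onD[OF assms(3) U] msmooth_onD[OF assms(4) U]])
qed

lemmas msmooth_on_mult = msmooth_on_bilinear[OF bounded_bilinear_mult]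
lemmas msmooth_on_scaleR = msmooth_on_bilinear[OF bounded_bilinear_scaleR]
lemmas msmooth_on_inner = msmooth_on_bilinear[OF bounded_bilinear_inner]

lemma msmooth_on_sum:
  "open W \<Longrightarrow> (\<And>i. i \<in> I \<Longrightarrow> msmooth_on A W (f i)) \<Longrightarrow> msmooth_on A W (\<lambda>x. \<Sum>i\<in>I. f i x)"
  by (induction I rule: infinite_finite_induct) (auto intro: msmooth_on_add msmooth_on_const)

lemma C_infD: "f \<in> C_inf A \<Longrightarrow> msmooth_on A W f"
  unfolding C_inf_def using msmooth_on_subset by blast

text \<open>The set Z is what extension by zero needs: an open set where \<kappa> vanishes and which
  together with U covers the base. An object smooth on U, multiplied by \<kappa>, can then be
  checked on U and on Z separately.\<close>

lemma bump:
  assumes "open U" "x \<in> U"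
  obtains \<kappa> W Z where "\<kappa> \<in> C_inf A" "open W" "x \<in> W" "\<And>y. y \<in> W \<Longrightarrow> \<kappa> y = 1"
    "open Z" "Z \<union> U = UNIV" "\<And>y. y \<in> Z \<Longrightarrow> \<kappa> y = 0"
proof -
  obtain V \<phi> where V: "(V, \<phi>) \<in> A" "x \<in> V" using chart_exists by blast
  let ?c = "\<phi> x"
  obtain r where r: "r > 0" "cball ?c r \<subseteq> \<phi> ` (V \<inter> U)"
    using chart_image_open[OF V(1) assms(1)] V(2) assms(2) open_contains_cball[of "\<phi> ` (V \<inter> U)"] by blast
  obtain h :: "real \<Rightarrow> real" where h: "smooth_on UNIV h" "\<And>t. t \<le> 1 \<Longrightarrow> h t = 1" "\<And>t. t \<ge> 2 \<Longrightarrow> h t = 0"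
    by (rule smooth_cutoff) blast
  \<comment> \<open>The factor 2 / r^2 puts the vanishing range t \<ge> 2 of the cutoff at distance
    r from the centre, so that \<kappa> is supported in the closed ball; \<kappa> is 1 where
    \<open>?q\<close> is below 1.\<close>
  let ?q = "\<lambda>z. 2 / r\<^sup>2 * ((z - ?c) \<bullet> (z - ?c))"
  define \<kappa> where "\<kappa> = (\<lambda>y. if y \<in> V then h (?q (\<phi> y)) else 0)"
  define K where "K = inv_into V \<phi> ` cball ?c r"
  have cV: "continuous_on V \<phi>" "continuous_on (\<phi> ` V) (inv_into V \<phi>)"
    using chart(3)[OF V(1)] by (auto simp: homeomorphism_def)
  have K: "K \<subseteq> V \<inter> U" using r(2) chart_inv[OF V(1)] by (force simp: K_def)
  have "compact (cball ?c r)"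
    using compact_cball_finite_dim smooth_manifold by (auto simp: smooth_manifold_def)
  then have "compact K"
    unfolding K_def using continuous_on_subset[OF cV(2)] r(2) by (intro compact_continuous_image) auto
  \<comment> \<open>A compact subset of a Hausdorff space is closed. So \<kappa> is smooth on two
    open sets covering the base: the chart domain, and the complement of K, where it is 0.\<close>
  then have oZ: "open (- K)" using compact_imp_closed by blast
  have q_le: "?q z < 2 \<Longrightarrow> z \<in> cball ?c r" for z
  proof -
    assume "?q z < 2"
    then have "(norm (z - ?c))\<^sup>2 < r\<^sup>2"
      using r(1) by (simp add: divide_simps power2_norm_eq_inner split: if_splits)
    then have "norm (z - ?c) < r" using r(1) by (simp add: power_less_imp_less_base)
    then show ?thesis by (simp add: dist_norm norm_minus_commute)
  qed
  have zero: "\<kappa> y = 0" if "y \<in> - K" for y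
  proof (rule ccontr)
    assume "\<kappa> y \<noteq> 0"
    then have y: "y \<in> V" "h (?q (\<phi> y)) \<noteq> 0" by (auto simp: \<kappa>_def split: if_splits)
    then have "\<phi> y \<in> cball ?c r" using h(3)[of "?q (\<phi> y)"] by (intro q_le) linarith
    then have "y \<in> K" using chart_inv[OF V(1) y(1)] by (metis K_def image_eqI)
    then show False using that by blast
  qed
  have "msmooth_on A V (\<lambda>y. h (?q (\<phi> y)))"
  proof (rule msmooth_onI)
    fix T \<psi> assume T: "(T, \<psi>) \<in> A"
    let ?S = "\<psi> ` (T \<inter> V)"
    have o: "open ?S" by (rule chart_image_open[OF T chart(1)[OF V(1)]])
    have "smooth_on ?S (\<lambda>y. \<phi> (inv_into T \<psi> y) + (- ?c))"
      using chart_change[OF T V(1)] by (intro smooth_on_add[OF o] smooth_on_const) (simp add: o_def)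
    then have s: "smooth_on ?S (\<lambda>y. \<phi> (inv_into T \<psi> y) - ?c)" by simp
    have "smooth_on ?S (\<lambda>y. ?q (\<phi> (inv_into T \<psi> y)))"
      by (rule smooth_on_bilinear[OF o bounded_bilinear_mult smooth_on_const
            smooth_on_bilinear[OF o bounded_bilinear_inner s s]])
    then show "smooth_on ?S (\<lambda>y. h (?q (\<phi> (inv_into T \<psi> y))))"
      by (rule smooth_on_compose_real[OF o h(1)])
  qed
  then have "msmooth_on A V \<kappa>"
    by (rule msmooth_on_cong[OF chart(1)[OF V(1)], rotated]) (simp add: \<kappa>_def)
  moreover have "msmooth_on A (- K) \<kappa>"
    by (rule msmooth_on_cong[OF oZ _ msmooth_on_const[of _ 0]]) (rule zero)
  ultimately have "msmooth_on A (V \<union> - K) \<kappa>" by (rule msmooth_on_Un[OF chart(1)[OF V(1)] oZ])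
  moreover have "V \<union> - K = UNIV" using K by auto
  ultimately have C: "\<kappa> \<in> C_inf A" by (simp add: C_inf_def)
  let ?W = "V \<inter> (\<lambda>y. ?q (\<phi> y)) -` {..<1}"
  have "open ?W"
    by (rule continuous_open_preimage[OF _ chart(1)[OF V(1)]])
      (use r(1) in \<open>auto intro!: continuous_intros cV\<close>)
  then show ?thesis
    by (intro that[of \<kappa> ?W "- K"]) (use C V(2) K h(2) oZ zero in \<open>auto simp: \<kappa>_def\<close>)
qed

end

section \<open>Sections of vector bundles\<close>

locale smooth_bundle =
  fixes E :: "('m::{t2_space,second_countable_topology}, 'b::real_inner, 'e, 'k::real_inner, 'z) vector_bundle_scheme"
  assumes smooth_vector_bundle: "smooth_vector_bundle E"

sublocale smooth_bundle \<subseteq> manifold "atlas E"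
  using smooth_vector_bundle by unfold_locales (simp add: smooth_vector_bundle_def)

context smooth_bundle
begin

abbreviation "C \<equiv> C_inf (atlas E)"
abbreviation "\<Gamma> \<equiv> smooth_sections E"

lemma fibre_closed:
  "u \<in> fibre E x \<Longrightarrow> v \<in> fibre E x \<Longrightarrow> vadd E u v \<in> fibre E x"
  "u \<in> fibre E x \<Longrightarrow> vscale E a u \<in> fibre E x"
proof -
  have "\<forall>x. \<forall>u\<in>fibre E x. \<forall>v\<in>fibre E x. \<forall>a. vadd E u v \<in> fibre E x \<and> vscale E a u \<in> fibre E x"
    using smooth_vector_bundle unfolding smooth_vector_bundle_def by (elim conjE)
  then show "u \<in> fibre E x \<Longrightarrow> v \<in> fibre E x \<Longrightarrow> vadd E u v \<in> fibre E x"
    "u \<in> fibre E x \<Longrightarrow> vscale E a u \<in> fibre E x" by blast+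
qed

lemma triv_exists: "\<exists>U \<Phi>. (U, \<Phi>) \<in> trivs E \<and> x \<in> U"
proof -
  have "x \<in> (\<Union>(U, \<Phi>)\<in>trivs E. U)" using smooth_vector_bundle by (simp add: smooth_vector_bundle_def)
  then show ?thesis by blast
qed

lemma triv:
  assumes "(U, \<Phi>) \<in> trivs E"
  shows "open U" and "x \<in> U \<Longrightarrow> bij_betw \<Phi> (fibre E x) UNIV"
    and "x \<in> U \<Longrightarrow> u \<in> fibre E x \<Longrightarrow> v \<in> fibre E x \<Longrightarrow> \<Phi> (vadd E u v) = \<Phi> u + \<Phi> v"
    and "x \<in> U \<Longrightarrow> u \<in> fibre E x \<Longrightarrow> \<Phi> (vscale E a u) = a *\<^sub>R \<Phi> u"
proof -
  have "\<forall>(U, \<Phi>)\<in>trivs E. open U \<and>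
        (\<forall>x\<in>U. bij_betw \<Phi> (fibre E x) UNIV \<and>
           (\<forall>u\<in>fibre E x. \<forall>v\<in>fibre E x. \<forall>a.
              \<Phi> (vadd E u v) = \<Phi> u + \<Phi> v \<and> \<Phi> (vscale E a u) = a *\<^sub>R \<Phi> u))"
    using smooth_vector_bundle unfolding smooth_vector_bundle_def by (elim conjE)
  from bspec[OF this assms]
  have *: "open U" "\<forall>x\<in>U. bij_betw \<Phi> (fibre E x) UNIV \<and>
           (\<forall>u\<in>fibre E x. \<forall>v\<in>fibre E x. \<forall>a.
              \<Phi> (vadd E u v) = \<Phi> u + \<Phi> v \<and> \<Phi> (vscale E a u) = a *\<^sub>R \<Phi> u)" by simp_all
  show "open U" by fact
  show "x \<in> U \<Longrightarrow> bij_betw \<Phi> (fibre E x) UNIV"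
    "x \<in> U \<Longrightarrow> u \<in> fibre E x \<Longrightarrow> v \<in> fibre E x \<Longrightarrow> \<Phi> (vadd E u v) = \<Phi> u + \<Phi> v"
    "x \<in> U \<Longrightarrow> u \<in> fibre E x \<Longrightarrow> \<Phi> (vscale E a u) = a *\<^sub>R \<Phi> u"
    using *(2) by blast+
qed

lemma triv_change:
  assumes "(U, \<Phi>) \<in> trivs E" "(V, \<Psi>) \<in> trivs E"
  shows "msmooth_on (atlas E) (U \<inter> V) (\<lambda>x. \<Psi> (triv_inv E \<Phi> x k))"
proof -
  have "\<forall>(U, \<Phi>)\<in>trivs E. \<forall>(V, \<Psi>)\<in>trivs E. \<forall>k.
        msmooth_on (atlas E) (U \<inter> V) (\<lambda>x. \<Psi> (triv_inv E \<Phi> x k))"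
    using smooth_vector_bundle unfolding smooth_vector_bundle_def by (elim conjE)
  from bspec[OF this assms(1)] show ?thesis using assms(2) by auto
qed

lemma triv_inv:
  assumes "(U, \<Phi>) \<in> trivs E" "x \<in> U"
  shows triv_inv_in: "triv_inv E \<Phi> x k \<in> fibre E x"
    and triv_triv_inv: "\<Phi> (triv_inv E \<Phi> x k) = k"
    and triv_inv_triv: "u \<in> fibre E x \<Longrightarrow> triv_inv E \<Phi> x (\<Phi> u) = u"
  using triv(2)[OF assms] unfolding triv_inv_def bij_betw_def
  by (auto intro!: inv_into_into f_inv_into_f)

lemma triv_inj:
  "(U, \<Phi>) \<in> trivs E \<Longrightarrow> x \<in> U \<Longrightarrow> u \<in> fibre E x \<Longrightarrow> v \<in> fibre E x \<Longrightarrow> \<Phi> u = \<Phi> v \<Longrightarrow> u = v"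
  using triv(2) unfolding bij_betw_def inj_on_def by blast

lemma triv_inv_add:
  assumes "(U, \<Phi>) \<in> trivs E" "x \<in> U"
  shows "triv_inv E \<Phi> x (k + l) = vadd E (triv_inv E \<Phi> x k) (triv_inv E \<Phi> x l)"
  by (rule triv_inj[OF assms]) (use assms in \<open>auto intro: fibre_closed simp: triv_inv triv(3)[OF assms]\<close>)

lemma triv_inv_scale:
  assumes "(U, \<Phi>) \<in> trivs E" "x \<in> U"
  shows "triv_inv E \<Phi> x (a *\<^sub>R k) = vscale E a (triv_inv E \<Phi> x k)"
  by (rule triv_inj[OF assms]) (use assms in \<open>auto intro: fibre_closed simp: triv_inv triv(4)[OF assms]\<close>)

definition basis :: "('k \<times> 'k) list" where
  "basis = (SOME bs. \<forall>k. k = (\<Sum>i<length bs. (snd (bs ! i) \<bullet> k) *\<^sub>R fst (bs ! i)))"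

abbreviation bv :: "nat \<Rightarrow> 'k" where "bv i \<equiv> fst (basis ! i)"
abbreviation dv :: "nat \<Rightarrow> 'k" where "dv i \<equiv> snd (basis ! i)"

lemma basis: "k = (\<Sum>i<length basis. (dv i \<bullet> k) *\<^sub>R bv i)"
proof -
  have "finite_dim TYPE('k)" using smooth_vector_bundle by (simp add: smooth_vector_bundle_def)
  from someI_ex[OF finite_dim_expansion[OF this]] show ?thesis
    unfolding basis_def by (rule spec)
qed

lemma linear_basis:
  assumes "linear (l :: 'k \<Rightarrow> real)"
  shows "l k = (\<Sum>i<length basis. (dv i \<bullet> k) * l (bv i))"
proof -
  have "l k = l (\<Sum>i<length basis. (dv i \<bullet> k) *\<^sub>R bv i)" by (simp flip: basis)
  then show ?thesis by (simp add: linear_sum[OF assms] linear_scale[OF assms])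
qed

text \<open>The constant sections of a trivialisation form a frame over its domain, with
  coefficients \<open>dv i \<bullet> \<Phi> u\<close> that are smooth along smooth sections.\<close>

lemma linear_fun_triv:
  assumes "(U, \<Phi>) \<in> trivs E" "x \<in> U" "linear_fun (fibre E x) (vadd E) (vscale E) \<phi>" "u \<in> fibre E x"
  shows "\<phi> u = (\<Sum>i<length basis. (dv i \<bullet> \<Phi> u) * \<phi> (triv_inv E \<Phi> x (bv i)))"
proof -
  have "linear (\<lambda>k. \<phi> (triv_inv E \<Phi> x k))"
    using triv_inv_in[OF assms(1,2)] assms(3)
    by (intro linearI) (simp_all add: triv_inv_add[OF assms(1,2)] triv_inv_scale[OF assms(1,2)]
        linear_fun_add linear_fun_scl)
  from linear_basis[OF this, of "\<Phi> u"] show ?thesis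
    using triv_inv_triv[OF assms(1,2,4)] by simp
qed

text \<open>The bundle record has no zero vector; 0 times any vector of the fibre provides
  one.\<close>

definition zero_sec :: "'m \<Rightarrow> 'e" where
  "zero_sec x = vscale E 0 (SOME u. u \<in> fibre E x)"

lemma zero_sec_in: "zero_sec x \<in> fibre E x"
proof -
  obtain U \<Phi> where "(U, \<Phi>) \<in> trivs E" "x \<in> U" using triv_exists by blast
  then have "\<exists>u. u \<in> fibre E x" using triv_inv_in by blast
  then show ?thesis unfolding zero_sec_def by (rule fibre_closed(2)[OF someI_ex])
qed

lemma triv_zero_sec:
  assumes "(U, \<Phi>) \<in> trivs E" "x \<in> U"
  shows "\<Phi> (zero_sec x) = 0"
proof -
  have ex: "\<exists>u. u \<in> fibre E x" using triv_inv_in[OF assms] by blast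
  then show ?thesis using triv(4)[OF assms someI_ex[OF ex], of 0] by (simp add: zero_sec_def)
qed

lemma sectionD: "s \<in> \<Gamma> \<Longrightarrow> s x \<in> fibre E x"
  "s \<in> \<Gamma> \<Longrightarrow> (U, \<Phi>) \<in> trivs E \<Longrightarrow> msmooth_on (atlas E) U (\<lambda>x. \<Phi> (s x))"
  unfolding smooth_sections_def by blast+

lemma sectionI:
  assumes "\<And>x. s x \<in> fibre E x" "\<And>U \<Phi>. (U, \<Phi>) \<in> trivs E \<Longrightarrow> msmooth_on (atlas E) U (\<lambda>x. \<Phi> (s x))"
  shows "s \<in> \<Gamma>"
  using assms unfolding smooth_sections_def by blast

lemma zero_sec_section: "zero_sec \<in> \<Gamma>"
proof (rule sectionI[OF zero_sec_in])
  fix U \<Phi> assume "(U, \<Phi>) \<in> trivs E"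
  then show "msmooth_on (atlas E) U (\<lambda>x. \<Phi> (zero_sec x))"
    by (intro msmooth_on_cong[OF triv(1) triv_zero_sec msmooth_on_const]) auto
qed

lemma sec_add_section:
  assumes "s \<in> \<Gamma>" "t \<in> \<Gamma>"
  shows "(\<lambda>x. vadd E (s x) (t x)) \<in> \<Gamma>"
proof (rule sectionI)
  show "vadd E (s x) (t x) \<in> fibre E x" for x using assms sectionD(1) fibre_closed by blast
  fix U \<Phi> assume U: "(U, \<Phi>) \<in> trivs E"
  have "msmooth_on (atlas E) U (\<lambda>x. \<Phi> (s x) + \<Phi> (t x))"
    using assms U by (intro msmooth_on_add triv(1) sectionD)
  then show "msmooth_on (atlas E) U (\<lambda>x. \<Phi> (vadd E (s x) (t x)))"
    by (rule msmooth_on_cong[OF triv(1)[OF U], rotated]) (use triv(3)[OF U] assms sectionD(1) in blast)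
qed

lemma sec_scale_section:
  assumes "f \<in> C" "s \<in> \<Gamma>"
  shows "(\<lambda>x. vscale E (f x) (s x)) \<in> \<Gamma>"
proof (rule sectionI)
  show "vscale E (f x) (s x) \<in> fibre E x" for x using assms sectionD(1) fibre_closed by blast
  fix U \<Phi> assume U: "(U, \<Phi>) \<in> trivs E"
  have "msmooth_on (atlas E) U (\<lambda>x. f x *\<^sub>R \<Phi> (s x))"
    using assms U by (intro msmooth_on_scaleR triv(1) sectionD C_infD)
  then show "msmooth_on (atlas E) U (\<lambda>x. \<Phi> (vscale E (f x) (s x)))"
    by (rule msmooth_on_cong[OF triv(1)[OF U], rotated]) (use triv(4)[OF U] assms sectionD(1) in blast)
qed

text \<open>The constant section k of the trivialisation, damped by \<kappa> and continued by zero
  to a global section; \<open>local_cosec\<close> is its counterpart for functionals.\<close>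

definition local_sec :: "'m set \<Rightarrow> ('e \<Rightarrow> 'k) \<Rightarrow> ('m \<Rightarrow> real) \<Rightarrow> 'k \<Rightarrow> 'm \<Rightarrow> 'e" where
  "local_sec U \<Phi> \<kappa> k x = (if x \<in> U then triv_inv E \<Phi> x (\<kappa> x *\<^sub>R k) else zero_sec x)"

definition local_cosec :: "'m set \<Rightarrow> ('e \<Rightarrow> 'k) \<Rightarrow> ('m \<Rightarrow> real) \<Rightarrow> ('k \<Rightarrow> real) \<Rightarrow> 'm \<Rightarrow> 'e \<Rightarrow> real" where
  "local_cosec U \<Phi> \<kappa> l x u = (if x \<in> U \<and> u \<in> fibre E x then \<kappa> x * l (\<Phi> u) else 0)"

text \<open>In another trivialisation over V, smoothness is checked on the two open pieces of V: on
  U it is the smooth change of trivialisation times \<kappa>, on Z the section is 0.\<close>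

lemma local_sec_section:
  assumes U: "(U, \<Phi>) \<in> trivs E" and \<kappa>: "\<kappa> \<in> C" and Z: "open Z" "Z \<union> U = UNIV" "\<And>y. y \<in> Z \<Longrightarrow> \<kappa> y = 0"
  shows "local_sec U \<Phi> \<kappa> k \<in> \<Gamma>"
proof (rule sectionI)
  show "local_sec U \<Phi> \<kappa> k x \<in> fibre E x" for x
    using triv_inv_in[OF U] zero_sec_in by (simp add: local_sec_def)
  fix V \<Psi> assume V: "(V, \<Psi>) \<in> trivs E"
  have eq: "\<Psi> (local_sec U \<Phi> \<kappa> k x) = \<kappa> x *\<^sub>R \<Psi> (triv_inv E \<Phi> x k)" if "x \<in> U \<inter> V" for x
    using triv_inv_scale[OF U, of x "\<kappa> x" k] triv(4)[OF V _ triv_inv_in[OF U]] that by (simp add: local_sec_def)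
  have o: "open (U \<inter> V)" using triv(1)[OF U] triv(1)[OF V] by (rule open_Int)
  have "msmooth_on (atlas E) (U \<inter> V) (\<lambda>x. \<kappa> x *\<^sub>R \<Psi> (triv_inv E \<Phi> x k))"
    by (rule msmooth_on_scaleR[OF o C_infD[OF \<kappa>] triv_change[OF U V]])
  then have 1: "msmooth_on (atlas E) (U \<inter> V) (\<lambda>x. \<Psi> (local_sec U \<Phi> \<kappa> k x))"
    by (rule msmooth_on_cong[OF o, rotated]) (rule eq)
  have "\<Psi> (local_sec U \<Phi> \<kappa> k x) = 0" if "x \<in> Z \<inter> V" for x
  proof (cases "x \<in> U")
    case True
    then show ?thesis
      using triv_inv_scale[OF U, of x 0 k] triv(4)[OF V, of x "triv_inv E \<Phi> x k" 0] triv_inv_in[OF U True] that Z(3)[of x]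
      by (simp add: local_sec_def)
  next
    case False
    then show ?thesis using triv_zero_sec[OF V] that by (simp add: local_sec_def)
  qed
  then have 2: "msmooth_on (atlas E) (Z \<inter> V) (\<lambda>x. \<Psi> (local_sec U \<Phi> \<kappa> k x))"
    using Z(1) triv(1)[OF V] by (intro msmooth_on_cong[OF _ _ msmooth_on_const[of _ 0]]) auto
  have "(U \<inter> V) \<union> (Z \<inter> V) = V" using Z(2) by auto
  then show "msmooth_on (atlas E) V (\<lambda>x. \<Psi> (local_sec U \<Phi> \<kappa> k x))"
    using msmooth_on_Un[OF _ _ 1 2] triv(1)[OF U] triv(1)[OF V] Z(1) by (simp add: open_Int)
qed

lemma local_sec_eq: "x \<in> U \<Longrightarrow> \<kappa> x = 1 \<Longrightarrow> local_sec U \<Phi> \<kappa> k x = triv_inv E \<Phi> x k"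
  by (simp add: local_sec_def)

abbreviation "\<Gamma>d \<equiv> dual_sections C (fibre E) (vadd E) (vscale E) \<Gamma>"

lemma dual_fibre_eq: "dual_fibre E x = dual_of (fibre E x) (vadd E) (vscale E)"
  by (simp add: dual_fibre_def dual_of_def linear_fun_def)

lemma local_cosec_section:
  assumes U: "(U, \<Phi>) \<in> trivs E" and \<kappa>: "\<kappa> \<in> C" and Z: "open Z" "Z \<union> U = UNIV" "\<And>y. y \<in> Z \<Longrightarrow> \<kappa> y = 0"
    and l: "linear l"
  shows "local_cosec U \<Phi> \<kappa> l \<in> \<Gamma>d"
  unfolding dual_sections_def mem_Collect_eq
proof (intro conjI allI ballI)
  show "local_cosec U \<Phi> \<kappa> l x \<in> dual_of (fibre E x) (vadd E) (vscale E)" for x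
    unfolding dual_of_def mem_Collect_eq
    using triv(3,4)[OF U] linear_add[OF l] linear_scale[OF l] fibre_closed
    by (cases "x \<in> U") (auto simp: local_cosec_def linear_fun_def algebra_simps)
  fix s assume s: "s \<in> \<Gamma>"
  have "msmooth_on (atlas E) U (\<lambda>x. \<Sum>i<length basis. (dv i \<bullet> \<Phi> (s x)) * l (bv i))"
    by (intro msmooth_on_sum msmooth_on_mult msmooth_on_inner msmooth_on_const triv(1)[OF U] sectionD(2)[OF s U])
  from msmooth_on_mult[OF triv(1)[OF U] C_infD[OF \<kappa>] this]
  have 1: "msmooth_on (atlas E) U (\<lambda>x. local_cosec U \<Phi> \<kappa> l x (s x))"
  proof (rule msmooth_on_cong[OF triv(1)[OF U], rotated])
    show "local_cosec U \<Phi> \<kappa> l x (s x) = \<kappa> x * (\<Sum>i<length basis. (dv i \<bullet> \<Phi> (s x)) * l (bv i))"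
      if "x \<in> U" for x
      unfolding linear_basis[OF l, symmetric] using that sectionD(1)[OF s] by (simp add: local_cosec_def)
  qed
  have 2: "msmooth_on (atlas E) Z (\<lambda>x. local_cosec U \<Phi> \<kappa> l x (s x))"
    by (rule msmooth_on_cong[OF Z(1) _ msmooth_on_const[of _ 0]]) (use Z(3) in \<open>auto simp: local_cosec_def\<close>)
  show "(\<lambda>x. local_cosec U \<Phi> \<kappa> l x (s x)) \<in> C"
    using msmooth_on_Un[OF triv(1)[OF U] Z(1) 1 2] Z(2) by (simp add: C_inf_def Un_commute)
qed

lemma local_cosec_eq: "x \<in> U \<Longrightarrow> \<kappa> x = 1 \<Longrightarrow> local_cosec U \<Phi> \<kappa> l x = triv_dual E \<Phi> x l"
  by (auto simp: local_cosec_def triv_dual_def)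

lemma tensor_bundle: "tensor_bundle C (fibre E) (vadd E) (vscale E) \<Gamma> \<Gamma>d"
proof
  show "(\<lambda>x. a) \<in> C" for a by (simp add: C_inf_def msmooth_on_const)
  show "f + g \<in> C" if "f \<in> C" "g \<in> C" for f g
    using msmooth_on_add[OF open_UNIV, of f g] that by (simp add: C_inf_def plus_fun_def)
  show mult: "f * g \<in> C" if "f \<in> C" "g \<in> C" for f g
    using msmooth_on_mult[OF open_UNIV, of f g] that by (simp add: C_inf_def times_fun_def)
  show "f \<in> C" if loc: "\<And>x. \<exists>W g. open W \<and> x \<in> W \<and> g \<in> C \<and> (\<forall>y\<in>W. f y = g y)" for f
  proof -
    have "msmooth_on (atlas E) UNIV f"
    proof (rule msmooth_on_local)
      fix x
      obtain W g where W: "open W" "x \<in> W" "g \<in> C" "\<And>y. y \<in> W \<Longrightarrow> f y = g y" using loc[of x] by blast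
      have "msmooth_on (atlas E) W f" by (rule msmooth_on_cong[OF W(1,4) C_infD[OF W(3)]])
      then show "\<exists>T. open T \<and> x \<in> T \<and> msmooth_on (atlas E) (UNIV \<inter> T) f" using W by auto
    qed simp
    then show ?thesis by (simp add: C_inf_def)
  qed
  show "u = v" if "u \<in> fibre E x" "v \<in> fibre E x"
    "\<And>\<phi>. linear_fun (fibre E x) (vadd E) (vscale E) \<phi> \<Longrightarrow> \<phi> u = \<phi> v" for u v x
  proof -
    obtain U \<Phi> where U: "(U, \<Phi>) \<in> trivs E" "x \<in> U" using triv_exists by blast
    have "k \<bullet> \<Phi> u = k \<bullet> \<Phi> v" for k
      by (rule that(3)) (use triv(3,4)[OF U] in \<open>auto simp: linear_fun_def inner_add_right\<close>)
    then have "\<Phi> u = \<Phi> v" by (metis inner_commute vector_eq_ldot)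
    then show ?thesis by (rule triv_inj[OF U that(1,2)])
  qed
  fix x
  obtain U \<Phi> where U: "(U, \<Phi>) \<in> trivs E" "x \<in> U" using triv_exists by blast
  obtain \<kappa> W Z where b: "\<kappa> \<in> C" "open W" "x \<in> W" "\<And>y. y \<in> W \<Longrightarrow> \<kappa> y = 1"
    "open Z" "Z \<union> U = UNIV" "\<And>y. y \<in> Z \<Longrightarrow> \<kappa> y = 0"
    using bump[OF triv(1)[OF U(1)] U(2)] by blast
  show "\<exists>h\<in>C. \<exists>W (n::nat) e c. open W \<and> x \<in> W \<and> (\<forall>y\<in>W. h y = 1) \<and> (\<forall>i<n. e i \<in> \<Gamma> \<and> c i \<in> \<Gamma>d) \<and>
      (\<forall>y. \<forall>v\<in>fibre E y. \<forall>\<phi>. linear_fun (fibre E y) (vadd E) (vscale E) \<phi> \<longrightarrow>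
        h y * \<phi> v = (\<Sum>i<n. c i y v * \<phi> (e i y)))"
  \<comment> \<open>The sections and the functionals each carry one factor \<kappa>, so their
    expansion reproduces vectors up to \<kappa>^2, which is also 1 on W.\<close>
  proof (rule bexI[of _ "\<kappa> * \<kappa>"], rule exI[of _ W], rule exI[of _ "length basis"],
      rule exI[of _ "\<lambda>i. local_sec U \<Phi> \<kappa> (bv i)"],
      rule exI[of _ "\<lambda>i. local_cosec U \<Phi> \<kappa> (\<lambda>k. dv i \<bullet> k)"], intro conjI allI impI ballI)
    fix y v \<phi> assume v: "v \<in> fibre E y" and \<phi>: "linear_fun (fibre E y) (vadd E) (vscale E) \<phi>"
    show "(\<kappa> * \<kappa>) y * \<phi> v =
        (\<Sum>i<length basis. local_cosec U \<Phi> \<kappa> (\<lambda>k. dv i \<bullet> k) y v * \<phi> (local_sec U \<Phi> \<kappa> (bv i) y))"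
    proof (cases "y \<in> U")
      case True
      have "\<phi> (local_sec U \<Phi> \<kappa> (bv i) y) = \<kappa> y * \<phi> (triv_inv E \<Phi> y (bv i))" for i
        using True linear_fun_scl[OF \<phi> triv_inv_in[OF U(1) True]] triv_inv_scale[OF U(1) True]
        by (simp add: local_sec_def)
      then show ?thesis
        using True v linear_fun_triv[OF U(1) True \<phi> v]
        by (simp add: local_cosec_def sum_distrib_left algebra_simps)
    next
      case False
      then have "\<kappa> y = 0" using b(6,7) by blast
      then show ?thesis using False by (simp add: local_cosec_def)
    qed
  next
    show "local_sec U \<Phi> \<kappa> (bv i) \<in> \<Gamma>" for i by (rule local_sec_section[OF U(1) b(1,5-7)])
    show "local_cosec U \<Phi> \<kappa> (\<lambda>k. dv i \<bullet> k) \<in> \<Gamma>d" for i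
      by (rule local_cosec_section[OF U(1) b(1,5-7)]) (auto intro: linearI simp: inner_add_right)
  qed (use b mult in auto)
qed (use fibre_closed sectionD(1) zero_sec_section sec_add_section sec_scale_section in auto)

end

sublocale smooth_bundle \<subseteq> bundle_pair "C_inf (atlas E)" "fibre E" "vadd E" "vscale E" "smooth_sections E"
  "dual_sections (C_inf (atlas E)) (fibre E) (vadd E) (vscale E) (smooth_sections E)"
  by (intro bundle_pair.intro tensor_bundle)

context smooth_bundle
begin

section \<open>Forms and multivectors as tensor fields\<close>

definition extends :: "'m set \<Rightarrow> ('e \<Rightarrow> 'k) \<Rightarrow> 'm \<Rightarrow> 'm set \<Rightarrow> ('m \<Rightarrow> real) \<Rightarrow> bool" where
  "extends U \<Phi> x W \<kappa> \<longleftrightarrow> open W \<and> x \<in> W \<and> W \<subseteq> U \<and> (\<forall>k. local_sec U \<Phi> \<kappa> k \<in> \<Gamma>) \<and>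
    (\<forall>l. linear l \<longrightarrow> local_cosec U \<Phi> \<kappa> l \<in> \<Gamma>d) \<and>
    (\<forall>y\<in>W. (\<forall>k. local_sec U \<Phi> \<kappa> k y = triv_inv E \<Phi> y k) \<and>
      (\<forall>l. local_cosec U \<Phi> \<kappa> l y = triv_dual E \<Phi> y l))"

lemma extendsD:
  assumes "extends U \<Phi> x W \<kappa>"
  shows "open W" "x \<in> W" "W \<subseteq> U" "local_sec U \<Phi> \<kappa> k \<in> \<Gamma>"
    "linear l \<Longrightarrow> local_cosec U \<Phi> \<kappa> l \<in> \<Gamma>d"
    "y \<in> W \<Longrightarrow> local_sec U \<Phi> \<kappa> k y = triv_inv E \<Phi> y k"
    "y \<in> W \<Longrightarrow> local_cosec U \<Phi> \<kappa> l y = triv_dual E \<Phi> y l"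
  using assms by (simp_all add: extends_def)

lemma extends_exists:
  assumes "(U, \<Phi>) \<in> trivs E" "x \<in> U"
  shows "\<exists>W \<kappa>. extends U \<Phi> x W \<kappa>"
proof -
  obtain \<kappa> W Z where b: "\<kappa> \<in> C" "open W" "x \<in> W" "\<And>y. y \<in> W \<Longrightarrow> \<kappa> y = 1"
    "open Z" "Z \<union> U = UNIV" "\<And>y. y \<in> Z \<Longrightarrow> \<kappa> y = 0"
    using bump[OF triv(1)[OF assms(1)] assms(2)] by blast
  have "extends U \<Phi> x (W \<inter> U) \<kappa>"
    unfolding extends_def
    using local_sec_section[OF assms(1) b(1,5-7)] local_cosec_section[OF assms(1) b(1,5-7)]
      b(2-4) triv(1)[OF assms(1)] assms(2)
    by (simp add: open_Int local_sec_eq local_cosec_eq)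
  then show ?thesis by blast
qed

lemma msmooth_on_cover:
  assumes "\<And>U \<Phi>. (U, \<Phi>) \<in> trivs E \<Longrightarrow> msmooth_on (atlas E) U f"
  shows "f \<in> C"
proof -
  have "msmooth_on (atlas E) UNIV f"
  proof (rule msmooth_on_local)
    fix x
    obtain U \<Phi> where "(U, \<Phi>) \<in> trivs E" "x \<in> U" using triv_exists by blast
    then show "\<exists>T. open T \<and> x \<in> T \<and> msmooth_on (atlas E) (UNIV \<inter> T) f"
      using assms[of U \<Phi>] triv(1)[of U \<Phi>] by (intro exI[of _ U]) simp
  qed simp
  then show ?thesis by (simp add: C_inf_def)
qed

text \<open>From trivialisations to global sections, each argument is expanded in constant sections
  with smooth coefficients. Conversely, near a point constant sections coincide with their global
  continuations \<open>local_sec\<close>.\<close>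

lemma forms_eq_tensors: "forms E = tensors"
proof (intro subset_antisym subsetI)
  fix \<eta> assume \<eta>: "\<eta> \<in> forms E"
  have sk: "skew_multilinear (fibre E x) (vadd E) (vscale E) (\<eta> x)" for x
    using \<eta> by (simp add: forms_def)
  \<comment> \<open>The expanded arguments gather in \<open>ks\<close>; with \<open>Vs\<close> empty
    this is the smoothness contained in \<open>forms\<close>.\<close>
  have sm: "msmooth_on (atlas E) U (\<lambda>x. \<eta> x (map (triv_inv E \<Phi> x) ks @ map (\<lambda>V. V x) Vs))"
    if U: "(U, \<Phi>) \<in> trivs E" and Vs: "Vs \<in> lists \<Gamma>" for U \<Phi> ks Vs
    using Vs
  proof (induction Vs arbitrary: ks rule: list.induct)
    case Nil
    then show ?case using \<eta> U by (auto simp: forms_def)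
  next
    case (Cons V Vs)
    then have V: "V \<in> \<Gamma>" "Vs \<in> lists \<Gamma>" by auto
    have "msmooth_on (atlas E) U (\<lambda>x. \<Sum>i<length basis. (dv i \<bullet> \<Phi> (V x)) *
        \<eta> x (map (triv_inv E \<Phi> x) (ks @ [bv i]) @ map (\<lambda>V. V x) Vs))"
    proof (intro msmooth_on_sum msmooth_on_mult msmooth_on_inner msmooth_on_const
        triv(1)[OF U] sectionD(2)[OF V(1) U])
      show "msmooth_on (atlas E) U (\<lambda>x. \<eta> x (map (triv_inv E \<Phi> x) (ks @ [bv i]) @ map (\<lambda>V. V x) Vs))" for i
        by (rule Cons.IH[OF V(2)])
    qed
    then show ?case
    proof (rule msmooth_on_cong[OF triv(1)[OF U], rotated])
      fix x assume x: "x \<in> U"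
      have "linear_fun (fibre E x) (vadd E) (vscale E)
          (\<lambda>v. \<eta> x (map (triv_inv E \<Phi> x) ks @ v # map (\<lambda>V. V x) Vs))"
        by (rule skew_multilinear_linear[OF sk]) (use V(2) sectionD(1) triv_inv_in[OF U x] in auto)
      from linear_fun_triv[OF U x this sectionD(1)[OF V(1)]]
      show "\<eta> x (map (triv_inv E \<Phi> x) ks @ map (\<lambda>V. V x) (V # Vs)) =
          (\<Sum>i<length basis. (dv i \<bullet> \<Phi> (V x)) * \<eta> x (map (triv_inv E \<Phi> x) (ks @ [bv i]) @ map (\<lambda>V. V x) Vs))"
        by simp
    qed
  qed
  obtain N where N: "\<forall>x vs. N < length vs \<longrightarrow> \<eta> x vs = 0" using \<eta> by (auto simp: forms_def)
  show "\<eta> \<in> tensors"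
  proof (rule tensorI[OF sk])
    show "N < length vs \<Longrightarrow> \<eta> x vs = 0" for x vs using N by blast
    show "eval_form \<eta> Vs \<in> C" if "Vs \<in> lists \<Gamma>" for Vs
      using sm[of _ _ Vs "[]"] that by (intro msmooth_on_cover) (simp add: eval_form_def)
  qed
next
  fix \<eta> assume \<eta>: "\<eta> \<in> tensors"
  have "msmooth_on (atlas E) U (\<lambda>x. \<eta> x (map (triv_inv E \<Phi> x) ks))" if U: "(U, \<Phi>) \<in> trivs E" for U \<Phi> ks
  proof (rule msmooth_on_local[OF triv(1)[OF U]])
    fix x assume "x \<in> U"
    then obtain W \<kappa> where "extends U \<Phi> x W \<kappa>" using extends_exists[OF U] by blast
  note W = extendsD[OF this]
    have "eval_form \<eta> (map (local_sec U \<Phi> \<kappa>) ks) \<in> C" by (rule tensor_eval[OF \<eta>]) (use W(4) in auto)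
    then have "msmooth_on (atlas E) W (eval_form \<eta> (map (local_sec U \<Phi> \<kappa>) ks))" by (rule C_infD)
    then have "msmooth_on (atlas E) W (\<lambda>x. \<eta> x (map (triv_inv E \<Phi> x) ks))"
      by (rule msmooth_on_cong[OF W(1), rotated]) (use W(6) in \<open>simp add: eval_form_def o_def\<close>)
    then show "\<exists>T. open T \<and> x \<in> T \<and> msmooth_on (atlas E) (U \<inter> T) (\<lambda>x. \<eta> x (map (triv_inv E \<Phi> x) ks))"
      using W(1-3) by (metis inf.absorb_iff2)
  qed
  then show "\<eta> \<in> forms E" using tensor_skew[OF \<eta>] tensor_bound[OF \<eta>] by (auto simp: forms_def)
qed

lemma dual_add_eq: "dual_add = (+)"
  by (simp add: fun_eq_iff dual_add_def)

lemma cosection_triv: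
  assumes "(U, \<Phi>) \<in> trivs E" "\<alpha> \<in> \<Gamma>d"
  shows "msmooth_on (atlas E) U (\<lambda>x. \<alpha> x (triv_inv E \<Phi> x k))"
proof (rule msmooth_on_local[OF triv(1)[OF assms(1)]])
  fix x assume "x \<in> U"
  then obtain W \<kappa> where "extends U \<Phi> x W \<kappa>" using extends_exists[OF assms(1)] by blast
  note W = extendsD[OF this]
  have "(\<lambda>x. \<alpha> x (local_sec U \<Phi> \<kappa> k x)) \<in> C" using assms(2) W(4) by (simp add: dual_sections_def)
  then have "msmooth_on (atlas E) W (\<lambda>x. \<alpha> x (local_sec U \<Phi> \<kappa> k x))" by (rule C_infD)
  then have "msmooth_on (atlas E) W (\<lambda>x. \<alpha> x (triv_inv E \<Phi> x k))"
    by (rule msmooth_on_cong[OF W(1), rotated]) (simp add: W(6))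
  then show "\<exists>T. open T \<and> x \<in> T \<and> msmooth_on (atlas E) (U \<inter> T) (\<lambda>x. \<alpha> x (triv_inv E \<Phi> x k))"
    using W(1-3) by (metis inf.absorb_iff2)
qed

lemma triv_dual_in:
  assumes "(U, \<Phi>) \<in> trivs E" "x \<in> U" "linear l"
  shows "triv_dual E \<Phi> x l \<in> dual_fibre E x"
  using triv(3,4)[OF assms(1,2)] fibre_closed
  by (auto simp: triv_dual_def dual_fibre_def linear_add[OF assms(3)] linear_scale[OF assms(3)])

text \<open>Parallel to forms, with \<open>dual_expansion\<close> for a section \<alpha> of the
  dual; its coefficients, the values of \<alpha> on constant sections, are smooth by
  \<open>cosection_triv\<close>.\<close>

lemma multivectors_eq_tensors: "multivectors E = multivecs"
proof (intro subset_antisym subsetI)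
  fix P assume P: "P \<in> multivectors E"
  have sk: "skew_multilinear (dual_of (fibre E x) (vadd E) (vscale E)) dual_add dual_scale (P x)" for x
    using P by (simp add: multivectors_def dual_fibre_eq dual_add_eq)
  have lin: "linear (\<lambda>k. dv i \<bullet> k)" for i by (auto intro: linearI simp: inner_add_right)
  have sm: "msmooth_on (atlas E) U (\<lambda>x. P x (map (triv_dual E \<Phi> x) ls @ map (\<lambda>\<alpha>. \<alpha> x) \<alpha>s))"
    if U: "(U, \<Phi>) \<in> trivs E" and "\<alpha>s \<in> lists \<Gamma>d" "\<forall>l\<in>set ls. linear l" for U \<Phi> ls \<alpha>s
    using that(2,3)
  proof (induction \<alpha>s arbitrary: ls rule: list.induct)
    case Nil
    then show ?case using P U by (auto simp: multivectors_def)
  next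
    case (Cons \<alpha> \<alpha>s)
    then have \<alpha>: "\<alpha> \<in> \<Gamma>d" "\<alpha>s \<in> lists \<Gamma>d" by auto
    have "msmooth_on (atlas E) U (\<lambda>x. \<Sum>i<length basis. \<alpha> x (triv_inv E \<Phi> x (bv i)) *
        P x (map (triv_dual E \<Phi> x) (ls @ [\<lambda>k. dv i \<bullet> k]) @ map (\<lambda>\<alpha>. \<alpha> x) \<alpha>s))"
    proof (intro msmooth_on_sum msmooth_on_mult triv(1)[OF U] cosection_triv[OF U \<alpha>(1)])
      show "msmooth_on (atlas E) U (\<lambda>x. P x (map (triv_dual E \<Phi> x) (ls @ [\<lambda>k. dv i \<bullet> k]) @ map (\<lambda>\<alpha>. \<alpha> x) \<alpha>s))" for i
        by (rule Cons.IH[OF \<alpha>(2)]) (use Cons.prems(2) lin in auto)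
    qed
    then show ?case
    proof (rule msmooth_on_cong[OF triv(1)[OF U], rotated])
      fix x assume x: "x \<in> U"
      let ?D = "dual_of (fibre E x) (vadd E) (vscale E)"
      have td: "triv_dual E \<Phi> x l \<in> ?D" if "linear l" for l
        using triv_dual_in[OF U x that] by (simp add: dual_fibre_eq)
      have \<alpha>x: "\<alpha> x \<in> ?D" using \<alpha>(1) by (simp add: dual_sections_def)
      have "linear_fun ?D dual_add dual_scale
          (\<lambda>\<beta>. P x (map (triv_dual E \<Phi> x) ls @ \<beta> # map (\<lambda>\<alpha>. \<alpha> x) \<alpha>s))"
        by (rule skew_multilinear_linear[OF sk]) (use \<alpha>(2) Cons.prems(2) td in \<open>auto simp: dual_sections_def\<close>)
      note lf = this
      have "1 * P x (map (triv_dual E \<Phi> x) ls @ \<alpha> x # map (\<lambda>\<alpha>. \<alpha> x) \<alpha>s) =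
          (\<Sum>i<length basis. \<alpha> x (triv_inv E \<Phi> x (bv i)) *
            P x (map (triv_dual E \<Phi> x) ls @ triv_dual E \<Phi> x (\<lambda>k. dv i \<bullet> k) # map (\<lambda>\<alpha>. \<alpha> x) \<alpha>s))"
      proof (rule dual_expansion[OF td[OF lin] _ \<alpha>x lf])
        show "1 * \<alpha> x v = (\<Sum>i<length basis. triv_dual E \<Phi> x (\<lambda>k. dv i \<bullet> k) v * \<alpha> x (triv_inv E \<Phi> x (bv i)))"
          if "v \<in> fibre E x" for v
          using linear_fun_triv[OF U x _ that, of "\<alpha> x"] \<alpha>x that by (simp add: triv_dual_def dual_of_def)
      qed
      then show "P x (map (triv_dual E \<Phi> x) ls @ map (\<lambda>\<alpha>. \<alpha> x) (\<alpha> # \<alpha>s)) =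
          (\<Sum>i<length basis. \<alpha> x (triv_inv E \<Phi> x (bv i)) *
            P x (map (triv_dual E \<Phi> x) (ls @ [\<lambda>k. dv i \<bullet> k]) @ map (\<lambda>\<alpha>. \<alpha> x) \<alpha>s))"
        by simp
    qed
  qed
  obtain N where N: "\<forall>x \<alpha>s. N < length \<alpha>s \<longrightarrow> P x \<alpha>s = 0" using P by (auto simp: multivectors_def)
  show "P \<in> multivecs"
  proof (rule dual.tensorI[OF sk])
    show "N < length vs \<Longrightarrow> P x vs = 0" for x vs using N by blast
    show "eval_form P \<alpha>s \<in> C" if "\<alpha>s \<in> lists \<Gamma>d" for \<alpha>s
      using sm[of _ _ \<alpha>s "[]"] that by (intro msmooth_on_cover) (simp add: eval_form_def)
  qed
next
  fix P assume P: "P \<in> multivecs"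
  have "msmooth_on (atlas E) U (\<lambda>x. P x (map (triv_dual E \<Phi> x) ls))"
    if U: "(U, \<Phi>) \<in> trivs E" and ls: "\<forall>l\<in>set ls. linear l" for U \<Phi> ls
  proof (rule msmooth_on_local[OF triv(1)[OF U]])
    fix x assume "x \<in> U"
    then obtain W \<kappa> where "extends U \<Phi> x W \<kappa>" using extends_exists[OF U] by blast
  note W = extendsD[OF this]
    have "eval_form P (map (local_cosec U \<Phi> \<kappa>) ls) \<in> C" by (rule dual.tensor_eval[OF P]) (use W(5) ls in auto)
    then have "msmooth_on (atlas E) W (eval_form P (map (local_cosec U \<Phi> \<kappa>) ls))" by (rule C_infD)
    then have "msmooth_on (atlas E) W (\<lambda>x. P x (map (triv_dual E \<Phi> x) ls))"
      by (rule msmooth_on_cong[OF W(1), rotated]) (use W(7) in \<open>simp add: eval_form_def o_def\<close>)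
    then show "\<exists>T. open T \<and> x \<in> T \<and> msmooth_on (atlas E) (U \<inter> T) (\<lambda>x. P x (map (triv_dual E \<Phi> x) ls))"
      using W(1-3) by (metis inf.absorb_iff2)
  qed
  then show "P \<in> multivectors E"
    using dual.tensor_skew[OF P] dual.tensor_bound[OF P] by (auto simp: multivectors_def dual_fibre_eq dual_add_eq)
qed

lemma of_sec_eq: "of_sec E V = one_form (bidual V)"
  by (auto simp: fun_eq_iff of_sec_def one_form_def bidual_def eval_at_def dual_fibre_eq split: list.split)

lemma forms_deg_1: "forms_deg E 1 = one_form ` \<Gamma>d"
proof (intro subset_antisym subsetI)
  fix \<eta> assume "\<eta> \<in> forms_deg E 1"
  then have \<eta>: "\<eta> \<in> tensors" "\<eta> \<in> homogeneous 1" by (auto simp: forms_deg_def forms_eq_tensors)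
  have "\<eta> = one_form (\<lambda>x v. \<eta> x [v])"
    using \<eta>(2) by (auto simp: fun_eq_iff one_form_def homogeneous_def split: list.split)
  moreover from this have "(\<lambda>x v. \<eta> x [v]) \<in> \<Gamma>d" using \<eta>(1) one_form_dual_section by metis
  ultimately show "\<eta> \<in> one_form ` \<Gamma>d" by blast
next
  fix \<eta> assume "\<eta> \<in> one_form ` \<Gamma>d"
  then show "\<eta> \<in> forms_deg E 1"
    using tensor_one_form by (auto simp: forms_deg_def forms_eq_tensors homogeneous_def one_form_degree)
qed

end

section \<open>Uniqueness of the operators\<close>

context tensor_bundle
begin

lemma real_linear_on_eqI:
  assumes D: "real_linear_on tensors D" and D': "real_linear_on tensors D'"
    and eq: "\<And>p \<omega>. \<omega> \<in> tensors \<Longrightarrow> \<omega> \<in> homogeneous p \<Longrightarrow> D \<omega> = D' \<omega>"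
    and \<omega>: "\<omega> \<in> tensors"
  shows "D \<omega> = D' \<omega>"
proof -
  obtain N where N: "\<And>x vs. N < length vs \<Longrightarrow> \<omega> x vs = 0" using tensor_bound[OF \<omega>] by blast
  define t where "t k = (\<lambda>x vs. (if length vs < k then 1 else 0) * \<omega> x vs)" for k
  define c where "c k = (\<lambda>x vs. (if length vs = k then 1 else 0) * \<omega> x vs)" for k
  have tc: "t k \<in> tensors" "c k \<in> tensors" for k
    unfolding t_def c_def
    using tensor_degree_scale[OF \<omega>, of "\<lambda>n. if n < k then 1 else 0"]
      tensor_degree_scale[OF \<omega>, of "\<lambda>n. if n = k then 1 else 0"] by auto
  have "D (t k) = D' (t k)" for k
  proof (induction k)
    case 0
    show ?case by (rule eq[OF tc(1), of _ 0]) (simp add: t_def homogeneous_def)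
  next
    case (Suc k)
    have e: "t (Suc k) = t k + c k" by (auto simp: t_def c_def fun_eq_iff)
    have "D (c k) = D' (c k)" by (rule eq[OF tc(2), of _ k]) (simp add: c_def homogeneous_def)
    then show ?case using Suc D D' tc unfolding e real_linear_on_def by metis
  qed
  moreover have "t (Suc N) = \<omega>" using N by (auto simp: t_def fun_eq_iff)
  ultimately show ?thesis by metis
qed

lemma homogeneous_0: "\<omega> \<in> homogeneous 0 \<Longrightarrow> \<omega> = of_fun (eval_form \<omega> [])"
  by (auto simp: homogeneous_def of_fun_def eval_form_def fun_eq_iff)

lemma homogeneous_eqI:
  assumes "\<omega> \<in> tensors" "\<zeta> \<in> tensors" "\<omega> \<in> homogeneous p" "\<zeta> \<in> homogeneous p"
    and "\<And>Vs. Vs \<in> lists \<Gamma> \<Longrightarrow> length Vs = p \<Longrightarrow> eval_form \<omega> Vs = eval_form \<zeta> Vs"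
  shows "\<omega> = \<zeta>"
proof (rule tensor_eqI[OF assms(1,2)])
  fix Vs assume "Vs \<in> lists \<Gamma>"
  then show "eval_form \<omega> Vs = eval_form \<zeta> Vs"
    using assms(3-5) by (cases "length Vs = p") (auto simp: homogeneous_def eval_form_def)
qed

end

lemma of_fun_homogeneous: "of_fun f \<in> homogeneous 0"
  by (simp add: homogeneous_def of_fun_def)

lemma wedge_list_homogeneous: "wedge_list (map one_form \<alpha>s) \<in> homogeneous (length \<alpha>s)"
proof (induction \<alpha>s)
  case Nil
  show ?case by (simp add: wedge_list_simps of_fun_homogeneous)
next
  case (Cons \<alpha> \<alpha>s)
  have "wedge_at (one_form \<alpha> x) (wedge_list (map one_form \<alpha>s) x) vs = 0" if "length vs \<noteq> Suc (length \<alpha>s)" for x vs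
    using that Cons by (subst wedge_at_degree_1) (auto intro!: sum.neutral one_form_degree simp: homogeneous_def)
  then show ?case by (simp add: wedge_list_simps wedge_apply homogeneous_def)
qed

lemma one_scale: "(\<lambda>_. 1) \<odot> \<omega> = \<omega>" "1 \<odot> \<omega> = \<omega>" and zero_scale: "(\<lambda>_. 0) \<odot> \<omega> = 0"
  by (simp_all add: fun_scale_def fun_eq_iff)

lemma eval_wedge_list_eq_det_fun:
  assumes "length \<alpha>s = length Vs" "\<And>\<alpha>. \<alpha> \<in> set \<alpha>s \<Longrightarrow> skew_multilinear F add scl (one_form \<alpha> x)"
  shows "eval_form (wedge_list (map one_form \<alpha>s)) Vs x =
    det_fun (length Vs) (\<lambda>i j. (map one_form \<alpha>s ! i) x [(Vs ! j) x])"
proof -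
  let ?gs = "map (\<lambda>\<alpha>. one_form \<alpha> x) \<alpha>s" and ?vs = "map (\<lambda>V. V x) Vs"
  have "eval_form (wedge_list (map one_form \<alpha>s)) Vs x = foldr wedge_at ?gs (of_fun 1 x) ?vs"
    by (simp add: eval_form_def wedge_list_at o_def)
  also have "\<dots> = det_on {0..<0 + length ?vs} (\<lambda>i j. (?gs ! (i - 0)) [?vs ! (j - 0)])"
  proof (rule foldr_wedge_at_eq_det[where F = F and add = add and scl = scl])
    show "length ?gs = length ?vs" using assms(1) by simp
    show "skew_multilinear F add scl g" if "g \<in> set ?gs" for g using that assms(2) by auto
    show "g us = 0" if "g \<in> set ?gs" "length us \<noteq> 1" for g us using that by (auto intro: one_form_degree)
    show "skew_multilinear F add scl (of_fun 1 x)" by (rule skew_multilinear_of_fun)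
    show "of_fun 1 x [] = 1" by (simp add: of_fun_def)
  qed
  also have "\<dots> = det_fun (length Vs) (\<lambda>i j. (map one_form \<alpha>s ! i) x [(Vs ! j) x])"
    unfolding det_on_def det_fun_def atLeast0LessThan
  proof (simp, intro sum.cong refl arg_cong2[of _ _ _ _ "(*)"] prod.cong)
    fix \<pi> i assume "\<pi> \<in> {\<pi>. \<pi> permutes {..<length Vs}}" "i \<in> {..<length Vs}"
    then have "i < length Vs" "\<pi> i < length Vs" using permutes_in_image by force+
    then show "(map (\<lambda>\<alpha>. one_form \<alpha> x) \<alpha>s ! i) [map (\<lambda>V. V x) Vs ! \<pi> i] = (map one_form \<alpha>s ! i) x [(Vs ! \<pi> i) x]"
      using assms(1) by simp
  qed
  finally show ?thesis .
qed

context smooth_bundle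
begin

lemma lists_of_sec: "map (of_sec E) Vs = map (\<lambda>V. one_form (bidual V)) Vs"
  by (simp add: of_sec_eq)

lemma lists_forms_deg_1:
  assumes "\<eta>s \<in> lists (forms_deg E 1)"
  obtains \<alpha>s where "\<alpha>s \<in> lists \<Gamma>d" "\<eta>s = map one_form \<alpha>s"
  using assms unfolding forms_deg_1 lists_image by blast

lemma pair_wedge_lists:
  assumes "\<alpha>s \<in> lists \<Gamma>d" "Vs \<in> lists \<Gamma>" "length \<alpha>s = length Vs"
  shows "pair (wedge_list (map one_form \<alpha>s)) (wedge_list (map (of_sec E) Vs)) =
    (\<lambda>x. det_fun (length Vs) (\<lambda>i j. (map one_form \<alpha>s ! i) x [(Vs ! j) x]))"
proof -
  have t: "one_form \<alpha> \<in> tensors" if "\<alpha> \<in> set \<alpha>s" for \<alpha>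
    using that assms(1) tensor_one_form by auto
  have "pair (wedge_list (map one_form \<alpha>s)) (wedge_list (map (of_sec E) Vs)) =
      eval_form (wedge_list (map one_form \<alpha>s)) Vs"
    unfolding lists_of_sec by (rule pair_wedge_list[OF assms(2)]) (use t in \<open>auto intro!: wedge_list_tensor\<close>)
  also have "\<dots> = (\<lambda>x. det_fun (length Vs) (\<lambda>i j. (map one_form \<alpha>s ! i) x [(Vs ! j) x]))"
    by (intro ext eval_wedge_list_eq_det_fun[OF assms(3), where F = "fibre E _"]) (rule tensor_skew[OF t])
  finally show ?thesis .
qed

lemma dual_wedge_list_cases:
  assumes "vs \<in> lists (bidual ` \<Gamma>)"
  obtains Vs where "Vs \<in> lists \<Gamma>" "map one_form vs = map (of_sec E) Vs"
proof -
  have "vs \<in> map bidual ` lists \<Gamma>" using assms by (simp only: lists_image)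
  then obtain Vs where "Vs \<in> lists \<Gamma>" "vs = map bidual Vs" by blast
  then show ?thesis by (intro that[of Vs]) (simp_all add: of_sec_eq)
qed

text \<open>\<open>pair\<close> satisfies the description. For uniqueness
  \<open>tensor_vanishing\<close> is used twice: against a fixed product of sections it reduces the
  form to products of one-forms, then against a fixed form its dual version reduces the multivector
  to products of sections.\<close>

lemma pairing_eq:
  assumes "\<eta> \<in> tensors" "P \<in> multivecs"
  shows "pairing E \<eta> P = pair \<eta> P"
proof -
  define Q where "Q \<beta> \<longleftrightarrow> \<beta> \<in> forms E \<rightarrow>\<^sub>E (multivectors E \<rightarrow>\<^sub>E C_inf (atlas E)) \<and>
     (\<forall>\<eta>\<in>forms E. \<forall>\<zeta>\<in>forms E. \<forall>f\<in>C_inf (atlas E). \<forall>g\<in>C_inf (atlas E).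
        \<forall>P\<in>multivectors E. \<beta> (f \<odot> \<eta> + g \<odot> \<zeta>) P = f * \<beta> \<eta> P + g * \<beta> \<zeta> P) \<and>
     (\<forall>P\<in>multivectors E. \<forall>Q\<in>multivectors E. \<forall>f\<in>C_inf (atlas E). \<forall>g\<in>C_inf (atlas E).
        \<forall>\<eta>\<in>forms E. \<beta> \<eta> (f \<odot> P + g \<odot> Q) = f * \<beta> \<eta> P + g * \<beta> \<eta> Q) \<and>
     (\<forall>p q. p \<noteq> q \<longrightarrow> (\<forall>\<eta>\<in>forms_deg E p. \<forall>P\<in>multivectors_deg E q. \<beta> \<eta> P = 0)) \<and>
     (\<forall>f\<in>C_inf (atlas E). \<forall>g\<in>C_inf (atlas E). \<beta> (of_fun f) (of_fun g) = f * g) \<and>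
     (\<forall>\<eta>s\<in>lists (forms_deg E 1). \<forall>Vs\<in>lists (smooth_sections E).
        length \<eta>s = length Vs \<and> Vs \<noteq> [] \<longrightarrow>
        \<beta> (wedge_list \<eta>s) (wedge_list (map (of_sec E) Vs)) =
          (\<lambda>x. det_fun (length Vs) (\<lambda>i j. (\<eta>s ! i) x [(Vs ! j) x])))" for \<beta>
  have def: "pairing E = (THE \<beta>. Q \<beta>)" unfolding pairing_def Q_def ..
  let ?b = "\<lambda>\<eta>\<in>tensors. \<lambda>P\<in>multivecs. pair \<eta> P"
  have sec_in: "wedge_list (map (of_sec E) Vs) \<in> multivecs" if "Vs \<in> lists \<Gamma>" for Vs
    unfolding lists_of_sec by (rule bidual_wedge_in[OF that])
  have form_in: "wedge_list (map one_form \<alpha>s) \<in> tensors" if "\<alpha>s \<in> lists \<Gamma>d" for \<alpha>s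
    by (rule wedge_list_one_form_tensor[OF that])
  have "Q ?b"
    unfolding Q_def forms_eq_tensors multivectors_eq_tensors forms_deg_def multivectors_deg_def
  proof (intro conjI ballI allI impI)
    show "?b \<in> tensors \<rightarrow>\<^sub>E (multivecs \<rightarrow>\<^sub>E C)" using pair_in by auto
    show "?b (f \<odot> \<eta> + g \<odot> \<zeta>) P = f * ?b \<eta> P + g * ?b \<zeta> P"
      if "\<eta> \<in> tensors" "\<zeta> \<in> tensors" "f \<in> C" "g \<in> C" "P \<in> multivecs" for \<eta> \<zeta> f g P
      using that by (simp add: pair_add_left pair_scale_left tensor_add tensor_scale)
    show "?b \<eta> (f \<odot> P + g \<odot> Q) = f * ?b \<eta> P + g * ?b \<eta> Q"
      if "P \<in> multivecs" "Q \<in> multivecs" "f \<in> C" "g \<in> C" "\<eta> \<in> tensors" for \<eta> P f g Q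
      using that by (simp add: pair_add_right pair_scale_right dual.tensor_add dual.tensor_scale)
    show "?b \<eta> P = 0" if "p \<noteq> q" "\<eta> \<in> tensors \<inter> homogeneous p" "P \<in> multivecs \<inter> homogeneous q" for p q \<eta> P
      using that pair_degrees[of \<eta> P p q] by simp
    show "?b (of_fun f) (of_fun g) = f * g" if "f \<in> C" "g \<in> C" for f g
      using that by (simp add: tensor_of_fun dual.tensor_of_fun pair_of_fun)
        (simp add: eval_form_def of_fun_def fun_eq_iff)
    fix \<eta>s Vs assume "\<eta>s \<in> lists (tensors \<inter> homogeneous 1)" and Vs: "Vs \<in> lists \<Gamma>" and l: "length \<eta>s = length Vs \<and> Vs \<noteq> []"
    then have "\<eta>s \<in> lists (forms_deg E 1)" by (simp add: forms_deg_def forms_eq_tensors)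
    then obtain \<alpha>s where \<alpha>s: "\<alpha>s \<in> lists \<Gamma>d" "\<eta>s = map one_form \<alpha>s" by (rule lists_forms_deg_1)
    show "?b (wedge_list \<eta>s) (wedge_list (map (of_sec E) Vs)) =
        (\<lambda>x. det_fun (length Vs) (\<lambda>i j. (\<eta>s ! i) x [(Vs ! j) x]))"
      using pair_wedge_lists[OF \<alpha>s(1) Vs] l sec_in[OF Vs] form_in[OF \<alpha>s(1)] by (simp add: \<alpha>s(2))
  qed
  moreover have eq: "\<beta> \<eta> P = pair \<eta> P" if "Q \<beta>" "\<eta> \<in> tensors" "P \<in> multivecs" for \<beta> \<eta> P
  proof -
    note q = \<open>Q \<beta>\<close>[unfolded Q_def forms_eq_tensors multivectors_eq_tensors forms_deg_def multivectors_deg_def]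
    from q have q1: "\<beta> (f \<odot> \<eta> + g \<odot> \<zeta>) P = f * \<beta> \<eta> P + g * \<beta> \<zeta> P"
      if "\<eta> \<in> tensors" "\<zeta> \<in> tensors" "f \<in> C" "g \<in> C" "P \<in> multivecs" for \<eta> \<zeta> f g P
      using that by (elim conjE) (simp only:)
    from q have q2: "\<beta> \<eta> (f \<odot> P + g \<odot> Q) = f * \<beta> \<eta> P + g * \<beta> \<eta> Q"
      if "P \<in> multivecs" "Q \<in> multivecs" "f \<in> C" "g \<in> C" "\<eta> \<in> tensors" for \<eta> P f g Q
      using that by (elim conjE) (simp only:)
    from q have q3: "\<forall>p q. p \<noteq> q \<longrightarrow> (\<forall>\<eta>\<in>tensors \<inter> homogeneous p. \<forall>P\<in>multivecs \<inter> homogeneous q. \<beta> \<eta> P = 0)"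
      by (elim conjE)
    from q have q4: "\<beta> (of_fun f) (of_fun g) = f * g" if "f \<in> C" "g \<in> C" for f g
      using that by (elim conjE) (simp only:)
    from \<open>Q \<beta>\<close> have q5: "\<forall>\<eta>s\<in>lists (forms_deg E 1). \<forall>Vs\<in>lists \<Gamma>. length \<eta>s = length Vs \<and> Vs \<noteq> [] \<longrightarrow>
        \<beta> (wedge_list \<eta>s) (wedge_list (map (of_sec E) Vs)) =
          (\<lambda>x. det_fun (length Vs) (\<lambda>i j. (\<eta>s ! i) x [(Vs ! j) x]))"
      unfolding Q_def by (elim conjE)
    have one: "(\<lambda>_. 1) \<in> C" and zero: "(\<lambda>_. 0) \<in> C" by (rule C_const)+
    have add_l: "\<beta> (\<eta> + \<zeta>) P = \<beta> \<eta> P + \<beta> \<zeta> P" if "\<eta> \<in> tensors" "\<zeta> \<in> tensors" "P \<in> multivecs" for \<eta> \<zeta> P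
      using q1[OF that(1,2) one one that(3)] by (simp add: one_scale fun_eq_iff)
    have scale_l: "\<beta> (f \<odot> \<eta>) P = f * \<beta> \<eta> P" if "f \<in> C" "\<eta> \<in> tensors" "P \<in> multivecs" for f \<eta> P
      using q1[OF that(2,2) that(1) zero that(3)] by (simp add: zero_scale fun_eq_iff)
    have add_r: "\<beta> \<eta> (P + Q) = \<beta> \<eta> P + \<beta> \<eta> Q" if "\<eta> \<in> tensors" "P \<in> multivecs" "Q \<in> multivecs" for \<eta> P Q
      using q2[OF that(2,3) one one that(1)] by (simp add: one_scale fun_eq_iff)
    have scale_r: "\<beta> \<eta> (f \<odot> P) = f * \<beta> \<eta> P" if "f \<in> C" "\<eta> \<in> tensors" "P \<in> multivecs" for f \<eta> P
      using q2[OF that(3,3) that(1) zero that(2)] by (simp add: zero_scale fun_eq_iff)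
    have w: "\<beta> \<eta> (wedge_list (map (of_sec E) Vs)) - pair \<eta> (wedge_list (map (of_sec E) Vs)) = 0"
      if Vs: "Vs \<in> lists \<Gamma>" and \<eta>: "\<eta> \<in> tensors" for Vs \<eta>
    proof (rule tensor_vanishing[of "\<lambda>\<eta>. \<beta> \<eta> (wedge_list (map (of_sec E) Vs)) - pair \<eta> (wedge_list (map (of_sec E) Vs))", OF _ _ _ \<eta>])
      let ?W = "wedge_list (map (of_sec E) Vs)"
      note W = sec_in[OF Vs]
      show "\<beta> (\<omega> + \<zeta>) ?W - pair (\<omega> + \<zeta>) ?W = (\<beta> \<omega> ?W - pair \<omega> ?W) + (\<beta> \<zeta> ?W - pair \<zeta> ?W)"
        if "\<omega> \<in> tensors" "\<zeta> \<in> tensors" for \<omega> \<zeta>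
        using that W by (simp add: add_l pair_add_left)
      show "\<beta> (f \<odot> \<omega>) ?W - pair (f \<odot> \<omega>) ?W = f * (\<beta> \<omega> ?W - pair \<omega> ?W)" if "f \<in> C" "\<omega> \<in> tensors" for f \<omega>
        using that W by (simp add: scale_l pair_scale_left algebra_simps)
      show "\<beta> (wedge_list (map one_form \<alpha>s)) ?W - pair (wedge_list (map one_form \<alpha>s)) ?W = 0"
        if \<alpha>s: "\<alpha>s \<in> lists \<Gamma>d" for \<alpha>s
      proof -
        note A = form_in[OF \<alpha>s]
        have "map one_form \<alpha>s \<in> lists (forms_deg E 1)" using \<alpha>s unfolding forms_deg_1 lists_image by blast
        then have det: "\<beta> (wedge_list (map one_form \<alpha>s)) ?W =
            (\<lambda>x. det_fun (length Vs) (\<lambda>i j. (map one_form \<alpha>s ! i) x [(Vs ! j) x]))"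
          if "length \<alpha>s = length Vs" "Vs \<noteq> []"
          using q5 Vs that by simp
        \<comment> \<open>The determinant rule covers nonempty lists of equal length. Different
          lengths fall under orthogonality of degrees, and two empty lists under the rule for
          functions, both products being the constant 1.\<close>
        consider "length \<alpha>s \<noteq> length Vs" | "\<alpha>s = []" "Vs = []" | "length \<alpha>s = length Vs" "Vs \<noteq> []" by force
        then show ?thesis
        proof cases
          case 1
          have hW: "?W \<in> homogeneous (length Vs)"
            using wedge_list_homogeneous[of "map bidual Vs"] by (simp add: lists_of_sec o_def)
          have "\<beta> (wedge_list (map one_form \<alpha>s)) ?W = 0"
            using q3 1 A W wedge_list_homogeneous[of \<alpha>s] hW by blast
          then show ?thesis
            using pair_degrees[OF A W wedge_list_homogeneous hW 1] by simp
        next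
          case 2
          then show ?thesis
            using q4[OF one one] by (simp add: wedge_list_simps one_fun_def[symmetric] pair_of_fun tensor_of_fun[OF one, folded one_fun_def])
              (simp add: eval_form_def of_fun_def fun_eq_iff)
        next
          case 3
          then show ?thesis using det pair_wedge_lists[OF \<alpha>s Vs] by simp
        qed
      qed
    qed
    have "\<beta> \<eta> P - pair \<eta> P = 0"
    proof (rule dual.tensor_vanishing[of "\<lambda>P. \<beta> \<eta> P - pair \<eta> P", OF _ _ _ that(3)])
      show "\<beta> \<eta> (P + Q) - pair \<eta> (P + Q) = (\<beta> \<eta> P - pair \<eta> P) + (\<beta> \<eta> Q - pair \<eta> Q)"
        if "P \<in> multivecs" "Q \<in> multivecs" for P Q
        using that \<open>\<eta> \<in> tensors\<close> by (simp add: add_r pair_add_right)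
      show "\<beta> \<eta> (f \<odot> P) - pair \<eta> (f \<odot> P) = f * (\<beta> \<eta> P - pair \<eta> P)" if "f \<in> C" "P \<in> multivecs" for f P
        using that \<open>\<eta> \<in> tensors\<close> by (simp add: scale_r pair_scale_right algebra_simps)
      show "\<beta> \<eta> (wedge_list (map one_form vs)) - pair \<eta> (wedge_list (map one_form vs)) = 0"
        if vs: "vs \<in> lists (bidual ` \<Gamma>)" for vs
      proof -
        obtain Vs where Vs: "Vs \<in> lists \<Gamma>" "map one_form vs = map (of_sec E) Vs"
          by (rule dual_wedge_list_cases[OF vs])
        show ?thesis unfolding Vs(2) by (rule w[OF Vs(1) \<open>\<eta> \<in> tensors\<close>])
      qed
    qed
    then show ?thesis by simp
  qed
  \<comment> \<open>A definite description requires equality of total functions: off forms and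
    multivectors the extensional function spaces fix the value, so \<open>PiE_ext\<close> applies in
    both arguments.\<close>
  ultimately have "Q (pairing E)"
  proof (subst def, intro theI[of Q ?b])
    fix \<beta> assume \<beta>: "Q \<beta>"
    then have "\<beta> \<in> tensors \<rightarrow>\<^sub>E (multivecs \<rightarrow>\<^sub>E C)"
      unfolding Q_def forms_eq_tensors multivectors_eq_tensors by (elim conjE)
    moreover have "?b \<in> tensors \<rightarrow>\<^sub>E (multivecs \<rightarrow>\<^sub>E C)" using pair_in by auto
    ultimately show "\<beta> = ?b"
    proof (rule PiE_ext)
      fix \<eta> assume \<eta>: "\<eta> \<in> tensors"
      have "\<beta> \<eta> \<in> multivecs \<rightarrow>\<^sub>E C" "?b \<eta> \<in> multivecs \<rightarrow>\<^sub>E C"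
        using \<eta> \<open>\<beta> \<in> _\<close> pair_in by auto
      then show "\<beta> \<eta> = ?b \<eta>"
        by (rule PiE_ext) (use eq[OF \<beta> \<eta>] \<eta> in simp)
    qed
  qed
  from eq[OF this assms] show ?thesis .
qed

text \<open>The description fixes the operator on products of sections for every form, so one
  reduction in the multivector suffices. It is made for the evaluation of the difference on fixed
  sections.\<close>

lemma interior_mv_eq:
  assumes "\<eta> \<in> tensors" "P \<in> multivecs"
  shows "interior_mv E P \<eta> = inter P \<eta>"
proof -
  define Q where "Q \<iota> \<longleftrightarrow> \<iota> \<in> multivectors E \<rightarrow>\<^sub>E (forms E \<rightarrow>\<^sub>E forms E) \<and>
     (\<forall>P\<in>multivectors E. \<forall>Q\<in>multivectors E. \<forall>f\<in>C_inf (atlas E). \<forall>g\<in>C_inf (atlas E).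
        \<forall>\<eta>\<in>forms E. \<iota> (f \<odot> P + g \<odot> Q) \<eta> = f \<odot> \<iota> P \<eta> + g \<odot> \<iota> Q \<eta>) \<and>
     (\<forall>f\<in>C_inf (atlas E). \<forall>\<eta>\<in>forms E. \<iota> (of_fun f) \<eta> = f \<odot> \<eta>) \<and>
     (\<forall>Vs\<in>lists (smooth_sections E). Vs \<noteq> [] \<longrightarrow> (\<forall>\<eta>\<in>forms E.
        \<iota> (wedge_list (map (of_sec E) Vs)) \<eta> = foldr interior_sec Vs \<eta>))" for \<iota>
  have def: "interior_mv E = (THE \<iota>. Q \<iota>)" unfolding interior_mv_def Q_def ..
  let ?i = "\<lambda>P\<in>multivecs. \<lambda>\<eta>\<in>tensors. inter P \<eta>"
  have sec_in: "wedge_list (map (of_sec E) Vs) \<in> multivecs" if "Vs \<in> lists \<Gamma>" for Vs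
    unfolding lists_of_sec by (rule bidual_wedge_in[OF that])
  have wedge: "inter (wedge_list (map (of_sec E) Vs)) \<eta> = foldr interior_sec Vs \<eta>"
    if "Vs \<in> lists \<Gamma>" "\<eta> \<in> tensors" for Vs \<eta>
    unfolding lists_of_sec by (rule inter_wedge_list[OF that])
  have "Q ?i"
    unfolding Q_def forms_eq_tensors multivectors_eq_tensors
  proof (intro conjI ballI allI impI)
    show "?i \<in> multivecs \<rightarrow>\<^sub>E (tensors \<rightarrow>\<^sub>E tensors)" using inter_tensor by auto
    show "?i (f \<odot> P + g \<odot> Q) \<eta> = f \<odot> ?i P \<eta> + g \<odot> ?i Q \<eta>"
      if "P \<in> multivecs" "Q \<in> multivecs" "f \<in> C" "g \<in> C" "\<eta> \<in> tensors" for \<eta> P f g Q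
      using that by (simp add: inter_add_left inter_scale_left dual.tensor_add dual.tensor_scale)
    show "?i (of_fun f) \<eta> = f \<odot> \<eta>" if "f \<in> C" "\<eta> \<in> tensors" for f \<eta>
      using that by (simp add: dual.tensor_of_fun inter_of_fun)
    show "?i (wedge_list (map (of_sec E) Vs)) \<eta> = foldr interior_sec Vs \<eta>"
      if "Vs \<in> lists \<Gamma>" "\<eta> \<in> tensors" for Vs \<eta>
      using that sec_in wedge by simp
  qed
  moreover have eq: "\<iota> P \<eta> = inter P \<eta>" if "Q \<iota>" "\<eta> \<in> tensors" "P \<in> multivecs" for \<iota> \<eta> P
  proof -
    note q = \<open>Q \<iota>\<close>[unfolded Q_def forms_eq_tensors multivectors_eq_tensors]
    from q have q0: "\<iota> \<in> multivecs \<rightarrow>\<^sub>E (tensors \<rightarrow>\<^sub>E tensors)" by (elim conjE)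
    from q have q2: "\<iota> (f \<odot> P + g \<odot> Q) \<eta> = f \<odot> \<iota> P \<eta> + g \<odot> \<iota> Q \<eta>"
      if "P \<in> multivecs" "Q \<in> multivecs" "f \<in> C" "g \<in> C" for P f g Q
      using that \<open>\<eta> \<in> tensors\<close> by (elim conjE) (simp only:)
    from q have q4: "\<iota> (of_fun f) \<eta> = f \<odot> \<eta>" if "f \<in> C" for f
      using that \<open>\<eta> \<in> tensors\<close> by (elim conjE) (simp only:)
    from q have q5: "\<forall>Vs\<in>lists \<Gamma>. Vs \<noteq> [] \<longrightarrow> (\<forall>\<eta>\<in>tensors.
        \<iota> (wedge_list (map (of_sec E) Vs)) \<eta> = foldr interior_sec Vs \<eta>)"
      by (elim conjE)
    have one: "(\<lambda>_. 1) \<in> C" and zero: "(\<lambda>_. 0) \<in> C" by (rule C_const)+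
    have add: "\<iota> (P + Q) \<eta> = \<iota> P \<eta> + \<iota> Q \<eta>" if "P \<in> multivecs" "Q \<in> multivecs" for P Q
      using q2[OF that one one] by (simp add: one_scale)
    have scale: "\<iota> (f \<odot> P) \<eta> = f \<odot> \<iota> P \<eta>" if "f \<in> C" "P \<in> multivecs" for f P
      using q2[OF that(2,2) that(1) zero] by (simp add: zero_scale)
    show ?thesis
    proof (rule tensor_eqI)
      show "\<iota> P \<eta> \<in> tensors" by (rule PiE_mem[OF PiE_mem[OF q0 that(3)] that(2)])
      show "inter P \<eta> \<in> tensors" by (rule inter_tensor[OF that(3,2)])
      fix Us assume "Us \<in> lists \<Gamma>"
      have "eval_form (\<iota> P \<eta> - inter P \<eta>) Us = 0"
      proof (rule dual.tensor_vanishing[of "\<lambda>P. eval_form (\<iota> P \<eta> - inter P \<eta>) Us", OF _ _ _ that(3)])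
        show "eval_form (\<iota> (P + Q) \<eta> - inter (P + Q) \<eta>) Us =
            eval_form (\<iota> P \<eta> - inter P \<eta>) Us + eval_form (\<iota> Q \<eta> - inter Q \<eta>) Us"
          if "P \<in> multivecs" "Q \<in> multivecs" for P Q
          using that \<open>\<eta> \<in> tensors\<close> by (simp add: add inter_add_left)
        show "eval_form (\<iota> (f \<odot> P) \<eta> - inter (f \<odot> P) \<eta>) Us = f * eval_form (\<iota> P \<eta> - inter P \<eta>) Us"
          if "f \<in> C" "P \<in> multivecs" for f P
          using that \<open>\<eta> \<in> tensors\<close> by (simp add: scale inter_scale_left algebra_simps)
        show "eval_form (\<iota> (wedge_list (map one_form vs)) \<eta> - inter (wedge_list (map one_form vs)) \<eta>) Us = 0"
          if vs: "vs \<in> lists (bidual ` \<Gamma>)" for vs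
        proof -
          obtain Vs where Vs: "Vs \<in> lists \<Gamma>" "map one_form vs = map (of_sec E) Vs"
            by (rule dual_wedge_list_cases[OF vs])
          have "\<iota> (wedge_list (map (of_sec E) Vs)) \<eta> = foldr interior_sec Vs \<eta>"
          \<comment> \<open>The empty product is the constant function 1, which the description
            treats under functions.\<close>
          proof (cases "Vs = []")
            case True
            then show ?thesis using q4[OF one] by (simp add: wedge_list_simps one_fun_def one_scale)
          next
            case False
            then show ?thesis using q5 Vs(1) \<open>\<eta> \<in> tensors\<close> by simp
          qed
          then show ?thesis
            unfolding Vs(2) using wedge[OF Vs(1) \<open>\<eta> \<in> tensors\<close>] by (simp add: eval_form_def fun_eq_iff)
        qed
      qed
      then show "eval_form (\<iota> P \<eta>) Us = eval_form (inter P \<eta>) Us" by simp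
    qed
  qed
  ultimately have "Q (interior_mv E)"
  proof (subst def, intro theI[of Q ?i])
    fix \<iota> assume \<iota>: "Q \<iota>"
    then have "\<iota> \<in> multivecs \<rightarrow>\<^sub>E (tensors \<rightarrow>\<^sub>E tensors)"
      unfolding Q_def forms_eq_tensors multivectors_eq_tensors by (elim conjE)
    moreover have "?i \<in> multivecs \<rightarrow>\<^sub>E (tensors \<rightarrow>\<^sub>E tensors)" using inter_tensor by auto
    ultimately show "\<iota> = ?i"
    proof (rule PiE_ext)
      fix P assume P: "P \<in> multivecs"
      have "\<iota> P \<in> tensors \<rightarrow>\<^sub>E tensors" "?i P \<in> tensors \<rightarrow>\<^sub>E tensors"
        using P \<open>\<iota> \<in> _\<close> inter_tensor by auto
      then show "\<iota> P = ?i P"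
        by (rule PiE_ext) (use eq[OF \<iota> _ P] P in simp)
    qed
  qed
  from eq[OF this assms] show ?thesis .
qed

end

section \<open>Lie algebroids\<close>

locale algebroid =
  fixes L :: "('m::{t2_space,second_countable_topology}, 'b::real_inner, 'e, 'k::real_inner) lie_algebroid_data"
  assumes lie_algebroid: "lie_algebroid L"

sublocale algebroid \<subseteq> smooth_bundle L
  using lie_algebroid by unfold_locales (simp add: lie_algebroid_def)

context algebroid
begin

lemma anchor_props:
  shows anchor_tangent: "anchor L e \<in> tangent_space (atlas L) (proj L e)"
    and anchor_linear: "linear_fun (fibre L x) (vadd L) (vscale L) (\<lambda>u. anchor L u f)"
    and anchor_smooth: "(U, \<Phi>) \<in> trivs L \<Longrightarrow> g \<in> C \<Longrightarrow> msmooth_on (atlas L) U (\<lambda>x. anchor L (triv_inv L \<Phi> x k) g)"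
proof -
  have a: "smooth_anchor L" using lie_algebroid by (simp add: lie_algebroid_def)
  show "anchor L e \<in> tangent_space (atlas L) (proj L e)" using a by (simp add: smooth_anchor_def)
  have "\<forall>x. \<forall>u\<in>fibre L x. \<forall>v\<in>fibre L x. \<forall>a f.
        anchor L (vadd L u v) f = anchor L u f + anchor L v f \<and> anchor L (vscale L a u) f = a * anchor L u f"
    using a unfolding smooth_anchor_def by (elim conjE)
  then show "linear_fun (fibre L x) (vadd L) (vscale L) (\<lambda>u. anchor L u f)"
    unfolding linear_fun_def by blast
  have "\<forall>(U, \<Phi>)\<in>trivs L. \<forall>k. \<forall>f\<in>C. msmooth_on (atlas L) U (\<lambda>x. anchor L (triv_inv L \<Phi> x k) f)"
    using a unfolding smooth_anchor_def by (elim conjE)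
  from bspec[OF this] show "(U, \<Phi>) \<in> trivs L \<Longrightarrow> g \<in> C \<Longrightarrow> msmooth_on (atlas L) U (\<lambda>x. anchor L (triv_inv L \<Phi> x k) g)"
    by auto
qed

lemma bracket_props:
  assumes "s \<in> \<Gamma>" "t \<in> \<Gamma>"
  shows bracket_in: "bracket L s t \<in> \<Gamma>"
    and bracket_skew: "bracket L s t = (\<lambda>x. vscale L (-1) (bracket L t s x))"
    and bracket_scale: "f \<in> C \<Longrightarrow> bracket L s (\<lambda>x. vscale L (f x) (t x)) =
      (\<lambda>x. vadd L (vscale L (f x) (bracket L s t x)) (vscale L (lie_fun L s f x) (t x)))"
    and anchor_bracket: "g \<in> C \<Longrightarrow> lie_fun L (bracket L s t) g =
      lie_fun L s (lie_fun L t g) - lie_fun L t (lie_fun L s g)"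
    and bracket_add_left: "u \<in> \<Gamma> \<Longrightarrow> bracket L (\<lambda>x. vadd L (s x) (t x)) u =
      (\<lambda>x. vadd L (bracket L s u x) (bracket L t u x))"
    and jacobi: "u \<in> \<Gamma> \<Longrightarrow> bracket L s (bracket L t u) =
      (\<lambda>x. vadd L (bracket L (bracket L s t) u x) (bracket L t (bracket L s u) x))"
proof -
  have b: "lie_bracket_on_sections L" using lie_algebroid by (simp add: lie_algebroid_def)
  have "\<forall>s\<in>\<Gamma>. \<forall>t\<in>\<Gamma>. bracket L s t \<in> \<Gamma> \<and> bracket L s t = sec_scale L (\<lambda>_. -1) (bracket L t s)"
    using b unfolding lie_bracket_on_sections_def by (elim conjE)
  then have "bracket L s t \<in> \<Gamma> \<and> bracket L s t = sec_scale L (\<lambda>_. -1) (bracket L t s)"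
    using assms by blast
  then show "bracket L s t \<in> \<Gamma>" and "bracket L s t = (\<lambda>x. vscale L (-1) (bracket L t s x))"
    unfolding sec_scale_def by blast+
  have "\<forall>s\<in>\<Gamma>. \<forall>t\<in>\<Gamma>. \<forall>f\<in>C. bracket L s (sec_scale L f t) =
          sec_add L (sec_scale L f (bracket L s t)) (sec_scale L (lie_fun L s f) t)"
    using lie_algebroid unfolding lie_algebroid_def by (elim conjE)
  then show "f \<in> C \<Longrightarrow> bracket L s (\<lambda>x. vscale L (f x) (t x)) =
      (\<lambda>x. vadd L (vscale L (f x) (bracket L s t x)) (vscale L (lie_fun L s f x) (t x)))"
    using assms by (simp add: sec_add_def sec_scale_def)
  have "\<forall>s\<in>\<Gamma>. \<forall>t\<in>\<Gamma>. anchor L \<circ> bracket L s t = vf_bracket (atlas L) (anchor L \<circ> s) (anchor L \<circ> t)"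
    using lie_algebroid unfolding lie_algebroid_def by (elim conjE)
  then have "anchor L \<circ> bracket L s t = vf_bracket (atlas L) (anchor L \<circ> s) (anchor L \<circ> t)"
    using assms by blast
  then have "anchor L (bracket L s t x) g = vf_bracket (atlas L) (anchor L \<circ> s) (anchor L \<circ> t) x g" for x g
    by (metis o_apply)
  then show "g \<in> C \<Longrightarrow> lie_fun L (bracket L s t) g =
      lie_fun L s (lie_fun L t g) - lie_fun L t (lie_fun L s g)"
    by (simp add: lie_fun_def vf_bracket_def fun_eq_iff)
  have "\<forall>s\<in>\<Gamma>. \<forall>t\<in>\<Gamma>. \<forall>u\<in>\<Gamma>. \<forall>a.
        bracket L (sec_add L s t) u = sec_add L (bracket L s u) (bracket L t u) \<and>
        bracket L (sec_scale L (\<lambda>_. a) s) u = sec_scale L (\<lambda>_. a) (bracket L s u) \<and>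
        bracket L s (bracket L t u) =
          sec_add L (bracket L (bracket L s t) u) (bracket L t (bracket L s u))"
    using b unfolding lie_bracket_on_sections_def by (elim conjE)
  then have *: "bracket L (sec_add L s t) u = sec_add L (bracket L s u) (bracket L t u)"
    "bracket L s (bracket L t u) = sec_add L (bracket L (bracket L s t) u) (bracket L t (bracket L s u))"
    if "u \<in> \<Gamma>" for u using assms that by blast+
  show "u \<in> \<Gamma> \<Longrightarrow> bracket L (\<lambda>x. vadd L (s x) (t x)) u = (\<lambda>x. vadd L (bracket L s u x) (bracket L t u x))"
    using *(1)[of u] by (simp add: sec_add_def)
  show "u \<in> \<Gamma> \<Longrightarrow> bracket L s (bracket L t u) =
      (\<lambda>x. vadd L (bracket L (bracket L s t) u x) (bracket L t (bracket L s u) x))"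
    using *(2)[of u] by (simp add: sec_add_def)
qed

text \<open>Vector identities in a fibre are verified in the typical fibre, through a
  trivialisation, which is linear and injective there.\<close>

lemma fibre_eqI:
  assumes "u \<in> fibre L x" "v \<in> fibre L x"
    and "\<And>\<Phi>. (\<And>u v. u \<in> fibre L x \<Longrightarrow> v \<in> fibre L x \<Longrightarrow> \<Phi> (vadd L u v) = \<Phi> u + \<Phi> v) \<Longrightarrow>
      (\<And>u a. u \<in> fibre L x \<Longrightarrow> \<Phi> (vscale L a u) = a *\<^sub>R \<Phi> u) \<Longrightarrow> \<Phi> u = (\<Phi> v :: 'k)"
  shows "u = v"
proof -
  obtain U \<Phi> where U: "(U, \<Phi>) \<in> trivs L" "x \<in> U" using triv_exists by blast
  show ?thesis
    by (rule triv_inj[OF U assms(1,2)]) (rule assms(3); use triv(3,4)[OF U] in blast)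
qed

lemma lie_fun_in:
  assumes "V \<in> \<Gamma>" "f \<in> C"
  shows "lie_fun L V f \<in> C"
proof (rule msmooth_on_cover)
  fix U \<Phi> assume U: "(U, \<Phi>) \<in> trivs L"
  have "msmooth_on (atlas L) U (\<lambda>x. \<Sum>i<length basis. (dv i \<bullet> \<Phi> (V x)) * anchor L (triv_inv L \<Phi> x (bv i)) f)"
    by (intro msmooth_on_sum msmooth_on_mult msmooth_on_inner msmooth_on_const triv(1)[OF U]
        sectionD(2)[OF assms(1) U] anchor_smooth[OF U assms(2)])
  then show "msmooth_on (atlas L) U (lie_fun L V f)"
  proof (rule msmooth_on_cong[OF triv(1)[OF U], rotated])
    show "lie_fun L V f x = (\<Sum>i<length basis. (dv i \<bullet> \<Phi> (V x)) * anchor L (triv_inv L \<Phi> x (bv i)) f)"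
      if "x \<in> U" for x
      unfolding lie_fun_def by (rule linear_fun_triv[OF U that anchor_linear sectionD(1)[OF assms(1)]])
  qed
qed

lemma anchor_section:
  assumes "V \<in> \<Gamma>"
  shows "anchor L (V x) \<in> tangent_space (atlas L) x"
  using anchor_tangent[of "V x"] sectionD(1)[OF assms, of x] by (simp add: fibre_def)

lemma lie_pair_section:
  assumes V: "V \<in> \<Gamma>"
  shows "lie_pair C (fibre L) (vadd L) (vscale L) \<Gamma> \<Gamma>d (lie_fun L V) (bracket L V)"
proof (intro lie_pair.intro lie_bundle.intro tensor_bundle lie_bundle_axioms.intro)
  show "lie_fun L V f \<in> C" if "f \<in> C" for f using V that by (rule lie_fun_in)
  have t: "(\<forall>f\<in>C. \<forall>g\<in>C. anchor L (V x) (f + g) = anchor L (V x) f + anchor L (V x) g) \<and>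
      (\<forall>f\<in>C. \<forall>a. anchor L (V x) (\<lambda>y. a * f y) = a * anchor L (V x) f) \<and>
      (\<forall>f\<in>C. \<forall>g\<in>C. anchor L (V x) (f * g) = f x * anchor L (V x) g + g x * anchor L (V x) f)" for x
    using anchor_section[OF V, of x] by (simp add: tangent_space_def)
  show "lie_fun L V (f + g) = lie_fun L V f + lie_fun L V g" if "f \<in> C" "g \<in> C" for f g
    using t that by (simp add: lie_fun_def fun_eq_iff)
  show "lie_fun L V (f * g) = f * lie_fun L V g + lie_fun L V f * g" if "f \<in> C" "g \<in> C" for f g
    using t that by (simp add: lie_fun_def fun_eq_iff)
  show "lie_fun L V (\<lambda>x. a * f x) = (\<lambda>x. a * lie_fun L V f x)" if "f \<in> C" for f a
    using t that by (simp add: lie_fun_def fun_eq_iff)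
  show "bracket L V s \<in> \<Gamma>" if "s \<in> \<Gamma>" for s using bracket_in[OF V that] .
  show "bracket L V (\<lambda>x. vscale L (f x) (s x)) =
      (\<lambda>x. vadd L (vscale L (f x) (bracket L V s x)) (vscale L (lie_fun L V f x) (s x)))"
    if "f \<in> C" "s \<in> \<Gamma>" for f s
    using bracket_scale[OF V that(2,1)] .
  show "bracket L V (\<lambda>x. vadd L (s x) (t x)) = (\<lambda>x. vadd L (bracket L V s x) (bracket L V t x))"
    if s: "s \<in> \<Gamma>" and t: "t \<in> \<Gamma>" for s t
  proof
    fix x
    have f: "bracket L s V x \<in> fibre L x" "bracket L t V x \<in> fibre L x"
      using bracket_in[OF s V] bracket_in[OF t V] sectionD(1) by blast+
    \<comment> \<open>The bracket is given as additive in its first argument; skew-symmetry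
      transfers this to the second.\<close>
    have "bracket L V (\<lambda>x. vadd L (s x) (t x)) x = vscale L (-1) (vadd L (bracket L s V x) (bracket L t V x))"
      using bracket_skew[OF V sec_add_section[OF s t]] bracket_add_left[OF s t V] by simp
    also have "\<dots> = vadd L (vscale L (-1) (bracket L s V x)) (vscale L (-1) (bracket L t V x))"
      by (rule fibre_eqI[of _ x]) (use f in \<open>auto simp: fibre_closed\<close>)
    also have "\<dots> = vadd L (bracket L V s x) (bracket L V t x)"
      by (simp flip: fun_cong[OF bracket_skew[OF V s]] fun_cong[OF bracket_skew[OF V t]])
    finally show "bracket L V (\<lambda>x. vadd L (s x) (t x)) x = vadd L (bracket L V s x) (bracket L V t x)" .
  qed
qed

abbreviation "lie_f V \<equiv> lie_bundle.lie_op (fibre L) \<Gamma> (lie_fun L V) (bracket L V)"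
abbreviation "lie_m V \<equiv> lie_bundle.lie_op (\<lambda>x. dual_of (fibre L x) (vadd L) (vscale L)) \<Gamma>d (lie_fun L V)
  (lie_bundle.dual_der (fibre L) \<Gamma> (lie_fun L V) (bracket L V))"

text \<open>The description fixes degree 0 by its values on functions and positive degrees by
  evaluation on sections; real linearity joins the components. Existence is
  \<open>lie_eval_eq\<close>.\<close>

lemma lie_form_eq:
  assumes V: "V \<in> \<Gamma>" and "\<eta> \<in> tensors"
  shows "lie_form L V \<eta> = lie_f V \<eta>"
proof -
  interpret V: lie_pair C "fibre L" "vadd L" "vscale L" \<Gamma> \<Gamma>d "lie_fun L V" "bracket L V"
    by (rule lie_pair_section[OF V])
  define Q where "Q D \<longleftrightarrow> D \<in> forms L \<rightarrow>\<^sub>E forms L \<and>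
     real_linear_on (forms L) D \<and>
     (\<forall>p. D ` forms_deg L p \<subseteq> forms_deg L p) \<and>
     (\<forall>f\<in>C_inf (atlas L). D (of_fun f) = of_fun (lie_fun L V f)) \<and>
     (\<forall>p>0. \<forall>\<eta>\<in>forms_deg L p. \<forall>Vs\<in>lists (smooth_sections L). length Vs = p \<longrightarrow>
        eval_form (D \<eta>) Vs = lie_fun L V (eval_form \<eta> Vs)
          - (\<Sum>i<p. eval_form \<eta> (Vs[i := bracket L V (Vs ! i)])))" for D
  have def: "lie_form L V = (THE D. Q D)" unfolding lie_form_def Q_def ..
  let ?D = "\<lambda>\<eta>\<in>tensors. lie_f V \<eta>"
  have QD: "Q ?D"
    unfolding Q_def forms_deg_def forms_eq_tensors
  proof (intro conjI allI ballI impI)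
    show "?D \<in> tensors \<rightarrow>\<^sub>E tensors" using V.lie_op_tensor by auto
    show "real_linear_on tensors ?D"
      unfolding real_linear_on_def
      by (auto simp: tensor_add tensor_scale C_const V.lie_op_add V.lie_op_scale)
        (simp add: fun_scale_def fun_eq_iff)
    show "?D ` (tensors \<inter> homogeneous p) \<subseteq> tensors \<inter> homogeneous p" for p
      using V.lie_op_tensor V.lie_op_homogeneous by auto
    show "?D (of_fun f) = of_fun (lie_fun L V f)" if "f \<in> C" for f
      using that by (simp add: tensor_of_fun V.lie_op_of_fun)
    show "eval_form (?D \<eta>) Vs = lie_fun L V (eval_form \<eta> Vs) - (\<Sum>i<p. eval_form \<eta> (Vs[i := bracket L V (Vs ! i)]))"
      if "0 < p" "\<eta> \<in> tensors \<inter> homogeneous p" "Vs \<in> lists \<Gamma>" "length Vs = p" for p \<eta> Vs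
      using that by (simp add: V.lie_op_eval V.lie_eval_eq)
  qed
  have eq: "D \<eta> = lie_f V \<eta>" if Q: "Q D" and \<eta>: "\<eta> \<in> tensors" for D \<eta>
  proof (rule real_linear_on_eqI[OF _ _ _ \<eta>])
    note q = Q[unfolded Q_def forms_deg_def forms_eq_tensors]
    from q show "real_linear_on tensors D" by (elim conjE)
    show "real_linear_on tensors (lie_f V)"
      unfolding real_linear_on_def
      by (auto simp: C_const V.lie_op_add V.lie_op_scale) (simp add: fun_scale_def fun_eq_iff)
    fix p \<omega> assume \<omega>: "\<omega> \<in> tensors" "\<omega> \<in> homogeneous p"
    show "D \<omega> = lie_f V \<omega>"
    proof (cases "p = 0")
      case True
      from q have "\<forall>f\<in>C. D (of_fun f) = of_fun (lie_fun L V f)" by (elim conjE)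
      moreover have "eval_form \<omega> [] \<in> C" using tensor_eval[OF \<omega>(1)] by simp
      moreover have "\<omega> = of_fun (eval_form \<omega> [])" using \<omega>(2) True homogeneous_0 by blast
      ultimately show ?thesis by (metis V.lie_op_of_fun)
    next
      case False
      from q have "D ` (tensors \<inter> homogeneous p) \<subseteq> tensors \<inter> homogeneous p" by (elim conjE) (rule spec)
      then have D: "D \<omega> \<in> tensors" "D \<omega> \<in> homogeneous p" using \<omega> by auto
      from q have "\<forall>p>0. \<forall>\<eta>\<in>tensors \<inter> homogeneous p. \<forall>Vs\<in>lists \<Gamma>. length Vs = p \<longrightarrow>
        eval_form (D \<eta>) Vs = lie_fun L V (eval_form \<eta> Vs)
          - (\<Sum>i<p. eval_form \<eta> (Vs[i := bracket L V (Vs ! i)]))" by (elim conjE)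
      then have "eval_form (D \<omega>) Vs = eval_form (lie_f V \<omega>) Vs" if "Vs \<in> lists \<Gamma>" "length Vs = p" for Vs
        using False \<omega> that by (simp add: V.lie_op_eval V.lie_eval_eq)
      then show ?thesis
        using D \<omega> by (intro homogeneous_eqI[of _ _ p] V.lie_op_tensor V.lie_op_homogeneous)
    qed
  qed
  have "Q (lie_form L V)"
  proof (subst def, rule theI[of Q, OF QD])
    fix D assume D: "Q D"
    then have "D \<in> tensors \<rightarrow>\<^sub>E tensors" unfolding Q_def forms_eq_tensors by (elim conjE)
    moreover have "?D \<in> tensors \<rightarrow>\<^sub>E tensors" using V.lie_op_tensor by auto
    ultimately show "D = ?D" by (rule PiE_ext) (use eq[OF D] in simp)
  qed
  from eq[OF this assms(2)] show ?thesis .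
qed

text \<open>In positive degree only the pairings of D P with forms are prescribed. Pairing with
  products of one-forms recovers the values of D P, by \<open>pair_wedge_list_left\<close>;
  existence is \<open>X_pair\<close>.\<close>

lemma lie_mv_eq:
  assumes V: "V \<in> \<Gamma>" and "P \<in> multivecs"
  shows "lie_mv L V P = lie_m V P"
proof -
  interpret V: lie_pair C "fibre L" "vadd L" "vscale L" \<Gamma> \<Gamma>d "lie_fun L V" "bracket L V"
    by (rule lie_pair_section[OF V])
  define Q where "Q D \<longleftrightarrow> D \<in> multivectors L \<rightarrow>\<^sub>E multivectors L \<and>
     real_linear_on (multivectors L) D \<and>
     (\<forall>p. D ` multivectors_deg L p \<subseteq> multivectors_deg L p) \<and>
     (\<forall>f\<in>C_inf (atlas L). D (of_fun f) = of_fun (lie_fun L V f)) \<and>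
     (\<forall>p>0. \<forall>P\<in>multivectors_deg L p. \<forall>\<eta>\<in>forms_deg L p.
        pairing L \<eta> (D P) = lie_fun L V (pairing L \<eta> P) - pairing L (lie_form L V \<eta>) P)" for D
  have def: "lie_mv L V = (THE D. Q D)" unfolding lie_mv_def Q_def ..
  let ?D = "\<lambda>P\<in>multivecs. lie_m V P"
  have lin: "real_linear_on multivecs (lie_m V)"
    unfolding real_linear_on_def
    by (auto simp: C_const V.dual.lie_op_add V.dual.lie_op_scale) (simp add: fun_scale_def fun_eq_iff)
  have lin': "real_linear_on multivecs ?D"
    using lin unfolding real_linear_on_def by (simp add: dual.tensor_add dual.tensor_scale C_const)
  have QD: "Q ?D"
    unfolding Q_def forms_deg_def multivectors_deg_def forms_eq_tensors multivectors_eq_tensors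
  proof (intro conjI allI ballI impI)
    show "?D \<in> multivecs \<rightarrow>\<^sub>E multivecs" using V.dual.lie_op_tensor by auto
    show "real_linear_on multivecs ?D" by (rule lin')
    show "?D ` (multivecs \<inter> homogeneous p) \<subseteq> multivecs \<inter> homogeneous p" for p
      using V.dual.lie_op_tensor V.dual.lie_op_homogeneous by auto
    show "?D (of_fun f) = of_fun (lie_fun L V f)" if "f \<in> C" for f
      using that by (simp add: dual.tensor_of_fun V.dual.lie_op_of_fun)
    show "pairing L \<eta> (?D P) = lie_fun L V (pairing L \<eta> P) - pairing L (lie_form L V \<eta>) P"
      if "0 < p" "P \<in> multivecs \<inter> homogeneous p" "\<eta> \<in> tensors \<inter> homogeneous p" for p P \<eta>
      using that V.X_pair[of \<eta> P]
      by (simp add: pairing_eq V.dual.lie_op_tensor lie_form_eq[OF V] V.lie_op_tensor)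
  qed
  have eq: "D P = lie_m V P" if Q: "Q D" and P: "P \<in> multivecs" for D P
  proof (rule dual.real_linear_on_eqI[OF _ lin _ P])
    note q = Q[unfolded Q_def forms_deg_def multivectors_deg_def forms_eq_tensors multivectors_eq_tensors]
    from q show "real_linear_on multivecs D" by (elim conjE)
    fix p P assume P: "P \<in> multivecs" "P \<in> homogeneous p"
    show "D P = lie_m V P"
    proof (cases "p = 0")
      case True
      from q have "\<forall>f\<in>C. D (of_fun f) = of_fun (lie_fun L V f)" by (elim conjE)
      moreover have "eval_form P [] \<in> C" using dual.tensor_eval[OF P(1)] by simp
      moreover have "P = of_fun (eval_form P [])" using P(2) True dual.homogeneous_0 by blast
      ultimately show ?thesis by (metis V.dual.lie_op_of_fun)
    next
      case False
      from q have "D ` (multivecs \<inter> homogeneous p) \<subseteq> multivecs \<inter> homogeneous p" by (elim conjE) (rule spec)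
      then have D: "D P \<in> multivecs" "D P \<in> homogeneous p" using P by auto
      from q have q: "\<forall>p>0. \<forall>P\<in>multivecs \<inter> homogeneous p. \<forall>\<eta>\<in>tensors \<inter> homogeneous p.
        pairing L \<eta> (D P) = lie_fun L V (pairing L \<eta> P) - pairing L (lie_form L V \<eta>) P" by (elim conjE)
      have "eval_form (D P) \<alpha>s = eval_form (lie_m V P) \<alpha>s" if \<alpha>s: "\<alpha>s \<in> lists \<Gamma>d" "length \<alpha>s = p" for \<alpha>s
      proof -
        let ?w = "wedge_list (map one_form \<alpha>s)"
        have w: "?w \<in> tensors" "?w \<in> homogeneous p"
          using wedge_list_one_form_tensor[OF \<alpha>s(1)] wedge_list_homogeneous[of \<alpha>s] \<alpha>s(2) by auto
        have "pairing L ?w (D P) = lie_fun L V (pairing L ?w P) - pairing L (lie_form L V ?w) P"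
          using q False P w by blast
        then have "pair ?w (D P) = lie_fun L V (pair ?w P) - pair (lie_f V ?w) P"
          using w D P by (simp add: pairing_eq lie_form_eq[OF V] V.lie_op_tensor)
        also have "\<dots> = pair ?w (lie_m V P)" using V.X_pair[OF w(1) P(1)] by simp
        finally show ?thesis
          using pair_wedge_list_left[OF \<alpha>s(1)] D(1) V.dual.lie_op_tensor[OF P(1)] by simp
      qed
      then show ?thesis
        using D P by (intro dual.homogeneous_eqI[of _ _ p] V.dual.lie_op_tensor V.dual.lie_op_homogeneous)
    qed
  qed
  have "Q (lie_mv L V)"
  proof (subst def, rule theI[of Q, OF QD])
    fix D assume D: "Q D"
    then have "D \<in> multivecs \<rightarrow>\<^sub>E multivecs" unfolding Q_def multivectors_eq_tensors by (elim conjE)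
    moreover have "?D \<in> multivecs \<rightarrow>\<^sub>E multivecs" using V.dual.lie_op_tensor by auto
    ultimately show "D = ?D" by (rule PiE_ext) (use eq[OF D] in simp)
  qed
  from eq[OF this assms(2)] show ?thesis .
qed

lemma of_sec_in: "W \<in> \<Gamma> \<Longrightarrow> of_sec L W \<in> multivecs"
  unfolding of_sec_eq by (intro dual.one_form_tensor) simp

lemma wedge_list_of_sec_in: "Vs \<in> lists \<Gamma> \<Longrightarrow> wedge_list (map (of_sec L) Vs) \<in> multivecs"
  unfolding lists_of_sec by (rule bidual_wedge_in)

lemma lie_m_of_sec:
  assumes V: "V \<in> \<Gamma>" and "W \<in> \<Gamma>"
  shows "lie_m V (of_sec L W) = of_sec L (bracket L V W)"
proof -
  interpret V: lie_pair C "fibre L" "vadd L" "vscale L" \<Gamma> \<Gamma>d "lie_fun L V" "bracket L V"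
    by (rule lie_pair_section[OF V])
  show ?thesis using V.lie_mv_one_form[OF assms(2)] by (simp only: of_sec_eq)
qed

lemma lie_m_wedge_list:
  assumes V: "V \<in> \<Gamma>" and "Vs \<in> lists \<Gamma>"
  shows "lie_m V (wedge_list (map (of_sec L) Vs)) =
    (\<Sum>i<length Vs. wedge_list (map (of_sec L) (Vs[i := bracket L V (Vs ! i)])))"
proof -
  interpret V: lie_pair C "fibre L" "vadd L" "vscale L" \<Gamma> \<Gamma>d "lie_fun L V" "bracket L V"
    by (rule lie_pair_section[OF V])
  show ?thesis using assms(2)
  proof (induction Vs rule: list.induct)
    case Nil
    have "lie_m V (of_fun 1) = of_fun 0"
      using V.dual.lie_op_of_fun[OF C_const[of 1]] by (simp add: one_fun_def)
    then show ?case by (simp add: wedge_list_simps of_fun_def fun_eq_iff)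
  next
    case (Cons W Vs)
    then have W: "W \<in> \<Gamma>" "Vs \<in> lists \<Gamma>" by auto
    have s: "P \<curlywedge> (\<Sum>i\<in>I. f i) = (\<Sum>i\<in>I. P \<curlywedge> f i)" for P :: "'m \<Rightarrow> ('e \<Rightarrow> real) list \<Rightarrow> real" and f and I :: "nat set"
    proof (induction I rule: infinite_finite_induct)
      case (insert i I)
      then show ?case by (simp only: sum.insert wedge_add_right not_False_eq_True)
    qed (simp_all add: wedge_def fun_eq_iff)
    have "lie_m V (of_sec L W \<curlywedge> wedge_list (map (of_sec L) Vs)) =
        of_sec L (bracket L V W) \<curlywedge> wedge_list (map (of_sec L) Vs) +
        of_sec L W \<curlywedge> lie_m V (wedge_list (map (of_sec L) Vs))"
      using V.dual.lie_op_wedge[OF of_sec_in[OF W(1)] wedge_list_of_sec_in[OF W(2)]]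
      by (simp only: lie_m_of_sec[OF V W(1)])
    also have "lie_m V (wedge_list (map (of_sec L) Vs)) =
        (\<Sum>i<length Vs. wedge_list (map (of_sec L) (Vs[i := bracket L V (Vs ! i)])))"
      by (rule Cons.IH[OF W(2)])
    also have "of_sec L (bracket L V W) \<curlywedge> wedge_list (map (of_sec L) Vs) +
        of_sec L W \<curlywedge> (\<Sum>i<length Vs. wedge_list (map (of_sec L) (Vs[i := bracket L V (Vs ! i)]))) =
        (\<Sum>i<length (W # Vs). wedge_list (map (of_sec L) ((W # Vs)[i := bracket L V ((W # Vs) ! i)])))"
      unfolding length_Cons sum.lessThan_Suc_shift by (simp add: wedge_list_simps s)
    finally show "lie_m V (wedge_list (map (of_sec L) (W # Vs))) =
        (\<Sum>i<length (W # Vs). wedge_list (map (of_sec L) ((W # Vs)[i := bracket L V ((W # Vs) ! i)])))"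
      by (simp only: list.map wedge_list_simps)
  qed
qed

text \<open>The commutator rule is used on two levels. For forms it follows from the Jacobi identity
  and the anchor; restricted to one-forms it is the commutator identity for \<open>dual_der\<close>,
  which is the hypothesis of the same rule on the dual bundle.\<close>

lemma lie_m_bracket:
  assumes V: "V \<in> \<Gamma>" and W: "W \<in> \<Gamma>" and "P \<in> multivecs"
  shows "lie_m (bracket L V W) P = lie_m V (lie_m W P) - lie_m W (lie_m V P)"
proof -
  interpret V: lie_pair C "fibre L" "vadd L" "vscale L" \<Gamma> \<Gamma>d "lie_fun L V" "bracket L V"
    by (rule lie_pair_section[OF V])
  interpret W: lie_pair C "fibre L" "vadd L" "vscale L" \<Gamma> \<Gamma>d "lie_fun L W" "bracket L W"
    by (rule lie_pair_section[OF W])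
  interpret VW: lie_pair C "fibre L" "vadd L" "vscale L" \<Gamma> \<Gamma>d "lie_fun L (bracket L V W)" "bracket L (bracket L V W)"
    by (rule lie_pair_section[OF bracket_in[OF V W]])
  have f: "lie_f (bracket L V W) \<omega> = lie_f V (lie_f W \<omega>) - lie_f W (lie_f V \<omega>)" if "\<omega> \<in> tensors" for \<omega>
    by (rule V.lie_op_commutator[OF W.lie_bundle_axioms VW.lie_bundle_axioms anchor_bracket[OF V W]
          jacobi[OF V W] that])
  show ?thesis
  proof (rule V.dual.lie_op_commutator[OF W.dual.lie_bundle_axioms VW.dual.lie_bundle_axioms
        anchor_bracket[OF V W] _ assms(3)])
    fix \<alpha> assume \<alpha>: "\<alpha> \<in> \<Gamma>d"
    show "V.dual_der (W.dual_der \<alpha>) = (\<lambda>x. dual_add (VW.dual_der \<alpha> x) (W.dual_der (V.dual_der \<alpha>) x))"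
    proof (intro ext)
      fix x v
      have "lie_f (bracket L V W) (one_form \<alpha>) = lie_f V (lie_f W (one_form \<alpha>)) - lie_f W (lie_f V (one_form \<alpha>))"
        by (rule f[OF tensor_one_form[OF \<alpha>]])
      then have "VW.dual_der \<alpha> x v =
          lie_f V (one_form (W.dual_der \<alpha>)) x [v] - lie_f W (one_form (V.dual_der \<alpha>)) x [v]"
        by (simp add: VW.dual_der_def V.lie_op_one_form[OF \<alpha>] W.lie_op_one_form[OF \<alpha>])
      then show "V.dual_der (W.dual_der \<alpha>) x v = dual_add (VW.dual_der \<alpha> x) (W.dual_der (V.dual_der \<alpha>) x) v"
        by (simp add: V.dual_der_def[of "W.dual_der \<alpha>"] W.dual_der_def[of "V.dual_der \<alpha>"] dual_add_apply)
    qed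
  qed
qed

section \<open>Lie derivatives along a section multiplied by a function\<close>

lemma d_rho_eq: "d_rho L f = one_form (\<lambda>x u. if u \<in> fibre L x then anchor L u f else 0)"
  by (auto simp: d_rho_def one_form_def fun_eq_iff split: list.split)

lemma d_rho_section:
  assumes "f \<in> C"
  shows "(\<lambda>x u. if u \<in> fibre L x then anchor L u f else 0) \<in> \<Gamma>d"
  unfolding dual_sections_def mem_Collect_eq
proof (intro conjI allI ballI)
  show "(\<lambda>u. if u \<in> fibre L x then anchor L u f else 0) \<in> dual_of (fibre L x) (vadd L) (vscale L)" for x
    using anchor_linear[of x f] fibre_closed by (auto simp: dual_of_def linear_fun_def)
  show "(\<lambda>x. if s x \<in> fibre L x then anchor L (s x) f else 0) \<in> C" if "s \<in> \<Gamma>" for s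
    using lie_fun_in[OF that assms] sectionD(1)[OF that] by (simp add: lie_fun_def)
qed

lemma lie_f_scaled:
  assumes V: "V \<in> \<Gamma>" and f: "f \<in> C" and \<eta>: "\<eta> \<in> tensors"
  shows "lie_f (sec_scale L f V) \<eta> = f \<odot> lie_f V \<eta> + d_rho L f \<curlywedge> interior_sec V \<eta>"
proof -
  interpret V: lie_pair C "fibre L" "vadd L" "vscale L" \<Gamma> \<Gamma>d "lie_fun L V" "bracket L V"
    by (rule lie_pair_section[OF V])
  have fV: "sec_scale L f V \<in> \<Gamma>" unfolding sec_scale_def by (rule sec_scale_section[OF f V])
  interpret fV: lie_pair C "fibre L" "vadd L" "vscale L" \<Gamma> \<Gamma>d "lie_fun L (sec_scale L f V)" "bracket L (sec_scale L f V)"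
    by (rule lie_pair_section[OF fV])
  show ?thesis
    unfolding d_rho_eq
  proof (rule V.lie_op_scaled[OF fV.lie_bundle_axioms _ _ V d_rho_section[OF f] f \<eta>])
    show "lie_fun L (sec_scale L f V) g = f * lie_fun L V g" for g
      using linear_fun_scl[OF anchor_linear sectionD(1)[OF V]]
      by (simp add: lie_fun_def sec_scale_def fun_eq_iff)
    fix s assume s: "s \<in> \<Gamma>"
    show "bracket L (sec_scale L f V) s = (\<lambda>x. vadd L (vscale L (f x) (bracket L V s x))
        (vscale L (- (if s x \<in> fibre L x then anchor L (s x) f else 0)) (V x)))"
    proof
      fix x
      have F: "bracket L s V x \<in> fibre L x" "V x \<in> fibre L x" "s x \<in> fibre L x"
        using sectionD(1)[OF bracket_in[OF s V]] sectionD(1)[OF V] sectionD(1)[OF s] by blast+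
      \<comment> \<open>The Leibniz rule concerns the second argument, so the bracket is reversed
        twice: {f V, s} = - {s, f V} = f {V, s} - (\<rho>(s) f) V.\<close>
      have "bracket L (sec_scale L f V) s x = vscale L (-1) (bracket L s (\<lambda>x. vscale L (f x) (V x)) x)"
        using fun_cong[OF bracket_skew[OF fV s], of x] by (simp add: sec_scale_def)
      also have "\<dots> = vscale L (-1) (vadd L (vscale L (f x) (bracket L s V x)) (vscale L (lie_fun L s f x) (V x)))"
        by (simp only: bracket_scale[OF s V f])
      also have "\<dots> = vadd L (vscale L (f x) (vscale L (-1) (bracket L s V x))) (vscale L (- lie_fun L s f x) (V x))"
        by (rule fibre_eqI[of _ x]) (use F in \<open>auto simp: fibre_closed algebra_simps\<close>)
      also have "vscale L (-1) (bracket L s V x) = bracket L V s x"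
        by (simp flip: fun_cong[OF bracket_skew[OF V s]])
      finally show "bracket L (sec_scale L f V) s x = vadd L (vscale L (f x) (bracket L V s x))
        (vscale L (- (if s x \<in> fibre L x then anchor L (s x) f else 0)) (V x))"
        using F(3) by (simp add: lie_fun_def)
    qed
  qed
qed

text \<open>\<open>X_pair\<close> for f V is compared with f times \<open>X_pair\<close> for V. The
  left sides agree because the anchor is linear, so the extra term of the Lie derivative of \<eta>
  reappears with the opposite sign on the multivector side.\<close>

lemma pair_lie_m_scaled:
  assumes V: "V \<in> \<Gamma>" and f: "f \<in> C" and \<eta>: "\<eta> \<in> tensors" and P: "P \<in> multivecs"
  shows "pair \<eta> (lie_m (sec_scale L f V) P) =
    f * pair \<eta> (lie_m V P) - pair (d_rho L f \<curlywedge> interior_sec V \<eta>) P"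
proof -
  interpret V: lie_pair C "fibre L" "vadd L" "vscale L" \<Gamma> \<Gamma>d "lie_fun L V" "bracket L V"
    by (rule lie_pair_section[OF V])
  have fV: "sec_scale L f V \<in> \<Gamma>" unfolding sec_scale_def by (rule sec_scale_section[OF f V])
  interpret fV: lie_pair C "fibre L" "vadd L" "vscale L" \<Gamma> \<Gamma>d "lie_fun L (sec_scale L f V)" "bracket L (sec_scale L f V)"
    by (rule lie_pair_section[OF fV])
  have d: "d_rho L f \<curlywedge> interior_sec V \<eta> \<in> tensors"
    unfolding d_rho_eq by (intro tensor_wedge tensor_one_form[OF d_rho_section[OF f]] tensor_interior[OF V \<eta>])
  have l: "f \<odot> lie_f V \<eta> \<in> tensors" by (intro tensor_scale f V.lie_op_tensor \<eta>)
  have "pair (lie_f (sec_scale L f V) \<eta>) P = f * pair (lie_f V \<eta>) P + pair (d_rho L f \<curlywedge> interior_sec V \<eta>) P"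
    unfolding lie_f_scaled[OF V f \<eta>] pair_add_left[OF l d P]
    using pair_scale_left[OF V.lie_op_tensor[OF \<eta>] P] by simp
  moreover have "lie_fun L (sec_scale L f V) g = f * lie_fun L V g" for g
    using linear_fun_scl[OF anchor_linear sectionD(1)[OF V]]
    by (simp add: lie_fun_def sec_scale_def fun_eq_iff)
  ultimately show ?thesis
    using fV.X_pair[OF \<eta> P] V.X_pair[OF \<eta> P] by (simp add: algebra_simps)
qed

lemma derivation_lie_m:
  assumes V: "V \<in> \<Gamma>"
  shows "derivation_deg0 L (lie_mv L V)"
proof -
  interpret V: lie_pair C "fibre L" "vadd L" "vscale L" \<Gamma> \<Gamma>d "lie_fun L V" "bracket L V"
    by (rule lie_pair_section[OF V])
  note eq = lie_mv_eq[OF V]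
  show ?thesis
    unfolding derivation_deg0_def multivectors_deg_def multivectors_eq_tensors
  proof (intro conjI allI ballI)
    show "real_linear_on multivecs (lie_mv L V)"
      unfolding real_linear_on_def
      by (auto simp: eq C_const V.dual.lie_op_add V.dual.lie_op_scale dual.tensor_add dual.tensor_scale)
        (simp add: fun_scale_def fun_eq_iff)
    show "lie_mv L V ` (multivecs \<inter> homogeneous p) \<subseteq> multivecs \<inter> homogeneous p" for p
      using V.dual.lie_op_tensor V.dual.lie_op_homogeneous by (auto simp: eq)
    show "lie_mv L V (P \<curlywedge> Q) = lie_mv L V P \<curlywedge> Q + P \<curlywedge> lie_mv L V Q"
      if "P \<in> multivecs" "Q \<in> multivecs" for P Q
      using that by (simp add: eq dual.tensor_wedge V.dual.lie_op_wedge)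
  qed
qed

lemma lie_m_in: "V \<in> \<Gamma> \<Longrightarrow> P \<in> multivecs \<Longrightarrow> lie_m V P \<in> multivecs"
proof -
  assume V: "V \<in> \<Gamma>" and P: "P \<in> multivecs"
  interpret V: lie_pair C "fibre L" "vadd L" "vscale L" \<Gamma> \<Gamma>d "lie_fun L V" "bracket L V"
    by (rule lie_pair_section[OF V])
  show ?thesis by (rule V.dual.lie_op_tensor[OF P])
qed

end

theorem proposition4p1p6:
  fixes L :: "('m::{t2_space,second_countable_topology}, 'b::real_inner, 'e, 'k::real_inner)
    lie_algebroid_data"
  assumes "lie_algebroid L"
  shows
    "(\<forall>V\<in>smooth_sections L. \<forall>W\<in>smooth_sections L.
        lie_mv L V (of_sec L W) = of_sec L (bracket L V W)) \<and>
     (\<forall>V\<in>smooth_sections L. \<forall>Vs\<in>lists (smooth_sections L).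
        lie_mv L V (wedge_list (map (of_sec L) Vs)) =
          (\<Sum>i<length Vs. wedge_list (map (of_sec L) (Vs[i := bracket L V (Vs ! i)])))) \<and>
     (\<forall>V\<in>smooth_sections L. derivation_deg0 L (lie_mv L V)) \<and>
     (\<forall>V\<in>smooth_sections L. \<forall>P\<in>multivectors L. \<forall>\<eta>\<in>forms L.
        lie_form L V (interior_mv L P \<eta>) =
          interior_mv L (lie_mv L V P) \<eta> + interior_mv L P (lie_form L V \<eta>)) \<and>
     (\<forall>V\<in>smooth_sections L. \<forall>P\<in>multivectors L. \<forall>\<eta>\<in>forms L.
        lie_fun L V (pairing L \<eta> P) =
          pairing L (lie_form L V \<eta>) P + pairing L \<eta> (lie_mv L V P)) \<and>
     (\<forall>V\<in>smooth_sections L. \<forall>W\<in>smooth_sections L. \<forall>P\<in>multivectors L.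
        lie_mv L (bracket L V W) P =
          lie_mv L V (lie_mv L W P) - lie_mv L W (lie_mv L V P)) \<and>
     (\<forall>V\<in>smooth_sections L. \<forall>f\<in>C_inf (atlas L). \<forall>P\<in>multivectors L. \<forall>\<eta>\<in>forms L.
        pairing L \<eta> (lie_mv L (sec_scale L f V) P) =
          f * pairing L \<eta> (lie_mv L V P) - pairing L (d_rho L f \<curlywedge> interior_sec V \<eta>) P)"
proof -
  interpret algebroid L by unfold_locales (rule assms)
  show ?thesis
    unfolding forms_eq_tensors multivectors_eq_tensors
  proof (intro conjI ballI)
    fix V W assume V: "V \<in> \<Gamma>" and W: "W \<in> \<Gamma>"
    show "lie_mv L V (of_sec L W) = of_sec L (bracket L V W)"
      using lie_mv_eq[OF V of_sec_in[OF W]] lie_m_of_sec[OF V W] by simp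
  next
    fix V Vs assume V: "V \<in> \<Gamma>" and Vs: "Vs \<in> lists \<Gamma>"
    show "lie_mv L V (wedge_list (map (of_sec L) Vs)) =
        (\<Sum>i<length Vs. wedge_list (map (of_sec L) (Vs[i := bracket L V (Vs ! i)])))"
      using lie_mv_eq[OF V wedge_list_of_sec_in[OF Vs]] lie_m_wedge_list[OF V Vs] by simp
  next
    fix V assume "V \<in> \<Gamma>"
    then show "derivation_deg0 L (lie_mv L V)" by (rule derivation_lie_m)
  next
    fix V P \<eta> assume V: "V \<in> \<Gamma>" and P: "P \<in> multivecs" and \<eta>: "\<eta> \<in> tensors"
    interpret V: lie_pair C "fibre L" "vadd L" "vscale L" \<Gamma> \<Gamma>d "lie_fun L V" "bracket L V"
      by (rule lie_pair_section[OF V])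
    show "lie_form L V (interior_mv L P \<eta>) = interior_mv L (lie_mv L V P) \<eta> + interior_mv L P (lie_form L V \<eta>)"
      \<comment> \<open>The identity holds for the explicit operators; the described ones equal them
        on tensor fields, hence the membership facts for every intermediate result.\<close>
      using V.lie_op_inter[OF \<eta> P]
      by (simp add: interior_mv_eq lie_mv_eq[OF V] lie_form_eq[OF V] P \<eta> inter_tensor V.lie_op_tensor lie_m_in[OF V])
    show "lie_fun L V (pairing L \<eta> P) = pairing L (lie_form L V \<eta>) P + pairing L \<eta> (lie_mv L V P)"
      using V.X_pair[OF \<eta> P]
      by (simp add: pairing_eq lie_mv_eq[OF V] lie_form_eq[OF V] P \<eta> V.lie_op_tensor lie_m_in[OF V])
  next
    fix V W P assume V: "V \<in> \<Gamma>" and W: "W \<in> \<Gamma>" and P: "P \<in> multivecs"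
    show "lie_mv L (bracket L V W) P = lie_mv L V (lie_mv L W P) - lie_mv L W (lie_mv L V P)"
      using lie_m_bracket[OF V W P]
      by (simp add: lie_mv_eq V W P bracket_in lie_m_in)
  next
    fix V f P \<eta> assume V: "V \<in> \<Gamma>" and f: "f \<in> C" and P: "P \<in> multivecs" and \<eta>: "\<eta> \<in> tensors"
    have fV: "sec_scale L f V \<in> \<Gamma>" unfolding sec_scale_def by (rule sec_scale_section[OF f V])
    have "d_rho L f \<curlywedge> interior_sec V \<eta> \<in> tensors"
      unfolding d_rho_eq by (intro tensor_wedge tensor_one_form[OF d_rho_section[OF f]] tensor_interior[OF V \<eta>])
    then show "pairing L \<eta> (lie_mv L (sec_scale L f V) P) =
        f * pairing L \<eta> (lie_mv L V P) - pairing L (d_rho L f \<curlywedge> interior_sec V \<eta>) P"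
      using pair_lie_m_scaled[OF V f \<eta> P]
      by (simp add: lie_mv_eq V fV P \<eta> pairing_eq lie_m_in)
  qed
qed

end
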